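(* Let $1<\alpha<3$ and $\beta\in\mathbb{R}$. Assume that $u_0\in H^1(\mathbb{R})\cap L^1(\mathbb{R})$, $xu_0\in L^1(\mathbb{R})$ and that $\|u_0\|_{H^1}+\|u_0\|_{L^1}$ is sufficiently small. Then the global mild solution $u(x,t)$ to $$u_t-u_{xx}-D_x^{\alpha}\partial_x u+\beta u^2u_x=0,\quad x\in\mathbb{R},\ t>0,\qquad u(x,0)=u_0(x),$$ satisfies the following asymptotics. (i) Suppose $2<\alpha<3$. Then, for any $1\le p\le\infty$, $$\lim_{t\to\infty}t^{\frac12(1-\frac1p)+\frac12}\left\|u(t)-MG(t)+\frac{\beta M^3}{12\sqrt3\,\pi}(\log t)\partial_xG(t)+\left(m+\frac{\beta\mathcal{M}}{3}\right)\partial_xG(t)+\frac{\beta M^3}{3}\Psi(t)\right\|_{L^p}=0.$$ (ii) Suppose $\alpha=\frac{N+1}{N}$ with $N\in\mathbb{N}$ ($N\ge1$). Then, for any $1\le p\le\infty$, $$\lim_{t\to\infty}t^{\frac12(1-\frac1p)+\frac12}\Biggl\|u(t)-\sum_{k=0}^{N-1}\frac{t^k}{k!}(D_x^\alpha\partial_x)^k\{MG(t)-m\partial_xG(t)\}-\frac{M}{N!}(tD_x^\alpha\partial_x)^NG(t)+\frac{\beta M^3}{12\sqrt3\,\pi}(\log t)\partial_xG(t)+\frac{\beta\mathcal{M}}{3}\partial_xG(t)+\frac{\beta M^3}{3}\Psi(t)\Biggr\|_{L^p}=0.$$ (iii) Suppose $\frac{N+2}{N+1}<\alpha<\frac{N+1}{N}$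 with $N\in\mathbb{N}$ ($N\ge1$). Then, for any $1\le p\le\infty$, $$\lim_{t\to\infty}t^{\frac12(1-\frac1p)+\frac12}\Biggl\|u(t)-\sum_{k=0}^{N}\frac{t^k}{k!}(D_x^\alpha\partial_x)^k\{MG(t)-m\partial_xG(t)\}+\frac{\beta M^3}{12\sqrt3\,\pi}(\log t)\partial_xG(t)+\frac{\beta\mathcal{M}}{3}\partial_xG(t)+\frac{\beta M^3}{3}\Psi(t)\Biggr\|_{L^p}=0.$$
   Context: Fourier transform: $\hat f(\xi)=\mathcal{F}[f](\xi)=\frac1{\sqrt{2\pi}}\int_{\mathbb{R}}e^{-ix\xi}f(x)\,dx$, $\mathcal{F}^{-1}[g](x)=\frac1{\sqrt{2\pi}}\int_{\mathbb{R}}e^{ix\xi}g(\xi)\,d\xi$. Fractional derivative: $D_x^\alpha f=\mathcal{F}^{-1}[|\xi|^\alpha\hat f(\xi)]$; thus $(D_x^\alpha\partial_x)^kf=\mathcal{F}^{-1}[(i|\xi|^\alpha\xi)^k\hat f(\xi)]$. Functions are real-valued, initial data $u_0$ is real-valued, and $*$ is convolution in $x$. $f(t)$ denotes $f(\cdot,t)$. Green function: $S_\alpha(x,t)=\frac1{\sqrt{2\pi}}\mathcal{F}^{-1}\bigl[e^{-t\xi^2+it|\xi|^\alpha\xi}\bigr](x)$. Global mild solution: $u\in C([0,\infty);H^1(\mathbb{R}))$ satisfying $u(t)=S_\alpha(t)*u_0-\frac{\beta}{3}\int_0^t\partial_xS_\alpha(t-\tau)*u^3(\tau)\,d\tau$.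 Under the smallness assumption there is a unique global mild solution; it satisfies $u\in L^\infty([0,\infty);L^\infty(\mathbb{R}))$, $t^{1/4}u\in L^\infty((0,\infty);L^2(\mathbb{R}))$, $\|u(t)\|_{L^p}\le C(1+t)^{-\frac12(1-\frac1p)}$ for $t\ge0$, $2\le p\le\infty$, $\|u(t)\|_{L^1}\le C(1+t^{-\frac{\alpha-1}{4}})$ and $\|\partial_xu(t)\|_{L^2}\le Ct^{-3/4}$ for $t>0$; this is the solution $u$ in the claim. "Sufficiently small" means: there is $\delta>0$ (depending only on $\alpha,\beta$) such that the conclusions hold whenever $\|u_0\|_{H^1}+\|u_0\|_{L^1}<\delta$. Heat kernel and constants: $G(x,t)=\frac1{\sqrt{4\pi t}}e^{-x^2/(4t)}$, $M=\int_{\mathbb{R}}u_0(x)\,dx$, $m=\int_{\mathbb{R}}xu_0(x)\,dx$, $\mathcal{M}=\int_0^1\int_{\mathbb{R}}u^3(y,\tau)\,dy\,d\tau+\int_1^\infty\int_{\mathbb{R}}\bigl(u^3-(MG)^3\bigr)(y,\tau)\,dy\,d\tau$. Profile: $\Psi(x,t)=t^{-1}\Psi_*\!\left(\frac{x}{\sqrt t}\right)$, $\Psi_*(x)=\frac{d}{dx}\left(\int_0^1\bigl(G(1-s)*F(s)\bigr)(x)\,ds\right)$, where $F(y,s)=s^{-3/2}F_*\!\left(\frac{y}{\sqrt s}\right)$, $F_*(y)=\frac{1}{8\sqrt{\pi^3}}e^{-3y^2/4}-\frac{1}{8\sqrt{3\pi^3}}e^{-y^2/4}$. *)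

theory Defs
  imports "HOL-Analysis.Analysis" "HOL-Probability.Essential_Supremum"
begin

section \<open>Function spaces on the real line\<close>

text \<open>
  The norm is extended-valued, so that a bound on it (or its convergence to 0) includes
  membership in \<open>L\<^sup>p\<close>; with a real-valued Bochner integral a non-integrable function
  would get norm 0.
\<close>

definition Lp_norm :: "ennreal \<Rightarrow> (real \<Rightarrow> 'a::real_normed_vector) \<Rightarrow> ennreal" where
  "Lp_norm p f =
    (if p = \<infinity> then esssup lebesgue (\<lambda>x. ennreal (norm (f x)))
     else let I = (\<integral>\<^sup>+ x. ennreal (norm (f x) powr enn2real p) \<partial>lebesgue)
          in if I = \<infinity> then \<infinity> else ennreal (enn2real I powr (1 / enn2real p)))"

definition square_integrable :: "(real \<Rightarrow> real) \<Rightarrow> bool" where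
  "square_integrable f \<longleftrightarrow>
     f \<in> borel_measurable lebesgue \<and> integrable lebesgue (\<lambda>x. (f x)\<^sup>2)"

definition test_function :: "(real \<Rightarrow> real) \<Rightarrow> bool" where
  "test_function \<phi> \<longleftrightarrow>
     (\<forall>n. (deriv ^^ n) \<phi> differentiable_on UNIV) \<and> bounded {x. \<phi> x \<noteq> 0}"

definition has_weak_derivative :: "(real \<Rightarrow> real) \<Rightarrow> (real \<Rightarrow> real) \<Rightarrow> bool" where
  "has_weak_derivative f g \<longleftrightarrow>
     (\<forall>\<phi>. test_function \<phi> \<longrightarrow>
        (LINT x|lebesgue. f x * deriv \<phi> x) = - (LINT x|lebesgue. g x * \<phi> x))"

definition H1 :: "(real \<Rightarrow> real) \<Rightarrow> bool" where
  "H1 f \<longleftrightarrow> square_integrable f \<and> (\<exists>g. square_integrable g \<and> has_weak_derivative f g)"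

text \<open>The weak derivative is unique only up to a null set; the norm below does not depend
  on the representative chosen.\<close>

definition weak_derivative :: "(real \<Rightarrow> real) \<Rightarrow> real \<Rightarrow> real" where
  "weak_derivative f = (SOME g. square_integrable g \<and> has_weak_derivative f g)"

definition H1_norm :: "(real \<Rightarrow> real) \<Rightarrow> real" where
  "H1_norm f = sqrt ((LINT x|lebesgue. (f x)\<^sup>2) + (LINT x|lebesgue. (weak_derivative f x)\<^sup>2))"

definition conv :: "(real \<Rightarrow> 'a::{real_normed_algebra, banach, second_countable_topology})
    \<Rightarrow> (real \<Rightarrow> 'a) \<Rightarrow> real \<Rightarrow> 'a" where
  "conv f g x = (LINT y|lebesgue. f (x - y) * g y)"


section \<open>Fourier transform and fractional derivative\<close>

text \<open>
  The transforms are given by their absolutely convergent integrals. This is all that is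
  needed: they are only applied to integrable functions with integrable image.
\<close>

definition fourier :: "(real \<Rightarrow> complex) \<Rightarrow> real \<Rightarrow> complex" where
  "fourier f \<xi> = complex_of_real (1 / sqrt (2 * pi)) *
     (LINT x|lebesgue. exp (- \<i> * of_real (x * \<xi>)) * f x)"

definition inv_fourier :: "(real \<Rightarrow> complex) \<Rightarrow> real \<Rightarrow> complex" where
  "inv_fourier g x = complex_of_real (1 / sqrt (2 * pi)) *
     (LINT \<xi>|lebesgue. exp (\<i> * of_real (x * \<xi>)) * g \<xi>)"

definition dx :: "(real \<Rightarrow> complex) \<Rightarrow> real \<Rightarrow> complex" where
  "dx f x = vector_derivative f (at x)"

definition frac_deriv :: "real \<Rightarrow> (real \<Rightarrow> complex) \<Rightarrow> real \<Rightarrow> complex" where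
  "frac_deriv \<alpha> f = inv_fourier (\<lambda>\<xi>. of_real (\<bar>\<xi>\<bar> powr \<alpha>) * fourier f \<xi>)"

text \<open>The operator \<open>D\<^sub>x\<^sup>\<alpha> \<partial>\<^sub>x\<close>; its powers are formed with \<open>^^\<close>.\<close>

definition frac_dx :: "real \<Rightarrow> (real \<Rightarrow> complex) \<Rightarrow> real \<Rightarrow> complex" where
  "frac_dx \<alpha> f = frac_deriv \<alpha> (dx f)"


section \<open>Mild solutions\<close>

definition green :: "real \<Rightarrow> real \<Rightarrow> real \<Rightarrow> complex" where
  "green \<alpha> t x = complex_of_real (1 / sqrt (2 * pi)) *
     inv_fourier (\<lambda>\<xi>. exp (of_real (- t * \<xi>\<^sup>2) + \<i> * of_real (t * \<bar>\<xi>\<bar> powr \<alpha> * \<xi>))) x"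

text \<open>
  A function of space and time is a curve \<open>u :: real \<Rightarrow> real \<Rightarrow> real\<close>, with \<open>u t\<close> the function
  of \<open>x\<close> at time \<open>t\<close>; only \<open>t \<ge> 0\<close> matters. Since \<open>u t\<close> stands for an element of a Sobolev
  space, the integral equation is an identity almost everywhere in \<open>x\<close>. At time 0 the
  Green function is the Dirac measure, so the equation there is the initial condition.
\<close>

definition H1_continuous :: "(real \<Rightarrow> real \<Rightarrow> real) \<Rightarrow> bool" where
  "H1_continuous u \<longleftrightarrow>
     (\<forall>t\<ge>0. H1 (u t) \<and> ((\<lambda>s. H1_norm (\<lambda>x. u s x - u t x)) \<longlongrightarrow> 0) (at t within {0..}))"

definition global_mild_solution ::
    "real \<Rightarrow> real \<Rightarrow> (real \<Rightarrow> real) \<Rightarrow> (real \<Rightarrow> real \<Rightarrow> real) \<Rightarrow> bool" where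
  "global_mild_solution \<alpha> \<beta> u0 u \<longleftrightarrow>
     H1_continuous u \<and>
     (AE x in lebesgue. u 0 x = u0 x) \<and>
     (\<forall>t>0. AE x in lebesgue.
        complex_of_real (u t x) =
          conv (green \<alpha> t) (\<lambda>y. of_real (u0 y)) x
          - of_real (\<beta> / 3) *
            (LINT \<tau>:{0..t}|lebesgue.
               conv (dx (green \<alpha> (t - \<tau>))) (\<lambda>y. of_real ((u \<tau> y) ^ 3)) x))"


section \<open>Heat kernel, constants and asymptotic profile\<close>

definition heat :: "real \<Rightarrow> real \<Rightarrow> real" where
  "heat t x = 1 / sqrt (4 * pi * t) * exp (- x\<^sup>2 / (4 * t))"

definition mass :: "(real \<Rightarrow> real) \<Rightarrow> real" where
  "mass u0 = (LINT x|lebesgue. u0 x)"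

definition first_moment :: "(real \<Rightarrow> real) \<Rightarrow> real" where
  "first_moment u0 = (LINT x|lebesgue. x * u0 x)"

definition cubic_moment :: "(real \<Rightarrow> real) \<Rightarrow> (real \<Rightarrow> real \<Rightarrow> real) \<Rightarrow> real" where
  "cubic_moment u0 u =
     (LINT \<tau>:{0..1}|lebesgue. LINT y|lebesgue. (u \<tau> y) ^ 3) +
     (LINT \<tau>:{1..}|lebesgue. LINT y|lebesgue. (u \<tau> y) ^ 3 - (mass u0 * heat \<tau> y) ^ 3)"

definition F_star :: "real \<Rightarrow> real" where
  "F_star y = 1 / (8 * sqrt (pi ^ 3)) * exp (- 3 * y\<^sup>2 / 4)
            - 1 / (8 * sqrt (3 * pi ^ 3)) * exp (- y\<^sup>2 / 4)"

definition F_scaled :: "real \<Rightarrow> real \<Rightarrow> real" where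
  "F_scaled s y = s powr (-3/2) * F_star (y / sqrt s)"

definition Psi_star :: "real \<Rightarrow> real" where
  "Psi_star = deriv (\<lambda>x. LINT s:{0..1}|lebesgue. conv (heat (1 - s)) (F_scaled s) x)"

definition Psi :: "real \<Rightarrow> real \<Rightarrow> real" where
  "Psi t x = Psi_star (x / sqrt t) / t"

end

theory Submission
  imports Defs "HOL-Probability.Probability"
begin

text \<open>
  On the parabolic scale \<open>\<xi> \<sim> t\<^sup>-\<^sup>1\<^sup>/\<^sup>2\<close> the phase \<open>t \<bar>\<xi>\<bar>\<^sup>\<alpha> \<xi>\<close> of the linear symbol is small: removing \<open>n\<close> Taylor terms from the
  oscillating factor gains \<open>t\<close> to the power \<open>-n(\<alpha>-1)/2\<close>, in the supremum norm directly and in \<open>L\<^sup>1\<close> by Plancherel and a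
  weighted Cauchy--Schwarz inequality. A continuity argument gives global decay of small solutions. In the Duhamel
  term the dispersive part of the kernel is then negligible, and \<open>u\<^sup>3\<close> may be replaced by \<open>(MG)\<^sup>3\<close> up to a space-time
  integrable error, which acts like a point mass and produces the cubic moment. Since \<open>G(\<tau>)\<^sup>3\<close> is a multiple of
  \<open>\<tau>\<^sup>-\<^sup>1 G(\<tau>/3)\<close>, the semigroup property turns the Duhamel term of \<open>(MG)\<^sup>3\<close> into an integral of
  \<open>\<tau>\<^sup>-\<^sup>1 \<partial>\<^sub>xG(t - 2\<tau>/3)\<close>; subtracting \<open>\<partial>\<^sub>xG(t)\<close> leaves the self-similar profile, and the subtracted part is
  the logarithm.
\<close>

abbreviation cplx :: "real \<Rightarrow> complex" where "cplx \<equiv> complex_of_real"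
abbreviation nnL1 :: "(real \<Rightarrow> 'a::real_normed_vector) \<Rightarrow> ennreal" where "nnL1 f \<equiv> \<integral>\<^sup>+x. ennreal (norm (f x)) \<partial>lborel"
abbreviation nnL2 :: "(real \<Rightarrow> 'a::real_normed_vector) \<Rightarrow> ennreal" where "nnL2 f \<equiv> \<integral>\<^sup>+x. ennreal ((norm (f x))\<^sup>2) \<partial>lborel"
abbreviation cubed :: "(real => real => real) => real => real => complex" where "cubed v \<equiv> \<lambda>s y. cplx (v s y ^ 3)"
abbreviation borel2 :: "('a::topological_space \<times> 'b::topological_space => 'c::topological_space) set" where
 "borel2 \<equiv> borel_measurable (borel \<Otimes>\<^sub>M borel)"

lemmas bochner_integrable_bound = Bochner_Integration.integrable_bound
lemmas bochner_integral_add = Bochner_Integration.integral_add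
lemmas bochner_integral_diff = Bochner_Integration.integral_diff
lemmas bochner_integral_cong = Bochner_Integration.integral_cong

section \<open>Fourier integrals\<close>

text \<open>All of 1/(2 pi) sits on the inverse transform, so that convolution becomes a plain
  product and the Green function is \<open>ift\<close> of its symbol without a constant. The
  symmetric normalisation is converted in \<open>inv_fourier_eq\<close> and
  \<open>fourier_eq\<close>.\<close>

definition ift :: "(real => complex) => real => complex" where
 "ift g x = (LINT \<xi>|lborel. iexp (x * \<xi>) * g \<xi>) / (2 * pi)"

definition ft :: "(real => complex) => real => complex" where
 "ft f \<xi> = (LINT x|lborel. iexp (- (x * \<xi>)) * f x)"

lemma borel_measurable_iexp [measurable]: "(\<lambda>x::real. iexp x) \<in> borel_measurable borel"
 by (intro borel_measurable_continuous_onI continuous_intros)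

text \<open>A non-integrable function has Bochner integral 0, so the bound is valid for every
  function and can be applied before integrability is known.\<close>

lemma norm_integral_le_nn_integral:
 fixes f :: "'a => 'b::{banach, second_countable_topology}"
 shows "ennreal (norm (integral\<^sup>L M f)) <= (\<integral>\<^sup>+x. ennreal (norm (f x)) \<partial>M)"
proof (cases "integrable M f")
 case True
 then show ?thesis by (rule integral_norm_bound_ennreal)
qed (simp add: not_integrable_integral_eq)

lemma integrable_product:
 fixes f :: "'a => 'c::{real_normed_div_algebra, banach, second_countable_topology}"
 assumes "pair_sigma_finite M N" and [measurable]: "integrable M f" "integrable N g"
 shows "integrable (M \<Otimes>\<^sub>M N) (\<lambda>(x, y). f x * g y)"
proof -
 interpret pair_sigma_finite M N by fact
 show ?thesis
  by (rule Fubini_integrable) (auto simp: norm_mult assms intro!: integrable_norm)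
qed

lemma integrable_iexp_mult:
 assumes "integrable M f" and [measurable]: "h \<in> borel_measurable M"
 shows "integrable M (\<lambda>x. iexp (h x) * f x)"
proof -
 have [measurable]: "f \<in> borel_measurable M" using assms by simp
 show ?thesis
  by (rule bochner_integrable_bound[OF assms(1)]) (auto simp: norm_mult)
qed

lemma ift_eq_ft: "ift g x = ft g (- x) / (2 * pi)"
 by (simp add: ift_def ft_def mult.commute)

lemma ft_measurable [measurable]:
 assumes [measurable]: "f \<in> borel_measurable lborel"
 shows "ft f \<in> borel_measurable lborel"
 unfolding ft_def by measurable

lemma ift_measurable [measurable]:
 assumes [measurable]: "f \<in> borel_measurable lborel"
 shows "ift f \<in> borel_measurable lborel"
 unfolding ift_def by measurable

lemma norm_ft_le: "norm (ft f \<xi>) <= (LINT x|lborel. norm (f x))"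
 unfolding ft_def by (rule order_trans[OF integral_norm_bound]) (simp add: norm_mult)

lemma norm_ift_le: "norm (ift f x) <= (LINT x|lborel. norm (f x)) / (2 * pi)"
 using norm_ft_le[of f "-x"] by (simp add: ift_eq_ft norm_divide divide_right_mono)

text \<open>The oscillating factor has modulus 1, so Fubini applies as soon as f and g are
  integrable. The phase is left arbitrary because three forms of it occur: Gaussian averaging,
  Plancherel and convolution.\<close>

lemma integral_iexp_exchange:
 fixes h :: "real => real => real"
 assumes [measurable]: "integrable lborel f" "integrable lborel g"
  and [measurable]: "case_prod h \<in> borel2"
 shows "(LINT x|lborel. f x * (LINT \<xi>|lborel. iexp (h x \<xi>) * g \<xi>)) =
     (LINT \<xi>|lborel. g \<xi> * (LINT x|lborel. iexp (h x \<xi>) * f x))"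
proof -
 have "pair_sigma_finite (lborel::real measure) (lborel::real measure)"
  by (simp add: lborel_pair.pair_sigma_finite_axioms)
 then have i: "integrable (lborel \<Otimes>\<^sub>M lborel) (\<lambda>z. iexp (case z of (x, \<xi>) => h x \<xi>) * (case z of (x, \<xi>) => f x * g \<xi>))"
  using assms by (intro integrable_iexp_mult integrable_product) auto
 have "(LINT x|lborel. f x * (LINT \<xi>|lborel. iexp (h x \<xi>) * g \<xi>)) =
   (LINT x|lborel. LINT \<xi>|lborel. iexp (h x \<xi>) * (f x * g \<xi>))"
  by (simp add: ac_simps flip: integral_mult_right_zero)
 also have "\<dots> = (LINT \<xi>|lborel. LINT x|lborel. iexp (h x \<xi>) * (f x * g \<xi>))"
  using i by (intro lborel_pair.Fubini_integral[symmetric]) (simp add: split_beta')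
 also have "\<dots> = (LINT \<xi>|lborel. g \<xi> * (LINT x|lborel. iexp (h x \<xi>) * f x))"
  by (simp add: ac_simps flip: integral_mult_right_zero)
 finally show ?thesis .
qed

section \<open>Gaussian integrals and the Plancherel inequality\<close>

lemma gaussian_eq_normal_density:
 assumes "0 < t"
 shows "exp (- (t * (x - a)\<^sup>2)) = sqrt (pi / t) * normal_density a (1 / sqrt (2 * t)) x"
 using assms
 by (simp add: normal_density_def power_divide real_sqrt_divide real_sqrt_mult field_simps)

lemma integrable_gaussian [intro]:
 assumes "0 < t"
 shows "integrable lborel (\<lambda>x::real. exp (- (t * (x - a)\<^sup>2)))"
 unfolding gaussian_eq_normal_density[OF assms]
 using assms by (intro integrable_mult_right integrable_normal_density) simp

lemma integral_gaussian:
 assumes "0 < t"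
 shows "(LINT x|lborel. exp (- (t * (x - a)\<^sup>2))) = sqrt (pi / t)"
 unfolding gaussian_eq_normal_density[OF assms]
 using assms by (simp add: integral_normal_density)

lemma nn_integral_gaussian:
 assumes "0 < t"
 shows "(\<integral>\<^sup>+x. ennreal (exp (- (t * (x - a)\<^sup>2))) \<partial>lborel) = ennreal (sqrt (pi / t))"
 by (subst nn_integral_eq_integral[OF integrable_gaussian[OF assms]]) (simp_all add: integral_gaussian[OF assms])

lemma integrable_gaussian_0 [intro]: "0 < t ==> integrable lborel (\<lambda>x::real. exp (- (t * x\<^sup>2)))"
 using integrable_gaussian[of t 0] by simp

text \<open>Rescaling by \<open>c\<close> turns the Gaussian into the standard normal density, whose
  characteristic function is known.\<close>

lemma integral_iexp_gaussian:
 assumes "0 < t"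
 shows "(LINT x|lborel. iexp (x * \<xi>) * cplx (exp (- (t * x\<^sup>2)))) =
  cplx (sqrt (pi / t) * exp (- \<xi>\<^sup>2 / (4 * t)))"
proof -
 define c where "c = 1 / sqrt (2 * t)"
 have c: "c > 0" "c\<^sup>2 = 1 / (2 * t)" using assms by (auto simp: c_def power_divide)
 have "(LINT x|lborel. iexp (x * \<xi>) * cplx (exp (- (t * x\<^sup>2)))) =
   c *\<^sub>R (LINT x|lborel. iexp ((0 + c * x) * \<xi>) * cplx (exp (- (t * (0 + c * x)\<^sup>2))))"
  using c by (subst lborel_integral_real_affine[where c=c and t=0]) auto
 also have "(\<lambda>x. iexp ((0 + c * x) * \<xi>) * cplx (exp (- (t * (0 + c * x)\<^sup>2)))) =
   (\<lambda>x. cplx (sqrt (2 * pi)) * (std_normal_density x *\<^sub>R iexp ((c * \<xi>) * x)))"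
  using assms by (auto simp: fun_eq_iff std_normal_density_def power_mult_distrib c scaleR_conv_of_real mult_ac field_simps)
 also have "(LINT x|lborel. cplx (sqrt (2 * pi)) * (std_normal_density x *\<^sub>R iexp ((c * \<xi>) * x)))
   = sqrt (2 * pi) * char std_normal_distribution (c * \<xi>)"
  unfolding integral_mult_right_zero by (simp add: char_def integral_density normal_density_nonneg)
 also have "\<dots> = cplx (sqrt (2 * pi) * exp (- ((c * \<xi>)\<^sup>2) / 2))"
  by (simp add: char_std_normal_distribution)
 also have "c *\<^sub>R \<dots> = cplx (sqrt (pi / t) * exp (- \<xi>\<^sup>2 / (4 * t)))"
  using assms by (auto simp: power_mult_distrib c scaleR_conv_of_real c_def real_sqrt_divide real_sqrt_mult field_simps)
 finally show ?thesis by simp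
qed

text \<open>A Gaussian damping factor in x becomes an average of g against a Gaussian centred at the
  frequency. As the damping vanishes this is an approximate identity; both Plancherel and Fourier
  inversion rest on it.\<close>

lemma ift_gaussian_average:
 assumes [measurable]: "integrable lborel g" and "0 < e"
 shows "(LINT x|lborel. iexp (- (x * \<eta>)) * cplx (exp (- (e * x\<^sup>2))) * ift g x) =
  (LINT \<xi>|lborel. g \<xi> * cplx (sqrt (pi / e) * exp (- (1 / (4 * e) * (\<xi> - \<eta>)\<^sup>2)))) / (2 * pi)"
proof -
 have i: "integrable lborel (\<lambda>x. iexp (- (x * \<eta>)) * cplx (exp (- (e * x\<^sup>2))))"
  using assms by (intro integrable_iexp_mult integrable_of_real) auto
 have "(LINT x|lborel. iexp (- (x * \<eta>)) * cplx (exp (- (e * x\<^sup>2))) * ift g x) =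
  (LINT x|lborel. (iexp (- (x * \<eta>)) * cplx (exp (- (e * x\<^sup>2)))) * (LINT \<xi>|lborel. iexp (x * \<xi>) * g \<xi>)) / (2 * pi)"
  by (simp add: ift_def)
 also have "\<dots> = (LINT \<xi>|lborel. g \<xi> * (LINT x|lborel. iexp (x * \<xi>) * (iexp (- (x * \<eta>)) * cplx (exp (- (e * x\<^sup>2)))))) / (2 * pi)"
  by (subst integral_iexp_exchange[OF i assms(1)]) auto
 also have "(\<lambda>\<xi>. (LINT x|lborel. iexp (x * \<xi>) * (iexp (- (x * \<eta>)) * cplx (exp (- (e * x\<^sup>2)))))) =
   (\<lambda>\<xi>. (LINT x|lborel. iexp (x * (\<xi> - \<eta>)) * cplx (exp (- (e * x\<^sup>2)))))"
 proof -
  have "iexp (x * \<xi>) * iexp (- (x * \<eta>)) = iexp (x * (\<xi> - \<eta>))" for x \<xi>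
   by (simp add: mult_exp_exp algebra_simps)
  then show ?thesis by (simp only: mult.assoc[symmetric])
 qed
 also have "\<dots> = (\<lambda>\<xi>. cplx (sqrt (pi / e) * exp (- (\<xi> - \<eta>)\<^sup>2 / (4 * e))))"
  by (subst integral_iexp_gaussian[OF assms(2)]) simp
 finally show ?thesis by simp
qed

text \<open>The damped L^2 norm of \<open>ift g\<close> is a double integral of g against a
  symmetric Gaussian kernel whose mass does not depend on the damping. The inequality 2ab <= a^2 +
  b^2 bounds it by the L^2 norm of g, and Fatou removes the damping. The right side may be
  infinite.\<close>

theorem plancherel_ineq:
 assumes [measurable]: "integrable lborel g"
 shows "(nnL2 (ift g)) <= ennreal (1 / (2 * pi)) * (nnL2 g)"
proof -
 define I where "I = (nnL2 g)"
 obtain B where bd: "\<And>x. norm (ift g x) <= B" using norm_ift_le by blast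
 have main: "(\<integral>\<^sup>+x. ennreal (exp (- (e * x\<^sup>2)) * (norm (ift g x))\<^sup>2) \<partial>lborel) <= ennreal (1 / (2 * pi)) * I" if e: "e > 0" for e :: real
 proof -
  define k where "k = (\<lambda>\<xi> \<eta>. sqrt (pi / e) * exp (- (1 / (4 * e) * (\<xi> - \<eta>)\<^sup>2)))"
  \<comment> \<open>The constant in ab <= (a^2 + b^2)/2.\<close>
  define h :: real where "h = 1 / 2"
  have h0: "h >= 0" by (simp add: h_def)
  have k0: "k \<xi> \<eta> >= 0" for \<xi> \<eta> using e by (simp add: k_def)
  have [measurable]: "(\<lambda>(x,y). k x y) \<in> borel2"
   unfolding k_def by measurable
  \<comment> \<open>The mass is 2 pi for every \<open>e\<close>: this uniformity is what survives
    the limit.\<close>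
  have kI: "(\<integral>\<^sup>+\<xi>. ennreal (k \<xi> \<eta>) \<partial>lborel) = ennreal (2 * pi)" for \<eta>
  proof -
   have "(\<integral>\<^sup>+\<xi>. ennreal (k \<xi> \<eta>) \<partial>lborel) = ennreal (sqrt (pi / e)) * ennreal (sqrt (pi / (1 / (4 * e))))"
    unfolding k_def using e
    by (subst nn_integral_gaussian[of "1 / (4 * e)" \<eta>, symmetric]) (auto simp: ennreal_mult nn_integral_cmult)
   also have "\<dots> = ennreal (2 * pi)"
    using e by (simp add: real_sqrt_divide real_sqrt_mult flip: ennreal_mult)
   finally show ?thesis .
  qed
  have ks: "k \<xi> \<eta> = k \<eta> \<xi>" for \<xi> \<eta> by (simp add: k_def power2_commute)
  have i1: "integrable lborel (\<lambda>x. cplx (exp (- (e * x\<^sup>2))) * ift g x)"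
   by (rule bochner_integrable_bound[OF integrable_mult_left[OF integrable_gaussian_0[OF e], of B]])
    (use bd in \<open>auto simp: norm_mult intro!: mult_left_mono order_trans[OF _ abs_ge_self]\<close>)
  have i2: "integrable lborel (\<lambda>x. exp (- (e * x\<^sup>2)) * (norm (ift g x))\<^sup>2)"
   by (rule bochner_integrable_bound[OF integrable_mult_left[OF integrable_gaussian_0[OF e], of "B\<^sup>2"]])
    (use bd in \<open>auto simp: norm_mult intro!: mult_left_mono power_mono order_trans[OF _ abs_ge_self]\<close>)
  have i3: "integrable lborel (\<lambda>\<xi>. cnj (g (-\<xi>)))"
   using lborel_integrable_real_affine[of "\<lambda>\<xi>. cnj (g \<xi>)" "-1" 0] assms by simp
  have "cplx (LINT x|lborel. exp (- (e * x\<^sup>2)) * (norm (ift g x))\<^sup>2) =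
    (LINT x|lborel. cplx (exp (- (e * x\<^sup>2)) * (norm (ift g x))\<^sup>2))"
   by (rule integral_complex_of_real[symmetric])
  also have "\<dots> = (LINT x|lborel. (cplx (exp (- (e * x\<^sup>2))) * ift g x) * cnj (ift g x))"
   by (intro bochner_integral_cong) (auto simp: complex_norm_square mult_ac simp del: of_real_power)
  \<comment> \<open>Conjugation is traded for a reflection of the frequency, so that the phase again
    has the form required by \<open>integral_iexp_exchange\<close>.\<close>
  also have "(\<lambda>x. cnj (ift g x)) = (\<lambda>x. (LINT \<xi>|lborel. iexp (x * \<xi>) * cnj (g (-\<xi>))) / (2 * pi))"
  proof
   fix x
   have "(LINT \<xi>|lborel. iexp (x * \<xi>) * cnj (g (-\<xi>))) = (LINT \<xi>|lborel. cnj (iexp (x * \<xi>) * g \<xi>))"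
    by (subst lborel_integral_real_affine[of "-1" _ 0]) (auto simp: exp_cnj)
   moreover have "cnj (ift g x) = (LINT \<xi>|lborel. cnj (iexp (x * \<xi>) * g \<xi>)) / (2 * pi)"
    using Bochner_Integration.integral_cnj[of lborel "\<lambda>\<xi>. iexp (x * \<xi>) * g \<xi>"]
    by (simp only: ift_def complex_cnj_divide complex_cnj_complex_of_real)
   ultimately show "cnj (ift g x) = (LINT \<xi>|lborel. iexp (x * \<xi>) * cnj (g (-\<xi>))) / (2 * pi)"
    by simp
  qed
  also have "(LINT x|lborel. (cplx (exp (- (e * x\<^sup>2))) * ift g x) * ((LINT \<xi>|lborel. iexp (x * \<xi>) * cnj (g (-\<xi>))) / (2 * pi))) = 
   (LINT x|lborel. (cplx (exp (- (e * x\<^sup>2))) * ift g x) * (LINT \<xi>|lborel. iexp (x * \<xi>) * cnj (g (-\<xi>)))) / (2 * pi)"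
   by simp
  also have "\<dots> = (LINT \<xi>|lborel. cnj (g (-\<xi>)) * (LINT x|lborel. iexp (x * \<xi>) * (cplx (exp (- (e * x\<^sup>2))) * ift g x))) / (2 * pi)"
   by (subst integral_iexp_exchange[OF i1 i3]) auto
  also have "(LINT \<xi>|lborel. cnj (g (-\<xi>)) * (LINT x|lborel. iexp (x * \<xi>) * (cplx (exp (- (e * x\<^sup>2))) * ift g x))) =
   (LINT \<eta>|lborel. cnj (g \<eta>) * (LINT x|lborel. iexp (- (x * \<eta>)) * cplx (exp (- (e * x\<^sup>2))) * ift g x))"
   by (subst lborel_integral_real_affine[of "-1" _ 0]) (auto simp: mult.assoc)
  also have "\<dots> = (LINT \<eta>|lborel. cnj (g \<eta>) * ((LINT \<xi>|lborel. g \<xi> * cplx (k \<xi> \<eta>)) / (2 * pi)))"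
   unfolding k_def by (subst ift_gaussian_average[OF assms e]) simp
  also have "\<dots> / (2 * pi) = (LINT \<eta>|lborel. (LINT \<xi>|lborel. cnj (g \<eta>) * g \<xi> * cplx (k \<xi> \<eta>))) / (4 * pi\<^sup>2)"
   by (simp add: mult.assoc power2_eq_square)
  finally have eq: "cplx (LINT x|lborel. exp (- (e * x\<^sup>2)) * (norm (ift g x))\<^sup>2) = \<dots>" .
  have "(\<integral>\<^sup>+x. ennreal (exp (- (e * x\<^sup>2)) * (norm (ift g x))\<^sup>2) \<partial>lborel) =
    ennreal (LINT x|lborel. exp (- (e * x\<^sup>2)) * (norm (ift g x))\<^sup>2)"
   by (rule nn_integral_eq_integral[OF i2]) simp
  also have "(LINT x|lborel. exp (- (e * x\<^sup>2)) * (norm (ift g x))\<^sup>2) = norm (cplx (LINT x|lborel. exp (- (e * x\<^sup>2)) * (norm (ift g x))\<^sup>2))"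
   by (simp add: integral_nonneg_AE)
  also have "\<dots> = norm (LINT \<eta>|lborel. (LINT \<xi>|lborel. cnj (g \<eta>) * g \<xi> * cplx (k \<xi> \<eta>))) / (4 * pi\<^sup>2)"
   unfolding eq by (simp add: norm_divide norm_mult norm_power)
  also have "ennreal \<dots> = ennreal (norm (LINT \<eta>|lborel. (LINT \<xi>|lborel. cnj (g \<eta>) * g \<xi> * cplx (k \<xi> \<eta>)))) * ennreal (1 / (4 * pi\<^sup>2))"
   by (simp flip: ennreal_mult)
  also have "ennreal (norm (LINT \<eta>|lborel. (LINT \<xi>|lborel. cnj (g \<eta>) * g \<xi> * cplx (k \<xi> \<eta>)))) \<le>
   (\<integral>\<^sup>+\<eta>. \<integral>\<^sup>+\<xi>. ennreal (norm (cnj (g \<eta>) * g \<xi> * cplx (k \<xi> \<eta>))) \<partial>lborel \<partial>lborel)"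
   by (rule order_trans[OF norm_integral_le_nn_integral]) (intro nn_integral_mono norm_integral_le_nn_integral)
  also have "\<dots> <= (\<integral>\<^sup>+\<eta>. \<integral>\<^sup>+\<xi>. ennreal h * (ennreal ((norm (g \<eta>))\<^sup>2) * ennreal (k \<xi> \<eta>)) + ennreal h * (ennreal ((norm (g \<xi>))\<^sup>2) * ennreal (k \<xi> \<eta>)) \<partial>lborel \<partial>lborel)"
  proof (intro nn_integral_mono)
   fix \<eta> \<xi> :: real
   have "norm (g \<eta>) * norm (g \<xi>) <= h * ((norm (g \<eta>))\<^sup>2 + (norm (g \<xi>))\<^sup>2)"
    using sum_squares_bound[of "norm (g \<eta>)" "norm (g \<xi>)"] by (simp add: h_def)
   then have "norm (g \<eta>) * norm (g \<xi>) * k \<xi> \<eta> <= h * ((norm (g \<eta>))\<^sup>2 + (norm (g \<xi>))\<^sup>2) * k \<xi> \<eta>"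
    using k0 by (intro mult_right_mono) auto
   then show "ennreal (norm (cnj (g \<eta>) * g \<xi> * cplx (k \<xi> \<eta>))) \<le>
     ennreal h * (ennreal ((norm (g \<eta>))\<^sup>2) * ennreal (k \<xi> \<eta>)) + ennreal h * (ennreal ((norm (g \<xi>))\<^sup>2) * ennreal (k \<xi> \<eta>))"
    using k0 h0 by (simp add: norm_mult algebra_simps flip: ennreal_mult ennreal_plus)
  qed
  also have "\<dots> = ennreal h * (\<integral>\<^sup>+\<eta>. \<integral>\<^sup>+\<xi>. ennreal ((norm (g \<eta>))\<^sup>2) * ennreal (k \<xi> \<eta>) \<partial>lborel \<partial>lborel) +
    ennreal h * (\<integral>\<^sup>+\<eta>. \<integral>\<^sup>+\<xi>. ennreal ((norm (g \<xi>))\<^sup>2) * ennreal (k \<xi> \<eta>) \<partial>lborel \<partial>lborel)"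
   by (simp add: nn_integral_add nn_integral_cmult)
  also have "(\<integral>\<^sup>+\<eta>. \<integral>\<^sup>+\<xi>. ennreal ((norm (g \<xi>))\<^sup>2) * ennreal (k \<xi> \<eta>) \<partial>lborel \<partial>lborel) = 
    (\<integral>\<^sup>+\<xi>. \<integral>\<^sup>+\<eta>. ennreal ((norm (g \<xi>))\<^sup>2) * ennreal (k \<xi> \<eta>) \<partial>lborel \<partial>lborel)"
   by (rule lborel_pair.Fubini') measurable
  also have "\<dots> = (\<integral>\<^sup>+\<xi>. \<integral>\<^sup>+\<eta>. ennreal ((norm (g \<xi>))\<^sup>2) * ennreal (k \<eta> \<xi>) \<partial>lborel \<partial>lborel)"
   by (subst ks) simp
  also have "(\<integral>\<^sup>+\<eta>. \<integral>\<^sup>+\<xi>. ennreal ((norm (g \<eta>))\<^sup>2) * ennreal (k \<xi> \<eta>) \<partial>lborel \<partial>lborel) = I * ennreal (2 * pi)"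
   by (simp add: nn_integral_cmult kI nn_integral_multc I_def)
  also have "(ennreal h * (I * ennreal (2 * pi)) + ennreal h * (I * ennreal (2 * pi))) * ennreal (1 / (4 * pi\<^sup>2)) = 
    I * (ennreal (2 * h * (2 * pi) * (1 / (4 * pi\<^sup>2))))"
  proof -
   have "(ennreal h * (I * ennreal a) + ennreal h * (I * ennreal a)) * ennreal b = I * ennreal (2 * h * a * b)"
    if "a >= 0" "b >= 0" for a b
    using h0 that by (simp add: ennreal_mult ac_simps flip: mult_2)
   from this[of "2 * pi" "1 / (4 * pi\<^sup>2)"] show ?thesis by simp
  qed
  also have "2 * h * (2 * pi) * (1 / (4 * pi\<^sup>2)) = 1 / (2 * pi)"
   by (simp add: power2_eq_square h_def)
  finally show ?thesis by (simp add: mult.commute mult_left_mono mult_right_mono)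
 qed
 \<comment> \<open>The damping parameter runs through 1/(n+1); the limit inferior of the integrals
   then dominates the undamped one.\<close>
 have lim: "(\<lambda>n. ennreal (exp (- (1 / real (Suc n) * x\<^sup>2)) * (norm (ift g x))\<^sup>2)) \<longlonglongrightarrow> ennreal (exp (- (0 * x\<^sup>2)) * (norm (ift g x))\<^sup>2)" for x
  by (intro tendsto_intros LIMSEQ_Suc[OF lim_1_over_n])
 have "(nnL2 (ift g)) = 
   (\<integral>\<^sup>+x. liminf (\<lambda>n. ennreal (exp (- (1 / real (Suc n) * x\<^sup>2)) * (norm (ift g x))\<^sup>2)) \<partial>lborel)"
  using lim_imp_Liminf[OF _ lim] by simp
 also have "\<dots> <= liminf (\<lambda>n. \<integral>\<^sup>+x. ennreal (exp (- (1 / real (Suc n) * x\<^sup>2)) * (norm (ift g x))\<^sup>2) \<partial>lborel)"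
  by (rule nn_integral_liminf) measurable
 also have "\<dots> <= ennreal (1 / (2 * pi)) * I"
  by (intro Liminf_le always_eventually allI main) auto
 finally show ?thesis by (simp add: I_def)
qed

section \<open>Weighted L^1 bounds for Gaussian-dominated symbols\<close>

lemma nn_integral_inverse_1_plus_square:
 "(\<integral>\<^sup>+x. ennreal (inverse (1 + (x::real)\<^sup>2)) \<partial>lborel) = ennreal pi"
proof -
 have "integrable lborel (\<lambda>x::real. inverse (1 + x\<^sup>2))"
  using integrable_inverse_1_plus_square by (simp add: set_integrable_def einterval_def)
 moreover have "(LINT x|lborel. inverse (1 + x\<^sup>2)) = pi"
  using LBINT_inverse_1_plus_square by (simp add: interval_lebesgue_integral_def set_lebesgue_integral_def einterval_def)
 ultimately show ?thesis by (subst nn_integral_eq_integral) auto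
qed

lemma nn_integral_inverse_1_plus_square_scaled:
 assumes "l > 0"
 shows "(\<integral>\<^sup>+x. ennreal (inverse (1 + (l * x)\<^sup>2)) \<partial>lborel) = ennreal (pi / l)"
proof -
 have "(\<integral>\<^sup>+x. ennreal (inverse (1 + (x::real)\<^sup>2)) \<partial>lborel) = ennreal \<bar>l\<bar> * (\<integral>\<^sup>+x. ennreal (inverse (1 + (0 + l * x)\<^sup>2)) \<partial>lborel)"
  using assms by (intro nn_integral_real_affine) auto
 then have eq: "ennreal pi = ennreal l * (\<integral>\<^sup>+x. ennreal (inverse (1 + (l * x)\<^sup>2)) \<partial>lborel)"
  using assms by (simp add: nn_integral_inverse_1_plus_square)
 have "ennreal (pi / l) = ennreal (1 / l) * ennreal pi" using assms by (simp flip: ennreal_mult)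
 also have "\<dots> = (ennreal (1 / l) * ennreal l) * (\<integral>\<^sup>+x. ennreal (inverse (1 + (l * x)\<^sup>2)) \<partial>lborel)"
  by (simp add: eq mult.assoc)
 also have "ennreal (1 / l) * ennreal l = 1" using assms by (simp flip: ennreal_mult)
 finally show ?thesis by simp
qed

definition gauss_bounded :: "real => real => (real => complex) => bool" where
 "gauss_bounded c \<kappa> g \<longleftrightarrow> g \<in> borel_measurable lborel \<and> (\<forall>\<xi>. norm (g \<xi>) <= \<kappa> * exp (- (c * \<xi>\<^sup>2)))"

lemma gauss_bounded_integrable:
 assumes "gauss_bounded c \<kappa> g" "c > 0"
 shows "integrable lborel g"
proof (rule bochner_integrable_bound)
 show "integrable lborel (\<lambda>\<xi>. \<kappa> * exp (- (c * \<xi>\<^sup>2)))"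
  using assms by auto
qed (use assms in \<open>auto simp: gauss_bounded_def intro: order_trans[OF _ abs_ge_self]\<close>)

lemma gauss_bounded_nonneg: "gauss_bounded c \<kappa> g ==> 0 <= \<kappa>"
proof -
 assume "gauss_bounded c \<kappa> g"
 then have "norm (g 0) <= \<kappa> * exp (- (c * 0\<^sup>2))" unfolding gauss_bounded_def by blast
 also have "\<dots> = \<kappa>" by simp
 finally show "0 <= \<kappa>" using norm_ge_zero[of "g 0"] by linarith
qed

lemma integral_norm_gauss_bounded:
 assumes "gauss_bounded c \<kappa> g" "c > 0"
 shows "(LINT \<xi>|lborel. norm (g \<xi>)) <= \<kappa> * sqrt (pi / c)"
proof -
 have "(LINT \<xi>|lborel. norm (g \<xi>)) <= (LINT \<xi>|lborel. \<kappa> * exp (- (c * \<xi>\<^sup>2)))"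
  using assms by (intro integral_mono integrable_norm gauss_bounded_integrable integrable_mult_right integrable_gaussian_0)
   (auto simp: gauss_bounded_def)
 then show ?thesis using integral_gaussian[of c 0] assms by simp
qed

lemma nn_integral_norm_square_gauss_bounded:
 assumes g: "gauss_bounded c \<kappa> g" "c > 0"
 shows "(nnL2 g) <= ennreal (\<kappa>\<^sup>2 * sqrt (pi / (2 * c)))"
proof -
 have "(nnL2 g) <= (\<integral>\<^sup>+\<xi>. ennreal (\<kappa>\<^sup>2) * ennreal (exp (- ((2 * c) * (\<xi> - 0)\<^sup>2))) \<partial>lborel)"
 proof (intro nn_integral_mono)
  fix \<xi> :: real
  have "(norm (g \<xi>))\<^sup>2 <= (\<kappa> * exp (- (c * \<xi>\<^sup>2)))\<^sup>2"
   using g by (intro power_mono) (auto simp: gauss_bounded_def)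
  also have "\<dots> = \<kappa>\<^sup>2 * exp (- ((2 * c) * \<xi>\<^sup>2))"
   by (simp add: power_mult_distrib flip: exp_of_nat_mult)
  finally show "ennreal ((norm (g \<xi>))\<^sup>2) <= ennreal (\<kappa>\<^sup>2) * ennreal (exp (- ((2 * c) * (\<xi> - 0)\<^sup>2)))"
   by (simp flip: ennreal_mult)
 qed
 also have "\<dots> = ennreal (\<kappa>\<^sup>2) * ennreal (sqrt (pi / (2 * c)))"
  using g by (subst nn_integral_cmult) (auto simp: nn_integral_gaussian[of "2 * c" 0, simplified])
 finally show ?thesis using g(2) by (simp flip: ennreal_mult)
qed

lemma gauss_tendsto_0:
 assumes "c > 0"
 shows "((\<lambda>x. \<kappa> * exp (- (c * x\<^sup>2))) \<longlongrightarrow> 0) at_top" "((\<lambda>x. \<kappa> * exp (- (c * x\<^sup>2))) \<longlongrightarrow> (0::real)) at_bot"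
proof -
 have "filterlim (\<lambda>x::real. c * x\<^sup>2) at_top F" if "filterlim (\<lambda>x::real. x\<^sup>2) at_top F" for F
  by (rule filterlim_tendsto_pos_mult_at_top[OF tendsto_const assms that])
 moreover have "filterlim (\<lambda>x::real. x\<^sup>2) at_top at_top" "filterlim (\<lambda>x::real. x\<^sup>2) at_top at_bot"
  by (simp_all add: filterlim_pow_at_top filterlim_pow_at_bot_even filterlim_ident)
 ultimately show "((\<lambda>x. \<kappa> * exp (- (c * x\<^sup>2))) \<longlongrightarrow> 0) at_top" "((\<lambda>x. \<kappa> * exp (- (c * x\<^sup>2))) \<longlongrightarrow> (0::real)) at_bot"
  by (auto intro!: tendsto_mult_right_zero filterlim_compose[OF exp_at_bot] simp: filterlim_uminus_at_top)
qed

lemma iexp_has_vector_derivative [derivative_intros]: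
 "((\<lambda>\<xi>. iexp (x * \<xi>)) has_vector_derivative \<i> * x * iexp (x * \<xi>)) (at \<xi>)"
proof -
 have "((\<lambda>z. exp (\<i> * x * z)) has_field_derivative \<i> * x * exp (\<i> * x * cplx \<xi>)) (at (cplx \<xi>))"
  by (auto intro!: derivative_eq_intros)
 from has_vector_derivative_real_field[OF this] show ?thesis by (simp add: mult_ac o_def)
qed

lemma ennreal_square_le_imp_le:
 assumes "x\<^sup>2 <= (ennreal b)\<^sup>2" "0 <= b"
 shows "x <= ennreal b"
proof (cases x)
 case (real a)
 then show ?thesis using assms by (auto simp: ennreal_power ennreal_le_iff intro: power2_le_imp_le)
next
 case top
 then show ?thesis using assms by (simp add: ennreal_power top_unique power2_eq_square ennreal_mult_eq_top_iff)
qed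

text \<open>The symbol and its derivative have separate constants because differentiation in
  frequency costs a power of t; the ratio of the two constants fixes the spatial scale of the
  kernel.\<close>

definition C1_gauss :: "real => real => real => (real => complex) => (real => complex) => bool" where
 "C1_gauss c \<kappa> \<kappa>' g g' \<longleftrightarrow> gauss_bounded c \<kappa> g \<and> gauss_bounded c \<kappa>' g' \<and>
   (\<forall>\<xi>. (g has_vector_derivative g' \<xi>) (at \<xi>)) \<and> continuous_on UNIV g'"

text \<open>Integration by parts on the whole line: the derivative of the integrand
  \<open>iexp (x * \<xi>) * g \<xi>\<close> integrates to 0 because the Gaussian bound removes both
  boundary terms.\<close>

lemma norm_x_ift:
 assumes g: "C1_gauss c \<kappa> \<kappa>' g g'" and c: "c > 0"
 shows "norm (cplx x * ift g x) = norm (ift g' x)"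
proof -
 have i: "integrable lborel g" "integrable lborel g'"
  using g c by (auto simp: C1_gauss_def intro: gauss_bounded_integrable)
 have d: "((\<lambda>\<xi>. iexp (x * \<xi>) * g \<xi>) has_vector_derivative (iexp (x * \<xi>) * g' \<xi> + (\<i> * x) * (iexp (x * \<xi>) * g \<xi>))) (at \<xi>)" for \<xi>
 proof -
  have "(g has_vector_derivative g' \<xi>) (at \<xi>)" using g by (simp add: C1_gauss_def)
  from has_vector_derivative_mult[OF iexp_has_vector_derivative this] show ?thesis by (simp only: mult.assoc)
 qed
 have cont: "isCont (\<lambda>\<xi>. iexp (x * \<xi>) * g' \<xi> + (\<i> * x) * (iexp (x * \<xi>) * g \<xi>)) \<xi>" for \<xi>
  using g unfolding C1_gauss_def continuous_on_eq_continuous_at[OF open_UNIV]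
  by (auto intro!: continuous_intros dest: has_vector_derivative_continuous)
 have z: "((\<lambda>\<xi>. iexp (x * \<xi>) * g \<xi>) \<longlongrightarrow> 0) F" if "((\<lambda>x. \<kappa> * exp (- (c * x\<^sup>2))) \<longlongrightarrow> 0) F" for F
  using g by (intro Lim_null_comparison[OF _ that]) (auto simp: C1_gauss_def gauss_bounded_def norm_mult)
 have i': "integrable lborel (\<lambda>\<xi>. iexp (x * \<xi>) * g \<xi>)" "integrable lborel (\<lambda>\<xi>. iexp (x * \<xi>) * g' \<xi>)"
  by (rule integrable_iexp_mult, rule i, simp)+
 have "(LBINT \<xi>=-\<infinity>..\<infinity>. (iexp (x * \<xi>) * g' \<xi> + (\<i> * x) * (iexp (x * \<xi>) * g \<xi>))) = 0 - 0"
 proof (rule interval_integral_FTC_integrable)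
  show "set_integrable lborel (einterval (- \<infinity>) \<infinity>) (\<lambda>\<xi>. iexp (x * \<xi>) * g' \<xi> + (\<i> * x) * (iexp (x * \<xi>) * g \<xi>))"
   unfolding set_integrable_def using i' by (auto simp: einterval_def intro!: integrable_add integrable_mult_right)
  show "(((\<lambda>\<xi>. iexp (x * \<xi>) * g \<xi>) \<circ> real_of_ereal) \<longlongrightarrow> 0) (at_right (- \<infinity>))"
   "(((\<lambda>\<xi>. iexp (x * \<xi>) * g \<xi>) \<circ> real_of_ereal) \<longlongrightarrow> 0) (at_left \<infinity>)"
   unfolding ereal_tendsto_simps by (rule z, rule gauss_tendsto_0[OF c])+
 qed (use d cont in auto)
 then have "(LINT \<xi>|lborel. iexp (x * \<xi>) * g' \<xi> + (\<i> * x) * (iexp (x * \<xi>) * g \<xi>)) = 0"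
  by (simp add: interval_lebesgue_integral_def set_lebesgue_integral_def einterval_def)
 also have "(LINT \<xi>|lborel. iexp (x * \<xi>) * g' \<xi> + (\<i> * x) * (iexp (x * \<xi>) * g \<xi>)) = 
   (LINT \<xi>|lborel. iexp (x * \<xi>) * g' \<xi>) + (\<i> * x) * (LINT \<xi>|lborel. iexp (x * \<xi>) * g \<xi>)"
  by (subst bochner_integral_add[OF i'(2) integrable_mult_right[OF i'(1)]]) simp
 finally have "ift g' x + \<i> * x * ift g x = 0"
  by (simp add: ift_def field_simps flip: add_divide_distrib)
 then have "ift g' x = - (\<i> * x * ift g x)"
  by (simp add: eq_neg_iff_add_eq_0)
 then show ?thesis by (simp add: norm_mult)
qed

lemma norm_ift_gauss_le:
 assumes "gauss_bounded c \<kappa> g" "c > 0"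
 shows "norm (ift g x) <= \<kappa> * sqrt (pi / c) / (2 * pi)"
 by (rule order_trans[OF norm_ift_le divide_right_mono[OF integral_norm_gauss_bounded[OF assms]]]) simp

lemma nn_integral_ift_square_le:
 assumes "gauss_bounded c \<kappa> g" "c > 0"
 shows "(nnL2 (ift g)) <= ennreal (\<kappa>\<^sup>2 * sqrt (pi / (2 * c)) / (2 * pi))"
proof -
 have "(nnL2 (ift g)) <= ennreal (1 / (2 * pi)) * (nnL2 g)"
  by (rule plancherel_ineq[OF gauss_bounded_integrable[OF assms]])
 also have "\<dots> <= ennreal (1 / (2 * pi)) * ennreal (\<kappa>\<^sup>2 * sqrt (pi / (2 * c)))"
  by (intro mult_left_mono nn_integral_norm_square_gauss_bounded assms) auto
 finally show ?thesis using assms(2) by (simp flip: ennreal_mult)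
qed

text \<open>Weight \<open>1 + (l x)\<^sup>2\<close> and Cauchy--Schwarz; the free scale \<open>l\<close> makes the bound sharp in time.\<close>

lemma nn_integral_ift_le:
 assumes g: "C1_gauss c \<kappa> \<kappa>' g g'" and c: "c > 0" and l: "l > 0"
 shows "(nnL1 (ift g)) \<le>
  ennreal (sqrt (1 / (2 * l) * ((\<kappa>\<^sup>2 + l\<^sup>2 * \<kappa>'\<^sup>2) * sqrt (pi / (2 * c)))))"
proof -
 have gb: "gauss_bounded c \<kappa> g" "gauss_bounded c \<kappa>' g'" using g by (auto simp: C1_gauss_def)
 have [measurable]: "g \<in> borel_measurable borel" "g' \<in> borel_measurable borel"
  using g by (auto simp: C1_gauss_def gauss_bounded_def)
 have [measurable]: "ift g \<in> borel_measurable borel" "ift g' \<in> borel_measurable borel"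
  using ift_measurable[of g] ift_measurable[of g'] by simp_all
 define w where "w = (\<lambda>x::real. 1 + (l * x)\<^sup>2)"
 have w: "w x > 0" for x by (simp add: w_def add_pos_nonneg)
 have [measurable]: "w \<in> borel_measurable borel" by (simp add: w_def)
 have "(nnL1 (ift g)) = (\<integral>\<^sup>+x. ennreal (inverse (sqrt (w x))) * ennreal (sqrt (w x) * norm (ift g x)) \<partial>lborel)"
  using w less_imp_le[OF w] by (intro nn_integral_cong) (simp add: w less_imp_neq[OF w, symmetric] flip: ennreal_mult)
 also have "\<dots>\<^sup>2 <= (\<integral>\<^sup>+x. (ennreal (inverse (sqrt (w x))))\<^sup>2 \<partial>lborel) * (\<integral>\<^sup>+x. (ennreal (sqrt (w x) * norm (ift g x)))\<^sup>2 \<partial>lborel)"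
  by (rule Cauchy_Schwarz_nn_integral) measurable
 also have "(\<integral>\<^sup>+x. (ennreal (inverse (sqrt (w x))))\<^sup>2 \<partial>lborel) = (\<integral>\<^sup>+x. ennreal (inverse (1 + (l * x)\<^sup>2)) \<partial>lborel)"
  using less_imp_le[OF w] by (intro nn_integral_cong) (simp add: ennreal_power power_inverse w_def)
 also have "\<dots> = ennreal (pi / l)" by (rule nn_integral_inverse_1_plus_square_scaled[OF l])
 also have "(\<integral>\<^sup>+x. (ennreal (sqrt (w x) * norm (ift g x)))\<^sup>2 \<partial>lborel) = 
   (\<integral>\<^sup>+x. ennreal ((norm (ift g x))\<^sup>2) + ennreal (l\<^sup>2) * ennreal ((norm (ift g' x))\<^sup>2) \<partial>lborel)"
 proof (intro nn_integral_cong)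
  fix x
  have "\<bar>x\<bar> * norm (ift g x) = norm (ift g' x)" using norm_x_ift[OF g c, of x] by (simp add: norm_mult)
  then have "(norm (ift g' x))\<^sup>2 = x\<^sup>2 * (norm (ift g x))\<^sup>2" by (metis power_mult_distrib power2_abs)
  then show "(ennreal (sqrt (w x) * norm (ift g x)))\<^sup>2 = ennreal ((norm (ift g x))\<^sup>2) + ennreal (l\<^sup>2) * ennreal ((norm (ift g' x))\<^sup>2)"
   using less_imp_le[OF w[of x]] by (simp add: ennreal_power power_mult_distrib w_def algebra_simps flip: ennreal_mult ennreal_plus)
 qed
 also have "\<dots> = (nnL2 (ift g)) + ennreal (l\<^sup>2) * (nnL2 (ift g'))"
  by (simp add: nn_integral_add nn_integral_cmult)
 also have "\<dots> <= ennreal (\<kappa>\<^sup>2 * sqrt (pi / (2 * c)) / (2 * pi)) + ennreal (l\<^sup>2) * ennreal (\<kappa>'\<^sup>2 * sqrt (pi / (2 * c)) / (2 * pi))"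
  by (intro add_mono mult_left_mono nn_integral_ift_square_le gb c) auto
 also have "\<dots> = ennreal ((\<kappa>\<^sup>2 + l\<^sup>2 * \<kappa>'\<^sup>2) * sqrt (pi / (2 * c)) / (2 * pi))"
  using c by (simp add: algebra_simps add_divide_distrib flip: ennreal_mult ennreal_plus)
 finally have "(nnL1 (ift g))\<^sup>2 <= ennreal (pi / l) * ennreal ((\<kappa>\<^sup>2 + l\<^sup>2 * \<kappa>'\<^sup>2) * sqrt (pi / (2 * c)) / (2 * pi))"
  by (simp add: mult_left_mono)
 also have "\<dots> = ennreal (1 / (2 * l) * ((\<kappa>\<^sup>2 + l\<^sup>2 * \<kappa>'\<^sup>2) * sqrt (pi / (2 * c))))"
  using l c by (simp flip: ennreal_mult add: field_simps)
 also have "\<dots> = (ennreal (sqrt (1 / (2 * l) * ((\<kappa>\<^sup>2 + l\<^sup>2 * \<kappa>'\<^sup>2) * sqrt (pi / (2 * c))))))\<^sup>2"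
  using l c by (subst ennreal_power) auto
 finally show ?thesis using l c by (intro ennreal_square_le_imp_le) auto
qed

text \<open>A sup bound and an L^1 bound are carried together, since every L^p norm follows from the
  two. The second is an extended integral, so it includes integrability.\<close>

definition bnd :: "(real => complex) => real => real => bool" where
 "bnd f A B \<longleftrightarrow> f \<in> borel_measurable lborel \<and> (\<forall>x. norm (f x) <= A) \<and>
   (nnL1 f) <= ennreal B"

text \<open>The parameter \<open>\<mu>\<close> measures by how much the derivative of the symbol
  exceeds the parabolic size \<open>\<kappa> * sqrt t\<close>; only the L^1 bound pays for it, with
  a square root.\<close>

lemma bnd_ift:
 assumes g: "C1_gauss (t / 2) \<kappa> (\<kappa> * sqrt t * \<mu>) g g'" and t: "t > 0" and \<mu>: "\<mu> > 0"
 shows "bnd (ift g) (\<kappa> / sqrt t) (2 * \<kappa> * sqrt \<mu>)"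
proof -
 have t2: "t / 2 > 0" using t by simp
 have gb: "gauss_bounded (t / 2) \<kappa> g" using g by (simp add: C1_gauss_def)
 have k: "\<kappa> >= 0" by (rule gauss_bounded_nonneg[OF gb])
 have s2: "sqrt 2 <= 2" by (rule real_le_lsqrt) auto
 have "norm (ift g x) <= \<kappa> / sqrt t" for x
 proof -
  have "norm (ift g x) <= \<kappa> * sqrt (pi / (t / 2)) / (2 * pi)"
   by (rule norm_ift_gauss_le[OF gb t2])
  also have "sqrt (pi / (t / 2)) = (sqrt 2 * sqrt pi) / sqrt t"
   by (simp add: real_sqrt_divide real_sqrt_mult mult.commute)
  also have "sqrt 2 * sqrt pi <= 2 * pi"
   using s2 pi_ge_two by (intro mult_mono real_le_lsqrt) (auto simp: power2_eq_square)
  then have "\<kappa> * (sqrt 2 * sqrt pi / sqrt t) / (2 * pi) <= \<kappa> * (2 * pi / sqrt t) / (2 * pi)"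
   using k t by (intro divide_right_mono mult_left_mono) auto
  finally show ?thesis by simp
 qed
 \<comment> \<open>The scale \<open>1 / (sqrt t * \<mu>)\<close> makes the contributions of the
   symbol and of its derivative equal.\<close>
 moreover have "(nnL1 (ift g)) <= ennreal (2 * \<kappa> * sqrt \<mu>)"
 proof (rule order_trans[OF nn_integral_ift_le[OF g t2, of "1 / (sqrt t * \<mu>)"]])
  show "0 < 1 / (sqrt t * \<mu>)" using t \<mu> by simp
  have "1 / (2 * (1 / (sqrt t * \<mu>))) * ((\<kappa>\<^sup>2 + (1 / (sqrt t * \<mu>))\<^sup>2 * (\<kappa> * sqrt t * \<mu>)\<^sup>2) * sqrt (pi / (2 * (t / 2)))) = \<kappa>\<^sup>2 * \<mu> * sqrt pi"
   using t \<mu> by (simp add: real_sqrt_divide field_simps power2_eq_square)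
  also have "\<dots> <= \<kappa>\<^sup>2 * \<mu> * 4"
   using \<mu> pi_less_4 by (intro mult_left_mono real_le_lsqrt) auto
  also have "\<dots> = (2 * \<kappa> * sqrt \<mu>)\<^sup>2" using \<mu> by (simp add: power_mult_distrib)
  finally show "ennreal (sqrt (1 / (2 * (1 / (sqrt t * \<mu>))) * ((\<kappa>\<^sup>2 + (1 / (sqrt t * \<mu>))\<^sup>2 * (\<kappa> * sqrt t * \<mu>)\<^sup>2) * sqrt (pi / (2 * (t / 2)))))) <= ennreal (2 * \<kappa> * sqrt \<mu>)"
   using k \<mu> by (intro ennreal_leI real_le_lsqrt) auto
 qed
 moreover have "ift g \<in> borel_measurable lborel" using gb by (intro ift_measurable) (auto simp: gauss_bounded_def)
 ultimately show ?thesis by (simp add: bnd_def)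
qed

text \<open>The damped transform of \<open>ift g\<close> is computed in two ways: dominated
  convergence on the left gives \<open>ft (ift g)\<close>, and on the right the approximate identity
  converges to g by continuity. Integrability of \<open>ift g\<close> comes from the weighted bound
  with scale 1.\<close>

lemma ft_ift:
 assumes g: "C1_gauss c \<kappa> \<kappa>' g g'" and c: "c > 0"
 shows "ft (ift g) \<eta> = g \<eta>" and "integrable lborel (ift g)"
proof -
 have gb: "gauss_bounded c \<kappa> g" using g by (simp add: C1_gauss_def)
 have ig: "integrable lborel g" by (rule gauss_bounded_integrable[OF gb c])
 have k: "\<kappa> >= 0" by (rule gauss_bounded_nonneg[OF gb])
 have gk: "norm (g \<xi>) <= \<kappa>" for \<xi>
 proof -
  have "norm (g \<xi>) <= \<kappa> * exp (- (c * \<xi>\<^sup>2))" using gb by (simp add: gauss_bounded_def)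
  also have "\<dots> <= \<kappa> * 1" using k c by (intro mult_left_mono) auto
  finally show ?thesis by simp
 qed
 have gc: "isCont g \<xi>" for \<xi> using g by (auto simp: C1_gauss_def intro: has_vector_derivative_continuous)
 have [measurable]: "g \<in> borel_measurable borel" using gb by (simp add: gauss_bounded_def)
 have [measurable]: "ift g \<in> borel_measurable borel" using ift_measurable[of g] by simp
 show i: "integrable lborel (ift g)"
  using nn_integral_ift_le[OF g c, of 1] by (intro integrableI_bounded) (auto intro: le_less_trans simp: ennreal_less_top)
 define e where "e = (\<lambda>n. 1 / real (Suc n))"
 have e: "e n > 0" for n by (simp add: e_def)
 have e0: "e \<longlonglongrightarrow> 0" unfolding e_def by (rule LIMSEQ_Suc[OF lim_1_over_n])
 have "(\<lambda>n. LINT x|lborel. iexp (- (x * \<eta>)) * cplx (exp (- (e n * x\<^sup>2))) * ift g x) \<longlonglongrightarrow> (LINT x|lborel. iexp (- (x * \<eta>)) * cplx (exp (- (0 * x\<^sup>2))) * ift g x)"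
 proof (rule integral_dominated_convergence[where w="\<lambda>x. norm (ift g x)"])
  show "AE x in lborel. (\<lambda>n. iexp (- (x * \<eta>)) * cplx (exp (- (e n * x\<^sup>2))) * ift g x) \<longlonglongrightarrow> iexp (- (x * \<eta>)) * cplx (exp (- (0 * x\<^sup>2))) * ift g x"
   by (intro AE_I2 tendsto_intros e0)
  show "AE x in lborel. norm (iexp (- (x * \<eta>)) * cplx (exp (- (e n * x\<^sup>2))) * ift g x) <= norm (ift g x)" for n
   using e[of n] by (intro AE_I2) (auto simp: norm_mult intro!: mult_left_le_one_le)
 qed (use i in auto)
 then have 1: "(\<lambda>n. LINT x|lborel. iexp (- (x * \<eta>)) * cplx (exp (- (e n * x\<^sup>2))) * ift g x) \<longlonglongrightarrow> ft (ift g) \<eta>"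
  by (simp add: ft_def)
 \<comment> \<open>Substituting \<eta> + 2 sqrt(e) z moves the shrinking width from the kernel into
   the argument of g, so the weight exp(-z^2) is fixed and can dominate.\<close>
 have eq: "(LINT x|lborel. iexp (- (x * \<eta>)) * cplx (exp (- (e n * x\<^sup>2))) * ift g x) =
   (LINT z|lborel. g (\<eta> + (2 * sqrt (e n)) * z) * cplx (exp (- z\<^sup>2))) / sqrt pi" for n
 proof -
  have "(LINT \<xi>|lborel. g \<xi> * cplx (sqrt (pi / e n) * exp (- (1 / (4 * e n) * (\<xi> - \<eta>)\<^sup>2)))) = 
   \<bar>2 * sqrt (e n)\<bar> *\<^sub>R (LINT z|lborel. g (\<eta> + (2 * sqrt (e n)) * z) * cplx (sqrt (pi / e n) * exp (- (1 / (4 * e n) * ((\<eta> + (2 * sqrt (e n)) * z) - \<eta>)\<^sup>2))))"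
   using e[of n] by (intro lborel_integral_real_affine) auto
  also have "\<dots> = \<bar>2 * sqrt (e n)\<bar> *\<^sub>R (LINT z|lborel. sqrt (pi / e n) * (g (\<eta> + (2 * sqrt (e n)) * z) * cplx (exp (- z\<^sup>2))))"
   using e[of n] by (simp add: power_mult_distrib mult_ac)
  also have "\<dots> = (2 * sqrt (e n)) * sqrt (pi / e n) * (LINT z|lborel. (g (\<eta> + (2 * sqrt (e n)) * z) * cplx (exp (- z\<^sup>2))))"
   using e[of n] by (simp add: scaleR_conv_of_real)
  also have "(2 * sqrt (e n)) * sqrt (pi / e n) = 2 * sqrt pi" using e[of n] by (simp add: real_sqrt_divide)
  finally show ?thesis
   unfolding ift_gaussian_average[OF ig e] 
   by (simp add: field_simps flip: of_real_mult)
 qed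
 have "(\<lambda>n. LINT z|lborel. g (\<eta> + (2 * sqrt (e n)) * z) * cplx (exp (- z\<^sup>2))) \<longlonglongrightarrow> (LINT z|lborel. g (\<eta> + (2 * sqrt 0) * z) * cplx (exp (- z\<^sup>2)))"
 proof (rule integral_dominated_convergence[where w="\<lambda>z. \<kappa> * exp (- z\<^sup>2)"])
  show "AE z in lborel. (\<lambda>n. g (\<eta> + (2 * sqrt (e n)) * z) * cplx (exp (- z\<^sup>2))) \<longlonglongrightarrow> g (\<eta> + (2 * sqrt 0) * z) * cplx (exp (- z\<^sup>2))"
   by (intro AE_I2 tendsto_mult tendsto_const isCont_tendsto_compose[OF gc] tendsto_add tendsto_real_sqrt e0)
  show "AE z in lborel. norm (g (\<eta> + (2 * sqrt (e n)) * z) * cplx (exp (- z\<^sup>2))) <= \<kappa> * exp (- z\<^sup>2)" for n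
   by (intro AE_I2) (auto simp: norm_mult gk)
 qed (use integrable_gaussian_0[of 1] in auto)
 then have 2: "(\<lambda>n. LINT x|lborel. iexp (- (x * \<eta>)) * cplx (exp (- (e n * x\<^sup>2))) * ift g x) \<longlonglongrightarrow> (LINT z|lborel. g \<eta> * cplx (exp (- z\<^sup>2))) / sqrt pi"
  unfolding eq by (intro tendsto_divide tendsto_const) auto
 have "(LINT z|lborel. cplx (exp (- z\<^sup>2))) = sqrt pi"
  using integral_gaussian[of 1 0] by (simp only: integral_complex_of_real) simp
 then have "(LINT z|lborel. g \<eta> * cplx (exp (- z\<^sup>2))) / sqrt pi = g \<eta>"
  by simp
 with LIMSEQ_unique[OF 1 2] show "ft (ift g) \<eta> = g \<eta>" by simp
qed

text \<open>Only Fubini is involved: the phase of x - y splits into a product. Convolution with a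
  kernel thereby becomes a Fourier multiplier, to which the L^2 bounds apply.\<close>

lemma conv_ift:
 assumes i: "integrable lborel g" "integrable lborel f"
 shows "(LINT y|lborel. ift g (x - y) * f y) = ift (\<lambda>\<xi>. g \<xi> * ft f \<xi>) x"
proof -
 have "(LINT y|lborel. ift g (x - y) * f y) = (LINT y|lborel. f y * (LINT \<xi>|lborel. iexp ((x - y) * \<xi>) * g \<xi>)) / (2 * pi)"
  by (simp add: ift_def mult.commute)
 also have "(LINT y|lborel. f y * (LINT \<xi>|lborel. iexp ((x - y) * \<xi>) * g \<xi>)) = (LINT \<xi>|lborel. g \<xi> * (LINT y|lborel. iexp ((x - y) * \<xi>) * f y))"
  by (rule integral_iexp_exchange[OF i(2,1)]) measurable
 also have "(\<lambda>\<xi>. g \<xi> * (LINT y|lborel. iexp ((x - y) * \<xi>) * f y)) = (\<lambda>\<xi>. iexp (x * \<xi>) * (g \<xi> * ft f \<xi>))"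
 proof
  fix \<xi>
  have "iexp ((x - y) * \<xi>) = iexp (x * \<xi>) * iexp (- (y * \<xi>))" for y by (simp add: mult_exp_exp algebra_simps)
  then show "g \<xi> * (LINT y|lborel. iexp ((x - y) * \<xi>) * f y) = iexp (x * \<xi>) * (g \<xi> * ft f \<xi>)"
   unfolding ft_def by (simp only: mult.assoc integral_mult_right_zero mult.left_commute)
 qed
 finally show ?thesis by (simp add: ift_def)
qed

text \<open>The second-order Taylor bound for the exponential leaves an error
  \<open>C * h\<^sup>2\<close> with \<open>C\<close> proportional to the second moment of the
  symbol.\<close>

lemma ift_has_vector_derivative:
 fixes g :: "real => complex"
 assumes i: "integrable lborel g" "integrable lborel (\<lambda>\<xi>. \<i> * \<xi> * g \<xi>)" "integrable lborel (\<lambda>\<xi>. \<xi>\<^sup>2 * norm (g \<xi>))"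
 shows "(ift g has_vector_derivative ift (\<lambda>\<xi>. \<i> * \<xi> * g \<xi>) x) (at x)"
proof -
 define C :: real where "C = (LINT \<xi>|lborel. \<xi>\<^sup>2 * norm (g \<xi>)) / (4 * pi)"
 have C: "C >= 0" by (simp add: C_def)
 have bd: "norm (ift g (x + h) - ift g x - h *\<^sub>R ift (\<lambda>\<xi>. \<i> * \<xi> * g \<xi>) x) <= C * h\<^sup>2" for h
 proof -
  have ii: "integrable lborel (\<lambda>\<xi>. iexp ((x + h) * \<xi>) * g \<xi>)" "integrable lborel (\<lambda>\<xi>. iexp (x * \<xi>) * g \<xi>)"
   "integrable lborel (\<lambda>\<xi>. iexp (x * \<xi>) * (\<i> * \<xi> * g \<xi>))"
   by (rule integrable_iexp_mult, rule i, simp)+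
  have "ift g (x + h) - ift g x - h *\<^sub>R ift (\<lambda>\<xi>. \<i> * \<xi> * g \<xi>) x =
   ((LINT \<xi>|lborel. iexp ((x + h) * \<xi>) * g \<xi>) - (LINT \<xi>|lborel. iexp (x * \<xi>) * g \<xi>) - (LINT \<xi>|lborel. cplx h * (iexp (x * \<xi>) * (\<i> * \<xi> * g \<xi>)))) / (2 * pi)"
   unfolding ift_def integral_mult_right_zero by (simp add: scaleR_conv_of_real diff_divide_distrib)
  also have "\<dots> = (LINT \<xi>|lborel. iexp ((x + h) * \<xi>) * g \<xi> - iexp (x * \<xi>) * g \<xi> - cplx h * (iexp (x * \<xi>) * (\<i> * \<xi> * g \<xi>))) / (2 * pi)"
   using ii by (simp del: integral_mult_right_zero)
  finally have "norm (ift g (x + h) - ift g x - h *\<^sub>R ift (\<lambda>\<xi>. \<i> * \<xi> * g \<xi>) x) = 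
   norm (LINT \<xi>|lborel. iexp ((x + h) * \<xi>) * g \<xi> - iexp (x * \<xi>) * g \<xi> - cplx h * (iexp (x * \<xi>) * (\<i> * \<xi> * g \<xi>))) / (2 * pi)"
   by (simp add: norm_divide)
  also have "norm (LINT \<xi>|lborel. iexp ((x + h) * \<xi>) * g \<xi> - iexp (x * \<xi>) * g \<xi> - cplx h * (iexp (x * \<xi>) * (\<i> * \<xi> * g \<xi>))) \<le>
    (LINT \<xi>|lborel. h\<^sup>2 / 2 * (\<xi>\<^sup>2 * norm (g \<xi>)))"
  proof (rule Bochner_Integration.integral_norm_bound_integral)
   fix \<xi> :: real
   have "iexp ((x + h) * \<xi>) * g \<xi> - iexp (x * \<xi>) * g \<xi> - cplx h * (iexp (x * \<xi>) * (\<i> * \<xi> * g \<xi>)) =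
    iexp (x * \<xi>) * g \<xi> * (iexp (h * \<xi>) - (\<Sum>k\<le>1. (\<i> * cplx (h * \<xi>))^k / fact k))"
    by (simp add: algebra_simps exp_add)
   then have "norm (iexp ((x + h) * \<xi>) * g \<xi> - iexp (x * \<xi>) * g \<xi> - cplx h * (iexp (x * \<xi>) * (\<i> * \<xi> * g \<xi>))) =
    norm (g \<xi>) * norm (iexp (h * \<xi>) - (\<Sum>k\<le>1. (\<i> * cplx (h * \<xi>))^k / fact k))"
    by (simp add: norm_mult)
   also have "\<dots> <= norm (g \<xi>) * (\<bar>h * \<xi>\<bar> ^ Suc 1 / fact (Suc 1))"
    by (intro mult_left_mono iexp_approx1) auto
   finally show "norm (iexp ((x + h) * \<xi>) * g \<xi> - iexp (x * \<xi>) * g \<xi> - cplx h * (iexp (x * \<xi>) * (\<i> * \<xi> * g \<xi>))) <= h\<^sup>2 / 2 * (\<xi>\<^sup>2 * norm (g \<xi>))"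
    by (simp add: power2_eq_square abs_mult mult_ac)
  qed (use ii i in auto)
  also have "(LINT \<xi>|lborel. h\<^sup>2 / 2 * (\<xi>\<^sup>2 * norm (g \<xi>))) / (2 * pi) = C * h\<^sup>2" by (simp add: C_def)
  finally show ?thesis by (simp add: divide_right_mono)
 qed
 show ?thesis
  unfolding has_vector_derivative_def has_derivative_at
 proof (intro conjI bounded_linear_scaleR_left)
  have "((\<lambda>h. C * \<bar>h\<bar>) \<longlongrightarrow> C * \<bar>0\<bar>) (at (0::real))" by (intro tendsto_intros)
  then have "((\<lambda>h. C * \<bar>h\<bar>) \<longlongrightarrow> 0) (at (0::real))" by simp
  then show "((\<lambda>h. norm (ift g (x + h) - ift g x - h *\<^sub>R ift (\<lambda>\<xi>. \<i> * \<xi> * g \<xi>) x) / norm h) \<longlongrightarrow> 0) (at 0)"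
  proof (rule Lim_null_comparison[rotated])
   have "norm (norm (ift g (x + h) - ift g x - h *\<^sub>R ift (\<lambda>\<xi>. \<i> * \<xi> * g \<xi>) x) / norm h) <= C * \<bar>h\<bar>"
    if "h \<noteq> 0" for h
    using bd[of h] that by (simp add: divide_le_eq power2_eq_square mult.assoc)
   then show "\<forall>\<^sub>F h in at 0. norm (norm (ift g (x + h) - ift g x - h *\<^sub>R ift (\<lambda>\<xi>. \<i> * \<xi> * g \<xi>) x) / norm h) <= C * \<bar>h\<bar>"
    by (simp add: eventually_at_filter)
  qed
 qed
qed

section \<open>The dispersive phase and the Taylor remainders of the oscillating factor\<close>

definition psi :: "real => real => real" where "psi \<alpha> \<xi> = \<bar>\<xi>\<bar> powr \<alpha> * \<xi>"

lemma psi_has_real_derivative: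
 assumes "\<alpha> > 0"
 shows "(psi \<alpha> has_real_derivative (\<alpha> + 1) * \<bar>\<xi>\<bar> powr \<alpha>) (at \<xi>)"
proof -
 consider "\<xi> > 0" | "\<xi> < 0" | "\<xi> = 0" by linarith
 then show ?thesis
 proof cases
  case 1
  have "((\<lambda>x. x powr (\<alpha> + 1)) has_real_derivative (\<alpha> + 1) * \<bar>\<xi>\<bar> powr \<alpha>) (at \<xi>)"
   using 1 by (auto intro!: derivative_eq_intros)
  then show ?thesis
   by (rule has_field_derivative_transform_within_open[OF _ open_greaterThan[of 0]])
    (use 1 in \<open>auto simp: psi_def powr_add\<close>)
 next
  case 2
  have "((\<lambda>x. - ((- x) powr (\<alpha> + 1))) has_real_derivative (\<alpha> + 1) * \<bar>\<xi>\<bar> powr \<alpha>) (at \<xi>)"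
   using 2 by (auto intro!: derivative_eq_intros)
  then show ?thesis
   by (rule has_field_derivative_transform_within_open[OF _ open_lessThan[of 0]])
    (use 2 in \<open>auto simp: psi_def powr_add\<close>)
 next
  case 3
  have "((\<lambda>h. \<bar>h\<bar> powr \<alpha>) \<longlongrightarrow> 0) (at (0::real))"
   using assms by (auto intro!: tendsto_eq_intros)
  then have "((\<lambda>h. (psi \<alpha> (0 + h) - psi \<alpha> 0) / h) \<longlongrightarrow> 0) (at 0)"
   by (rule Lim_transform_eventually) (auto simp: psi_def eventually_at intro!: exI[of _ 1])
  then show ?thesis using 3 assms by (simp add: DERIV_def)
 qed
qed

definition rho :: "nat => real => complex" where
 "rho n \<theta> = iexp \<theta> - (\<Sum>k<n. (\<i> * \<theta>) ^ k / fact k)"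

lemma rho_Suc: "rho (Suc n) \<theta> = rho n \<theta> - (\<i> * \<theta>) ^ n / fact n"
 by (simp add: rho_def)

lemma power_has_vector_derivative:
 "((\<lambda>\<theta>. (\<i> * cplx \<theta>) ^ n) has_vector_derivative of_nat n * \<i> * (\<i> * \<theta>) ^ (n - 1)) (at \<theta>)"
proof -
 have "((\<lambda>z. (\<i> * z) ^ n) has_field_derivative of_nat n * \<i> * (\<i> * cplx \<theta>) ^ (n - 1)) (at (cplx \<theta>))"
  by (auto intro!: derivative_eq_intros)
 from has_vector_derivative_real_field[OF this] show ?thesis by (simp add: o_def)
qed

text \<open>Truncated subtraction is meant: for n = 0 no term has been removed, the function is the
  exponential itself, and its derivative is again \<open>\<i> * rho 0 \<theta>\<close>.\<close>

lemma rho_has_vector_derivative: "(rho n has_vector_derivative \<i> * rho (n - 1) \<theta>) (at \<theta>)"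
proof (induction n)
 case 0
 show ?case using iexp_has_vector_derivative[of 1 \<theta>] by (simp add: rho_def[abs_def])
next
 case (Suc n)
 have "((\<lambda>\<theta>. rho n \<theta> - (\<i> * \<theta>) ^ n / fact n) has_vector_derivative (\<i> * rho (n - 1) \<theta> - of_nat n * \<i> * (\<i> * \<theta>) ^ (n - 1) / fact n)) (at \<theta>)"
  by (intro has_vector_derivative_diff Suc.IH has_vector_derivative_divide power_has_vector_derivative)
 moreover have "\<i> * rho (n - 1) \<theta> - of_nat n * \<i> * (\<i> * \<theta>) ^ (n - 1) / fact n = \<i> * rho n \<theta>"
 proof (cases n)
  case (Suc m)
  have "of_nat (Suc m) * \<i> * (\<i> * cplx \<theta>) ^ m / fact (Suc m) = \<i> * ((\<i> * \<theta>) ^ m / fact m)"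
   by (simp add: fact_Suc del: of_nat_Suc)
  then show ?thesis by (simp only: Suc diff_Suc_1 rho_Suc right_diff_distrib)
 qed simp
 ultimately show ?case unfolding rho_Suc[abs_def] by simp
qed

lemma norm_rho_le: "norm (rho n \<theta>) <= \<bar>\<theta>\<bar> ^ n"
proof (cases n)
 case (Suc m)
 have "norm (rho n \<theta>) <= \<bar>\<theta>\<bar> ^ Suc m / fact (Suc m)"
  using iexp_approx1[of \<theta> m] by (simp add: rho_def Suc lessThan_Suc_atMost)
 also have "\<dots> <= \<bar>\<theta>\<bar> ^ Suc m / 1"
  by (intro divide_left_mono) (auto intro: fact_ge_1 simp del: fact_Suc)
 finally show ?thesis by (simp add: Suc)
qed (simp add: rho_def)

lemma continuous_on_rho [continuous_intros]: "continuous_on A f ==> continuous_on A (\<lambda>x. rho n (f x))"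
 unfolding rho_def
 by (intro continuous_on_diff continuous_on_sum continuous_on_divide continuous_on_power continuous_on_mult
   continuous_on_exp continuous_on_of_real continuous_on_const) auto

lemma continuous_on_psi [continuous_intros]: "\<alpha> > 0 ==> continuous_on A f ==> continuous_on A (\<lambda>x. psi \<alpha> (f x))"
 unfolding psi_def by (intro continuous_intros continuous_on_powr') auto

text \<open>The parameter \<open>c\<close> switches the dispersion on or off, \<open>j\<close> counts spatial derivatives, and \<open>n\<close> counts the
 Taylor terms removed from the oscillating exponential.\<close>

definition symb :: "real => real => nat => nat => real => real => complex" where
 "symb c \<alpha> j n t \<xi> = (\<i> * cplx \<xi>) ^ j * cplx (exp (- (t * \<xi>\<^sup>2))) * rho n (c * t * psi \<alpha> \<xi>)"

definition symb' :: "real => real => nat => nat => real => real => complex" where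
 "symb' c \<alpha> j n t \<xi> =
   (of_nat j * \<i> * (\<i> * cplx \<xi>) ^ (j - 1)) * cplx (exp (- (t * \<xi>\<^sup>2))) * rho n (c * t * psi \<alpha> \<xi>)
  + (\<i> * cplx \<xi>) ^ j * cplx (exp (- (t * \<xi>\<^sup>2)) * (- (2 * t * \<xi>))) * rho n (c * t * psi \<alpha> \<xi>)
  + (\<i> * cplx \<xi>) ^ j * cplx (exp (- (t * \<xi>\<^sup>2))) * (cplx (c * t * ((\<alpha> + 1) * \<bar>\<xi>\<bar> powr \<alpha>)) * (\<i> * rho (n - 1) (c * t * psi \<alpha> \<xi>)))"

lemma symb_has_vector_derivative:
 assumes "\<alpha> > 0"
 shows "(symb c \<alpha> j n t has_vector_derivative symb' c \<alpha> j n t \<xi>) (at \<xi>)"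
proof -
 have 1: "((\<lambda>\<xi>. exp (- (t * \<xi>\<^sup>2))) has_real_derivative exp (- (t * \<xi>\<^sup>2)) * (- (2 * t * \<xi>))) (at \<xi>)"
  by (auto intro!: derivative_eq_intros)
 have 2: "((\<lambda>\<xi>. c * t * psi \<alpha> \<xi>) has_real_derivative c * t * ((\<alpha> + 1) * \<bar>\<xi>\<bar> powr \<alpha>)) (at \<xi>)"
  by (intro DERIV_cmult psi_has_real_derivative assms)
 have 3: "((\<lambda>\<xi>. rho n (c * t * psi \<alpha> \<xi>)) has_vector_derivative (c * t * ((\<alpha> + 1) * \<bar>\<xi>\<bar> powr \<alpha>)) *\<^sub>R (\<i> * rho (n - 1) (c * t * psi \<alpha> \<xi>))) (at \<xi>)"
  using vector_diff_chain_at[OF 2[unfolded has_real_derivative_iff_has_vector_derivative] rho_has_vector_derivative]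
  by (simp add: o_def)
 note 4 = has_vector_derivative_of_real[OF 1, where 'a=complex]
 note 5 = has_vector_derivative_mult[OF has_vector_derivative_mult[OF power_has_vector_derivative 4] 3]
 show ?thesis
  unfolding symb_def[abs_def] by (rule has_vector_derivative_eq_rhs[OF 5[of j]]) (simp only: symb'_def scaleR_conv_of_real distrib_right add.commute add.left_commute)
qed

lemma continuous_on_symb: "\<alpha> > 0 ==> continuous_on UNIV (symb c \<alpha> j n t)"
 unfolding symb_def[abs_def]
 by (intro continuous_on_mult continuous_on_rho continuous_on_psi continuous_on_of_real continuous_on_exp
   continuous_on_power continuous_on_minus continuous_on_const continuous_on_id)

lemma continuous_on_symbb': "\<alpha> > 0 ==> continuous_on UNIV (symb' c \<alpha> j n t)"
 unfolding symb'_def[abs_def]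
 by (intro continuous_on_add continuous_on_mult continuous_on_rho continuous_on_psi continuous_on_of_real
   continuous_on_exp continuous_on_power continuous_on_minus continuous_on_const continuous_on_id
   continuous_on_powr' continuous_on_rabs) auto

section \<open>Gaussian bounds for the symbols, uniform in time\<close>

lemma poly_exp_le:
 fixes r a :: real
 assumes "r >= 0" "a >= 0"
 shows "r ^ k * (r powr a) ^ m <= exp ((real k + a * real m) * r)"
proof -
 have 1: "r <= exp r" using exp_ge_add_one_self[of r] by linarith
 have 2: "r powr a <= exp (a * r)"
 proof (cases "r = 0")
  case False
  then have "ln r <= r" using assms ln_le_minus_one[of r] by linarith
  then show ?thesis using assms False by (simp add: powr_def mult_left_mono)
 qed simp
 have "r ^ k * (r powr a) ^ m <= exp r ^ k * exp (a * r) ^ m"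
  using 1 2 assms by (intro mult_mono power_mono) auto
 also have "\<dots> = exp ((real k + a * real m) * r)" by (simp add: algebra_simps exp_add flip: exp_of_nat_mult)
 finally show ?thesis .
qed

text \<open>Powers are absorbed into exp(s r), and s r - r^2 <= s^2/2 - r^2/2 by completing the
  square. Half of the Gaussian is thus kept, whence the rate t/2 in all symbol bounds.\<close>

lemma poly_gauss_le:
 fixes r a :: real
 assumes "r >= 0" "a >= 0"
 shows "r ^ k * (r powr a) ^ m * exp (- r\<^sup>2) <= exp ((real k + a * real m)\<^sup>2 / 2) * exp (- (r\<^sup>2 / 2))"
proof -
 define s where "s = real k + a * real m"
 have "r ^ k * (r powr a) ^ m * exp (- r\<^sup>2) <= exp (s * r) * exp (- r\<^sup>2)"
  unfolding s_def using poly_exp_le[OF assms] by (intro mult_right_mono) auto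
 also have "\<dots> = exp (s * r - r\<^sup>2)" by (simp add: mult_exp_exp)
 also have "\<dots> <= exp (s\<^sup>2 / 2 - r\<^sup>2 / 2)"
  using zero_le_power2[of "s - r"] by (simp add: power2_diff)
 also have "\<dots> = exp (s\<^sup>2 / 2) * exp (- (r\<^sup>2 / 2))" by (simp add: mult_exp_exp)
 finally show ?thesis by (simp add: s_def)
qed

text \<open>Parabolic scaling \<open>r = \<surd>t \<bar>\<xi>\<bar>\<close> turns the phase \<open>t \<bar>\<xi>\<bar>\<^sup>\<alpha> \<xi>\<close> into \<open>\<epsilon> r\<^sup>\<alpha>\<^sup>+\<^sup>1\<close>
 with \<open>\<epsilon> = t powr (- (\<alpha> - 1) / 2)\<close>.\<close>

lemma C1_gauss_symb:
 assumes \<alpha>: "\<alpha> > 0"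
 shows "\<exists>C>0. \<forall>c t. 0 <= c --> c <= 1 --> 0 < t -->
  C1_gauss (t / 2) (C * (1 / sqrt t) ^ j * (t powr (- ((\<alpha> - 1) / 2))) ^ n)
   (C * (1 / sqrt t) ^ j * (t powr (- ((\<alpha> - 1) / 2))) ^ n * sqrt t * (if n = 0 then 1 + c * t powr (- ((\<alpha> - 1) / 2)) else 1))
   (symb c \<alpha> j n t) (symb' c \<alpha> j n t)"
proof -
 define K where "K = (\<lambda>k m. exp ((real k + \<alpha> * real m)\<^sup>2 / 2))"
 have K0: "K k m > 0" for k m by (simp add: K_def)
 have Kb: "r ^ k * (r powr \<alpha>) ^ m * exp (- r\<^sup>2) <= K k m * exp (- (r\<^sup>2 / 2))" if "r >= 0" for r :: real and k m
  unfolding K_def using poly_gauss_le[OF that] \<alpha> by simp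
 \<comment> \<open>The first summand serves the symbol, the others the three product-rule terms of
   its derivative. The last bracket covers both n > 0 (\<open>K (j + n - 1) n\<close>) and n = 0
   (\<open>K j 1\<close>).\<close>
 define C where "C = K (j + n) n + real j * K (j - 1 + n) n + 2 * K (j + 1 + n) n + (\<alpha> + 1) * (K (j + n - 1) n + K j 1)"
 have C0: "C > 0" unfolding C_def using K0 \<alpha> by (intro add_pos_pos add_pos_nonneg mult_nonneg_nonneg mult_pos_pos) (auto intro: less_imp_le)
 have "C1_gauss (t / 2) (C * (1 / sqrt t) ^ j * (t powr (- ((\<alpha> - 1) / 2))) ^ n)
   (C * (1 / sqrt t) ^ j * (t powr (- ((\<alpha> - 1) / 2))) ^ n * sqrt t * (if n = 0 then 1 + c * t powr (- ((\<alpha> - 1) / 2)) else 1))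
   (symb c \<alpha> j n t) (symb' c \<alpha> j n t)" if c: "0 <= c" "c <= 1" and t: "0 < t" for c t
 proof -
  define q where "q = 1 / sqrt t"
  define e where "e = t powr (- ((\<alpha> - 1) / 2))"
  \<comment> \<open>Differentiating the phase yields a factor \<open>c * e\<close> and lowers
    \<open>rho n\<close> to \<open>rho (n - 1)\<close>. For n > 0 the lost factor \<open>e\<close>
    is thereby restored; for n = 0 there is none to lose and \<open>c * e\<close> remains as an
    extra cost.\<close>
  define \<mu> where "\<mu> = (if n = 0 then 1 + c * e else 1)"
  have q: "q > 0" "t = 1 / q\<^sup>2" "sqrt t = 1 / q" using t by (auto simp: q_def power_divide)
  have sq: "sqrt t * q = 1" using t by (simp add: q_def)
  have tq: "t * q = sqrt t" using t by (simp add: q_def real_div_sqrt)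
  have e: "e = q powr (\<alpha> - 1)"
  proof -
   have "q powr (\<alpha> - 1) = (t powr (- (1/2))) powr (\<alpha> - 1)" using t by (simp add: q_def powr_minus powr_half_sqrt inverse_eq_divide)
   then show ?thesis by (simp add: e_def powr_powr algebra_simps diff_divide_distrib)
  qed
  have e0: "e > 0" using q by (simp add: e)
  have mu1: "\<mu> >= 1" using c e0 by (auto simp: \<mu>_def)
  have main: "norm (symb c \<alpha> j n t \<xi>) <= C * q ^ j * e ^ n * exp (- (t / 2 * \<xi>\<^sup>2))"
   "norm (symb' c \<alpha> j n t \<xi>) <= C * q ^ j * e ^ n * sqrt t * \<mu> * exp (- (t / 2 * \<xi>\<^sup>2))" for \<xi>
  proof -
   define r where "r = \<bar>\<xi>\<bar> / q"
   have r: "r >= 0" "\<bar>\<xi>\<bar> = q * r" using q by (auto simp: r_def)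
   have tx: "t * \<xi>\<^sup>2 = r\<^sup>2" using q by (simp add: r_def power_divide)
   then have tx2: "t / 2 * \<xi>\<^sup>2 = r\<^sup>2 / 2" by simp
   have qa: "q powr \<alpha> = e * q" using q by (simp add: e powr_diff)
   have ps: "\<bar>\<xi>\<bar> powr \<alpha> = e * q * r powr \<alpha>" using q r by (simp add: powr_mult qa)
   have th: "\<bar>c * t * psi \<alpha> \<xi>\<bar> <= e * r powr \<alpha> * r"
   proof -
    have "\<bar>c * t * psi \<alpha> \<xi>\<bar> = c * (t * (\<bar>\<xi>\<bar> powr \<alpha> * \<bar>\<xi>\<bar>))" using c t by (simp add: psi_def abs_mult)
    also have "\<dots> <= 1 * (t * (\<bar>\<xi>\<bar> powr \<alpha> * \<bar>\<xi>\<bar>))" using c t by (intro mult_right_mono) auto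
    also have "\<dots> = e * r powr \<alpha> * r" unfolding ps unfolding r(2) using q(1) by (simp add: q(2) power2_eq_square)
    finally show ?thesis .
   qed
   have rh: "norm (rho m (c * t * psi \<alpha> \<xi>)) <= e ^ m * (r powr \<alpha>) ^ m * r ^ m" for m
    using order_trans[OF norm_rho_le power_mono[OF th]] by (simp add: power_mult_distrib)
   have xj: "norm ((\<i> * cplx \<xi>) ^ k) = q ^ k * r ^ k" for k
    using r q by (simp add: norm_power norm_mult power_mult_distrib)
   have E: "exp (- (t * \<xi>\<^sup>2)) = exp (- r\<^sup>2)" by (simp add: tx)
   have "norm (symb c \<alpha> j n t \<xi>) = q ^ j * r ^ j * exp (- r\<^sup>2) * norm (rho n (c * t * psi \<alpha> \<xi>))"
    by (simp add: symb_def norm_mult xj E)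
   also have "\<dots> <= q ^ j * r ^ j * exp (- r\<^sup>2) * (e ^ n * (r powr \<alpha>) ^ n * r ^ n)"
    using q(1) r(1) by (intro mult_left_mono rh) auto
   also have "\<dots> = q ^ j * e ^ n * (r ^ (j + n) * (r powr \<alpha>) ^ n * exp (- r\<^sup>2))"
    by (simp add: power_add)
   also have "\<dots> <= q ^ j * e ^ n * (K (j + n) n * exp (- (r\<^sup>2 / 2)))"
    using q(1) e0 r(1) by (intro mult_left_mono Kb) auto
   also have "\<dots> <= q ^ j * e ^ n * (C * exp (- (r\<^sup>2 / 2)))"
   proof -
    have "K (j + n) n <= C" unfolding C_def using K0 \<alpha> by (simp add: less_imp_le add_nonneg_nonneg)
    then show ?thesis using q(1) e0 by (intro mult_left_mono mult_right_mono) auto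
   qed
   finally show "norm (symb c \<alpha> j n t \<xi>) <= C * q ^ j * e ^ n * exp (- (t / 2 * \<xi>\<^sup>2))" unfolding tx2 by (simp add: mult_ac)
   let ?X = "exp (- (r\<^sup>2 / 2))"
   let ?D = "q ^ j * e ^ n * sqrt t"
   have D0: "?D >= 0" using q(1) e0 t by auto
   have DX: "?D * (K k m * ?X) <= ?D * (\<mu> * (K k m * ?X))" for k m
   proof -
    have "1 * (K k m * ?X) <= \<mu> * (K k m * ?X)" using mu1 K0[of k m] by (intro mult_right_mono) auto
    then show ?thesis using D0 by (intro mult_left_mono) auto
   qed
   have T1: "norm ((of_nat j * \<i> * (\<i> * cplx \<xi>) ^ (j - 1)) * cplx (exp (- (t * \<xi>\<^sup>2))) * rho n (c * t * psi \<alpha> \<xi>)) <= real j * (?D * (\<mu> * (K (j - 1 + n) n * ?X)))"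
   proof (cases "j = 0")
    case False
    have "norm ((of_nat j * \<i> * (\<i> * cplx \<xi>) ^ (j - 1)) * cplx (exp (- (t * \<xi>\<^sup>2))) * rho n (c * t * psi \<alpha> \<xi>)) = real j * (q ^ (j - 1) * r ^ (j - 1)) * exp (- r\<^sup>2) * norm (rho n (c * t * psi \<alpha> \<xi>))"
     by (simp add: norm_mult xj E)
    also have "\<dots> <= real j * (q ^ (j - 1) * r ^ (j - 1)) * exp (- r\<^sup>2) * (e ^ n * (r powr \<alpha>) ^ n * r ^ n)"
     using q(1) r(1) by (intro mult_left_mono rh) auto
    also have "\<dots> = real j * (?D * (r ^ (j - 1 + n) * (r powr \<alpha>) ^ n * exp (- r\<^sup>2)))"
    proof -
     obtain m where m: "j = Suc m" using False by (cases j) auto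
     have "q ^ (j - 1) = q ^ (j - 1) * (q * sqrt t)" using sq by (simp add: mult.commute)
     also have "\<dots> = q ^ j * sqrt t" by (simp add: m)
     finally show ?thesis by (simp only: power_add mult_ac)
    qed
    also have "\<dots> <= real j * (?D * (K (j - 1 + n) n * ?X))"
     using D0 r(1) by (intro mult_left_mono Kb) auto
    also have "\<dots> <= real j * (?D * (\<mu> * (K (j - 1 + n) n * ?X)))"
     by (intro mult_left_mono DX) auto
    finally show ?thesis .
   qed simp
   have T2: "norm ((\<i> * cplx \<xi>) ^ j * cplx (exp (- (t * \<xi>\<^sup>2)) * (- (2 * t * \<xi>))) * rho n (c * t * psi \<alpha> \<xi>)) <= 2 * (?D * (\<mu> * (K (j + 1 + n) n * ?X)))"
   proof -
    have "norm ((\<i> * cplx \<xi>) ^ j * cplx (exp (- (t * \<xi>\<^sup>2)) * (- (2 * t * \<xi>))) * rho n (c * t * psi \<alpha> \<xi>)) = (q ^ j * r ^ j) * (exp (- r\<^sup>2) * (2 * t * \<bar>\<xi>\<bar>)) * norm (rho n (c * t * psi \<alpha> \<xi>))"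
     using t by (simp add: norm_mult xj E)
    also have "\<dots> <= (q ^ j * r ^ j) * (exp (- r\<^sup>2) * (2 * t * \<bar>\<xi>\<bar>)) * (e ^ n * (r powr \<alpha>) ^ n * r ^ n)"
     using q(1) r(1) t by (intro mult_left_mono rh) auto
    also have "2 * t * \<bar>\<xi>\<bar> = 2 * (sqrt t * r)" unfolding r(2) tq[symmetric] by simp
    also have "(q ^ j * r ^ j) * (exp (- r\<^sup>2) * (2 * (sqrt t * r))) * (e ^ n * (r powr \<alpha>) ^ n * r ^ n) = 2 * (?D * (r ^ (j + 1 + n) * (r powr \<alpha>) ^ n * exp (- r\<^sup>2)))"
     by (simp add: power_add)
    also have "\<dots> <= 2 * (?D * (K (j + 1 + n) n * ?X))"
     using D0 r(1) by (intro mult_left_mono Kb) auto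
    also have "\<dots> <= 2 * (?D * (\<mu> * (K (j + 1 + n) n * ?X)))"
     by (intro mult_left_mono DX) auto
    finally show ?thesis .
   qed
   have T3: "norm ((\<i> * cplx \<xi>) ^ j * cplx (exp (- (t * \<xi>\<^sup>2))) * (cplx (c * t * ((\<alpha> + 1) * \<bar>\<xi>\<bar> powr \<alpha>)) * (\<i> * rho (n - 1) (c * t * psi \<alpha> \<xi>)))) 
     <= (\<alpha> + 1) * (?D * (\<mu> * ((K (j + n - 1) n + K j 1) * ?X)))"
   proof -
    have t1: "t * \<bar>\<xi>\<bar> powr \<alpha> = sqrt t * e * r powr \<alpha>" unfolding ps tq[symmetric] by simp
    have "norm ((\<i> * cplx \<xi>) ^ j * cplx (exp (- (t * \<xi>\<^sup>2))) * (cplx (c * t * ((\<alpha> + 1) * \<bar>\<xi>\<bar> powr \<alpha>)) * (\<i> * rho (n - 1) (c * t * psi \<alpha> \<xi>)))) 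
     = (q ^ j * r ^ j) * exp (- r\<^sup>2) * ((c * ((\<alpha> + 1) * (t * \<bar>\<xi>\<bar> powr \<alpha>))) * norm (rho (n - 1) (c * t * psi \<alpha> \<xi>)))"
     using c t \<alpha> by (simp add: norm_mult xj E abs_mult)
    also have "\<dots> <= (q ^ j * r ^ j) * exp (- r\<^sup>2) * ((c * ((\<alpha> + 1) * (t * \<bar>\<xi>\<bar> powr \<alpha>))) * (e ^ (n - 1) * (r powr \<alpha>) ^ (n - 1) * r ^ (n - 1)))"
     using q(1) r(1) t c \<alpha> by (intro mult_left_mono rh) auto
    also have "\<dots> <= (\<alpha> + 1) * (?D * (\<mu> * ((K (j + n - 1) n + K j 1) * ?X)))"
    proof (cases n)
     \<comment> \<open>Now \<open>n - 1\<close> is 0 and the remainder factor is bounded by 1, so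
       \<open>c * e\<close> survives and is absorbed by \<open>\<mu>\<close>.\<close>
     case 0
     have "(q ^ j * r ^ j) * exp (- r\<^sup>2) * ((c * ((\<alpha> + 1) * (t * \<bar>\<xi>\<bar> powr \<alpha>))) * (e ^ (n - 1) * (r powr \<alpha>) ^ (n - 1) * r ^ (n - 1)))
       = (\<alpha> + 1) * (?D * ((c * e) * (r ^ j * (r powr \<alpha>) ^ 1 * exp (- r\<^sup>2))))"
      unfolding t1 by (simp add: 0)
     also have "\<dots> <= (\<alpha> + 1) * (?D * ((c * e) * (K j 1 * ?X)))"
      using D0 r(1) c e0 \<alpha> by (intro mult_left_mono Kb) auto
     also have "\<dots> <= (\<alpha> + 1) * (?D * (\<mu> * ((K (j + n - 1) n + K j 1) * ?X)))"
      using D0 r(1) c e0 \<alpha> K0 by (intro mult_left_mono mult_mono) (auto simp: \<mu>_def 0 less_imp_le)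
     finally show ?thesis .
    next
     case (Suc m)
     have "(q ^ j * r ^ j) * exp (- r\<^sup>2) * ((c * ((\<alpha> + 1) * (t * \<bar>\<xi>\<bar> powr \<alpha>))) * (e ^ (n - 1) * (r powr \<alpha>) ^ (n - 1) * r ^ (n - 1)))
       = (\<alpha> + 1) * (?D * (c * (r ^ (j + n - 1) * (r powr \<alpha>) ^ n * exp (- r\<^sup>2))))"
      unfolding t1 by (simp add: Suc power_add)
     also have "\<dots> <= (\<alpha> + 1) * (?D * (c * (K (j + n - 1) n * ?X)))"
      using D0 r(1) c e0 \<alpha> by (intro mult_left_mono Kb) auto
     also have "\<dots> <= (\<alpha> + 1) * (?D * (\<mu> * ((K (j + n - 1) n + K j 1) * ?X)))"
      using D0 r(1) c e0 \<alpha> K0 by (intro mult_left_mono mult_mono) (auto simp: \<mu>_def Suc less_imp_le)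
     finally show ?thesis .
    qed
    finally show ?thesis .
   qed
   have "norm (symb' c \<alpha> j n t \<xi>) <= real j * (?D * (\<mu> * (K (j - 1 + n) n * ?X))) + 2 * (?D * (\<mu> * (K (j + 1 + n) n * ?X))) + (\<alpha> + 1) * (?D * (\<mu> * ((K (j + n - 1) n + K j 1) * ?X)))"
    unfolding symb'_def by (rule order_trans[OF norm_triangle_ineq add_mono[OF order_trans[OF norm_triangle_ineq add_mono[OF T1 T2]] T3]])
   also have "\<dots> = (C - K (j + n) n) * (?D * \<mu> * ?X)" by (simp add: C_def algebra_simps)
   also have "\<dots> <= C * (?D * \<mu> * ?X)" using D0 mu1 K0[of "j+n" n] by (intro mult_right_mono) auto
   finally show "norm (symb' c \<alpha> j n t \<xi>) <= C * q ^ j * e ^ n * sqrt t * \<mu> * exp (- (t / 2 * \<xi>\<^sup>2))"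
    unfolding tx2 by (simp add: mult_ac)
  qed
  show ?thesis
   unfolding C1_gauss_def gauss_bounded_def q_def[symmetric] e_def[symmetric] \<mu>_def[symmetric]
   using main symb_has_vector_derivative[OF \<alpha>] continuous_on_symb[OF \<alpha>] continuous_on_symbb'[OF \<alpha>]
   by (auto intro: borel_measurable_continuous_onI)
 qed
 then show ?thesis by (intro exI[of _ C] conjI C0 allI impI)
qed

section \<open>Oscillating heat kernels\<close>

lemma bnd_mono: "bnd f A B ==> A <= A' ==> B <= B' ==> bnd f A' B'"
 by (auto simp: bnd_def intro: order_trans ennreal_leI)

lemma bnd_nonneg: "bnd f A B ==> 0 <= A"
 unfolding bnd_def using norm_ge_zero order_trans by blast

lemma bnd_conv_integrable:
 assumes k: "bnd k A B" and f: "integrable lborel f"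
 shows "integrable lborel (\<lambda>y. k (x - y) * f y)"
proof (rule bochner_integrable_bound[OF integrable_mult_right[OF integrable_norm[OF f], of A]])
 have [measurable]: "k \<in> borel_measurable borel" "f \<in> borel_measurable borel" using k f by (auto simp: bnd_def)
 show "(\<lambda>y. k (x - y) * f y) \<in> borel_measurable lborel" by measurable
 show "AE y in lborel. norm (k (x - y) * f y) <= norm (A * norm (f y))"
 proof (intro AE_I2)
  fix y
  have "norm (k (x - y)) * norm (f y) <= A * norm (f y)" using k by (intro mult_right_mono) (auto simp: bnd_def)
  then show "norm (k (x - y) * f y) <= norm (A * norm (f y))" unfolding norm_mult using bnd_nonneg[OF k] by (simp add: abs_mult)
 qed
qed

lemma bnd_add:
 assumes "bnd f A B" "bnd g A' B'" "0 <= B" "0 <= B'"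
 shows "bnd (\<lambda>x. f x + g x) (A + A') (B + B')"
proof -
 have [measurable]: "f \<in> borel_measurable lborel" "g \<in> borel_measurable lborel" using assms by (auto simp: bnd_def)
 have "(nnL1 (\<lambda>x. f x + g x)) <= (\<integral>\<^sup>+x. ennreal (norm (f x)) + ennreal (norm (g x)) \<partial>lborel)"
  by (intro nn_integral_mono) (simp add: norm_triangle_ineq flip: ennreal_plus)
 also have "\<dots> = (nnL1 f) + (nnL1 g)"
  by (rule nn_integral_add) auto
 also have "\<dots> <= ennreal (B + B')" using assms by (simp add: bnd_def add_mono)
 finally show ?thesis using assms by (auto simp: bnd_def intro: norm_triangle_le add_mono)
qed

lemma bnd_cmult:
 assumes "bnd f A B"
 shows "bnd (\<lambda>x. c * f x) (norm c * A) (norm c * B)"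
proof -
 have [measurable]: "f \<in> borel_measurable lborel" using assms by (auto simp: bnd_def)
 have "(nnL1 (\<lambda>x. c * f x)) = ennreal (norm c) * (nnL1 f)"
  by (simp add: norm_mult ennreal_mult nn_integral_cmult)
 also have "\<dots> <= ennreal (norm c) * ennreal B" using assms by (intro mult_left_mono) (auto simp: bnd_def)
 also have "\<dots> = ennreal (norm c * B)" by (rule ennreal_mult'[symmetric]) simp
 finally show ?thesis using assms by (auto simp: bnd_def norm_mult intro: mult_left_mono)
qed

lemma bnd_diff:
 assumes "bnd f A B" "bnd g A' B'" "0 <= B" "0 <= B'"
 shows "bnd (\<lambda>x. f x - g x) (A + A') (B + B')"
 using bnd_add[OF assms(1) bnd_cmult[OF assms(2), of "-1"]] assms by simp

lemma bnd_shift: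
 assumes "bnd f A B"
 shows "bnd (\<lambda>x. f (x - a)) A B"
proof -
 have [measurable]: "f \<in> borel_measurable borel" using assms by (auto simp: bnd_def)
 have "(nnL1 f) = ennreal \<bar>1\<bar> * (nnL1 (\<lambda>x. f (- a + 1 * x)))"
  by (rule nn_integral_real_affine) auto
 then show ?thesis using assms by (auto simp: bnd_def)
qed

text \<open>The triangle inequality for integrals in both norms; Tonelli supplies the L^1 half. The
  pointwise bounds may depend on the parameter as long as they are integrable in it.\<close>

lemma bnd_superpose:
 assumes sf: "sigma_finite_measure M"
  and [measurable]: "(\<lambda>(x, w). K x w) \<in> borel_measurable (lborel \<Otimes>\<^sub>M M)"
  and A: "AE w in M. \<forall>x. norm (K x w) <= A w"
  and B: "AE w in M. (nnL1 (\<lambda>x. K x w)) <= ennreal (B w)" "AE w in M. 0 <= B w"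
  and iA: "integrable M A" "(LINT w|M. A w) <= a"
  and iB: "integrable M B" "(LINT w|M. B w) <= b"
 shows "bnd (\<lambda>x. LINT w|M. K x w) a b"
proof -
 interpret sigma_finite_measure M by fact
 interpret pair_sigma_finite lborel M ..
 have A0: "AE w in M. 0 <= A w" using A by eventually_elim (meson norm_ge_zero order_trans)
 have "ennreal (norm (LINT w|M. K x w)) <= ennreal a" for x
 proof -
  have "ennreal (norm (LINT w|M. K x w)) <= (\<integral>\<^sup>+w. ennreal (norm (K x w)) \<partial>M)"
   by (rule norm_integral_le_nn_integral)
  also have "\<dots> <= (\<integral>\<^sup>+w. ennreal (A w) \<partial>M)"
   using A by (intro nn_integral_mono_AE) (auto elim!: eventually_mono intro: ennreal_leI)
  also have "\<dots> = ennreal (LINT w|M. A w)" by (rule nn_integral_eq_integral[OF iA(1) A0])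
  finally show ?thesis using iA(2) by (meson ennreal_leI order_trans)
 qed
 moreover have "0 <= a" using integral_nonneg_AE[OF A0] iA(2) by linarith
 moreover have "(nnL1 (\<lambda>x. LINT w|M. K x w)) <= ennreal b"
 proof -
  have "(nnL1 (\<lambda>x. LINT w|M. K x w)) <= (\<integral>\<^sup>+x. \<integral>\<^sup>+w. ennreal (norm (K x w)) \<partial>M \<partial>lborel)"
   by (intro nn_integral_mono norm_integral_le_nn_integral)
  also have "\<dots> = (\<integral>\<^sup>+w. \<integral>\<^sup>+x. ennreal (norm (K x w)) \<partial>lborel \<partial>M)"
   by (rule Fubini'[symmetric]) measurable
  also have "\<dots> <= (\<integral>\<^sup>+w. ennreal (B w) \<partial>M)"
   using B by (intro nn_integral_mono_AE) auto
  also have "\<dots> = ennreal (LINT w|M. B w)" by (rule nn_integral_eq_integral[OF iB(1) B(2)])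
  finally show ?thesis using iB(2) by (meson ennreal_leI order_trans)
 qed
 moreover have "(\<lambda>x. LINT w|M. K x w) \<in> borel_measurable lborel" by measurable
 ultimately show ?thesis by (simp add: bnd_def)
qed

text \<open>Young's inequality in two versions, which differ in the factor that takes the sup norm:
  close to the final time the kernel can afford only L^1, at earlier times the forcing is better
  used in L^1.\<close>

lemma bnd_cnv:
 assumes k: "bnd k A B" "0 <= B" and [measurable]: "f \<in> borel_measurable borel"
  and S: "\<And>y. norm (f y) <= S" and F: "(nnL1 f) <= ennreal F" "0 <= F"
 shows "bnd (\<lambda>x. LINT y|lborel. k (x - y) * f y) (B * S) (B * F)"
  and "bnd (\<lambda>x. LINT y|lborel. k (x - y) * f y) (A * F) (B * F)"
proof -
 have [measurable]: "k \<in> borel_measurable borel" using k by (simp add: bnd_def)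
 have A0: "A >= 0" using bnd_nonneg k by blast
 have i: "integrable lborel (\<lambda>y. norm (f y))"
  using F by (intro integrableI_bounded) (auto intro: le_less_trans)
 have iF: "(LINT y|lborel. norm (f y)) <= F"
  using F nn_integral_eq_integral[OF i] by (simp add: ennreal_le_iff)
 show g: "bnd (\<lambda>x. LINT y|lborel. k (x - y) * f y) (A * F) (B * F)"
 proof (rule bnd_superpose[where A="\<lambda>y. A * norm (f y)" and B="\<lambda>y. B * norm (f y)"])
  show "AE y in lborel. (nnL1 (\<lambda>x. k (x - y) * f y)) <= ennreal (B * norm (f y))"
  proof (intro AE_I2)
   fix y
   have "bnd (\<lambda>x. k (x - y) * f y) (A * norm (f y)) (B * norm (f y))"
    using bnd_cmult[OF bnd_shift[OF k(1), of y], of "f y"] by (simp add: mult.commute)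
   then show "(nnL1 (\<lambda>x. k (x - y) * f y)) <= ennreal (B * norm (f y))"
    by (simp add: bnd_def)
  qed
  show "AE y in lborel. \<forall>x. norm (k (x - y) * f y) <= A * norm (f y)"
   using k by (intro AE_I2) (auto simp: bnd_def norm_mult intro: mult_right_mono)
 qed (use k i iF A0 in \<open>auto intro!: mult_left_mono integrable_mult_right simp: lborel.sigma_finite_measure_axioms\<close>)
 have "norm (LINT y|lborel. k (x - y) * f y) <= B * S" for x
 proof -
  have "S >= 0" using S[of 0] norm_ge_zero[of "f 0"] by linarith
  have "(nnL1 k) = ennreal \<bar>-1\<bar> * (nnL1 (\<lambda>y. k (x + (-1) * y)))"
   by (rule nn_integral_real_affine) auto
  then have kk: "(nnL1 (\<lambda>y. k (x - y))) <= ennreal B" using k by (simp add: bnd_def)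
  have "ennreal (norm (LINT y|lborel. k (x - y) * f y)) <= (nnL1 (\<lambda>y. k (x - y) * f y))"
   by (rule norm_integral_le_nn_integral)
  also have "\<dots> <= (\<integral>\<^sup>+y. ennreal (norm (k (x - y))) * ennreal S \<partial>lborel)"
   using S \<open>S >= 0\<close> by (intro nn_integral_mono) (auto simp: norm_mult intro!: mult_left_mono simp flip: ennreal_mult)
  also have "\<dots> = (nnL1 (\<lambda>y. k (x - y))) * ennreal S"
   by (rule nn_integral_multc) measurable
  also have "\<dots> <= ennreal B * ennreal S" by (intro mult_right_mono kk) auto
  finally show ?thesis using k \<open>S >= 0\<close> by (simp add: ennreal_le_iff flip: ennreal_mult)
 qed
 then show "bnd (\<lambda>x. LINT y|lborel. k (x - y) * f y) (B * S) (B * F)"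
  using g by (simp add: bnd_def)
qed

text \<open>The fundamental theorem in the path parameter writes the increment as a superposition of
  derivatives, so one bound on the derivative controls the increment in sup and L^1 at once.\<close>

lemma bnd_path:
 fixes F :: "real => real => complex"
 assumes d: "\<And>s x. s \<in> {0..1} ==> ((\<lambda>s. F s x) has_vector_derivative F' s x) (at s within {0..1})"
  and c: "\<And>x. continuous_on {0..1} (\<lambda>s. F' s x)"
  and b: "\<And>s. s \<in> {0..1} ==> bnd (F' s) A B" and B: "0 <= B"
  and [measurable]: "(\<lambda>(x, s). F' s x) \<in> borel2"
 shows "bnd (\<lambda>x. F 1 x - F 0 x) A B"
proof -
 have A0: "A >= 0" using bnd_nonneg[OF b[of 0]] by simp
 have eq: "F 1 x - F 0 x = (LINT s|lborel. indicator {0..1} s *\<^sub>R F' s x)" for x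
 proof -
  have "has_bochner_integral lborel (\<lambda>s. indicator {0..1} s *\<^sub>R F' s x) (F 1 x - F 0 x)"
   by (rule has_bochner_integral_FTC_Icc[of 0 1]) (use d c in auto)
  then show ?thesis by (simp add: has_bochner_integral_integral_eq)
 qed
 have ind: "integrable lborel (\<lambda>s::real. indicator {0..1} s * C)" "(LINT s|lborel. indicator {0..1::real} s * C) = C" for C :: real
  by (auto simp: content_real)
 show ?thesis unfolding eq
 proof (rule bnd_superpose[where A="\<lambda>s. indicator {0..1} s * A" and B="\<lambda>s. indicator {0..1} s * B"])
  show "AE s in lborel. (nnL1 (\<lambda>x. indicator {0..1} s *\<^sub>R F' s x)) <= ennreal (indicator {0..1} s * B)"
   using b by (intro AE_I2) (auto simp: bnd_def indicator_def)
  show "AE s in lborel. \<forall>x. norm (indicator {0..1} s *\<^sub>R F' s x) <= indicator {0..1} s * A"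
   using b by (intro AE_I2) (auto simp: bnd_def indicator_def)
 qed (use ind B in \<open>auto simp: lborel.sigma_finite_measure_axioms\<close>)
qed

lemma bnd_increment:
 assumes d: "\<And>x. (f has_vector_derivative f' x) (at x)" and c: "continuous_on UNIV f'"
  and b: "bnd f' A B" "0 <= B"
 shows "bnd (\<lambda>x. f (x - y) - f x) (\<bar>y\<bar> * A) (\<bar>y\<bar> * B)"
proof -
 have [measurable]: "f' \<in> borel_measurable borel" using b by (simp add: bnd_def)
 have "bnd (\<lambda>x. (\<lambda>s x. f (x - s * y)) 1 x - (\<lambda>s x. f (x - s * y)) 0 x) (\<bar>y\<bar> * A) (\<bar>y\<bar> * B)"
 proof (rule bnd_path[where F'="\<lambda>s x. cplx (- y) * f' (x - s * y)"])
  fix s x :: real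
  have "((\<lambda>s. x - s * y) has_real_derivative - y) (at s)" by (auto intro!: derivative_eq_intros)
  from vector_diff_chain_at[OF this[unfolded has_real_derivative_iff_has_vector_derivative] d]
  show "((\<lambda>s. f (x - s * y)) has_vector_derivative cplx (- y) * f' (x - s * y)) (at s within {0..1})"
   by (auto simp: o_def scaleR_conv_of_real intro: has_vector_derivative_at_within)
  show "bnd (\<lambda>x. cplx (- y) * f' (x - s * y)) (\<bar>y\<bar> * A) (\<bar>y\<bar> * B)"
   using bnd_cmult[OF bnd_shift[OF b(1)], of "- y" "s * y"] by simp
  show "continuous_on {0..1} (\<lambda>s. cplx (- y) * f' (x - s * y))"
   by (intro continuous_intros continuous_on_compose2[OF c]) auto
 qed (use b in auto)
 then show ?thesis by simp
qed

text \<open>The path adds the first-order correction linearly; its derivative is -y times a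
  first-order increment of \<open>f'\<close>, to which \<open>bnd_increment\<close> applies.\<close>

lemma bnd_increment2:
 assumes d: "\<And>x. (f has_vector_derivative f' x) (at x)" and d': "\<And>x. (f' has_vector_derivative f'' x) (at x)"
  and c: "continuous_on UNIV f''"
  and b: "bnd f'' A B" "0 <= B"
 shows "bnd (\<lambda>x. f (x - y) - f x + cplx y * f' x) (y\<^sup>2 * A) (y\<^sup>2 * B)"
proof -
 have A0: "A >= 0" using bnd_nonneg[OF b(1)] .
 have c': "continuous_on UNIV f'"
  using d' by (auto intro!: continuous_at_imp_continuous_on has_vector_derivative_continuous)
 have [measurable]: "f' \<in> borel_measurable borel" by (rule borel_measurable_continuous_onI[OF c'])
 have "bnd (\<lambda>x. (\<lambda>s x. f (x - s * y) + cplx (s * y) * f' x) 1 x - (\<lambda>s x. f (x - s * y) + cplx (s * y) * f' x) 0 x) (y\<^sup>2 * A) (y\<^sup>2 * B)"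
 proof (rule bnd_path[where F'="\<lambda>s x. cplx (- y) * (f' (x - s * y) - f' x)"])
  fix s x :: real
  have "((\<lambda>s. x - s * y) has_real_derivative - y) (at s)" by (auto intro!: derivative_eq_intros)
  from vector_diff_chain_at[OF this[unfolded has_real_derivative_iff_has_vector_derivative] d]
  have 1: "((\<lambda>s. f (x - s * y)) has_vector_derivative cplx (- y) * f' (x - s * y)) (at s within {0..1})"
   by (auto simp: o_def scaleR_conv_of_real intro: has_vector_derivative_at_within)
  have 2: "((\<lambda>s. cplx (s * y) * f' x) has_vector_derivative cplx y * f' x) (at s within {0..1})"
   by (rule has_vector_derivative_mult_left[OF has_vector_derivative_of_real]) (auto intro!: derivative_eq_intros)
  show "((\<lambda>s. f (x - s * y) + cplx (s * y) * f' x) has_vector_derivative cplx (- y) * (f' (x - s * y) - f' x)) (at s within {0..1})"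
   by (rule has_vector_derivative_eq_rhs[OF has_vector_derivative_add[OF 1 2]]) (simp add: algebra_simps)
  show "continuous_on {0..1} (\<lambda>s. cplx (- y) * (f' (x - s * y) - f' x))"
   by (intro continuous_intros continuous_on_compose2[OF c']) auto
 next
  fix s :: real assume s: "s \<in> {0..1}"
  have "bnd (\<lambda>x. f' (x - s * y) - f' x) (\<bar>s * y\<bar> * A) (\<bar>s * y\<bar> * B)"
   by (rule bnd_increment[OF d' c b])
  from bnd_cmult[OF this, of "cplx (- y)"]
  show "bnd (\<lambda>x. cplx (- y) * (f' (x - s * y) - f' x)) (y\<^sup>2 * A) (y\<^sup>2 * B)"
  proof (rule bnd_mono)
   have *: "norm (cplx (- y)) * (\<bar>s * y\<bar> * C) <= y\<^sup>2 * C" if "C >= 0" for C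
   proof -
    have "norm (cplx (- y)) * (\<bar>s * y\<bar> * C) = s * (y\<^sup>2 * C)" using s by (simp add: abs_mult power2_eq_square)
    also have "\<dots> <= 1 * (y\<^sup>2 * C)" using s that by (intro mult_right_mono) auto
    finally show ?thesis by simp
   qed
   show "norm (cplx (- y)) * (\<bar>s * y\<bar> * A) <= y\<^sup>2 * A" "norm (cplx (- y)) * (\<bar>s * y\<bar> * B) <= y\<^sup>2 * B"
    using * A0 b by auto
  qed
 qed (use b in auto)
 then show ?thesis by (simp add: algebra_simps)
qed

text \<open>For c = 1 and n = 0 this is the jth space derivative of the Green function, for c = 0
  and n = 0 that of the heat kernel, and for c = 1 and n > 0 what remains of the former after n
  Taylor terms of the phase have been removed.\<close>

definition kern :: "real => real => nat => nat => real => real => complex" where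
 "kern c \<alpha> j n t = ift (symb c \<alpha> j n t)"

lemma symb_measurable [measurable]:
 assumes [measurable]: "f \<in> borel_measurable M" "g \<in> borel_measurable M"
 shows "(\<lambda>w. symb c \<alpha> j n (f w) (g w)) \<in> borel_measurable M"
 unfolding symb_def rho_def psi_def by measurable

lemma kern_measurable_pair: "(\<lambda>(t, x). kern c \<alpha> j n t x) \<in> borel2"
 unfolding kern_def ift_def by measurable

lemma kern_measurable [measurable]:
 assumes [measurable]: "f \<in> borel_measurable M" "g \<in> borel_measurable M"
 shows "(\<lambda>w. kern c \<alpha> j n (f w) (g w)) \<in> borel_measurable M"
 using measurable_compose[OF measurable_Pair[OF assms] kern_measurable_pair] by simp

lemma symb_gauss_bounded:
 assumes "\<alpha> > 0" "0 <= c" "c <= 1" "t > 0"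
 shows "\<exists>\<kappa>. gauss_bounded (t / 2) \<kappa> (symb c \<alpha> j n t)"
 using C1_gauss_symb[OF assms(1), of j n] assms unfolding C1_gauss_def by blast

lemma symb_integrable:
 assumes "\<alpha> > 0" "0 <= c" "c <= 1" "t > 0"
 shows "integrable lborel (symb c \<alpha> j n t)"
 using symb_gauss_bounded[OF assms] gauss_bounded_integrable assms by (meson half_gt_zero)

lemma kern_has_vector_derivative:
 assumes "\<alpha> > 0" "0 <= c" "c <= 1" "t > 0"
 shows "(kern c \<alpha> j n t has_vector_derivative kern c \<alpha> (Suc j) n t x) (at x)"
proof -
 have eq: "symb c \<alpha> (Suc j) n t = (\<lambda>\<xi>. \<i> * \<xi> * symb c \<alpha> j n t \<xi>)"
  by (simp add: fun_eq_iff symb_def)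
 have eq2: "(\<lambda>\<xi>. \<xi>\<^sup>2 * norm (symb c \<alpha> j n t \<xi>)) = (\<lambda>\<xi>. norm (symb c \<alpha> (Suc (Suc j)) n t \<xi>))"
  by (simp add: fun_eq_iff symb_def norm_mult power2_eq_square)
 have "integrable lborel (\<lambda>\<xi>. \<xi>\<^sup>2 * norm (symb c \<alpha> j n t \<xi>))"
  unfolding eq2 by (intro integrable_norm symb_integrable assms)
 then show ?thesis
  unfolding kern_def eq using symb_integrable[OF assms, of j n] symb_integrable[OF assms, of "Suc j" n, unfolded eq]
  by (intro ift_has_vector_derivative) auto
qed

lemma continuous_on_kern: 
 assumes "\<alpha> > 0" "0 <= c" "c <= 1" "t > 0"
 shows "continuous_on A (kern c \<alpha> j n t)"
 using kern_has_vector_derivative[OF assms]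
 by (auto intro!: continuous_at_imp_continuous_on has_vector_derivative_continuous)

text \<open>The zeroth Taylor term of the oscillating factor is 1, so removing it subtracts exactly
  the heat kernel: \<open>kern 1 \<alpha> j 1\<close> is the dispersive part.\<close>

lemma kern_Suc: 
 assumes "\<alpha> > 0" "t > 0"
 shows "kern 1 \<alpha> j 1 t x = kern 1 \<alpha> j 0 t x - kern 0 \<alpha> j 0 t x"
proof -
 have "symb 1 \<alpha> j 1 t \<xi> = symb 1 \<alpha> j 0 t \<xi> - symb 0 \<alpha> j 0 t \<xi>" for \<xi>
 proof -
  have "rho 1 \<theta> = rho 0 \<theta> - rho 0 0" for \<theta> by (simp add: rho_def)
  then show ?thesis by (simp add: symb_def right_diff_distrib)
 qed
 then have "kern 1 \<alpha> j 1 t x = (LINT \<xi>|lborel. iexp (x * \<xi>) * symb 1 \<alpha> j 0 t \<xi> - iexp (x * \<xi>) * symb 0 \<alpha> j 0 t \<xi>) / (2 * pi)"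
  by (simp add: kern_def ift_def right_diff_distrib)
 also have "(LINT \<xi>|lborel. iexp (x * \<xi>) * symb 1 \<alpha> j 0 t \<xi> - iexp (x * \<xi>) * symb 0 \<alpha> j 0 t \<xi>) =
   (LINT \<xi>|lborel. iexp (x * \<xi>) * symb 1 \<alpha> j 0 t \<xi>) - (LINT \<xi>|lborel. iexp (x * \<xi>) * symb 0 \<alpha> j 0 t \<xi>)"
  using assms by (intro bochner_integral_diff integrable_iexp_mult symb_integrable) auto
 finally show ?thesis by (simp add: kern_def ift_def diff_divide_distrib)
qed

text \<open>Each derivative costs t^(-1/2) and each removed Taylor term gains t^(-(\<alpha>-1)/2).
  For n = 0 the L^1 bound has an additional factor which grows like t^(-(\<alpha>-1)/4) as t tends
  to 0 when the dispersion is on, and is 1 when it is off.\<close>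

lemma kern_bnd:
 assumes \<alpha>: "\<alpha> > 0"
 shows "\<exists>C>0. \<forall>c t. 0 <= c --> c <= 1 --> 0 < t -->
  bnd (kern c \<alpha> j n t) (C * t powr (- (real j + 1) / 2 - real n * ((\<alpha> - 1) / 2)))
   (C * t powr (- real j / 2 - real n * ((\<alpha> - 1) / 2)) * sqrt (if n = 0 then 1 + c * t powr (- ((\<alpha> - 1) / 2)) else 1))"
proof -
 obtain C where C: "C > 0" and g: "\<And>c t. 0 <= c ==> c <= 1 ==> 0 < t ==>
  C1_gauss (t / 2) (C * (1 / sqrt t) ^ j * (t powr (- ((\<alpha> - 1) / 2))) ^ n)
   (C * (1 / sqrt t) ^ j * (t powr (- ((\<alpha> - 1) / 2))) ^ n * sqrt t * (if n = 0 then 1 + c * t powr (- ((\<alpha> - 1) / 2)) else 1))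
   (symb c \<alpha> j n t) (symb' c \<alpha> j n t)"
  using C1_gauss_symb[OF \<alpha>, of j n] by blast
 have "bnd (kern c \<alpha> j n t) ((2 * C) * t powr (- (real j + 1) / 2 - real n * ((\<alpha> - 1) / 2)))
   ((2 * C) * t powr (- real j / 2 - real n * ((\<alpha> - 1) / 2)) * sqrt (if n = 0 then 1 + c * t powr (- ((\<alpha> - 1) / 2)) else 1))"
  if ct: "0 <= c" "c <= 1" "0 < t" for c t
 proof -
  have mu: "(if n = 0 then 1 + c * t powr (- ((\<alpha> - 1) / 2)) else 1) > (0::real)" using ct by (auto intro: add_pos_nonneg)
  have q: "1 / sqrt t = t powr (- 1 / 2)" using ct by (simp add: powr_minus powr_half_sqrt inverse_eq_divide)
  have k: "(1 / sqrt t) ^ j * (t powr (- ((\<alpha> - 1) / 2))) ^ n = t powr (- real j / 2 - real n * ((\<alpha> - 1) / 2))"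
   unfolding q using ct by (simp add: powr_power algebra_simps flip: powr_add)
  have k2: "t powr (- real j / 2 - real n * ((\<alpha> - 1) / 2)) / sqrt t = t powr (- (real j + 1) / 2 - real n * ((\<alpha> - 1) / 2))"
  proof -
   have "t powr (- real j / 2 - real n * ((\<alpha> - 1) / 2)) / sqrt t = t powr (- real j / 2 - real n * ((\<alpha> - 1) / 2)) * t powr (- 1 / 2)"
    unfolding q[symmetric] by simp
   also have "\<dots> = t powr (- (real j + 1) / 2 - real n * ((\<alpha> - 1) / 2))"
    unfolding powr_add[symmetric] by (rule arg_cong[of _ _ "\<lambda>a. t powr a"]) (simp add: field_simps)
   finally show ?thesis .
  qed
  from bnd_ift[OF g[OF ct] ct(3) mu] show ?thesis
   unfolding kern_def
  proof (rule bnd_mono)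
   show "C * (1 / sqrt t) ^ j * (t powr (- ((\<alpha> - 1) / 2))) ^ n / sqrt t <= 2 * C * t powr (- (real j + 1) / 2 - real n * ((\<alpha> - 1) / 2))"
   proof -
    have "C * (1 / sqrt t) ^ j * (t powr (- ((\<alpha> - 1) / 2))) ^ n / sqrt t = C * t powr (- (real j + 1) / 2 - real n * ((\<alpha> - 1) / 2))"
     unfolding k2[symmetric] k[symmetric] by simp
    also have "\<dots> <= 2 * C * t powr (- (real j + 1) / 2 - real n * ((\<alpha> - 1) / 2))" using C by (intro mult_right_mono) auto
    finally show ?thesis .
   qed
  qed (simp only: k mult.assoc order_refl)
 qed
 with C show ?thesis by (intro exI[of _ "2 * C"]) auto
qed

lemma heat_kern_bnd:
 assumes "\<alpha> > 0"
 shows "\<exists>C>0. \<forall>t>0. bnd (kern 0 \<alpha> j 0 t) (C * t powr (- (real j + 1) / 2)) (C * t powr (- real j / 2))"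
 using kern_bnd[OF assms, of j 0] by (force simp del: minus_add_distrib)

lemma kern_bnd_Suc:
 assumes "\<alpha> > 0" "n > 0"
 shows "\<exists>C>0. \<forall>t>0. bnd (kern 1 \<alpha> j n t) (C * t powr (- (real j + 1) / 2 - real n * ((\<alpha> - 1) / 2)))
   (C * t powr (- real j / 2 - real n * ((\<alpha> - 1) / 2)))"
proof -
 obtain C where "C > 0" and C: "\<And>c t. 0 <= c ==> c <= 1 ==> 0 < t ==>
  bnd (kern c \<alpha> j n t) (C * t powr (- (real j + 1) / 2 - real n * ((\<alpha> - 1) / 2)))
   (C * t powr (- real j / 2 - real n * ((\<alpha> - 1) / 2)) * sqrt (if n = 0 then 1 + c * t powr (- ((\<alpha> - 1) / 2)) else 1))"
  using kern_bnd[OF assms(1), of j n] by blast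
 show ?thesis using C[of 1] assms(2) \<open>C > 0\<close> by (intro exI[of _ C]) simp
qed

lemma kern_bnd_large:
 assumes "\<alpha> > 1"
 shows "\<exists>C>0. \<forall>t\<ge>1. bnd (kern 1 \<alpha> j 0 t) (C * t powr (- (real j + 1) / 2)) (C * t powr (- real j / 2))"
proof -
 have a: "\<alpha> > 0" using assms by simp
 obtain C where "C > 0" and C: "\<And>c t. 0 <= c ==> c <= 1 ==> 0 < t ==>
  bnd (kern c \<alpha> j 0 t) (C * t powr (- (real j + 1) / 2 - real 0 * ((\<alpha> - 1) / 2)))
   (C * t powr (- real j / 2 - real 0 * ((\<alpha> - 1) / 2)) * sqrt (if (0::nat) = 0 then 1 + c * t powr (- ((\<alpha> - 1) / 2)) else 1))"
  using kern_bnd[OF a, of j 0] by blast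
 have "bnd (kern 1 \<alpha> j 0 t) (2 * C * t powr (- (real j + 1) / 2)) (2 * C * t powr (- real j / 2))" if t: "t >= 1" for t
 proof (rule bnd_mono[OF C[of 1 t]])
  have "t powr (- ((\<alpha> - 1) / 2)) <= 1" using assms t powr_mono[of "- ((\<alpha> - 1) / 2)" 0 t] by simp
  then have s: "sqrt (1 + t powr (- ((\<alpha> - 1) / 2))) <= 2" by (intro real_le_lsqrt) auto
  have "C * t powr (- real j / 2) * sqrt (1 + t powr (- ((\<alpha> - 1) / 2))) <= C * t powr (- real j / 2) * 2"
   using s \<open>C > 0\<close> by (intro mult_left_mono) auto
  then show "C * t powr (- real j / 2 - real 0 * ((\<alpha> - 1) / 2)) * sqrt (if (0::nat) = 0 then 1 + 1 * t powr (- ((\<alpha> - 1) / 2)) else 1) <= 2 * C * t powr (- real j / 2)"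
   by simp
 qed (use t \<open>C > 0\<close> in auto)
 with \<open>C > 0\<close> show ?thesis by (intro exI[of _ "2 * C"]) auto
qed

text \<open>For t >= 1 the Taylor gain is used. For t < 1 it would be a loss, t^(-\<alpha>/2), so
  the Green function and the heat kernel are estimated separately; this gives t^(-(\<alpha>+1)/4),
  whose exponent stays above -1 exactly for \<alpha> < 3.\<close>

lemma dkern_diff_bnd:
 assumes "\<alpha> > 1"
 shows "\<exists>C>0. \<forall>t>0. bnd (kern 1 \<alpha> 1 1 t) (C * t powr (- 1 - (\<alpha> - 1) / 2)) (C * t powr (- ((\<alpha> + 1) / 4)))"
proof -
 have a: "\<alpha> > 0" using assms by simp
 obtain C1 where C1: "C1 > 0" "\<And>t. 0 < t ==> bnd (kern 1 \<alpha> 1 1 t) (C1 * t powr (- 1 - (\<alpha> - 1) / 2)) (C1 * t powr (- 1 / 2 - (\<alpha> - 1) / 2))"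
  using kern_bnd_Suc[OF a, of 1 1] by auto
 obtain C2 where C2_pos: "C2 > 0" and C2': "\<forall>c t. 0 <= c --> c <= 1 --> 0 < t -->
  bnd (kern c \<alpha> 1 0 t) (C2 * t powr (- (real 1 + 1) / 2 - real 0 * ((\<alpha> - 1) / 2)))
   (C2 * t powr (- real 1 / 2 - real 0 * ((\<alpha> - 1) / 2)) * sqrt (if (0::nat) = 0 then 1 + c * t powr (- ((\<alpha> - 1) / 2)) else 1))"
  using kern_bnd[OF a, of 1 0] by blast
 have C2: "C2 > 0" "\<And>t. 0 < t ==> bnd (kern 1 \<alpha> 1 0 t) (C2 * t powr (- 1)) (C2 * t powr (- 1 / 2) * sqrt (1 + t powr (- ((\<alpha> - 1) / 2))))"
  using C2_pos spec[OF C2', of 1] by auto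
 obtain C3 where C3: "C3 > 0" "\<And>t. 0 < t ==> bnd (kern 0 \<alpha> 1 0 t) (C3 * t powr (- 1)) (C3 * t powr (- 1 / 2))"
  using heat_kern_bnd[OF a, of 1] by auto
 define C where "C = C1 + 2 * C2 + C3"
 have "bnd (kern 1 \<alpha> 1 1 t) (C * t powr (- 1 - (\<alpha> - 1) / 2)) (C * t powr (- ((\<alpha> + 1) / 4)))" if t: "t > 0" for t
 proof (cases "t >= 1")
  case True
  show ?thesis
  proof (rule bnd_mono[OF C1(2)[OF t]])
   show "C1 * t powr (- 1 / 2 - (\<alpha> - 1) / 2) <= C * t powr (- ((\<alpha> + 1) / 4))"
    using C1 C2 C3 assms True by (intro mult_mono powr_mono) (auto simp: C_def field_simps)
  qed (use C1 C2 C3 in \<open>auto simp: C_def intro!: mult_right_mono\<close>)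
 next
  case False
  have e1: "t powr (- ((\<alpha> - 1) / 2)) >= 1" using False t assms powr_mono'[of "- ((\<alpha> - 1) / 2)" 0 t] by simp
  have "sqrt (1 + t powr (- ((\<alpha> - 1) / 2))) <= sqrt (4 * t powr (- ((\<alpha> - 1) / 2)))" using e1 by simp
  also have "\<dots> = 2 * t powr (- ((\<alpha> - 1) / 4))" using t by (simp add: real_sqrt_mult powr_powr flip: powr_half_sqrt)
  finally have "t powr (- 1 / 2) * sqrt (1 + t powr (- ((\<alpha> - 1) / 2))) <= t powr (- 1 / 2) * (2 * t powr (- ((\<alpha> - 1) / 4)))"
   by (intro mult_left_mono) auto
  also have "\<dots> = 2 * t powr (- ((\<alpha> + 1) / 4))"
  proof -
   have "t powr (- 1 / 2) * t powr (- ((\<alpha> - 1) / 4)) = t powr (- ((\<alpha> + 1) / 4))"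
    unfolding powr_add[symmetric] by (rule arg_cong[of _ _ "\<lambda>a. t powr a"]) (simp add: field_simps)
   then show ?thesis by simp
  qed
  finally have 1: "C2 * (t powr (- 1 / 2) * sqrt (1 + t powr (- ((\<alpha> - 1) / 2)))) <= C2 * (2 * t powr (- ((\<alpha> + 1) / 4)))"
   using C2(1) by (intro mult_left_mono) auto
  have 2: "C3 * t powr (- 1 / 2) <= C3 * t powr (- ((\<alpha> + 1) / 4))"
   using C3(1) False t assms by (intro mult_left_mono powr_mono') auto
  have "bnd (kern 1 \<alpha> 1 1 t) (C2 * t powr (- 1) + C3 * t powr (- 1)) (C2 * t powr (- 1 / 2) * sqrt (1 + t powr (- ((\<alpha> - 1) / 2))) + C3 * t powr (- 1 / 2))"
   unfolding kern_Suc[OF a t, abs_def] using C2(1) C3(1) by (intro bnd_diff C2 C3 t) auto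
  moreover have "C2 * t powr (- 1 / 2) * sqrt (1 + t powr (- ((\<alpha> - 1) / 2))) + C3 * t powr (- 1 / 2) <= C * t powr (- ((\<alpha> + 1) / 4))"
  proof -
   have "C2 * t powr (- 1 / 2) * sqrt (1 + t powr (- ((\<alpha> - 1) / 2))) + C3 * t powr (- 1 / 2) <= (2 * C2 + C3) * t powr (- ((\<alpha> + 1) / 4))"
    using 1 2 by (simp add: algebra_simps)
   also have "\<dots> <= C * t powr (- ((\<alpha> + 1) / 4))" using C1 by (intro mult_right_mono) (auto simp: C_def)
   finally show ?thesis .
  qed
  moreover have "C1 * t powr (- 1 - (\<alpha> - 1) / 2) <= C * t powr (- 1 - (\<alpha> - 1) / 2)"
   using C1 C2 C3 by (intro mult_right_mono) (auto simp: C_def)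
  ultimately show ?thesis using C1(2)[OF t] unfolding bnd_def by (meson ennreal_leI order_trans)
 qed
 moreover have "C > 0" using C1 C2 C3 by (simp add: C_def)
 ultimately show ?thesis by blast
qed

section \<open>The heat kernel, its explicit derivatives and its increments\<close>

lemma kern_heat:
 assumes "t > 0"
 shows "kern 0 \<alpha> 0 0 t x = cplx (heat t x)"
proof -
 have "kern 0 \<alpha> 0 0 t x = (LINT \<xi>|lborel. iexp (\<xi> * x) * cplx (exp (- (t * \<xi>\<^sup>2)))) / (2 * pi)"
  by (simp add: kern_def ift_def symb_def rho_def mult.commute[of x])
 also have "\<dots> = cplx (sqrt (pi / t) * exp (- x\<^sup>2 / (4 * t)) / (2 * pi))"
  unfolding integral_iexp_gaussian[OF assms] by simp
 also have "sqrt (pi / t) / (2 * pi) = 1 / sqrt (4 * pi * t)"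
  using assms by (simp add: real_sqrt_divide real_sqrt_mult field_simps)
 then have "sqrt (pi / t) * exp (- x\<^sup>2 / (4 * t)) / (2 * pi) = heat t x"
  by (simp add: heat_def field_simps)
 finally show ?thesis .
qed

text \<open>Space derivatives of the heat kernel in closed form. By the heat equation
  \<open>heat2\<close> and \<open>heat3\<close> are also the time derivatives of \<open>heat\<close>
  and \<open>heat1\<close>, so kernel bounds with more space derivatives control increments in
  time.\<close>

definition heat1 :: "real => real => real" where "heat1 t x = - (x / (2 * t)) * heat t x"
definition heat2 :: "real => real => real" where "heat2 t x = (x\<^sup>2 / (4 * t\<^sup>2) - 1 / (2 * t)) * heat t x"
definition heat3 :: "real => real => real" where "heat3 t x = (3 * x / (4 * t\<^sup>2) - x ^ 3 / (8 * t ^ 3)) * heat t x"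

lemma heat_DERIV: "t > 0 ==> (heat t has_real_derivative heat1 t x) (at x)"
 unfolding heat_def[abs_def] heat1_def by (auto intro!: derivative_eq_intros simp: field_simps)

lemma heat1_DERIV: "t > 0 ==> (heat1 t has_real_derivative heat2 t x) (at x)"
 unfolding heat1_def[abs_def] heat2_def
 by (auto intro!: derivative_eq_intros heat_DERIV simp: heat1_def field_simps power2_eq_square)

lemma heat2_DERIV: "t > 0 ==> (heat2 t has_real_derivative heat3 t x) (at x)"
 unfolding heat2_def[abs_def] heat3_def
 by (auto intro!: derivative_eq_intros heat_DERIV simp: heat1_def field_simps power2_eq_square power3_eq_cube)

lemma deriv_heat: "t > 0 ==> deriv (heat t) x = heat1 t x"
 by (rule DERIV_imp_deriv[OF heat_DERIV])

lemma heat_DERIV_t: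
 assumes "t > 0"
 shows "((\<lambda>t. heat t x) has_real_derivative heat2 t x) (at t)"
proof -
 define s where "s = sqrt (4 * pi * t)"
 have pt: "pi * t > 0" using assms by simp
 have s: "s > 0" "s * s = 4 * pi * t" using pt by (auto simp: s_def)
 have 1: "((\<lambda>t. 1 / sqrt (4 * pi * t)) has_real_derivative - (4 * pi / (2 * s)) / (s * s)) (at t)"
 proof -
  have "((\<lambda>t. sqrt (4 * pi * t)) has_real_derivative inverse (sqrt (4 * pi * t)) / 2 * (4 * pi)) (at t)"
   by (rule DERIV_chain2[OF DERIV_real_sqrt]) (use pt in \<open>auto intro!: derivative_eq_intros\<close>)
  from DERIV_divide[OF DERIV_const[of 1] this] have "((\<lambda>t. 1 / sqrt (4 * pi * t)) has_real_derivative (0 * s - 1 * (inverse s / 2 * (4 * pi))) / (s * s)) (at t)"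
   using s(1) assms by (simp add: s_def)
  then show ?thesis by (rule DERIV_cong) (use s(1) in \<open>simp add: field_simps\<close>)
 qed
 have 2: "((\<lambda>t. exp (- x\<^sup>2 / (4 * t))) has_real_derivative exp (- x\<^sup>2 / (4 * t)) * (x\<^sup>2 / (4 * t\<^sup>2))) (at t)"
  using assms by (auto intro!: derivative_eq_intros simp: power2_eq_square field_simps)
 have 3: "- (4 * pi / (2 * s)) / (s * s) = - (1 / (2 * t)) * (1 / s)" unfolding s(2) using assms s(1) by (simp add: field_simps)
 show ?thesis unfolding heat_def
  by (rule DERIV_cong[OF DERIV_mult[OF 1 2]]) (unfold 3 heat2_def heat_def s_def[symmetric], simp add: algebra_simps)
qed

lemma heat1_DERIV_t:
 assumes "t > 0"
 shows "((\<lambda>t. heat1 t x) has_real_derivative heat3 t x) (at t)"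
 unfolding heat1_def heat3_def using assms
 by (auto intro!: derivative_eq_intros heat_DERIV_t simp: heat2_def field_simps power2_eq_square power3_eq_cube)

text \<open>By uniqueness of derivatives an identification at level j passes to level j + 1, so only
  one Gaussian Fourier integral has to be evaluated.\<close>

lemma kern_next:
 assumes "\<alpha> > 0" "t > 0" "\<And>x. kern 0 \<alpha> j 0 t x = cplx (f x)" "\<And>x. (f has_real_derivative f' x) (at x)"
 shows "kern 0 \<alpha> (Suc j) 0 t x = cplx (f' x)"
proof -
 have "kern 0 \<alpha> j 0 t = (\<lambda>x. cplx (f x))" using assms(3) by auto
 then have "((\<lambda>x. cplx (f x)) has_vector_derivative kern 0 \<alpha> (Suc j) 0 t x) (at x)"
  using kern_has_vector_derivative[OF assms(1), of 0 t j 0 x] assms(2) by simp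
 moreover have "((\<lambda>x. cplx (f x)) has_vector_derivative cplx (f' x)) (at x)"
  by (rule has_vector_derivative_of_real[OF assms(4)])
 ultimately show ?thesis by (rule vector_derivative_unique_at)
qed

lemma kern_heat1: "\<alpha> > 0 ==> t > 0 ==> kern 0 \<alpha> 1 0 t x = cplx (heat1 t x)"
 using kern_next[of \<alpha> t 0 "heat t" "heat1 t" x] by (simp add: kern_heat heat_DERIV)

lemma kern_heat2: "\<alpha> > 0 ==> t > 0 ==> kern 0 \<alpha> 2 0 t x = cplx (heat2 t x)"
 using kern_next[of \<alpha> t 1 "heat1 t" "heat2 t" x] by (simp add: kern_heat1[unfolded One_nat_def] heat1_DERIV numeral_2_eq_2)

lemma kern_heat3: "\<alpha> > 0 ==> t > 0 ==> kern 0 \<alpha> 3 0 t x = cplx (heat3 t x)"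
 using kern_next[of \<alpha> t 2 "heat2 t" "heat3 t" x] by (simp add: kern_heat2[unfolded numeral_2_eq_2] heat2_DERIV numeral_3_eq_3 numeral_2_eq_2)

definition dheat :: "real => real => complex" where "dheat t x = cplx (heat1 t x)"

lemma dheat_eq_kern: "t > 0 ==> \<alpha> > 0 ==> dheat t = kern 0 \<alpha> 1 0 t"
 by (auto simp: dheat_def kern_heat1[unfolded One_nat_def])

lemma heat_measurable [measurable]:
 assumes [measurable]: "f \<in> borel_measurable M" "g \<in> borel_measurable M"
 shows "(\<lambda>w. heat (f w) (g w)) \<in> borel_measurable M" "(\<lambda>w. heat1 (f w) (g w)) \<in> borel_measurable M"
  "(\<lambda>w. heat2 (f w) (g w)) \<in> borel_measurable M" "(\<lambda>w. heat3 (f w) (g w)) \<in> borel_measurable M"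
  "(\<lambda>w. dheat (f w) (g w)) \<in> borel_measurable M"
 unfolding dheat_def heat1_def heat2_def heat3_def heat_def by measurable

lemma dheat_bnd: "\<exists>C>0. \<forall>t>0. bnd (dheat t) (C * t powr (- 1)) (C * t powr (- 1 / 2))"
 using heat_kern_bnd[of 1 1] dheat_eq_kern[of _ 1] by auto

lemma dheat_increment:
 "\<exists>C>0. \<forall>t>0. \<forall>y. bnd (\<lambda>x. dheat t (x - y) - dheat t x) (C * \<bar>y\<bar> * t powr (- 3 / 2)) (C * \<bar>y\<bar> * t powr (- 1))"
proof -
 obtain C where C: "C > 0" "\<And>t. t > 0 ==> bnd (kern 0 1 2 0 t) (C * t powr (- (real 2 + 1) / 2)) (C * t powr (- real 2 / 2))"
  using heat_kern_bnd[of 1 2] by auto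
 have "bnd (\<lambda>x. dheat t (x - y) - dheat t x) (C * \<bar>y\<bar> * t powr (- 3 / 2)) (C * \<bar>y\<bar> * t powr (- 1))" if t: "t > 0" for t y
 proof -
  have "bnd (\<lambda>x. kern 0 1 1 0 t (x - y) - kern 0 1 1 0 t x) (\<bar>y\<bar> * (C * t powr (- (real 2 + 1) / 2))) (\<bar>y\<bar> * (C * t powr (- real 2 / 2)))"
  proof (rule bnd_increment)
   show "(kern 0 1 1 0 t has_vector_derivative kern 0 1 2 0 t x) (at x)" for x
    using kern_has_vector_derivative[of 1 0 t 1 0 x] t by (simp add: numeral_2_eq_2)
  qed (use C t continuous_on_kern in auto)
  then show ?thesis using dheat_eq_kern[OF t, of 1] by (simp add: mult_ac)
 qed
 with C show ?thesis by blast
qed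

text \<open>The time derivative of the first space derivative is the third space derivative. The
  range up to 2t/3 keeps the time above t/3, and it is exactly what the cubed heat kernel produces,
  whose Duhamel term contains the times t - 2s/3.\<close>

lemma dheat_time_increment:
 "\<exists>C>0. \<forall>t>0. \<forall>\<tau>. 0 <= \<tau> --> \<tau> <= 2 / 3 * t --> bnd (\<lambda>x. dheat (t - \<tau>) x - dheat t x) (C * \<tau> * t powr (- 2)) (C * \<tau> * t powr (- 3 / 2))"
proof -
 obtain C where C: "C > 0" "\<And>t. t > 0 ==> bnd (kern 0 1 3 0 t) (C * t powr (- (real 3 + 1) / 2)) (C * t powr (- real 3 / 2))"
  using heat_kern_bnd[of 1 3] by auto
 \<comment> \<open>Times stay above t/3 and the exponents are at most 2, so the loss is at most
   3^2.\<close>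
 define K where "K = C * 9"
 have "bnd (\<lambda>x. dheat (t - \<tau>) x - dheat t x) (K * \<tau> * t powr (- 2)) (K * \<tau> * t powr (- 3 / 2))"
  if t: "t > 0" and \<tau>: "0 <= \<tau>" "\<tau> <= 2 / 3 * t" for t \<tau>
 proof -
  have pos: "t - s * \<tau> >= t / 3" if "s \<in> {0..1}" for s
  proof -
   have "s * \<tau> <= 1 * \<tau>" using that \<tau> by (intro mult_right_mono) auto
   then show ?thesis using \<tau> by simp
  qed
  have pos0: "t - s * \<tau> > 0" if "s \<in> {0..1}" for s using pos[OF that] t by simp
  have "bnd (\<lambda>x. (\<lambda>s x. dheat (t - s * \<tau>) x) 1 x - (\<lambda>s x. dheat (t - s * \<tau>) x) 0 x) (K * \<tau> * t powr (- 2)) (K * \<tau> * t powr (- 3 / 2))"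
  proof (rule bnd_path[where F'="\<lambda>s x. cplx (- \<tau>) * cplx (heat3 (t - s * \<tau>) x)"])
   fix s x :: real assume s: "s \<in> {0..1}"
   have "((\<lambda>s. t - s * \<tau>) has_real_derivative - \<tau>) (at s)" by (auto intro!: derivative_eq_intros)
   from DERIV_chain2[OF heat1_DERIV_t[OF pos0[OF s]] this]
   have "((\<lambda>s. heat1 (t - s * \<tau>) x) has_real_derivative heat3 (t - s * \<tau>) x * - \<tau>) (at s)" .
   from has_vector_derivative_of_real[OF this]
   show "((\<lambda>s. dheat (t - s * \<tau>) x) has_vector_derivative cplx (- \<tau>) * cplx (heat3 (t - s * \<tau>) x)) (at s within {0..1})"
    by (auto simp: dheat_def mult.commute intro: has_vector_derivative_at_within)
  next
   fix x :: real
   show "continuous_on {0..1} (\<lambda>s. cplx (- \<tau>) * cplx (heat3 (t - s * \<tau>) x))"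
    unfolding heat3_def heat_def using pos0 t
    by (intro continuous_intros) (auto simp: less_imp_neq[symmetric] dest!: pos0)
  next
   fix s :: real assume s: "s \<in> {0..1}"
   have p: "(t - s * \<tau>) powr (- a) <= 9 * t powr (- a)" if "0 <= a" "a <= 2" for a
   proof -
    have "(t - s * \<tau>) powr (- a) <= (t / 3) powr (- a)" using pos[OF s] t that by (intro powr_mono2') auto
    also have "\<dots> = 3 powr a * t powr (- a)" using t by (simp add: powr_divide powr_minus field_simps)
    also have "3 powr a <= 3 powr (2::real)" using that by (intro powr_mono) auto
    finally show ?thesis by (simp add: mult_right_mono)
   qed
   have k3: "kern 0 1 3 0 (t - s * \<tau>) = (\<lambda>x. cplx (heat3 (t - s * \<tau>) x))"
    using kern_heat3[of 1 "t - s * \<tau>"] pos0[OF s] by auto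
   have "bnd (\<lambda>x. cplx (- \<tau>) * cplx (heat3 (t - s * \<tau>) x)) (\<tau> * (C * (t - s * \<tau>) powr (- 2))) (\<tau> * (C * (t - s * \<tau>) powr (- (3 / 2))))"
    using bnd_cmult[OF C(2)[OF pos0[OF s]], of "cplx (- \<tau>)"] \<tau> by (simp add: k3)
   then show "bnd (\<lambda>x. cplx (- \<tau>) * cplx (heat3 (t - s * \<tau>) x)) (K * \<tau> * t powr (- 2)) (K * \<tau> * t powr (- 3 / 2))"
   proof (rule bnd_mono)
    have "\<tau> * (C * (t - s * \<tau>) powr (- a)) <= \<tau> * (C * (9 * t powr (- a)))" if "0 <= a" "a <= 2" for a
     using p[OF that] \<tau> C by (intro mult_left_mono) auto
    from this[of 2] this[of "3/2"] show "\<tau> * (C * (t - s * \<tau>) powr (- 2)) <= K * \<tau> * t powr (- 2)"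
     "\<tau> * (C * (t - s * \<tau>) powr (- (3 / 2))) <= K * \<tau> * t powr (- 3 / 2)"
     by (auto simp: K_def mult_ac)
   qed
  qed (use C \<tau> in \<open>auto simp: K_def\<close>)
  then show ?thesis by simp
 qed
 moreover have "K > 0" using C by (simp add: K_def)
 ultimately show ?thesis by blast
qed

section \<open>Fourier multipliers and fractional derivatives\<close>

lemma ft_eq_ift: "ft f \<xi> = 2 * pi * ift f (- \<xi>)"
 by (simp add: ift_eq_ft)

lemma ft_plancherel_ineq:
 assumes i: "integrable lborel f"
 shows "(nnL2 (ft f)) <= ennreal (2 * pi) * (nnL2 f)"
proof -
 have [measurable]: "ift f \<in> borel_measurable borel" using ift_measurable[of f] i by simp
 have "(nnL2 (ft f)) = (\<integral>\<^sup>+\<xi>. ennreal ((2 * pi)\<^sup>2) * ennreal ((norm (ift f (0 + (-1) * \<xi>)))\<^sup>2) \<partial>lborel)"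
  by (simp add: ft_eq_ift norm_mult power_mult_distrib flip: ennreal_mult)
 also have "\<dots> = ennreal ((2 * pi)\<^sup>2) * (nnL2 (\<lambda>\<xi>. ift f (0 + (-1) * \<xi>)))"
  by (rule nn_integral_cmult) measurable
 also have "(nnL2 (\<lambda>\<xi>. ift f (0 + (-1) * \<xi>))) = (nnL2 (ift f))"
  using nn_integral_real_affine[of "\<lambda>x. ennreal ((norm (ift f x))\<^sup>2)" "-1" 0] by simp
 also have "ennreal ((2 * pi)\<^sup>2) * \<dots> <= ennreal ((2 * pi)\<^sup>2) * (ennreal (1 / (2 * pi)) * (nnL2 f))"
  by (intro mult_left_mono plancherel_ineq i) auto
 also have "\<dots> = ennreal ((2 * pi)\<^sup>2 * (1 / (2 * pi))) * (nnL2 f)"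
  by (subst ennreal_mult) (auto simp: mult.assoc)
 also have "(2 * pi)\<^sup>2 * (1 / (2 * pi)) = 2 * pi" by (simp add: power2_eq_square)
 finally show ?thesis .
qed

section \<open>Multiplier bounds between L^1, L^2 and the supremum norm\<close>

context
 fixes g f :: "real => complex" and c \<kappa> :: real
 assumes g: "gauss_bounded c \<kappa> g" and c: "c > 0" and f: "integrable lborel f"
begin

private lemma meas [measurable]: "g \<in> borel_measurable borel" "f \<in> borel_measurable borel" "ft f \<in> borel_measurable borel"
 using g f ft_measurable[of f] by (auto simp: gauss_bounded_def)

private lemma g_le: "norm (g \<xi>) <= \<kappa>"
proof -
 have "norm (g \<xi>) <= \<kappa> * exp (- (c * \<xi>\<^sup>2))" using g by (simp add: gauss_bounded_def)
 also have "\<dots> <= \<kappa> * 1" using gauss_bounded_nonneg[OF g] c by (intro mult_left_mono) auto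
 finally show ?thesis by simp
qed

lemma multiplier_integrable: "integrable lborel (\<lambda>\<xi>. g \<xi> * ft f \<xi>)"
proof (rule bochner_integrable_bound)
 show "integrable lborel (\<lambda>\<xi>. norm (g \<xi>) * (LINT x|lborel. norm (f x)))"
  using gauss_bounded_integrable[OF g c] by auto
 show "AE \<xi> in lborel. norm (g \<xi> * ft f \<xi>) <= norm (norm (g \<xi>) * (LINT x|lborel. norm (f x)))"
  by (intro AE_I2) (auto simp: norm_mult norm_ft_le abs_mult intro!: mult_left_mono order_trans[OF norm_ft_le abs_ge_self])
qed measurable

text \<open>Only the modulus of the symbol enters, here and in the three bounds below. The
  dispersive phase therefore costs nothing, even as t tends to 0, in contrast to the L^1 bounds of
  the kernel.\<close>

lemma multiplier_L2:
 "(nnL2 (\<lambda>x. ift (\<lambda>\<xi>. g \<xi> * ft f \<xi>) x)) <= ennreal (\<kappa>\<^sup>2) * (nnL2 f)"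
proof -
 have "(nnL2 (\<lambda>x. ift (\<lambda>\<xi>. g \<xi> * ft f \<xi>) x)) <= ennreal (1 / (2 * pi)) * (nnL2 (\<lambda>\<xi>. g \<xi> * ft f \<xi>))"
  by (rule plancherel_ineq[OF multiplier_integrable])
 also have "(nnL2 (\<lambda>\<xi>. g \<xi> * ft f \<xi>)) <= (\<integral>\<^sup>+\<xi>. ennreal (\<kappa>\<^sup>2) * ennreal ((norm (ft f \<xi>))\<^sup>2) \<partial>lborel)"
  by (intro nn_integral_mono) (auto simp: norm_mult power_mult_distrib g_le intro!: ennreal_leI mult_right_mono power_mono simp flip: ennreal_mult)
 also have "\<dots> = ennreal (\<kappa>\<^sup>2) * (nnL2 (ft f))"
  by (rule nn_integral_cmult) measurable
 also have "\<dots> <= ennreal (\<kappa>\<^sup>2) * (ennreal (2 * pi) * (nnL2 f))"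
  by (intro mult_left_mono ft_plancherel_ineq f) auto
 also have "ennreal (1 / (2 * pi)) * (ennreal (\<kappa>\<^sup>2) * (ennreal (2 * pi) * (nnL2 f))) = 
   ennreal (1 / (2 * pi) * \<kappa>\<^sup>2 * (2 * pi)) * (nnL2 f)"
  by (simp only: ennreal_mult mult.assoc zero_le_power2 zero_le_mult_iff zero_le_divide_iff pi_ge_zero zero_le_numeral zero_le_one simp_thms)
 also have "1 / (2 * pi) * \<kappa>\<^sup>2 * (2 * pi) = \<kappa>\<^sup>2" by simp
 finally show ?thesis by (simp add: mult_left_mono)
qed

text \<open>Cauchy-Schwarz on the frequency side: the L^2 norm of the Gaussian-bounded symbol times
  that of the transformed function. Squares are kept to stay within extended reals.\<close>

lemma multiplier_sup:
 "ennreal ((norm (ift (\<lambda>\<xi>. g \<xi> * ft f \<xi>) x))\<^sup>2) <= ennreal (\<kappa>\<^sup>2 * sqrt (pi / (2 * c))) * (nnL2 f)"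
proof -
 define E where "E = (nnL2 f)"
 have "ennreal (norm (LINT \<xi>|lborel. iexp (x * \<xi>) * (g \<xi> * ft f \<xi>))) <= (\<integral>\<^sup>+\<xi>. ennreal (norm (g \<xi>)) * ennreal (norm (ft f \<xi>)) \<partial>lborel)"
  by (rule order_trans[OF norm_integral_le_nn_integral]) (simp add: norm_mult ennreal_mult)
 then have "(ennreal (norm (LINT \<xi>|lborel. iexp (x * \<xi>) * (g \<xi> * ft f \<xi>))))\<^sup>2 <= (\<integral>\<^sup>+\<xi>. ennreal (norm (g \<xi>)) * ennreal (norm (ft f \<xi>)) \<partial>lborel)\<^sup>2"
  by (rule power_mono) simp
 also have "\<dots> <= (\<integral>\<^sup>+\<xi>. (ennreal (norm (g \<xi>)))\<^sup>2 \<partial>lborel) * (\<integral>\<^sup>+\<xi>. (ennreal (norm (ft f \<xi>)))\<^sup>2 \<partial>lborel)"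
  by (rule Cauchy_Schwarz_nn_integral) measurable
 also have "\<dots> = (nnL2 g) * (nnL2 (ft f))"
  by (simp add: ennreal_power)
 also have "\<dots> <= ennreal (\<kappa>\<^sup>2 * sqrt (pi / (2 * c))) * (ennreal (2 * pi) * E)"
  unfolding E_def by (intro mult_mono nn_integral_norm_square_gauss_bounded[OF g c] ft_plancherel_ineq f) auto
 finally have 1: "(ennreal (norm (LINT \<xi>|lborel. iexp (x * \<xi>) * (g \<xi> * ft f \<xi>))))\<^sup>2 <= ennreal (\<kappa>\<^sup>2 * sqrt (pi / (2 * c))) * (ennreal (2 * pi) * E)" .
 have "ennreal ((norm (ift (\<lambda>\<xi>. g \<xi> * ft f \<xi>) x))\<^sup>2) = ennreal ((1 / (2 * pi))\<^sup>2) * (ennreal (norm (LINT \<xi>|lborel. iexp (x * \<xi>) * (g \<xi> * ft f \<xi>))))\<^sup>2"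
  by (simp add: ift_def norm_divide norm_mult power_divide ennreal_power flip: ennreal_mult)
 also have "\<dots> <= ennreal ((1 / (2 * pi))\<^sup>2) * (ennreal (\<kappa>\<^sup>2 * sqrt (pi / (2 * c))) * (ennreal (2 * pi) * E))"
  by (intro mult_left_mono 1) auto
 also have "\<dots> = (ennreal ((1 / (2 * pi))\<^sup>2) * ennreal (2 * pi)) * (ennreal (\<kappa>\<^sup>2 * sqrt (pi / (2 * c))) * E)"
  by (simp add: ac_simps)
 also have "\<dots> <= 1 * (ennreal (\<kappa>\<^sup>2 * sqrt (pi / (2 * c))) * E)"
 proof (intro mult_right_mono)
  have "ennreal ((1 / (2 * pi))\<^sup>2) * ennreal (2 * pi) = ennreal ((1 / (2 * pi))\<^sup>2 * (2 * pi))"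
   by (rule ennreal_mult[symmetric]) auto
  also have "(1 / (2 * pi))\<^sup>2 * (2 * pi) = 1 / (2 * pi)" by (simp add: power2_eq_square)
  also have "ennreal (1 / (2 * pi)) <= ennreal 1" using pi_ge_two by (intro ennreal_leI) simp
  finally show "ennreal ((1 / (2 * pi))\<^sup>2) * ennreal (2 * pi) <= 1" by simp
 qed simp
 finally show ?thesis by (simp add: E_def)
qed

lemma multiplier_L2_L1:
 assumes N: "(LINT x|lborel. norm (f x)) <= N"
 shows "(nnL2 (\<lambda>x. ift (\<lambda>\<xi>. g \<xi> * ft f \<xi>) x)) <= ennreal (\<kappa>\<^sup>2 * sqrt (pi / (2 * c)) * N\<^sup>2)"
proof -
 have fN: "norm (ft f \<xi>) <= N" for \<xi> using norm_ft_le[of f \<xi>] N by linarith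
 have "(nnL2 (\<lambda>x. ift (\<lambda>\<xi>. g \<xi> * ft f \<xi>) x)) <= ennreal (1 / (2 * pi)) * (nnL2 (\<lambda>\<xi>. g \<xi> * ft f \<xi>))"
  by (rule plancherel_ineq[OF multiplier_integrable])
 also have "\<dots> <= 1 * (\<integral>\<^sup>+\<xi>. ennreal (N\<^sup>2) * ennreal ((norm (g \<xi>))\<^sup>2) \<partial>lborel)"
 proof (intro mult_mono nn_integral_mono)
  show "ennreal (1 / (2 * pi)) <= 1" using pi_ge_two ennreal_leI[of "1 / (2 * pi)" 1] by simp
  fix \<xi>
  have "(norm (ft f \<xi>))\<^sup>2 * (norm (g \<xi>))\<^sup>2 <= N\<^sup>2 * (norm (g \<xi>))\<^sup>2" by (intro mult_right_mono power_mono fN) auto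
  then show "ennreal ((norm (g \<xi> * ft f \<xi>))\<^sup>2) <= ennreal (N\<^sup>2) * ennreal ((norm (g \<xi>))\<^sup>2)"
   by (simp add: norm_mult power_mult_distrib mult.commute flip: ennreal_mult)
 qed auto
 also have "\<dots> = ennreal (N\<^sup>2) * (nnL2 g)"
  by (simp add: nn_integral_cmult)
 also have "\<dots> <= ennreal (N\<^sup>2) * ennreal (\<kappa>\<^sup>2 * sqrt (pi / (2 * c)))"
  by (intro mult_left_mono nn_integral_norm_square_gauss_bounded[OF g c]) auto
 finally show ?thesis using c by (simp add: mult.commute flip: ennreal_mult)
qed

lemma multiplier_sup_L1:
 assumes N: "(LINT x|lborel. norm (f x)) <= N"
 shows "norm (ift (\<lambda>\<xi>. g \<xi> * ft f \<xi>) x) <= \<kappa> * sqrt (pi / c) * N"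
proof -
 have fN: "norm (ft f \<xi>) <= N" for \<xi> using norm_ft_le[of f \<xi>] N by linarith
 have N0: "N >= 0" using fN[of 0] norm_ge_zero[of "ft f 0"] by linarith
 have k0: "\<kappa> >= 0" by (rule gauss_bounded_nonneg[OF g])
 have "norm (ift (\<lambda>\<xi>. g \<xi> * ft f \<xi>) x) <= (LINT \<xi>|lborel. norm (g \<xi> * ft f \<xi>)) / (2 * pi)"
  by (rule norm_ift_le)
 also have "\<dots> <= (LINT \<xi>|lborel. norm (g \<xi>) * N) / (2 * pi)"
  using integrable_norm[OF multiplier_integrable] integrable_norm[OF gauss_bounded_integrable[OF g c]]
  by (intro divide_right_mono integral_mono) (simp_all add: norm_mult fN mult_left_mono)
 also have "\<dots> = (LINT \<xi>|lborel. norm (g \<xi>)) * N / (2 * pi)" by simp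
 also have "\<dots> <= \<kappa> * sqrt (pi / c) * N / (2 * pi)"
  using integral_norm_gauss_bounded[OF g c] N0 by (intro divide_right_mono mult_right_mono) auto
 also have "\<dots> <= \<kappa> * sqrt (pi / c) * N / 1"
  using k0 N0 c pi_ge_two by (intro divide_left_mono) auto
 finally show ?thesis by simp
qed

end

lemma ennreal_power2_le_imp_le:
 fixes x y :: ennreal
 assumes "x\<^sup>2 <= y\<^sup>2"
 shows "x <= y"
proof (cases y)
 case (real b)
 with assms show ?thesis by (auto intro: ennreal_square_le_imp_le)
qed simp

text \<open>The square of the inner integral is written as a double integral over s and r; Tonelli
  and Cauchy-Schwarz in x bound each pair by \<open>n s * n r\<close>, and the product integral
  factors again.\<close>

lemma minkowski_nn_integral:
 fixes h :: "'a => 'b => ennreal"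
 assumes "sigma_finite_measure M" "sigma_finite_measure N"
  and [measurable]: "(\<lambda>(x, s). h x s) \<in> borel_measurable (M \<Otimes>\<^sub>M N)" 
  and [measurable]: "n \<in> borel_measurable N"
  and n: "\<And>s. s \<in> space N ==> (\<integral>\<^sup>+x. (h x s)\<^sup>2 \<partial>M) <= (n s)\<^sup>2"
 shows "(\<integral>\<^sup>+x. (\<integral>\<^sup>+s. h x s \<partial>N)\<^sup>2 \<partial>M) <= (\<integral>\<^sup>+s. n s \<partial>N)\<^sup>2"
proof -
 interpret M: sigma_finite_measure M by fact
 interpret N: sigma_finite_measure N by fact
 interpret MN: pair_sigma_finite M N ..
 have cs: "(\<integral>\<^sup>+x. h x s * h x r \<partial>M) <= n s * n r" if [simp]: "s \<in> space N" "r \<in> space N" for s r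
 proof (rule ennreal_power2_le_imp_le)
  have [measurable]: "(\<lambda>x. h x s) \<in> borel_measurable M" "(\<lambda>x. h x r) \<in> borel_measurable M" by measurable
  have "(\<integral>\<^sup>+x. h x s * h x r \<partial>M)\<^sup>2 <= (\<integral>\<^sup>+x. (h x s)\<^sup>2 \<partial>M) * (\<integral>\<^sup>+x. (h x r)\<^sup>2 \<partial>M)"
   by (rule Cauchy_Schwarz_nn_integral) measurable
  also have "\<dots> <= (n s)\<^sup>2 * (n r)\<^sup>2" by (intro mult_mono n) auto
  finally show "(\<integral>\<^sup>+x. h x s * h x r \<partial>M)\<^sup>2 <= (n s * n r)\<^sup>2" by (simp add: power_mult_distrib)
 qed
 have "(\<integral>\<^sup>+x. (\<integral>\<^sup>+s. h x s \<partial>N)\<^sup>2 \<partial>M) = (\<integral>\<^sup>+x. \<integral>\<^sup>+s. \<integral>\<^sup>+r. h x s * h x r \<partial>N \<partial>N \<partial>M)"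
  by (intro nn_integral_cong) (simp add: power2_eq_square nn_integral_cmult nn_integral_multc)
 also have "\<dots> = (\<integral>\<^sup>+s. \<integral>\<^sup>+x. \<integral>\<^sup>+r. h x s * h x r \<partial>N \<partial>M \<partial>N)"
  by (rule MN.Fubini'[symmetric]) measurable
 also have "\<dots> = (\<integral>\<^sup>+s. \<integral>\<^sup>+r. \<integral>\<^sup>+x. h x s * h x r \<partial>M \<partial>N \<partial>N)"
  by (intro nn_integral_cong MN.Fubini'[symmetric]) measurable
 also have "\<dots> <= (\<integral>\<^sup>+s. \<integral>\<^sup>+r. n s * n r \<partial>N \<partial>N)"
  by (intro nn_integral_mono cs) auto
 also have "\<dots> = (\<integral>\<^sup>+s. n s \<partial>N)\<^sup>2"
  by (simp add: power2_eq_square nn_integral_cmult nn_integral_multc)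
 finally show ?thesis .
qed

section \<open>Symbols for which the fractional operator can be iterated\<close>

definition good :: "(real => complex) => bool" where
 "good g \<longleftrightarrow> (\<exists>c>0. \<exists>\<kappa> \<kappa>' g'. C1_gauss c \<kappa> \<kappa>' g g')"

text \<open>The growth is absorbed by half of the Gaussian: s|\<xi>| <= c \<xi>^2/2 + s^2/(2c),
  which is the source of the constant \<open>A\<close>. The rate is halved at each use, hence the
  existential rate in \<open>good\<close>.\<close>

lemma good_multiplier:
 assumes g: "good g" and p: "\<And>\<xi>. (p has_vector_derivative p' \<xi>) (at \<xi>)" "continuous_on UNIV p'"
  and b: "\<And>\<xi>. norm (p \<xi>) <= a * exp (s * \<bar>\<xi>\<bar>)" "\<And>\<xi>. norm (p' \<xi>) <= a * exp (s * \<bar>\<xi>\<bar>)"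
 shows "good (\<lambda>\<xi>. p \<xi> * g \<xi>)"
proof -
 obtain c \<kappa> \<kappa>' g' where c: "c > 0" and g': "C1_gauss c \<kappa> \<kappa>' g g'" using g by (auto simp: good_def)
 define A where "A = a * exp (s\<^sup>2 / (2 * c))"
 have "0 <= norm (p 0)" by simp
 also have "\<dots> <= a" using b(1)[of 0] by simp
 finally have a0: "a >= 0" .
 have k: "\<kappa> >= 0" "\<kappa>' >= 0" using g' gauss_bounded_nonneg unfolding C1_gauss_def by blast+
 have e: "a * exp (s * \<bar>\<xi>\<bar>) * exp (- (c * \<xi>\<^sup>2)) <= A * exp (- (c / 2 * \<xi>\<^sup>2))" for \<xi>
 proof -
  have "0 <= (c * \<bar>\<xi>\<bar> - s)\<^sup>2 / (2 * c)" using c by simp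
  also have "\<dots> = c / 2 * \<xi>\<^sup>2 - s * \<bar>\<xi>\<bar> + s\<^sup>2 / (2 * c)" using c by (simp add: power2_diff power_mult_distrib field_simps power2_eq_square)
  finally have "s * \<bar>\<xi>\<bar> + - (c * \<xi>\<^sup>2) <= s\<^sup>2 / (2 * c) + - (c / 2 * \<xi>\<^sup>2)" by (simp add: field_simps)
  then show ?thesis using a0 by (simp add: A_def mult.assoc mult_exp_exp mult_left_mono)
 qed
 have pg: "norm (q * w) <= (A * K) * exp (- (c / 2 * \<xi>\<^sup>2))" if "norm q <= a * exp (s * \<bar>\<xi>\<bar>)" "norm w <= K * exp (- (c * \<xi>\<^sup>2))" "K >= 0" for q w :: complex and \<xi> K
 proof -
  have "norm (q * w) <= (a * exp (s * \<bar>\<xi>\<bar>)) * (K * exp (- (c * \<xi>\<^sup>2)))"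
   unfolding norm_mult using that a0 by (intro mult_mono) auto
  also have "\<dots> = K * (a * exp (s * \<bar>\<xi>\<bar>) * exp (- (c * \<xi>\<^sup>2)))" by simp
  also have "\<dots> <= K * (A * exp (- (c / 2 * \<xi>\<^sup>2)))" by (intro mult_left_mono e that)
  finally show ?thesis by (simp add: mult_ac)
 qed
 have gb: "norm (g \<xi>) <= \<kappa> * exp (- (c * \<xi>\<^sup>2))" "norm (g' \<xi>) <= \<kappa>' * exp (- (c * \<xi>\<^sup>2))" for \<xi>
  using g' unfolding C1_gauss_def gauss_bounded_def by blast+
 have gd: "(g has_vector_derivative g' \<xi>) (at \<xi>)" for \<xi> using g' unfolding C1_gauss_def by blast
 have cont: "continuous_on UNIV p" "continuous_on UNIV g" "continuous_on UNIV g'"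
  using has_vector_derivative_continuous[OF p(1)] has_vector_derivative_continuous[OF gd] g'
  unfolding C1_gauss_def by (blast intro: continuous_at_imp_continuous_on)+
 have "C1_gauss (c / 2) (A * \<kappa>) (A * \<kappa>' + A * \<kappa>) (\<lambda>\<xi>. p \<xi> * g \<xi>) (\<lambda>\<xi>. p \<xi> * g' \<xi> + p' \<xi> * g \<xi>)"
  unfolding C1_gauss_def gauss_bounded_def
 proof (intro conjI allI)
  show "norm (p \<xi> * g \<xi>) <= A * \<kappa> * exp (- (c / 2 * \<xi>\<^sup>2))" for \<xi> by (rule pg[OF b(1) gb(1) k(1)])
  show "norm (p \<xi> * g' \<xi> + p' \<xi> * g \<xi>) <= (A * \<kappa>' + A * \<kappa>) * exp (- (c / 2 * \<xi>\<^sup>2))" for \<xi>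
   unfolding distrib_right by (rule order_trans[OF norm_triangle_ineq add_mono[OF pg[OF b(1) gb(2) k(2)] pg[OF b(2) gb(1) k(1)]]])
  show "((\<lambda>\<xi>. p \<xi> * g \<xi>) has_vector_derivative p \<xi> * g' \<xi> + p' \<xi> * g \<xi>) (at \<xi>)" for \<xi>
   by (rule has_vector_derivative_mult[OF p(1) gd])
  show c2: "continuous_on UNIV (\<lambda>\<xi>. p \<xi> * g' \<xi> + p' \<xi> * g \<xi>)" by (intro continuous_intros cont p)
  show "(\<lambda>\<xi>. p \<xi> * g \<xi>) \<in> borel_measurable lborel" "(\<lambda>\<xi>. p \<xi> * g' \<xi> + p' \<xi> * g \<xi>) \<in> borel_measurable lborel"
   using borel_measurable_continuous_onI[OF c2] borel_measurable_continuous_onI[OF continuous_on_mult[OF cont(1,2)]] by auto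
 qed
 then show ?thesis using c unfolding good_def by (intro exI[of _ "c / 2"] conjI exI) auto
qed

lemma good_psi:
 assumes "good g" "\<alpha> > 0"
 shows "good (\<lambda>\<xi>. cplx b * \<i> * psi \<alpha> \<xi> * g \<xi>)"
proof (rule good_multiplier[OF assms(1), where p'="\<lambda>\<xi>. cplx b * \<i> * cplx ((\<alpha> + 1) * \<bar>\<xi>\<bar> powr \<alpha>)" and a="\<bar>b\<bar> * (\<alpha> + 1)" and s="\<alpha> + 1"])
 fix \<xi> :: real
 show "((\<lambda>\<xi>. cplx b * \<i> * cplx (psi \<alpha> \<xi>)) has_vector_derivative cplx b * \<i> * cplx ((\<alpha> + 1) * \<bar>\<xi>\<bar> powr \<alpha>)) (at \<xi>)"
  by (intro has_vector_derivative_mult_right has_vector_derivative_of_real psi_has_real_derivative assms)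
 have "\<bar>\<xi>\<bar> ^ 1 * (\<bar>\<xi>\<bar> powr \<alpha>) ^ 1 <= exp ((real 1 + \<alpha> * real 1) * \<bar>\<xi>\<bar>)"
  by (rule poly_exp_le) (use assms in auto)
 then have e: "\<bar>\<xi>\<bar> * \<bar>\<xi>\<bar> powr \<alpha> <= exp ((\<alpha> + 1) * \<bar>\<xi>\<bar>)" by (simp add: add.commute)
 have "norm (cplx b * \<i> * cplx (psi \<alpha> \<xi>)) = \<bar>b\<bar> * (1 * (\<bar>\<xi>\<bar> * \<bar>\<xi>\<bar> powr \<alpha>))"
  by (simp add: norm_mult psi_def abs_mult)
 also have "\<dots> <= \<bar>b\<bar> * ((\<alpha> + 1) * exp ((\<alpha> + 1) * \<bar>\<xi>\<bar>))" using e assms by (intro mult_left_mono mult_mono) auto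
 finally show "norm (cplx b * \<i> * cplx (psi \<alpha> \<xi>)) <= \<bar>b\<bar> * (\<alpha> + 1) * exp ((\<alpha> + 1) * \<bar>\<xi>\<bar>)" by simp
 have "\<bar>\<xi>\<bar> ^ 0 * (\<bar>\<xi>\<bar> powr \<alpha>) ^ 1 <= exp ((real 0 + \<alpha> * real 1) * \<bar>\<xi>\<bar>)"
  by (rule poly_exp_le) (use assms in auto)
 also have "\<dots> <= exp ((\<alpha> + 1) * \<bar>\<xi>\<bar>)" by (simp add: mult_right_mono)
 finally have "\<bar>b\<bar> * (\<alpha> + 1) * \<bar>\<xi>\<bar> powr \<alpha> <= \<bar>b\<bar> * (\<alpha> + 1) * exp ((\<alpha> + 1) * \<bar>\<xi>\<bar>)"
  using assms by (intro mult_left_mono) auto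
 then show "norm (cplx b * \<i> * cplx ((\<alpha> + 1) * \<bar>\<xi>\<bar> powr \<alpha>)) <= \<bar>b\<bar> * (\<alpha> + 1) * exp ((\<alpha> + 1) * \<bar>\<xi>\<bar>)"
  using assms by (simp add: norm_mult abs_mult mult_ac)
 show "continuous_on UNIV (\<lambda>\<xi>. cplx b * \<i> * cplx ((\<alpha> + 1) * \<bar>\<xi>\<bar> powr \<alpha>))"
  using assms by (intro continuous_on_mult continuous_on_of_real continuous_on_powr' continuous_on_const continuous_on_rabs continuous_on_id) auto
qed

lemma good_ixi:
 assumes "good g"
 shows "good (\<lambda>\<xi>. \<i> * \<xi> * g \<xi>)"
proof (rule good_multiplier[OF assms, where p'="\<lambda>\<xi>. \<i>" and a=1 and s=1])
 fix \<xi> :: real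
 have "\<bar>\<xi>\<bar> <= exp \<bar>\<xi>\<bar>" using exp_ge_add_one_self[of "\<bar>\<xi>\<bar>"] by linarith
 then show "norm (\<i> * cplx \<xi>) <= 1 * exp (1 * \<bar>\<xi>\<bar>)" by (simp add: norm_mult)
 show "((\<lambda>\<xi>. \<i> * cplx \<xi>) has_vector_derivative \<i>) (at \<xi>)"
  using power_has_vector_derivative[of 1 \<xi>] by simp
qed auto

lemma good_D:
 assumes "good g"
 shows "integrable lborel g" "integrable lborel (ift g)" "ft (ift g) = g" "g \<in> borel_measurable borel"
proof -
 obtain c \<kappa> \<kappa>' g' where c: "c > 0" and g': "C1_gauss c \<kappa> \<kappa>' g g'" using assms by (auto simp: good_def)
 show "integrable lborel g" "integrable lborel (ift g)" "ft (ift g) = g"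
  using gauss_bounded_integrable[of c \<kappa> g] ft_ift[OF g' c] g' c by (auto simp: C1_gauss_def)
 then show "g \<in> borel_measurable borel" by auto
qed

lemma good_dx:
 assumes "good g"
 shows "dx (ift g) = ift (\<lambda>\<xi>. \<i> * \<xi> * g \<xi>)" "\<And>x. (ift g has_vector_derivative ift (\<lambda>\<xi>. \<i> * \<xi> * g \<xi>) x) (at x)"
proof -
 note 1 = good_ixi[OF assms]
 note 2 = good_ixi[OF 1]
 have "integrable lborel (\<lambda>\<xi>. \<xi>\<^sup>2 * norm (g \<xi>))"
 proof -
  have "(\<lambda>\<xi>. \<xi>\<^sup>2 * norm (g \<xi>)) = (\<lambda>\<xi>. norm (\<i> * \<xi> * (\<i> * \<xi> * g \<xi>)))"
   by (simp add: fun_eq_iff norm_mult power2_eq_square flip: mult.assoc)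
  then show ?thesis using integrable_norm[OF good_D(1)[OF 2]] by simp
 qed
 then show d: "(ift g has_vector_derivative ift (\<lambda>\<xi>. \<i> * \<xi> * g \<xi>) x) (at x)" for x
  using good_D(1)[OF assms] good_D(1)[OF 1] by (intro ift_has_vector_derivative) auto
 then show "dx (ift g) = ift (\<lambda>\<xi>. \<i> * \<xi> * g \<xi>)"
  by (auto simp: dx_def vector_derivative_at)
qed

lemma lebesgue_integral_lborel:
 fixes f :: "real => 'a::{banach, second_countable_topology}"
 shows "f \<in> borel_measurable borel ==> integral\<^sup>L lebesgue f = integral\<^sup>L lborel f"
 by (rule integral_completion) simp

lemma inv_fourier_eq:
 assumes [measurable]: "g \<in> borel_measurable borel"
 shows "inv_fourier g x = cplx (sqrt (2 * pi)) * ift g x"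
proof -
 have "(LINT \<xi>|lebesgue. exp (\<i> * of_real (x * \<xi>)) * g \<xi>) = 2 * pi * ift g x"
  by (subst lebesgue_integral_lborel) (auto simp: ift_def)
 moreover have "1 / sqrt (2 * pi) * (2 * pi) = sqrt (2 * pi)" by (simp add: real_div_sqrt)
 then have "cplx (1 / sqrt (2 * pi)) * (2 * pi) = cplx (sqrt (2 * pi))" by (metis of_real_mult)
 ultimately show ?thesis by (simp add: inv_fourier_def flip: mult.assoc)
qed

lemma fourier_eq:
 assumes [measurable]: "f \<in> borel_measurable borel"
 shows "fourier f \<xi> = ft f \<xi> / cplx (sqrt (2 * pi))"
 unfolding fourier_def by (subst lebesgue_integral_lborel) (auto simp: ft_def)

text \<open>The operator transforms forward and back, so acting on it means recovering the symbol
  from \<open>ift\<close>: Fourier inversion for the differentiated function is the essential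
  ingredient.\<close>

lemma frac_dx_ift:
 assumes g: "good g" and "\<alpha> > 0"
 shows "frac_dx \<alpha> (ift g) = ift (\<lambda>\<xi>. \<i> * psi \<alpha> \<xi> * g \<xi>)"
proof
 fix x
 note 1 = good_ixi[OF g]
 note 2 = good_psi[OF g assms(2), of 1]
 have [measurable]: "ift (\<lambda>\<xi>. \<i> * \<xi> * g \<xi>) \<in> borel_measurable borel"
  using ift_measurable[OF borel_measurable_integrable[OF good_D(1)[OF 1]]] by simp
 have [measurable]: "(\<lambda>\<xi>. \<i> * \<xi> * g \<xi>) \<in> borel_measurable borel" by (rule good_D[OF 1])
 have [measurable]: "g \<in> borel_measurable borel" by (rule good_D[OF g])
 have f: "fourier (ift (\<lambda>\<xi>. \<i> * \<xi> * g \<xi>)) \<xi> = \<i> * \<xi> * g \<xi> / cplx (sqrt (2 * pi))" for \<xi>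
  by (simp add: fourier_eq good_D(3)[OF 1])
 have "frac_dx \<alpha> (ift g) x = inv_fourier (\<lambda>\<xi>. cplx (\<bar>\<xi>\<bar> powr \<alpha>) * (\<i> * \<xi> * g \<xi> / cplx (sqrt (2 * pi)))) x"
  by (simp add: frac_dx_def frac_deriv_def good_dx(1)[OF g] f)
 also have "(\<lambda>\<xi>. cplx (\<bar>\<xi>\<bar> powr \<alpha>) * (\<i> * \<xi> * g \<xi> / cplx (sqrt (2 * pi)))) = (\<lambda>\<xi>. \<i> * psi \<alpha> \<xi> * g \<xi> / cplx (sqrt (2 * pi)))"
  by (simp add: psi_def fun_eq_iff)
 also have "inv_fourier \<dots> x = cplx (sqrt (2 * pi)) * ift (\<lambda>\<xi>. \<i> * psi \<alpha> \<xi> * g \<xi> / cplx (sqrt (2 * pi))) x"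
  unfolding psi_def by (rule inv_fourier_eq) measurable
 also have "\<dots> = ift (\<lambda>\<xi>. \<i> * psi \<alpha> \<xi> * g \<xi>) x"
  by (simp add: ift_def)
 finally show "frac_dx \<alpha> (ift g) x = ift (\<lambda>\<xi>. \<i> * psi \<alpha> \<xi> * g \<xi>) x" .
qed

text \<open>Both claims are proved in one induction, because each application needs the current
  symbol to be good. The factor b serves two purposes: b = 1 for the plain powers, b = t for the
  operator with the time factor inside.\<close>

lemma frac_dx_power:
 assumes "good g" "\<alpha> > 0"
 shows "good (\<lambda>\<xi>. (cplx b * \<i> * psi \<alpha> \<xi>) ^ k * g \<xi>)
  \<and> ((\<lambda>f y. cplx b * frac_dx \<alpha> f y) ^^ k) (ift g) = ift (\<lambda>\<xi>. (cplx b * \<i> * psi \<alpha> \<xi>) ^ k * g \<xi>)"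
proof (induction k)
 case 0
 show ?case using assms by simp
next
 case (Suc k)
 let ?h = "\<lambda>\<xi>. (cplx b * \<i> * psi \<alpha> \<xi>) ^ k * g \<xi>"
 have h: "good ?h" using Suc by blast
 have eq: "(\<lambda>\<xi>. (cplx b * \<i> * psi \<alpha> \<xi>) ^ Suc k * g \<xi>) = (\<lambda>\<xi>. cplx b * \<i> * psi \<alpha> \<xi> * ?h \<xi>)"
  by (simp add: fun_eq_iff)
 have "((\<lambda>f y. cplx b * frac_dx \<alpha> f y) ^^ Suc k) (ift g) = (\<lambda>y. cplx b * frac_dx \<alpha> (ift ?h) y)"
  using Suc by simp
 also have "\<dots> = ift (\<lambda>\<xi>. cplx b * \<i> * psi \<alpha> \<xi> * ?h \<xi>)"
 proof
  fix y
  show "cplx b * frac_dx \<alpha> (ift ?h) y = ift (\<lambda>\<xi>. cplx b * \<i> * psi \<alpha> \<xi> * ?h \<xi>) y"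
   unfolding frac_dx_ift[OF h assms(2)] ift_def times_divide_eq_right integral_mult_right_zero[symmetric]
   by (intro arg_cong2[where f="(/)"] bochner_integral_cong refl) (simp add: mult_ac)
 qed
 finally show ?case using good_psi[OF h assms(2), of b] by (simp only: eq)
qed

section \<open>Continuous representatives of Sobolev functions\<close>

lemma real_derivative_zero_of_square_bound:
 assumes "\<And>x. \<bar>F x\<bar> <= C * (x - x0)\<^sup>2"
 shows "(F has_real_derivative 0) (at x0)"
proof -
 have F0: "F x0 = 0" using assms[of x0] by simp
 have "((\<lambda>h. C * \<bar>h\<bar>) \<longlongrightarrow> C * \<bar>0\<bar>) (at 0)" by (intro tendsto_intros)
 then have "((\<lambda>h. C * \<bar>h\<bar>) \<longlongrightarrow> 0) (at 0)" by simp
 then have "((\<lambda>h. (F (x0 + h) - F x0) / h) \<longlongrightarrow> 0) (at 0)"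
 proof (rule Lim_null_comparison[rotated])
  have "norm ((F (x0 + h) - F x0) / h) <= C * \<bar>h\<bar>" if "h \<noteq> 0" for h
   using assms[of "x0 + h"] that by (simp add: F0 divide_le_eq power2_eq_square mult.assoc)
  then show "\<forall>\<^sub>F h in at 0. norm ((F (x0 + h) - F x0) / h) <= C * \<bar>h\<bar>"
   by (simp add: eventually_at_filter)
 qed
 then show ?thesis by (simp add: DERIV_def)
qed

text \<open>With \<open>w\<close> the scaled parabola vanishing at a and b, the functions p w^(-k)
  exp(-1/w) are closed under differentiation, which gives smoothness. For p = 1 and k = 0 they tend
  to the indicator of the open interval as the parameter n grows.\<close>

definition bump :: "real => real => real => real poly => nat => real => real" where
 "bump a b n p k x = (let w = n * (x - a) * (b - x) in
   if a < x \<and> x < b then poly p x * inverse w ^ k * exp (- inverse w) else 0)"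

text \<open>Inside the interval this is the product rule; at the endpoints and outside, the function
  is bounded by a multiple of the squared distance to the point, so its derivative there is
  0.\<close>

lemma bump_has_derivative:
 assumes ab: "a < b" and n: "n > 0"
 shows "\<exists>p'. \<forall>x. (bump a b n p k has_real_derivative bump a b n p' (k + 2) x) (at x)"
proof -
 define W where "W = smult n ([:-a, 1:] * [:b, -1:])"
 define w where "w = (\<lambda>x. n * (x - a) * (b - x))"
 have W: "poly W x = w x" for x by (simp add: W_def w_def algebra_simps)
 have wd: "(w has_real_derivative poly (pderiv W) x) (at x)" for x
  using poly_DERIV[of W x] unfolding W[abs_def] by simp
 have wpos: "w x > 0" if "a < x" "x < b" for x using that n by (simp add: w_def)
 define p' where "p' = pderiv p * W\<^sup>2 - smult (real k) (p * pderiv W * W) + p * pderiv W"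
 have "(bump a b n p k has_real_derivative bump a b n p' (k + 2) x) (at x)" for x
 proof (cases "a < x \<and> x < b")
  case True
  then have w0: "w x > 0" by (simp add: wpos)
  have "((\<lambda>x. poly p x * inverse (w x) ^ k * exp (- inverse (w x))) has_real_derivative
    poly p' x * inverse (w x) ^ (k + 2) * exp (- inverse (w x))) (at x)"
  proof -
   have i: "((\<lambda>x. inverse (w x)) has_real_derivative - (inverse (w x) * poly (pderiv W) x * inverse (w x))) (at x)"
    by (rule DERIV_inverse'[OF wd]) (use w0 in simp)
   have e: "((\<lambda>x. exp (- inverse (w x))) has_real_derivative exp (- inverse (w x)) * (inverse (w x) * poly (pderiv W) x * inverse (w x))) (at x)"
    using DERIV_chain2[OF DERIV_exp DERIV_minus[OF i]] by simp
   have pw: "((\<lambda>x. inverse (w x) ^ k) has_real_derivative real k * inverse (w x) ^ (k - 1) * - (inverse (w x) * poly (pderiv W) x * inverse (w x))) (at x)"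
    using DERIV_power[OF i, of k] by (simp add: mult_ac)
   have kk: "real k * inverse (w x) ^ (k - 1) * inverse (w x) = real k * inverse (w x) ^ k"
    by (cases k) auto
   have eq: "(poly p x * (real k * inverse (w x) ^ (k - 1) * - (inverse (w x) * poly (pderiv W) x * inverse (w x))) + poly (pderiv p) x * inverse (w x) ^ k) * exp (- inverse (w x))
     + exp (- inverse (w x)) * (inverse (w x) * poly (pderiv W) x * inverse (w x)) * (poly p x * inverse (w x) ^ k) = poly p' x * inverse (w x) ^ (k + 2) * exp (- inverse (w x))"
   proof -
    have "poly p x * (real k * inverse (w x) ^ (k - 1) * - (inverse (w x) * poly (pderiv W) x * inverse (w x))) = - poly p x * poly (pderiv W) x * inverse (w x) * (real k * inverse (w x) ^ (k - 1) * inverse (w x))"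
     by simp
    also have "\<dots> = - poly p x * poly (pderiv W) x * inverse (w x) * (real k * inverse (w x) ^ k)" by (simp only: kk)
    finally have 1: "poly p x * (real k * inverse (w x) ^ (k - 1) * - (inverse (w x) * poly (pderiv W) x * inverse (w x))) = - poly p x * poly (pderiv W) x * inverse (w x) * (real k * inverse (w x) ^ k)" .
    show ?thesis unfolding 1 using w0 by (simp add: p'_def W power_add power2_eq_square field_simps)
   qed
   show ?thesis
    by (rule DERIV_cong[OF DERIV_mult[OF DERIV_mult[OF poly_DERIV pw] e]]) (use eq in \<open>simp add: algebra_simps\<close>)
  qed
  then have "(bump a b n p k has_real_derivative poly p' x * inverse (w x) ^ (k + 2) * exp (- inverse (w x))) (at x)"
   by (rule has_field_derivative_transform_within_open[OF _ open_greaterThanLessThan[of a b]]) (use True in \<open>auto simp: bump_def w_def Let_def\<close>)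
  then show ?thesis using True by (simp add: bump_def w_def Let_def)
 next
  case False
  obtain P where P: "\<And>y. y \<in> {a..b} ==> \<bar>poly p y\<bar> <= P"
  proof -
   have "compact ((\<lambda>y. poly p y) ` {a..b})" by (intro compact_continuous_image continuous_intros) auto
   then have "bounded ((\<lambda>y. poly p y) ` {a..b})" by (rule compact_imp_bounded)
   then obtain P where "\<forall>y\<in>{a..b}. \<bar>poly p y\<bar> <= P" unfolding bounded_iff by auto
   then show ?thesis using that by blast
  qed
  have P0: "P >= 0" using P[of a] ab by auto
  define C where "C = P * fact (k + 2) * (n * (b - a))\<^sup>2"
  have C0: "C >= 0" using P0 by (simp add: C_def)
  have "\<bar>bump a b n p k y\<bar> <= C * (y - x)\<^sup>2" for y
  proof (cases "a < y \<and> y < b")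
   case True
   then have w0: "w y > 0" by (simp add: wpos)
   \<comment> \<open>A single term of the exponential series suffices; its index is chosen so that
     two powers of \<open>w\<close> are left over.\<close>
   have "(\<Sum>i\<in>{k + 2}. inverse (w y) ^ i /\<^sub>R fact i) <= exp (inverse (w y))"
    unfolding exp_def by (rule sum_le_suminf[OF summable_exp_generic]) (use w0 in auto)
   then have "inverse (w y) ^ (k + 2) / fact (k + 2) <= exp (inverse (w y))"
    by (simp add: divide_inverse mult.commute del: fact_Suc power_Suc add_2_eq_Suc')
   then have "inverse (w y) ^ (k + 2) <= exp (inverse (w y)) * fact (k + 2)"
    by (simp add: pos_divide_le_eq del: fact_Suc power_Suc add_2_eq_Suc')
   then have "inverse (w y) ^ (k + 2) * exp (- inverse (w y)) <= exp (inverse (w y)) * fact (k + 2) * exp (- inverse (w y))"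
    by (intro mult_right_mono) auto
   also have "\<dots> = fact (k + 2)" by (simp add: exp_minus del: fact_Suc add_2_eq_Suc')
   finally have "inverse (w y) ^ (k + 2) * exp (- inverse (w y)) <= fact (k + 2)" .
   then have "w y ^ 2 * (inverse (w y) ^ (k + 2) * exp (- inverse (w y))) <= w y ^ 2 * fact (k + 2)"
    by (intro mult_left_mono) auto
   moreover have "w y ^ 2 * (inverse (w y) ^ (k + 2) * exp (- inverse (w y))) = inverse (w y) ^ k * exp (- inverse (w y))"
    using w0 by (simp add: power_add power2_eq_square field_simps)
   ultimately have 1: "inverse (w y) ^ k * exp (- inverse (w y)) <= fact (k + 2) * w y ^ 2" by (metis mult.commute)
   \<comment> \<open>The point x lies outside the interval, so one of the two factors y - a and b -
     y is at most |y - x|.\<close>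
   have "w y <= n * (b - a) * \<bar>y - x\<bar>"
   proof (cases "x <= a")
    case True
    have "(y - a) * (b - y) <= \<bar>y - x\<bar> * (b - a)" using True \<open>a < y \<and> y < b\<close> by (intro mult_mono) auto
    then show ?thesis using n by (simp add: w_def mult.assoc mult.commute[of "b - a"])
   next
    case x: False
    then have "x >= b" using False by auto
    then have "(y - a) * (b - y) <= (b - a) * \<bar>y - x\<bar>" using \<open>a < y \<and> y < b\<close> by (intro mult_mono) auto
    then show ?thesis using n by (simp add: w_def mult.assoc)
   qed
   then have "w y ^ 2 <= (n * (b - a) * \<bar>y - x\<bar>)\<^sup>2" using w0 by (intro power_mono) auto
   also have "\<dots> = (n * (b - a))\<^sup>2 * (y - x)\<^sup>2" by (simp add: power_mult_distrib)
   finally have 2: "w y ^ 2 <= (n * (b - a))\<^sup>2 * (y - x)\<^sup>2" .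
   have "bump a b n p k y = poly p y * (inverse (w y) ^ k * exp (- inverse (w y)))"
    using True by (simp add: bump_def w_def Let_def)
   then have "\<bar>bump a b n p k y\<bar> = \<bar>poly p y\<bar> * (inverse (w y) ^ k * exp (- inverse (w y)))"
    using w0 by (simp add: abs_mult)
   also have "\<dots> <= P * (fact (k + 2) * w y ^ 2)"
    using True w0 P[of y] by (intro mult_mono[OF _ 1]) auto
   also have "\<dots> <= P * (fact (k + 2) * ((n * (b - a))\<^sup>2 * (y - x)\<^sup>2))"
    using 2 P0 by (intro mult_left_mono) auto
   finally show ?thesis by (simp add: C_def mult_ac)
  qed (use C0 in \<open>auto simp: bump_def\<close>)
  then have "(bump a b n p k has_real_derivative 0) (at x)" by (rule real_derivative_zero_of_square_bound)
  moreover have "bump a b n p' (k + 2) x = 0" unfolding bump_def Let_def using False by auto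
  ultimately show ?thesis by simp
 qed
 then show ?thesis by blast
qed

lemma bump_test_function:
 assumes "a < b" "n > 0"
 shows "test_function (bump a b n p k)"
proof -
 have "\<exists>p' k'. (deriv ^^ m) (bump a b n p k) = bump a b n p' k'" for m
 proof (induction m)
  case (Suc m)
  then obtain p' k' where eq: "(deriv ^^ m) (bump a b n p k) = bump a b n p' k'" by blast
  obtain q where "\<And>x. (bump a b n p' k' has_real_derivative bump a b n q (k' + 2) x) (at x)"
   using bump_has_derivative[OF assms] by blast
  then have "deriv (bump a b n p' k') = bump a b n q (k' + 2)" by (auto intro: DERIV_imp_deriv)
  then show ?case using eq by auto
 qed auto
 moreover have "bump a b n p' k' differentiable_on UNIV" for p' k'
  using bump_has_derivative[OF assms, of p' k'] unfolding differentiable_on_def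
  by (meson differentiable_at_withinI real_differentiable_def UNIV_I real_differentiableE)
 ultimately have "(deriv ^^ m) (bump a b n p k) differentiable_on UNIV" for m by metis
 moreover have "bounded {x. bump a b n p k x \<noteq> 0}"
  by (rule bounded_subset[of "{a..b}"]) (auto simp: bump_def Let_def split: if_splits)
 ultimately show ?thesis by (auto simp: test_function_def)
qed

section \<open>Calculus of test functions\<close>

lemma test_function_D:
 assumes "test_function \<phi>"
 shows "(\<phi> has_real_derivative deriv \<phi> x) (at x)" "continuous_on UNIV \<phi>" "test_function (deriv \<phi>)"
  "\<exists>R>0. \<forall>x. \<bar>x\<bar> > R --> \<phi> x = 0"
proof -
 have d: "\<And>n x. (deriv ^^ n) \<phi> differentiable (at x)"
  using assms by (auto simp: test_function_def differentiable_on_eq_differentiable_at)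
 show d0: "(\<phi> has_real_derivative deriv \<phi> x) (at x)" for x
  using d[of 0 x] by (simp add: DERIV_deriv_iff_real_differentiable)
 then show "continuous_on UNIV \<phi>" by (auto intro!: continuous_at_imp_continuous_on DERIV_isCont)
 obtain B where B: "\<And>x. \<phi> x \<noteq> 0 ==> \<bar>x\<bar> <= B" using assms by (auto simp: test_function_def bounded_iff)
 show ex: "\<exists>R>0. \<forall>x. \<bar>x\<bar> > R --> \<phi> x = 0"
  using B by (intro exI[of _ "max B 1"]) force
 then obtain R where R: "R > 0" "\<And>x. \<bar>x\<bar> > R ==> \<phi> x = 0" by blast
 have "deriv \<phi> x = 0" if "\<bar>x\<bar> > R" for x
 proof -
  have "open {x. \<bar>x\<bar> > R}" by (intro open_Collect_less continuous_intros)
  have "((\<lambda>_. 0) has_real_derivative 0) (at x)" by simp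
  then have "(\<phi> has_real_derivative 0) (at x)"
   by (rule has_field_derivative_transform_within_open[OF _ \<open>open {x. \<bar>x\<bar> > R}\<close>]) (use that R in auto)
  then show ?thesis by (rule DERIV_imp_deriv)
 qed
 then have "bounded {x. deriv \<phi> x \<noteq> 0}" by (intro boundedI[of _ R]) force
 moreover have "(deriv ^^ n) (deriv \<phi>) differentiable_on UNIV" for n
  using assms unfolding test_function_def by (metis funpow_Suc_right o_apply)
 ultimately show "test_function (deriv \<phi>)" by (simp add: test_function_def)
qed

lemma test_function_integrable:
 assumes "test_function \<phi>"
 shows "integrable lborel \<phi>" "integrable lborel (\<lambda>x. (\<phi> x)\<^sup>2)" "\<phi> \<in> borel_measurable borel"
proof -
 obtain R where R: "R > 0" "\<And>x. \<bar>x\<bar> > R ==> \<phi> x = 0" using test_function_D(4)[OF assms] by blast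
 note c = test_function_D(2)[OF assms]
 show "\<phi> \<in> borel_measurable borel" by (rule borel_measurable_continuous_onI[OF c])
 have i: "integrable lborel f" if c: "continuous_on UNIV f" and z: "\<And>x. \<bar>x\<bar> > R ==> f x = 0" for f :: "real => real"
 proof -
  have "integrable lborel (\<lambda>x. indicator {-R..R} x *\<^sub>R f x)"
   using borel_integrable_atLeastAtMost'[of "-R" R f] continuous_on_subset[OF c] by (simp add: set_integrable_def)
  also have "(\<lambda>x. indicator {-R..R} x *\<^sub>R f x) = f" using z by (force simp: fun_eq_iff indicator_def)
  finally show ?thesis .
 qed
 show "integrable lborel \<phi>" "integrable lborel (\<lambda>x. (\<phi> x)\<^sup>2)"
  using R c by (auto intro!: i continuous_intros)
qed

lemma test_function_diff:
 assumes "test_function \<phi>" "test_function \<eta>"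
 shows "test_function (\<lambda>x. \<phi> x - c * \<eta> x)"
proof -
 have d: "(deriv ^^ n) \<phi> differentiable_on UNIV" "(deriv ^^ n) \<eta> differentiable_on UNIV" for n
  using assms by (auto simp: test_function_def)
 have eq: "(deriv ^^ n) (\<lambda>x. \<phi> x - c * \<eta> x) = (\<lambda>x. (deriv ^^ n) \<phi> x - c * (deriv ^^ n) \<eta> x)" for n
 proof (induction n)
  case (Suc n)
  have "((deriv ^^ n) \<phi> has_real_derivative deriv ((deriv ^^ n) \<phi>) x) (at x)" "((deriv ^^ n) \<eta> has_real_derivative deriv ((deriv ^^ n) \<eta>) x) (at x)" for x
   using d[of n] unfolding differentiable_on_eq_differentiable_at[OF open_UNIV] DERIV_deriv_iff_real_differentiable by auto
  then have "deriv (\<lambda>x. (deriv ^^ n) \<phi> x - c * (deriv ^^ n) \<eta> x) x = deriv ((deriv ^^ n) \<phi>) x - c * deriv ((deriv ^^ n) \<eta>) x" for x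
   by (intro DERIV_imp_deriv DERIV_diff DERIV_cmult) auto
  then show ?case using Suc by auto
 qed simp
 have "(deriv ^^ n) (\<lambda>x. \<phi> x - c * \<eta> x) differentiable_on UNIV" for n
  unfolding eq using d[of n] by (intro derivative_intros) auto
 moreover have "bounded {x. \<phi> x - c * \<eta> x \<noteq> 0}"
  by (rule bounded_subset[of "{x. \<phi> x \<noteq> 0} \<union> {x. \<eta> x \<noteq> 0}"]) (use assms in \<open>auto simp: test_function_def\<close>)
 ultimately show ?thesis by (simp add: test_function_def)
qed

text \<open>The vanishing mean makes the integral from the left zero again to the right of the
  support, so the primitive has compact support.\<close>

lemma test_function_antiderivative:
 assumes t: "test_function \<phi>" and z: "(LINT x|lborel. \<phi> x) = 0"
 defines "\<Psi> \<equiv> \<lambda>u. (LINT x|lborel. indicator {..u} x * \<phi> x)"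
 shows "test_function \<Psi>" "deriv \<Psi> = \<phi>"
proof -
 note i = test_function_integrable(1)[OF t]
 obtain R where R: "R > 0" "\<And>x. \<bar>x\<bar> > R ==> \<phi> x = 0" using test_function_D(4)[OF t] by blast
 have d: "(\<Psi> has_real_derivative \<phi> u) (at u)" for u
 proof -
  have eq: "\<Psi> v = \<Psi> (u - 1) + (LBINT x=u-1..v. \<phi> x)" if "v > u - 1" for v
  proof -
   have "(LBINT x=u-1..v. \<phi> x) = (LINT x|lborel. indicator {u-1<..v} x * \<phi> x)"
    using that by (simp add: interval_integral_Ioc set_lebesgue_integral_def)
   moreover have "(LINT x|lborel. indicator {..u-1} x * \<phi> x) + (LINT x|lborel. indicator {u-1<..v} x * \<phi> x) =
     (LINT x|lborel. indicator {..u-1} x * \<phi> x + indicator {u-1<..v} x * \<phi> x)"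
    using i by (intro bochner_integral_add[symmetric]) (auto intro: integrable_real_mult_indicator simp: mult.commute)
   moreover have "\<dots> = \<Psi> v" unfolding \<Psi>_def using that
    by (intro bochner_integral_cong) (auto simp: indicator_def)
   ultimately show ?thesis unfolding \<Psi>_def by simp
  qed
  have "((\<lambda>v. LBINT x=ereal (u-1)..ereal v. \<phi> x) has_vector_derivative \<phi> u) (at u within {u-1..u+1})"
   by (rule interval_integral_FTC2) (auto intro: continuous_on_subset[OF test_function_D(2)[OF t]])
  then have "((\<lambda>v. LBINT x=ereal (u-1)..ereal v. \<phi> x) has_real_derivative \<phi> u) (at u)"
   by (simp add: has_real_derivative_iff_has_vector_derivative at_within_Icc_at)
  then have "((\<lambda>v. \<Psi> (u - 1) + (LBINT x=ereal (u-1)..ereal v. \<phi> x)) has_real_derivative \<phi> u) (at u)"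
   by (auto intro!: derivative_eq_intros)
  then show ?thesis
   by (rule has_field_derivative_transform_within_open[OF _ open_greaterThan[of "u - 1"]]) (use eq in auto)
 qed
 then show dd: "deriv \<Psi> = \<phi>" by (auto intro: DERIV_imp_deriv)
 have "\<Psi> u = 0" if "\<bar>u\<bar> > R" for u
 proof (cases "u > 0")
  case True
  have "\<Psi> u = (LINT x|lborel. \<phi> x)" unfolding \<Psi>_def
   using R True that by (intro bochner_integral_cong) (auto simp: indicator_def)
  then show ?thesis using z by simp
 next
  case False
  have "indicator {..u} x * \<phi> x = 0" for x
   using False that R(2)[of x] by (auto simp: indicator_def)
  then have "(\<lambda>x. indicator {..u} x * \<phi> x) = (\<lambda>x. 0)" by blast
  then show ?thesis unfolding \<Psi>_def by simp
 qed
 then have "bounded {x. \<Psi> x \<noteq> 0}" by (intro boundedI[of _ R]) force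
 moreover have "(deriv ^^ n) \<Psi> differentiable_on UNIV" for n
 proof (cases n)
  case 0
  then show ?thesis using d unfolding differentiable_on_def
   by (auto intro!: differentiable_at_withinI simp: real_differentiable_def)
 next
  case (Suc m)
  then have "(deriv ^^ n) \<Psi> = (deriv ^^ m) \<phi>" by (simp add: funpow_Suc_right dd del: funpow.simps)
  then show ?thesis using t by (simp add: test_function_def)
 qed
 ultimately show "test_function \<Psi>" by (simp add: test_function_def)
qed

section \<open>Weak derivatives and the one-dimensional Sobolev embedding\<close>

lemma square_integrable_rep:
 assumes "square_integrable f"
 obtains f0 where "f0 \<in> borel_measurable borel" "AE x in lborel. f x = f0 x" "integrable lborel (\<lambda>x. (f0 x)\<^sup>2)"
  "(LINT x|lebesgue. (f x)\<^sup>2) = (LINT x|lborel. (f0 x)\<^sup>2)"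
proof -
 have m: "f \<in> borel_measurable lebesgue" and i: "integrable lebesgue (\<lambda>x. (f x)\<^sup>2)"
  using assms by (auto simp: square_integrable_def)
 obtain f0 where f0: "f0 \<in> borel_measurable lborel" "AE x in lborel. f x = f0 x"
  using completion_ex_borel_measurable_real[OF m] by auto
 have [measurable]: "f0 \<in> borel_measurable borel" using f0 by simp
 have ae: "AE x in lebesgue. (f x)\<^sup>2 = (f0 x)\<^sup>2" using f0(2) by (intro AE_completion) auto
 have m0: "(\<lambda>x. (f0 x)\<^sup>2) \<in> borel_measurable lebesgue" by (rule measurable_completion) simp
 have eq: "(LINT x|lebesgue. (f x)\<^sup>2) = (LINT x|lebesgue. (f0 x)\<^sup>2)"
  by (rule integral_cong_AE[OF _ m0 ae]) (use i in auto)
 have "integrable lebesgue (\<lambda>x. (f0 x)\<^sup>2)" using integrable_cong_AE[OF _ m0 ae] i by auto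
 then have "integrable lborel (\<lambda>x. (f0 x)\<^sup>2)" by (subst (asm) integrable_completion) auto
 moreover have "(LINT x|lebesgue. (f0 x)\<^sup>2) = (LINT x|lborel. (f0 x)\<^sup>2)" by (rule integral_completion) simp
 ultimately show ?thesis using that[of f0] f0 eq by simp
qed

lemma integrable_L2_mult:
 assumes [measurable]: "f \<in> borel_measurable M" "g \<in> borel_measurable M"
  and "integrable M (\<lambda>x. (f x)\<^sup>2)" "integrable M (\<lambda>x. (g x)\<^sup>2)"
 shows "integrable M (\<lambda>x. f x * g x :: real)"
proof (rule bochner_integrable_bound)
 show "integrable M (\<lambda>x. (f x)\<^sup>2 + (g x)\<^sup>2)" using assms by auto
 show "AE x in M. norm (f x * g x) <= norm ((f x)\<^sup>2 + (g x)\<^sup>2)"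
 proof (intro AE_I2)
  fix x
  have "2 * (\<bar>f x\<bar> * \<bar>g x\<bar>) <= (f x)\<^sup>2 + (g x)\<^sup>2" using sum_squares_bound[of "\<bar>f x\<bar>" "\<bar>g x\<bar>"] by simp
  moreover have "0 <= \<bar>f x\<bar> * \<bar>g x\<bar>" by simp
  ultimately have "\<bar>f x\<bar> * \<bar>g x\<bar> <= (f x)\<^sup>2 + (g x)\<^sup>2" by linarith
  then show "norm (f x * g x) <= norm ((f x)\<^sup>2 + (g x)\<^sup>2)" by (simp add: abs_mult)
 qed
qed measurable

lemma integral_lebesgue_AE_eq:
 assumes "f \<in> borel_measurable lebesgue" "\<phi> \<in> borel_measurable borel" "f0 \<in> borel_measurable borel" "AE x in lborel. f x = f0 x"
 shows "(LINT x|lebesgue. f x * \<phi> x :: real) = (LINT x|lborel. f0 x * \<phi> x)"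
proof -
 note [measurable] = assms(2,3)
 have "(LINT x|lebesgue. f x * \<phi> x) = (LINT x|lebesgue. f0 x * \<phi> x)"
 proof (rule integral_cong_AE)
  show "AE x in lebesgue. f x * \<phi> x = f0 x * \<phi> x" using assms(4) by (intro AE_completion) auto
  show "(\<lambda>x. f x * \<phi> x) \<in> borel_measurable lebesgue" using assms(1,2) by (intro borel_measurable_times) (auto intro: measurable_completion)
  show "(\<lambda>x. f0 x * \<phi> x) \<in> borel_measurable lebesgue" by (rule measurable_completion) simp
 qed
 also have "\<dots> = (LINT x|lborel. f0 x * \<phi> x)" by (rule integral_completion) simp
 finally show ?thesis .
qed

lemma integral_abs_interval_le:
 assumes [measurable]: "g \<in> borel_measurable borel" and i: "integrable lborel (\<lambda>x. (g x)\<^sup>2)" and ab: "a <= b"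
 shows "integrable lborel (\<lambda>x. g x * indicator {a<..b} x)"
  "(LINT x|lborel. \<bar>g x\<bar> * indicator {a<..b} x) <= sqrt ((b - a) * (LINT x|lborel. (g x)\<^sup>2))"
proof -
 show i1: "integrable lborel (\<lambda>x. g x * indicator {a<..b} x)"
 proof (rule integrable_L2_mult[OF _ _ i])
  have "(\<lambda>x. (indicator {a<..b} x :: real)\<^sup>2) = indicator {a<..b}" by (auto simp: indicator_def fun_eq_iff)
  then show "integrable lborel (\<lambda>x. (indicator {a<..b} x :: real)\<^sup>2)" using ab by simp
 qed auto
 have i2: "integrable lborel (\<lambda>x. \<bar>g x\<bar> * indicator {a<..b} x)"
  using integrable_abs[OF i1] by (simp add: abs_mult)
 define I where "I = (LINT x|lborel. \<bar>g x\<bar> * indicator {a<..b} x)"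
 define G where "G = (LINT x|lborel. (g x)\<^sup>2)"
 have G0: "G >= 0" by (simp add: G_def)
 have I: "ennreal I = (\<integral>\<^sup>+x. ennreal \<bar>g x\<bar> * indicator {a<..b} x \<partial>lborel)"
  unfolding I_def by (subst nn_integral_eq_integral[OF i2, symmetric]) (auto intro!: nn_integral_cong simp: indicator_def)
 have "(ennreal I)\<^sup>2 <= (\<integral>\<^sup>+x. (ennreal \<bar>g x\<bar>)\<^sup>2 \<partial>lborel) * (\<integral>\<^sup>+x. (indicator {a<..b} x)\<^sup>2 \<partial>lborel)"
  unfolding I by (rule Cauchy_Schwarz_nn_integral) measurable
 also have "(\<integral>\<^sup>+x. (ennreal \<bar>g x\<bar>)\<^sup>2 \<partial>lborel) = ennreal G"
  unfolding G_def by (subst nn_integral_eq_integral[OF i, symmetric]) (auto simp: ennreal_power)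
 also have "(\<integral>\<^sup>+x. (indicator {a<..b} x)\<^sup>2 \<partial>lborel) = (\<integral>\<^sup>+x. indicator {a<..b} x \<partial>lborel)"
  by (intro nn_integral_cong) (auto simp: indicator_def)
 also have "\<dots> = ennreal (b - a)" using ab by simp
 also have "ennreal G * ennreal (b - a) = (ennreal (sqrt ((b - a) * G)))\<^sup>2"
  using ab G0 by (subst ennreal_power) (auto simp: mult.commute simp flip: ennreal_mult)
 finally have "ennreal I <= ennreal (sqrt ((b - a) * G))"
  by (rule ennreal_power2_le_imp_le)
 then show "(LINT x|lborel. \<bar>g x\<bar> * indicator {a<..b} x) <= sqrt ((b - a) * (LINT x|lborel. (g x)\<^sup>2))"
  unfolding I_def G_def by (subst (asm) ennreal_le_iff) (use ab in auto)
qed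

text \<open>On a bounded window the positive and negative parts of \<open>D\<close> are densities of
  finite measures which agree on all half-lines. The measures are then equal, and so are the
  densities almost everywhere.\<close>

lemma AE_zero_of_interval_integrals:
 fixes D :: "real => real"
 assumes [measurable]: "D \<in> borel_measurable borel"
  and i: "\<And>a b. a < b ==> integrable lborel (\<lambda>x. D x * indicator {a<..<b} x)"
  and z: "\<And>a b. a < b ==> (LINT x|lborel. D x * indicator {a<..<b} x) = 0"
 shows "AE x in lborel. D x = 0"
proof -
 have "AE x in lborel. x \<in> {-real (Suc N)<..<real (Suc N)} --> D x = 0" for N
 proof -
  let ?J = "{-real (Suc N)<..<real (Suc N)}"
  define p where "p = (\<lambda>x. ennreal (D x) * indicator ?J x)"
  define q where "q = (\<lambda>x. ennreal (- D x) * indicator ?J x)"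
  have [measurable]: "p \<in> borel_measurable borel" "q \<in> borel_measurable borel" by (auto simp: p_def q_def)
  have pq: "p x = ennreal (D x * indicator ?J x)" "q x = ennreal (- (D x * indicator ?J x))" for x
   by (auto simp: p_def q_def indicator_def)
  have fin: "(\<integral>\<^sup>+x. p x \<partial>lborel) < \<infinity>" "(\<integral>\<^sup>+x. q x \<partial>lborel) < \<infinity>"
   using i[of "- real (Suc N)" "real (Suc N)"] unfolding pq real_integrable_def by (auto simp: less_top)
  have eq: "emeasure (density lborel p) {x<..} = emeasure (density lborel q) {x<..}" for x
  proof -
   define a where "a = max x (- real (Suc N))"
   have set: "D y * indicator ?J y * indicator {x<..} y = D y * indicator {a<..<real (Suc N)} y" for y
    by (auto simp: indicator_def a_def)
   have zz: "(LINT y|lborel. D y * indicator {a<..<real (Suc N)} y) = 0" "integrable lborel (\<lambda>y. D y * indicator {a<..<real (Suc N)} y)"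
   proof (atomize(full), cases "a < real (Suc N)")
    case False
    then have "{a<..<real (Suc N)} = {}" by auto
    then show "(LINT y|lborel. D y * indicator {a<..<real (Suc N)} y) = 0 \<and> integrable lborel (\<lambda>y. D y * indicator {a<..<real (Suc N)} y)" by simp
   qed (use z i in auto)
   have "(\<integral>\<^sup>+y. ennreal (D y * indicator {a<..<real (Suc N)} y) \<partial>lborel) = (\<integral>\<^sup>+y. ennreal (- (D y * indicator {a<..<real (Suc N)} y)) \<partial>lborel)"
    using real_lebesgue_integral_def[OF zz(2)] zz unfolding real_integrable_def
    by (metis (no_types, lifting) ennreal_enn2real eq_iff_diff_eq_0 infinity_ennreal_def less_top)
   moreover have "emeasure (density lborel p) {x<..} = (\<integral>\<^sup>+y. ennreal (D y * indicator {a<..<real (Suc N)} y) \<partial>lborel)"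
    unfolding set[symmetric]
    by (subst emeasure_density) (auto intro!: nn_integral_cong simp: pq indicator_def)
   moreover have "emeasure (density lborel q) {x<..} = (\<integral>\<^sup>+y. ennreal (- (D y * indicator {a<..<real (Suc N)} y)) \<partial>lborel)"
    unfolding set[symmetric]
    by (subst emeasure_density) (auto intro!: nn_integral_cong simp: pq indicator_def)
   ultimately show ?thesis by simp
  qed
  have "density lborel p = density lborel q"
  proof (rule measure_eqI_lessThan)
   fix x
   have "emeasure (density lborel p) {x<..} <= emeasure (density lborel p) UNIV" by (intro emeasure_mono) auto
   also have "\<dots> < \<infinity>" using fin(1) by (simp add: emeasure_density)
   finally show "emeasure (density lborel p) {x<..} < \<infinity>" .
  qed (use eq in auto)
  then have "AE x in lborel. p x = q x" by (intro sigma_finite_measure.density_unique[OF lborel.sigma_finite_measure_axioms]) auto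
  then show ?thesis
  proof eventually_elim
   case (elim x)
   then show ?case by (cases "D x >= 0") (auto simp: p_def q_def ennreal_neg indicator_def)
  qed
 qed
 then have "AE x in lborel. \<forall>N. x \<in> {-real (Suc N)<..<real (Suc N)} --> D x = 0" unfolding AE_all_countable by blast
 then show ?thesis
 proof eventually_elim
  case (elim x)
  obtain N where "\<bar>x\<bar> < real N" using reals_Archimedean2 by blast
  then have "- real (Suc N) < x" "x < real (Suc N)" by linarith+
  then show ?case using elim[rule_format, of N] by simp
 qed
qed

context
 fixes f g :: "real => real"
 assumes fm [measurable]: "f \<in> borel_measurable borel" and gm [measurable]: "g \<in> borel_measurable borel"
  and fi: "integrable lborel (\<lambda>x. (f x)\<^sup>2)" and gi: "integrable lborel (\<lambda>x. (g x)\<^sup>2)"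
  and wd: "\<And>\<phi>. test_function \<phi> ==> (LINT x|lborel. f x * deriv \<phi> x) = - (LINT x|lborel. g x * \<phi> x)"
begin

text \<open>The oriented integral of g from 0 to x; the difference of indicators encodes the sign
  for negative x.\<close>

definition primitive :: "real => real" where
 "primitive x = (LINT y|lborel. g y * (indicator {0<..x} y - indicator {x<..0} y))"

private lemma prim_diff:
 assumes "a <= b"
 shows "primitive b - primitive a = (LINT y|lborel. g y * indicator {a<..b} y)"
proof -
 have i: "integrable lborel (\<lambda>y. g y * indicator {c<..d} y)" for c d :: real
  using integral_abs_interval_le(1)[OF gm gi, of c d] by (cases "c <= d") auto
 have "primitive b - primitive a = (LINT y|lborel. g y * (indicator {0<..b} y - indicator {b<..0} y) - g y * (indicator {0<..a} y - indicator {a<..0} y))"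
  unfolding primitive_def using i by (intro bochner_integral_diff[symmetric]) (auto simp: right_diff_distrib)
 also have "\<dots> = (LINT y|lborel. g y * indicator {a<..b} y)"
  using assms by (intro bochner_integral_cong) (auto simp: indicator_def)
 finally show ?thesis .
qed

private lemma prim_diff_le:
 "\<bar>primitive b - primitive a\<bar> <= sqrt (\<bar>b - a\<bar> * (LINT x|lborel. (g x)\<^sup>2))"
proof -
 have 1: "\<bar>primitive b - primitive a\<bar> <= sqrt (\<bar>b - a\<bar> * (LINT x|lborel. (g x)\<^sup>2))" if "a <= b" for a b
 proof -
  have "\<bar>primitive b - primitive a\<bar> <= (LINT y|lborel. \<bar>g y * indicator {a<..b} y\<bar>)"
   unfolding prim_diff[OF that] by (rule integral_abs_bound)
  also have "\<dots> = (LINT y|lborel. \<bar>g y\<bar> * indicator {a<..b} y)" by (simp add: abs_mult)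
  also have "\<dots> <= sqrt ((b - a) * (LINT x|lborel. (g x)\<^sup>2))" by (rule integral_abs_interval_le(2)[OF gm gi that])
  finally show ?thesis using that by simp
 qed
 show ?thesis using 1[of a b] 1[of b a] by (cases "a <= b") (auto simp: abs_minus_commute)
qed

private lemma prim_cont: "continuous_on UNIV primitive"
proof (intro continuous_at_imp_continuous_on ballI)
 fix a :: real
 have "((\<lambda>b. sqrt (\<bar>b - a\<bar> * (LINT x|lborel. (g x)\<^sup>2))) \<longlongrightarrow> sqrt (\<bar>a - a\<bar> * (LINT x|lborel. (g x)\<^sup>2))) (at a)"
  by (intro tendsto_intros)
 then have "((\<lambda>b. sqrt (\<bar>b - a\<bar> * (LINT x|lborel. (g x)\<^sup>2))) \<longlongrightarrow> 0) (at a)" by simp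
 then have "((\<lambda>b. primitive b - primitive a) \<longlongrightarrow> 0) (at a)"
  by (rule Lim_null_comparison[rotated]) (simp add: prim_diff_le)
 then show "isCont primitive a" by (simp add: isCont_def LIM_zero_iff)
qed

text \<open>Integration by parts through Fubini. For y > 0 the inner integral runs over x >= y, and
  the vanishing mean turns it into minus the integral over x < y, so both signs of y give the same
  formula.\<close>

private lemma prim_test:
 assumes t: "test_function \<phi>" and z: "(LINT x|lborel. \<phi> x) = 0"
 shows "(LINT x|lborel. primitive x * \<phi> x) = - (LINT y|lborel. g y * (LINT x|lborel. indicator {..y} x * \<phi> x))"
proof -
 note ti = test_function_integrable[OF t]
 note [measurable] = ti(3)
 obtain R where R: "R > 0" "\<And>x. \<bar>x\<bar> > R ==> \<phi> x = 0" using test_function_D(4)[OF t] by blast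
 define k where "k = (\<lambda>x y::real. indicator {0<..x} y - indicator {x<..0} y :: real)"
 have keq: "k x y = (if 0 < y \<and> y <= x then 1 else 0) - (if x < y \<and> y <= 0 then 1 else 0)" for x y by (auto simp: k_def indicator_def)
 have [measurable]: "(\<lambda>(x, y). k x y) \<in> borel2"
  unfolding keq by measurable
 have gR: "integrable lborel (\<lambda>y. g y * indicator {-R<..R} y)"
  using integral_abs_interval_le(1)[OF gm gi, of "-R" R] R by simp
 have ii: "integrable (lborel \<Otimes>\<^sub>M lborel) (\<lambda>(x, y). \<phi> x * (g y * k x y))"
 proof (rule bochner_integrable_bound[OF integrable_product[OF lborel_pair.pair_sigma_finite_axioms ti(1) gR]])
  show "AE z in lborel \<Otimes>\<^sub>M lborel. norm (case z of (x, y) => \<phi> x * (g y * k x y)) <= norm (case z of (x, y) => \<phi> x * (g y * indicator {-R<..R} y))"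
  proof (intro AE_I2)
   fix z :: "real \<times> real"
   obtain x y where xy: "z = (x, y)" by fastforce
   show "norm (case z of (x, y) => \<phi> x * (g y * k x y)) <= norm (case z of (x, y) => \<phi> x * (g y * indicator {-R<..R} y))"
   proof (cases "\<bar>x\<bar> > R")
    case False
    then have "\<bar>k x y\<bar> <= indicator {-R<..R} y" by (auto simp: keq indicator_def)
    then show ?thesis by (simp add: xy abs_mult mult_left_mono)
   qed (simp add: xy R)
  qed
 qed measurable
 have "(LINT x|lborel. primitive x * \<phi> x) = (LINT x|lborel. LINT y|lborel. \<phi> x * (g y * k x y))"
  by (simp add: primitive_def k_def mult.commute)
 also have "\<dots> = (LINT y|lborel. LINT x|lborel. \<phi> x * (g y * k x y))"
  by (rule lborel_pair.Fubini_integral[OF ii, symmetric])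
 also have "\<dots> = (LINT y|lborel. - (g y * (LINT x|lborel. indicator {..y} x * \<phi> x)))"
 proof (rule integral_cong_AE)
  have "AE y in lborel. y \<noteq> 0" by (rule AE_lborel_singleton)
  have inner: "(LINT x|lborel. \<phi> x * k x y) = - (LINT x|lborel. indicator {..<y} x * \<phi> x)" for y
  proof (cases "y > 0")
   case True
   have "k x y = indicator {y..} x" for x using True by (auto simp: keq indicator_def)
   then have "integrable lborel (\<lambda>x. \<phi> x * k x y)" using integrable_real_mult_indicator[OF _ ti(1), of "{y..}"] by simp
   moreover have "integrable lborel (\<lambda>x. indicator {..<y} x * \<phi> x)"
    using integrable_real_mult_indicator[OF _ ti(1), of "{..<y}"] by (simp add: mult.commute)
   ultimately have "(LINT x|lborel. indicator {..<y} x * \<phi> x) + (LINT x|lborel. \<phi> x * k x y) = (LINT x|lborel. indicator {..<y} x * \<phi> x + \<phi> x * k x y)"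
    by simp
   also have "\<dots> = (LINT x|lborel. \<phi> x)" using True by (intro bochner_integral_cong) (auto simp: keq indicator_def)
   finally show ?thesis using z by simp
  next
   case False
   have "(LINT x|lborel. \<phi> x * k x y) = (LINT x|lborel. - (indicator {..<y} x * \<phi> x))"
    using False by (intro bochner_integral_cong) (auto simp: keq indicator_def)
   then show ?thesis by simp
  qed
  have "(LINT x|lborel. indicator {..<y} x * \<phi> x) = (LINT x|lborel. indicator {..y} x * \<phi> x)" for y
   using AE_lborel_singleton[of y] by (intro integral_cong_AE) (auto elim!: eventually_mono simp: indicator_def)
  then show "AE y in lborel. (LINT x|lborel. \<phi> x * (g y * k x y)) = - (g y * (LINT x|lborel. indicator {..y} x * \<phi> x))"
  proof (intro AE_I2)
   fix y
   have "(LINT x|lborel. \<phi> x * (g y * k x y)) = g y * (LINT x|lborel. \<phi> x * k x y)"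
    unfolding integral_mult_right_zero[symmetric] by (simp add: mult.left_commute)
   then show "(LINT x|lborel. \<phi> x * (g y * k x y)) = - (g y * (LINT x|lborel. indicator {..y} x * \<phi> x))"
    using inner \<open>(LINT x|lborel. indicator {..<y} x * \<phi> x) = (LINT x|lborel. indicator {..y} x * \<phi> x)\<close> by simp
  qed
  have *: "(\<lambda>(y, x). indicator {..y} x * \<phi> x) \<in> borel2"
  proof -
   have "indicator {..y} x * \<phi> x = (if x <= y then \<phi> x else 0)" for x y by (simp add: indicator_def)
   then show ?thesis by (simp only:) measurable
  qed
  then show "(\<lambda>y. - (g y * (LINT x|lborel. indicator {..y} x * \<phi> x))) \<in> borel_measurable lborel" by measurable
 qed measurable
 finally show ?thesis by simp
qed

text \<open>The du Bois-Reymond argument: f minus \<open>primitive\<close> is orthogonal to all test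
  functions of mean zero, hence equals a constant almost everywhere. The sup bound comes from
  averaging |v x| <= |v y| + G over y in a unit interval.\<close>

lemma weak_derivative_continuous_rep:
 "\<exists>v. continuous_on UNIV v \<and> (AE x in lborel. f x = v x) \<and> (\<forall>x. \<bar>v x\<bar> <= sqrt (LINT x|lborel. (f x)\<^sup>2) + sqrt (LINT x|lborel. (g x)\<^sup>2))"
proof -
 have [measurable]: "primitive \<in> borel_measurable borel" by (rule borel_measurable_continuous_onI[OF prim_cont])
 have ft: "integrable lborel (\<lambda>x. f x * \<phi> x)" "integrable lborel (\<lambda>x. primitive x * \<phi> x)" if t: "test_function \<phi>" for \<phi>
 proof -
  note ti = test_function_integrable[OF t]
  note [measurable] = ti(3)
  show "integrable lborel (\<lambda>x. f x * \<phi> x)" by (rule integrable_L2_mult[OF _ _ fi ti(2)]) auto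
  obtain R where R: "R > 0" "\<And>x. \<bar>x\<bar> > R ==> \<phi> x = 0" using test_function_D(4)[OF t] by blast
  have "compact (primitive ` {-R..R})" using continuous_on_subset[OF prim_cont] by (intro compact_continuous_image) auto
  then have "bounded (primitive ` {-R..R})" by (rule compact_imp_bounded)
  then obtain B where "\<forall>x\<in>{-R..R}. \<bar>primitive x\<bar> <= B" unfolding bounded_iff by auto
  then have B: "\<And>x. x \<in> {-R..R} ==> \<bar>primitive x\<bar> <= B" by blast
  show "integrable lborel (\<lambda>x. primitive x * \<phi> x)"
  proof (rule bochner_integrable_bound[OF integrable_mult_right[OF ti(1), of B]])
   show "AE x in lborel. norm (primitive x * \<phi> x) <= norm (B * \<phi> x)"
   proof (intro AE_I2)
    fix x
    show "norm (primitive x * \<phi> x) <= norm (B * \<phi> x)"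
    proof (cases "\<bar>x\<bar> > R")
     case False
     then have "\<bar>primitive x\<bar> <= B" by (intro B) auto
     then have "\<bar>primitive x\<bar> <= \<bar>B\<bar>" by linarith
     then show ?thesis by (simp add: abs_mult mult_right_mono)
    qed (simp add: R)
   qed
  qed measurable
 qed
 \<comment> \<open>A fixed test function with positive integral, used to split off the mean of an
   arbitrary one.\<close>
 define \<eta> where "\<eta> = bump 0 1 1 1 0"
 have \<eta>: "test_function \<eta>" unfolding \<eta>_def by (rule bump_test_function) auto
 note \<eta>i = test_function_integrable[OF \<eta>]
 have \<eta>pos: "(LINT x|lborel. \<eta> x) > 0"
 proof -
  have nn: "\<eta> x >= 0" for x by (auto simp: \<eta>_def bump_def Let_def)
  have "(LINT x|lborel. \<eta> x) \<noteq> 0"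
  proof
   assume "(LINT x|lborel. \<eta> x) = 0"
   then have "AE x in lborel. \<eta> x = 0" using integral_nonneg_eq_0_iff_AE[OF \<eta>i(1)] nn by auto
   then have "AE x in lborel. x \<notin> {0<..<1::real}" by eventually_elim (auto simp: \<eta>_def bump_def Let_def split: if_splits)
   then have "emeasure lborel {0<..<1::real} = 0" by (subst (asm) AE_iff_measurable[of "{0<..<1}"]) auto
   then show False by simp
  qed
  moreover have "(LINT x|lborel. \<eta> x) >= 0" using nn by (intro integral_nonneg_AE) auto
  ultimately show ?thesis by simp
 qed
 define K where "K = (LINT x|lborel. (f x - primitive x) * \<eta> x) / (LINT x|lborel. \<eta> x)"
 have main: "(LINT x|lborel. (f x - primitive x - K) * \<phi> x) = 0" if t: "test_function \<phi>" for \<phi>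
 proof -
  \<comment> \<open>Subtracting \<open>c * \<eta>\<close> removes the mean; the constant
    \<open>K\<close> is the value that makes the pairing with \<open>\<eta>\<close> vanish
    too.\<close>
  define c where "c = (LINT x|lborel. \<phi> x) / (LINT x|lborel. \<eta> x)"
  note ti = test_function_integrable[OF t]
  define \<phi>0 where "\<phi>0 = (\<lambda>x. \<phi> x - c * \<eta> x)"
  have t0: "test_function \<phi>0" unfolding \<phi>0_def by (rule test_function_diff[OF t \<eta>])
  have z0: "(LINT x|lborel. \<phi>0 x) = 0" using ti \<eta>i \<eta>pos by (simp add: \<phi>0_def c_def)
  note ad = test_function_antiderivative[OF t0 z0]
  have "(LINT x|lborel. f x * \<phi>0 x) = (LINT x|lborel. primitive x * \<phi>0 x)"
   using wd[OF ad(1)] prim_test[OF t0 z0] unfolding ad(2) by simp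
  then have "(LINT x|lborel. f x * \<phi> x) - c * (LINT x|lborel. f x * \<eta> x) = (LINT x|lborel. primitive x * \<phi> x) - c * (LINT x|lborel. primitive x * \<eta> x)"
   using ft[OF t] ft[OF \<eta>] by (simp add: \<phi>0_def right_diff_distrib mult.left_commute)
  moreover have "K * (LINT x|lborel. \<phi> x) = c * ((LINT x|lborel. f x * \<eta> x) - (LINT x|lborel. primitive x * \<eta> x))"
   using ft[OF \<eta>] \<eta>pos by (simp add: K_def c_def left_diff_distrib right_diff_distrib diff_divide_distrib mult.commute)
  ultimately show ?thesis using ft[OF t] ti by (simp add: left_diff_distrib algebra_simps)
 qed
 define D where "D = (\<lambda>x. f x - primitive x - K)"
 have [measurable]: "D \<in> borel_measurable borel" by (simp add: D_def)
 have Di: "integrable lborel (\<lambda>x. D x * indicator {a<..<b} x)" if ab: "a < b" for a b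
 proof -
  have 1: "integrable lborel (\<lambda>x. f x * indicator {a<..<b} x)"
  proof (rule integrable_L2_mult[OF _ _ fi])
   have "(\<lambda>x. (indicator {a<..<b} x :: real)\<^sup>2) = indicator {a<..<b}" by (auto simp: indicator_def fun_eq_iff)
   then show "integrable lborel (\<lambda>x. (indicator {a<..<b} x :: real)\<^sup>2)" using ab by simp
  qed auto
  have "set_integrable lborel {a..b} (\<lambda>x. primitive x + K)"
   by (rule borel_integrable_atLeastAtMost') (intro continuous_intros continuous_on_subset[OF prim_cont], auto)
  then have "set_integrable lborel {a<..<b} (\<lambda>x. primitive x + K)" by (rule set_integrable_subset) auto
  then have 2: "integrable lborel (\<lambda>x. (primitive x + K) * indicator {a<..<b} x)" by (simp add: set_integrable_def mult.commute)
  show ?thesis using Bochner_Integration.integrable_diff[OF 1 2] by (simp add: D_def algebra_simps)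
 qed
 have Dz: "(LINT x|lborel. D x * indicator {a<..<b} x) = 0" if ab: "a < b" for a b
 proof -
  \<comment> \<open>Bumps on the same interval with growing parameter increase to its indicator, so
    orthogonality passes to indicators.\<close>
  define \<phi> where "\<phi> = (\<lambda>n. bump a b (real (Suc n)) 1 0)"
  have "(\<lambda>n. LINT x|lborel. D x * \<phi> n x) \<longlonglongrightarrow> (LINT x|lborel. D x * indicator {a<..<b} x)"
  proof (rule integral_dominated_convergence[where w="\<lambda>x. \<bar>D x * indicator {a<..<b} x\<bar>"])
   have \<phi>m: "\<phi> n \<in> borel_measurable borel" for n
    unfolding \<phi>_def by (intro test_function_integrable(3) bump_test_function ab) auto
   then show "(\<lambda>x. D x * \<phi> n x) \<in> borel_measurable lborel" for n by simp
   show "AE x in lborel. norm (D x * \<phi> n x) <= \<bar>D x * indicator {a<..<b} x\<bar>" for n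
    by (intro AE_I2) (auto simp: \<phi>_def bump_def Let_def abs_mult indicator_def mult_left_le)
   show "AE x in lborel. (\<lambda>n. D x * \<phi> n x) \<longlonglongrightarrow> D x * indicator {a<..<b} x"
   proof (intro AE_I2 tendsto_mult tendsto_const)
    fix x
    show "(\<lambda>n. \<phi> n x) \<longlonglongrightarrow> indicator {a<..<b} x"
    proof (cases "a < x \<and> x < b")
     case True
     then have w: "(x - a) * (b - x) > 0" by simp
     have "(\<lambda>n. exp (- (1 / real (Suc n) * inverse ((x - a) * (b - x))))) \<longlonglongrightarrow> exp (- (0 * inverse ((x - a) * (b - x))))"
      by (intro tendsto_intros LIMSEQ_Suc[OF lim_1_over_n])
     moreover have "\<phi> n x = exp (- (1 / real (Suc n) * inverse ((x - a) * (b - x))))" for n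
      using True by (simp add: \<phi>_def bump_def Let_def inverse_eq_divide mult.assoc)
     ultimately show ?thesis using True by simp
    qed (auto simp: \<phi>_def bump_def)
   qed
  qed (use Di[OF ab] in auto)
  moreover have "(LINT x|lborel. D x * \<phi> n x) = 0" for n
   unfolding D_def \<phi>_def by (intro main bump_test_function ab) auto
  ultimately show ?thesis by (simp add: LIMSEQ_const_iff)
 qed
 have ae: "AE x in lborel. D x = 0" by (rule AE_zero_of_interval_integrals[OF _ Di Dz]) auto
 define v where "v = (\<lambda>x. primitive x + K)"
 have vc: "continuous_on UNIV v" unfolding v_def by (intro continuous_intros prim_cont)
 have [measurable]: "v \<in> borel_measurable borel" by (rule borel_measurable_continuous_onI[OF vc])
 have vae: "AE x in lborel. f x = v x" using ae by eventually_elim (simp add: D_def v_def)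
 have "\<bar>v x\<bar> <= sqrt (LINT x|lborel. (f x)\<^sup>2) + sqrt (LINT x|lborel. (g x)\<^sup>2)" for x
 proof -
  define G where "G = sqrt (LINT x|lborel. (g x)\<^sup>2)"
  \<comment> \<open>The unit length keeps the increment of \<open>primitive\<close> below the L^2
    norm of g.\<close>
  have le: "\<bar>v x\<bar> <= \<bar>v y\<bar> + G" if "y \<in> {x<..x + 1}" for y
  proof -
   have "\<bar>primitive y - primitive x\<bar> <= sqrt (\<bar>y - x\<bar> * (LINT x|lborel. (g x)\<^sup>2))" by (rule prim_diff_le)
   also have "\<dots> <= sqrt (1 * (LINT x|lborel. (g x)\<^sup>2))" using that by (intro real_sqrt_le_mono mult_right_mono) auto
   finally have "\<bar>v y - v x\<bar> <= G" by (simp add: v_def G_def)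
   then show ?thesis by linarith
  qed
  have fi1: "integrable lborel (\<lambda>y. f y * indicator {x<..x + 1} y)" using integral_abs_interval_le(1)[OF fm fi, of x "x+1"] by simp
  have vi: "integrable lborel (\<lambda>y. \<bar>v y\<bar> * indicator {x<..x + 1} y)"
   by (rule integrable_cong_AE_imp[OF integrable_abs[OF fi1]]) (use vae in \<open>auto elim!: eventually_mono simp: abs_mult\<close>)
  have "\<bar>v x\<bar> = (LINT y|lborel. \<bar>v x\<bar> * indicator {x<..x + 1} y)" by simp
  also have "\<dots> <= (LINT y|lborel. \<bar>v y\<bar> * indicator {x<..x + 1} y + G * indicator {x<..x + 1} y)"
  proof (rule integral_mono)
   have ci: "integrable lborel (\<lambda>y. c * indicator {x<..x + 1} y)" for c :: real by simp
   show "integrable lborel (\<lambda>y. \<bar>v x\<bar> * indicator {x<..x + 1} y)" by (rule ci)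
   show "integrable lborel (\<lambda>y. \<bar>v y\<bar> * indicator {x<..x + 1} y + G * indicator {x<..x + 1} y)"
    by (rule Bochner_Integration.integrable_add[OF vi ci])
  qed (use le in \<open>auto simp: indicator_def\<close>)
  also have "\<dots> = (LINT y|lborel. \<bar>v y\<bar> * indicator {x<..x + 1} y) + G"
   using vi by (subst bochner_integral_add) auto
  also have "(LINT y|lborel. \<bar>v y\<bar> * indicator {x<..x + 1} y) = (LINT y|lborel. \<bar>f y\<bar> * indicator {x<..x + 1} y)"
   using vae by (intro integral_cong_AE) (auto elim!: eventually_mono)
  also have "\<dots> <= sqrt ((x + 1 - x) * (LINT x|lborel. (f x)\<^sup>2))" by (rule integral_abs_interval_le(2)[OF fm fi]) simp
  finally show ?thesis by (simp add: G_def)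
 qed
 with vc vae show ?thesis by blast
qed

end

lemma H1_continuous_rep:
 assumes "H1 f"
 shows "\<exists>v. continuous_on UNIV v \<and> (AE x in lborel. f x = v x) \<and> (\<forall>x. \<bar>v x\<bar> <= 2 * H1_norm f)
  \<and> integrable lborel (\<lambda>x. (v x)\<^sup>2) \<and> (LINT x|lborel. (v x)\<^sup>2) <= (H1_norm f)\<^sup>2"
proof -
 have sf: "square_integrable f" and "\<exists>g. square_integrable g \<and> has_weak_derivative f g" using assms by (auto simp: H1_def)
 from someI_ex[OF this(2)] have sg: "square_integrable (weak_derivative f)" and w: "has_weak_derivative f (weak_derivative f)"
  by (auto simp: weak_derivative_def)
 obtain f0 where f0: "f0 \<in> borel_measurable borel" "AE x in lborel. f x = f0 x" "integrable lborel (\<lambda>x. (f0 x)\<^sup>2)" "(LINT x|lebesgue. (f x)\<^sup>2) = (LINT x|lborel. (f0 x)\<^sup>2)"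
  by (rule square_integrable_rep[OF sf])
 obtain g0 where g0: "g0 \<in> borel_measurable borel" "AE x in lborel. weak_derivative f x = g0 x" "integrable lborel (\<lambda>x. (g0 x)\<^sup>2)" "(LINT x|lebesgue. (weak_derivative f x)\<^sup>2) = (LINT x|lborel. (g0 x)\<^sup>2)"
  by (rule square_integrable_rep[OF sg])
 have "(LINT x|lborel. f0 x * deriv \<phi> x) = - (LINT x|lborel. g0 x * \<phi> x)" if t: "test_function \<phi>" for \<phi>
 proof -
  note m = test_function_integrable(3)[OF t] test_function_integrable(3)[OF test_function_D(3)[OF t]]
  have "(LINT x|lebesgue. f x * deriv \<phi> x) = (LINT x|lborel. f0 x * deriv \<phi> x)"
   by (rule integral_lebesgue_AE_eq) (use sf f0 m in \<open>auto simp: square_integrable_def\<close>)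
  moreover have "(LINT x|lebesgue. weak_derivative f x * \<phi> x) = (LINT x|lborel. g0 x * \<phi> x)"
   by (rule integral_lebesgue_AE_eq) (use sg g0 m in \<open>auto simp: square_integrable_def\<close>)
  ultimately show ?thesis using w t by (simp add: has_weak_derivative_def)
 qed
 from weak_derivative_continuous_rep[OF f0(1) g0(1) f0(3) g0(3) this]
 obtain v where v: "continuous_on UNIV v" "AE x in lborel. f0 x = v x" "\<And>x. \<bar>v x\<bar> <= sqrt (LINT x|lborel. (f0 x)\<^sup>2) + sqrt (LINT x|lborel. (g0 x)\<^sup>2)"
  by blast
 note [measurable] = f0(1) borel_measurable_continuous_onI[OF v(1)]
 have n: "H1_norm f = sqrt ((LINT x|lborel. (f0 x)\<^sup>2) + (LINT x|lborel. (g0 x)\<^sup>2))"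
  by (simp add: H1_norm_def f0 g0)
 have le: "sqrt (LINT x|lborel. (f0 x)\<^sup>2) <= H1_norm f" "sqrt (LINT x|lborel. (g0 x)\<^sup>2) <= H1_norm f" by (auto simp: n)
 have 1: "AE x in lborel. f x = v x" using f0(2) v(2) by eventually_elim simp
 have 2: "AE x in lborel. (f0 x)\<^sup>2 = (v x)\<^sup>2" using v(2) by eventually_elim simp
 have 3: "integrable lborel (\<lambda>x. (v x)\<^sup>2)" by (rule integrable_cong_AE_imp[OF f0(3)]) (use 2 in \<open>auto elim!: eventually_mono\<close>)
 have "(LINT x|lborel. (v x)\<^sup>2) = (LINT x|lborel. (f0 x)\<^sup>2)" using 2 by (intro integral_cong_AE) (auto elim!: eventually_mono)
 then have 4: "(LINT x|lborel. (v x)\<^sup>2) <= (H1_norm f)\<^sup>2" unfolding n by simp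
 have 5: "\<bar>v x\<bar> <= 2 * H1_norm f" for x using v(3)[of x] le by linarith
 show ?thesis using v(1) 1 3 4 5 by blast
qed

text \<open>Continuity in time is stated through H^1 norms of differences; the embedding applies to
  these only once the differences are known to lie in H^1.\<close>

lemma H1_diff:
 assumes "H1 f" "H1 h"
 shows "H1 (\<lambda>x. f x - h x)"
proof -
 obtain f' h' where w: "square_integrable f" "square_integrable h" "square_integrable f'" "square_integrable h'" "has_weak_derivative f f'" "has_weak_derivative h h'"
  using assms by (auto simp: H1_def)
 have sd: "square_integrable (\<lambda>x. a x - b x)" if "square_integrable a" "square_integrable b" for a b
 proof -
  have [measurable]: "a \<in> borel_measurable lebesgue" "b \<in> borel_measurable lebesgue" using that by (auto simp: square_integrable_def)
  have "integrable lebesgue (\<lambda>x. a x * b x)" by (rule integrable_L2_mult) (use that in \<open>auto simp: square_integrable_def\<close>)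
  then show ?thesis using that by (auto simp: square_integrable_def power2_diff mult.assoc)
 qed
 have st: "integrable lebesgue (\<lambda>x. a x * \<phi> x)" if a: "square_integrable a" and t: "test_function \<phi>" for a \<phi>
 proof (rule integrable_L2_mult)
  note ti = test_function_integrable[OF t]
  show m: "\<phi> \<in> borel_measurable lebesgue" using ti(3) by (intro measurable_completion) simp
  show "integrable lebesgue (\<lambda>x. (\<phi> x)\<^sup>2)" using ti by (subst integrable_completion) auto
 qed (use a in \<open>auto simp: square_integrable_def\<close>)
 have "has_weak_derivative (\<lambda>x. f x - h x) (\<lambda>x. f' x - h' x)"
  unfolding has_weak_derivative_def
 proof (intro allI impI)
  fix \<phi> assume t: "test_function \<phi>"
  note d = test_function_D(3)[OF t]
  show "(LINT x|lebesgue. (f x - h x) * deriv \<phi> x) = - (LINT x|lebesgue. (f' x - h' x) * \<phi> x)"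
   using w t st[OF w(1) d] st[OF w(2) d] st[OF w(3) t] st[OF w(4) t] by (simp add: has_weak_derivative_def left_diff_distrib)
 qed
 then show ?thesis using sd w by (auto simp: H1_def)
qed

section \<open>Decay of small solutions\<close>

lemma symb_gauss_const:
 assumes "\<alpha> > 0"
 shows "\<exists>C>0. \<forall>t>0. gauss_bounded (t / 2) (C * (1 / sqrt t) ^ j) (symb 1 \<alpha> j 0 t)"
proof -
 obtain C where "C > 0" and C: "\<forall>c t. 0 <= c --> c <= 1 --> 0 < t -->
  C1_gauss (t / 2) (C * (1 / sqrt t) ^ j * (t powr (- ((\<alpha> - 1) / 2))) ^ 0)
   (C * (1 / sqrt t) ^ j * (t powr (- ((\<alpha> - 1) / 2))) ^ 0 * sqrt t * (if (0::nat) = 0 then 1 + c * t powr (- ((\<alpha> - 1) / 2)) else 1))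
   (symb c \<alpha> j 0 t) (symb' c \<alpha> j 0 t)"
  using C1_gauss_symb[OF assms, of j 0] by blast
 then show ?thesis using spec[OF C, of 1] unfolding C1_gauss_def by (intro exI[of _ C]) simp
qed

text \<open>The substitution s to t s reduces to Euler's Beta integral; exponents below 1 keep both
  endpoints integrable, and scaling gives the power of t.\<close>

lemma nn_integral_beta:
 fixes p q :: real
 assumes "p < 1" "q < 1"
 shows "\<exists>B>0. \<forall>t>0. (\<integral>\<^sup>+s. ennreal (indicator {0<..<t} s * ((t - s) powr (- p) * s powr (- q))) \<partial>lborel) <= ennreal (B * t powr (1 - p - q))"
proof -
 define B where "B = Beta (1 - q) (1 - p)"
 have B: "B > 0" using assms by (simp add: B_def Beta_def Gamma_real_pos)
 have "((\<lambda>s. s powr (1 - q - 1) * (1 - s) powr (1 - p - 1)) has_integral B) {0..1}"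
  unfolding B_def using assms by (intro has_integral_Beta_real) auto
 then have I0: "((\<lambda>s. if s \<in> {0..1} then s powr (1 - q - 1) * (1 - s) powr (1 - p - 1) else 0) has_integral B) UNIV"
  by (simp only: has_integral_restrict_UNIV)
 define b where "b = (\<lambda>s::real. ennreal (if s \<in> {0..1} then s powr (1 - q - 1) * (1 - s) powr (1 - p - 1) else 0))"
 have [measurable]: "b \<in> borel_measurable borel" unfolding b_def by measurable
 from I0 have I1: "(\<integral>\<^sup>+s. b s \<partial>lborel) = ennreal B"
  unfolding b_def by (intro nn_integral_has_integral_lborel) auto
 have "(\<integral>\<^sup>+s. ennreal (indicator {0<..<t} s * ((t - s) powr (- p) * s powr (- q))) \<partial>lborel) <= ennreal (B * t powr (1 - p - q))" if t: "t > 0" for t :: real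
 proof -
  have "(\<integral>\<^sup>+s. ennreal (indicator {0<..<t} s * ((t - s) powr (- p) * s powr (- q))) \<partial>lborel) = 
    ennreal \<bar>t\<bar> * (\<integral>\<^sup>+s. ennreal (indicator {0<..<t} (0 + t * s) * ((t - (0 + t * s)) powr (- p) * (0 + t * s) powr (- q))) \<partial>lborel)"
   using t by (intro nn_integral_real_affine) auto
  also have "(\<integral>\<^sup>+s. ennreal (indicator {0<..<t} (0 + t * s) * ((t - (0 + t * s)) powr (- p) * (0 + t * s) powr (- q))) \<partial>lborel)
    <= (\<integral>\<^sup>+s. ennreal (t powr (- p - q)) * b s \<partial>lborel)"
  proof (intro nn_integral_mono)
   fix s :: real
   show "ennreal (indicator {0<..<t} (0 + t * s) * ((t - (0 + t * s)) powr (- p) * (0 + t * s) powr (- q))) <= ennreal (t powr (- p - q)) * b s"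
   proof (cases "0 < s \<and> s < 1")
    case True
    have "t - t * s = t * (1 - s)" by (simp add: algebra_simps)
    then have "(t - t * s) powr (- p) * (t * s) powr (- q) = t powr (- p - q) * (s powr (- q) * (1 - s) powr (- p))"
    proof -
     have "(t - t * s) powr (- p) = t powr (- p) * (1 - s) powr (- p)"
      unfolding \<open>t - t * s = t * (1 - s)\<close> using True t by (simp add: powr_mult)
     moreover have "(t * s) powr (- q) = t powr (- q) * s powr (- q)" using True t by (simp add: powr_mult)
     moreover have "t powr (- p - q) = t powr (- p) * t powr (- q)" unfolding powr_add[symmetric] by simp
     ultimately show ?thesis by simp
    qed
    then show ?thesis using True t by (simp add: b_def indicator_def flip: ennreal_mult)
   next
    case False
    then have "0 + t * s \<notin> {0<..<t}" using t by (auto simp: zero_less_mult_iff)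
    then show ?thesis by simp
   qed
  qed
  also have "\<dots> = ennreal (t powr (- p - q)) * ennreal B"
   unfolding I1[symmetric] by (rule nn_integral_cmult) measurable
  also have "ennreal \<bar>t\<bar> * (ennreal (t powr (- p - q)) * ennreal B) = ennreal (B * (t * t powr (- p - q)))"
   using t B by (simp add: ennreal_mult mult_ac)
  also have "t * t powr (- p - q) = t powr (1 - p - q)"
   using t by (simp add: powr_mult_base add_diff_eq)
  finally show ?thesis by (simp add: mult_left_mono)
 qed
 with B show ?thesis by blast
qed

text \<open>Glues a bound useful for t <= 1 to one useful for t >= 1. The factor 2 comes from
  2^(-1/4) >= 1/2.\<close>

lemma powr_min_le:
 fixes t A X :: real
 assumes "t > 0" "X <= A" "X <= A * t powr (- 1 / 4)" "A >= 0"
 shows "X <= 2 * A * (1 + t) powr (- 1 / 4)"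
proof -
 have two: "(2::real) powr (- 1 / 4) >= 1 / 2"
  using powr_mono[of "-1" "- 1 / 4" "2::real"] by (simp add: powr_minus)
 show ?thesis
 proof (cases "t <= 1")
  case True
  have "(2::real) powr (- 1 / 4) <= (1 + t) powr (- 1 / 4)" using assms True by (intro powr_mono2') auto
  then have "1 <= 2 * (1 + t) powr (- 1 / 4)" using two by simp
  then have "A * 1 <= A * (2 * (1 + t) powr (- 1 / 4))" using assms by (intro mult_left_mono) auto
  then show ?thesis using assms by simp
 next
  case False
  have "(2 * t) powr (- 1 / 4) <= (1 + t) powr (- 1 / 4)" using assms False by (intro powr_mono2') auto
  moreover have "(2 * t) powr (- 1 / 4) = 2 powr (- 1 / 4) * t powr (- 1 / 4)" using assms by (simp add: powr_mult)
  moreover have "1 / 2 * t powr (- 1 / 4) <= 2 powr (- 1 / 4) * t powr (- 1 / 4)" using two by (intro mult_right_mono) auto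
  ultimately have "t powr (- 1 / 4) <= 2 * (1 + t) powr (- 1 / 4)" by simp
  then have "A * t powr (- 1 / 4) <= A * (2 * (1 + t) powr (- 1 / 4))" using assms by (intro mult_left_mono) auto
  then show ?thesis using assms by simp
 qed
qed

definition duhamel :: "real => (real => real => complex) => real => real => complex" where
 "duhamel \<alpha> f t x = (LINT \<tau>|lborel. indicator {0<..<t} \<tau> *\<^sub>R (LINT y|lborel. kern 1 \<alpha> 1 0 (t - \<tau>) (x - y) * f \<tau> y))"

abbreviation derivative_kernel_estimate :: "real => real => bool" where
 "derivative_kernel_estimate \<alpha> C \<equiv> \<forall>t>0. \<forall>f E. integrable lborel f --> 0 <= E --> (nnL2 f) <= ennreal (E\<^sup>2) -->
   (nnL2 (\<lambda>x. LINT y|lborel. kern 1 \<alpha> 1 0 t (x - y) * f y)) <= ennreal ((C * t powr (- (1/2)) * E)\<^sup>2) \<and>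
   (\<forall>x. norm (LINT y|lborel. kern 1 \<alpha> 1 0 t (x - y) * f y) <= C * t powr (- (3/4)) * E)"

text \<open>These are the heat rates: the derivative costs t^(-1/2), and passing from L^2 to sup
  another t^(-1/4). The multiplier bounds see only the modulus of the symbol, so the dispersion
  leaves the rates unchanged.\<close>

lemma dkern_conv_bounds:
 assumes "\<alpha> > 0"
 shows "\<exists>C>0. derivative_kernel_estimate \<alpha> C"
proof -
 obtain C where C: "C > 0" "\<And>t. t > 0 ==> gauss_bounded (t / 2) (C * (1 / sqrt t) ^ 1) (symb 1 \<alpha> 1 0 t)"
  using symb_gauss_const[OF assms, of 1] by blast
 have "(nnL2 (\<lambda>x. LINT y|lborel. kern 1 \<alpha> 1 0 t (x - y) * f y)) <= ennreal ((2 * C * t powr (- (1/2)) * E)\<^sup>2) \<and>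
   (\<forall>x. norm (LINT y|lborel. kern 1 \<alpha> 1 0 t (x - y) * f y) <= 2 * C * t powr (- (3/4)) * E)"
  if t: "t > 0" and f: "integrable lborel f" and E: "0 <= E" "(nnL2 f) <= ennreal (E\<^sup>2)" for t f E
 proof -
  have t2: "t / 2 > 0" using t by simp
  have q: "1 / sqrt t = t powr (- (1/2))" using t by (simp add: powr_minus powr_half_sqrt inverse_eq_divide)
  have gb: "gauss_bounded (t / 2) (C * t powr (- (1/2))) (symb 1 \<alpha> 1 0 t)" using C(2)[OF t] by (simp add: q)
  have eq: "(LINT y|lborel. kern 1 \<alpha> 1 0 t (x - y) * f y) = ift (\<lambda>\<xi>. symb 1 \<alpha> 1 0 t \<xi> * ft f \<xi>) x" for x
   unfolding kern_def by (rule conv_ift[OF gauss_bounded_integrable[OF gb t2] f])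
  have "(nnL2 (\<lambda>x. ift (\<lambda>\<xi>. symb 1 \<alpha> 1 0 t \<xi> * ft f \<xi>) x)) <= ennreal ((C * t powr (- (1/2)))\<^sup>2) * (nnL2 f)"
   by (rule multiplier_L2[OF gb t2 f])
  also have "\<dots> <= ennreal ((C * t powr (- (1/2)))\<^sup>2) * ennreal (E\<^sup>2)" by (intro mult_left_mono E) auto
  also have "\<dots> = ennreal ((C * t powr (- (1/2)) * E)\<^sup>2)" by (simp add: power_mult_distrib flip: ennreal_mult)
  also have "\<dots> <= ennreal ((2 * C * t powr (- (1/2)) * E)\<^sup>2)" using C E by (intro ennreal_leI power_mono mult_right_mono) auto
  finally have 1: "(nnL2 (\<lambda>x. ift (\<lambda>\<xi>. symb 1 \<alpha> 1 0 t \<xi> * ft f \<xi>) x)) <= ennreal ((2 * C * t powr (- (1/2)) * E)\<^sup>2)" .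
  have 2: "norm (ift (\<lambda>\<xi>. symb 1 \<alpha> 1 0 t \<xi> * ft f \<xi>) x) <= 2 * C * t powr (- (3/4)) * E" for x
  proof -
   have "ennreal ((norm (ift (\<lambda>\<xi>. symb 1 \<alpha> 1 0 t \<xi> * ft f \<xi>) x))\<^sup>2) <= ennreal ((C * t powr (- (1/2)))\<^sup>2 * sqrt (pi / (2 * (t / 2)))) * (nnL2 f)"
    by (rule multiplier_sup[OF gb t2 f])
   also have "\<dots> <= ennreal ((C * t powr (- (1/2)))\<^sup>2 * sqrt (pi / (2 * (t / 2)))) * ennreal (E\<^sup>2)" by (intro mult_left_mono E) auto
   also have "\<dots> = ennreal ((C * t powr (- (1/2)))\<^sup>2 * sqrt (pi / t) * E\<^sup>2)" using t by (simp flip: ennreal_mult)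
   finally have "(norm (ift (\<lambda>\<xi>. symb 1 \<alpha> 1 0 t \<xi> * ft f \<xi>) x))\<^sup>2 <= (C * t powr (- (1/2)))\<^sup>2 * sqrt (pi / t) * E\<^sup>2"
    using t by (simp add: ennreal_le_iff)
   also have "\<dots> <= (C * t powr (- (1/2)))\<^sup>2 * (4 * t powr (- (1/2))) * E\<^sup>2"
   proof (intro mult_right_mono mult_left_mono)
    have "sqrt (pi / t) = sqrt pi * t powr (- (1/2))" by (simp add: real_sqrt_divide flip: q)
    also have "sqrt pi <= 4" using pi_less_4 by (intro real_le_lsqrt) auto
    finally show "sqrt (pi / t) <= 4 * t powr (- (1/2))" by (simp add: mult_right_mono)
   qed auto
   also have "\<dots> = (2 * C * t powr (- (3/4)) * E)\<^sup>2"
   proof -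
    have "(t powr (- (1/2)))\<^sup>2 * t powr (- (1/2)) = (t powr (- (3/4)))\<^sup>2"
     unfolding power2_eq_square powr_add[symmetric] by simp
    then show ?thesis by (simp add: power_mult_distrib mult_ac)
   qed
   finally show ?thesis using C E by (intro power2_le_imp_le[of "norm _"]) auto
  qed
  show ?thesis unfolding eq using 1 2 by blast
 qed
 with C(1) show ?thesis by (intro exI[of _ "2 * C"]) auto
qed

lemma duhamel_inner_measurable [measurable]:
 assumes [measurable]: "(\<lambda>(s, y). f s y) \<in> borel2"
 shows "(\<lambda>(x, \<tau>). LINT y|lborel. kern c \<alpha> j n (t - \<tau>) (x - y) * f \<tau> y) \<in> borel2"
proof -
 have "(\<lambda>z. LINT y|lborel. kern c \<alpha> j n (t - snd z) (fst z - y) * f (snd z) y) \<in> borel2"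
  by measurable
 then show ?thesis by (simp add: split_beta')
qed

abbreviation duhamel_estimate :: "real => real => bool" where
 "duhamel_estimate \<alpha> C \<equiv> \<forall>t>0. \<forall>f E. (\<lambda>(s, y). f s y) \<in> borel2 --> E \<in> borel_measurable borel -->
   (\<forall>s. 0 < s --> s < t --> integrable lborel (f s) \<and> 0 <= E s \<and> (nnL2 (f s)) <= ennreal ((E s)\<^sup>2)) -->
   (nnL2 (duhamel \<alpha> f t)) <= (\<integral>\<^sup>+s. ennreal (C * (indicator {0<..<t} s * ((t - s) powr (- (1/2)) * E s))) \<partial>lborel)\<^sup>2 \<and>
   (\<forall>x. ennreal (norm (duhamel \<alpha> f t x)) <= (\<integral>\<^sup>+s. ennreal (C * (indicator {0<..<t} s * ((t - s) powr (- (3/4)) * E s))) \<partial>lborel))"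

text \<open>Minkowski's inequality moves the L^2 norm inside the time integral, so both bounds
  reduce to scalar integrals of the kernel rate against a majorant \<open>E\<close> of the L^2 norm
  of the forcing.\<close>

lemma duhamel_bounds:
 assumes "\<alpha> > 0"
 shows "\<exists>C>0. duhamel_estimate \<alpha> C"
proof -
 from dkern_conv_bounds[OF assms] obtain C where C: "C > 0" "derivative_kernel_estimate \<alpha> C"
  by (elim exE conjE)
 show ?thesis
 proof (intro exI[of _ C] conjI allI impI C(1))
  fix t :: real and f :: "real => real => complex" and E :: "real => real"
  assume t: "t > 0" and [measurable]: "(\<lambda>(s, y). f s y) \<in> borel2" "E \<in> borel_measurable borel"
   and H: "\<forall>s. 0 < s --> s < t --> integrable lborel (f s) \<and> 0 <= E s \<and> (nnL2 (f s)) <= ennreal ((E s)\<^sup>2)"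
  define W where "W = (\<lambda>x s. LINT y|lborel. kern 1 \<alpha> 1 0 (t - s) (x - y) * f s y)"
  have [measurable]: "(\<lambda>(x, s). W x s) \<in> borel2" unfolding W_def by measurable
  have Wb: "(nnL2 (\<lambda>x. W x s)) <= ennreal ((C * (t - s) powr (- (1/2)) * E s)\<^sup>2)" "norm (W x s) <= C * (t - s) powr (- (3/4)) * E s"
   if "s \<in> {0<..<t}" for s x
  proof -
   have "t - s > 0" "integrable lborel (f s)" "0 <= E s" "(nnL2 (f s)) <= ennreal ((E s)\<^sup>2)"
    using H that by auto
   note C(2)[rule_format, OF this]
   then show "(nnL2 (\<lambda>x. W x s)) <= ennreal ((C * (t - s) powr (- (1/2)) * E s)\<^sup>2)" "norm (W x s) <= C * (t - s) powr (- (3/4)) * E s"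
    unfolding W_def by (blast, blast)
  qed
  have deq: "duhamel \<alpha> f t x = (LINT s|lborel. indicator {0<..<t} s *\<^sub>R W x s)" for x
   by (simp only: duhamel_def W_def)
  have le: "ennreal (norm (duhamel \<alpha> f t x)) <= (\<integral>\<^sup>+s. ennreal (indicator {0<..<t} s * norm (W x s)) \<partial>lborel)" for x
   unfolding deq by (rule order_trans[OF norm_integral_le_nn_integral]) simp
  show "ennreal (norm (duhamel \<alpha> f t x)) <= (\<integral>\<^sup>+s. ennreal (C * (indicator {0<..<t} s * ((t - s) powr (- (3/4)) * E s))) \<partial>lborel)" for x
   using Wb(2) by (intro order_trans[OF le] nn_integral_mono ennreal_leI) (auto simp: indicator_def mult.assoc)
  have "(nnL2 (duhamel \<alpha> f t)) <= (\<integral>\<^sup>+x. (\<integral>\<^sup>+s. ennreal (indicator {0<..<t} s * norm (W x s)) \<partial>lborel)\<^sup>2 \<partial>lborel)"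
   by (intro nn_integral_mono) (simp add: power_mono[OF le] flip: ennreal_power)
  also have "\<dots> <= (\<integral>\<^sup>+s. ennreal (C * (indicator {0<..<t} s * ((t - s) powr (- (1/2)) * E s))) \<partial>lborel)\<^sup>2"
  proof (rule minkowski_nn_integral)
   fix s :: real
   show "(\<integral>\<^sup>+x. (ennreal (indicator {0<..<t} s * norm (W x s)))\<^sup>2 \<partial>lborel) <= (ennreal (C * (indicator {0<..<t} s * ((t - s) powr (- (1/2)) * E s))))\<^sup>2"
   proof (cases "s \<in> {0<..<t}")
    case True
    then have "0 <= E s" using H by auto
    then show ?thesis using True Wb(1)[OF True] C(1) by (simp add: ennreal_power mult.assoc)
   qed simp
  qed (auto simp: lborel.sigma_finite_measure_axioms)
  finally show "(nnL2 (duhamel \<alpha> f t)) <= (\<integral>\<^sup>+s. ennreal (C * (indicator {0<..<t} s * ((t - s) powr (- (1/2)) * E s))) \<partial>lborel)\<^sup>2" .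
 qed
qed

text \<open>The weights \<open>\<tau>\<^sup>-\<^sup>1\<^sup>/\<^sup>4 (1 + \<tau>)\<^sup>-\<^sup>1\<^sup>/\<^sup>4\<close> and \<open>(1 + \<tau>)\<^sup>-\<^sup>1\<^sup>/\<^sup>4\<close> avoid any use of the derivative norm:
 all four Duhamel integrals become Beta integrals.\<close>

definition decays :: "(real => real => real) => real => real => bool" where
 "decays v K t \<longleftrightarrow> (\<forall>x. \<bar>v t x\<bar> * (t powr (1/4) * (1 + t) powr (1/4)) <= K) \<and>
   integrable lborel (\<lambda>x. (v t x)\<^sup>2) \<and> (LINT x|lborel. (v t x)\<^sup>2) * (1 + t) powr (1/2) <= K\<^sup>2"

lemma decays_sup: "decays v K t ==> t > 0 ==> \<bar>v t x\<bar> <= K * (t powr (- (1/4)) * (1 + t) powr (- (1/4)))"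
proof -
 assume d: "decays v K t" and t: "t > 0"
 have "t powr (1/4) * (1 + t) powr (1/4) > 0" using t by simp
 then have "\<bar>v t x\<bar> <= K / (t powr (1/4) * (1 + t) powr (1/4))"
  using d by (simp add: pos_le_divide_eq decays_def)
 also have "\<dots> = K * (t powr (- (1/4)) * (1 + t) powr (- (1/4)))"
  unfolding powr_minus by (simp only: divide_inverse inverse_mult_distrib)
 finally show ?thesis .
qed

lemma decays_L2: "decays v K t ==> t > 0 ==> (\<integral>\<^sup>+x. ennreal ((v t x)\<^sup>2) \<partial>lborel) <= ennreal ((K * (1 + t) powr (- (1/4)))\<^sup>2)"
proof -
 assume d: "decays v K t" and t: "t > 0"
 have e: "((1 + t) powr (- (1/4)))\<^sup>2 = (1 + t) powr (- (1/2))" unfolding power2_eq_square powr_add[symmetric] by simp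
 have "(1 + t) powr (1/2) > 0" using t by simp
 then have "(LINT x|lborel. (v t x)\<^sup>2) <= K\<^sup>2 / (1 + t) powr (1/2)"
  using d by (simp add: decays_def pos_le_divide_eq)
 also have "\<dots> = (K * (1 + t) powr (- (1/4)))\<^sup>2"
  unfolding power_mult_distrib e by (simp add: powr_minus_divide)
 finally have "(LINT x|lborel. (v t x)\<^sup>2) <= (K * (1 + t) powr (- (1/4)))\<^sup>2" .
 then show ?thesis using d by (subst nn_integral_eq_integral) (auto simp: decays_def)
qed

lemma norm_cube: "norm (cplx (a ^ 3)) = \<bar>a\<bar> * a\<^sup>2"
 unfolding norm_of_real by (simp add: power3_eq_cube power2_eq_square abs_mult mult.assoc)

text \<open>Hoelder with the two decaying quantities: the L^2 norm of the cube takes two sup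
  factors, the L^1 norm one sup factor and the squared L^2 norm, the sup norm three sup
  factors.\<close>

lemma cube_bounds:
 assumes d: "decays v K t" and t: "t > 0" and K: "K >= 0" and [measurable]: "v t \<in> borel_measurable borel"
 shows "integrable lborel (\<lambda>x. cplx (v t x ^ 3))"
  "(nnL2 (\<lambda>x. cplx (v t x ^ 3))) <= ennreal ((K ^ 3 * (t powr (- (1/2)) * (1 + t) powr (- (3/4))))\<^sup>2)"
  "(nnL1 (\<lambda>x. cplx (v t x ^ 3))) <= ennreal (K ^ 3 * (t powr (- (1/4)) * (1 + t) powr (- (3/4))))"
  "norm (cplx (v t x ^ 3)) <= K ^ 3 * (t powr (- (3/4)) * (1 + t) powr (- (3/4)))"
proof -
 define S where "S = K * (t powr (- (1/4)) * (1 + t) powr (- (1/4)))"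
 have S0: "S >= 0" using K by (simp add: S_def)
 have s: "\<bar>v t x\<bar> <= S" for x unfolding S_def by (rule decays_sup[OF d t])
 have i2: "integrable lborel (\<lambda>x. (v t x)\<^sup>2)" using d by (simp add: decays_def)
 show i3: "integrable lborel (\<lambda>x. cplx (v t x ^ 3))"
 proof (rule bochner_integrable_bound[OF integrable_mult_right[OF i2, of S]])
  show "AE x in lborel. norm (cplx (v t x ^ 3)) <= norm (S * (v t x)\<^sup>2)"
   using s S0 by (intro AE_I2) (simp add: norm_cube abs_mult mult_right_mono del: of_real_power norm_of_real)
 qed measurable
 have p: "(t powr (- (1/4))) ^ 2 = t powr (- (1/2))" "(t powr (- (1/4))) ^ 3 = t powr (- (3/4))"
   "((1 + t) powr (- (1/4))) ^ 3 = (1 + t) powr (- (3/4))"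
  unfolding power2_eq_square power3_eq_cube powr_add[symmetric] by simp_all
 have "(nnL2 (\<lambda>x. cplx (v t x ^ 3))) <= (\<integral>\<^sup>+x. ennreal (S ^ 4) * ennreal ((v t x)\<^sup>2) \<partial>lborel)"
 proof (intro nn_integral_mono)
  fix x
  have "(norm (cplx (v t x ^ 3)))\<^sup>2 = \<bar>v t x\<bar> ^ 4 * (v t x)\<^sup>2"
   unfolding norm_cube by (simp add: power_mult_distrib mult.commute flip: power_mult)
  also have "\<dots> <= S ^ 4 * (v t x)\<^sup>2" using s by (intro mult_right_mono power_mono) auto
  finally show "ennreal ((norm (cplx (v t x ^ 3)))\<^sup>2) <= ennreal (S ^ 4) * ennreal ((v t x)\<^sup>2)" using S0 by (simp flip: ennreal_mult)
 qed
 also have "\<dots> = ennreal (S ^ 4) * (\<integral>\<^sup>+x. ennreal ((v t x)\<^sup>2) \<partial>lborel)" by (simp add: nn_integral_cmult)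
 also have "\<dots> <= ennreal (S ^ 4) * ennreal ((K * (1 + t) powr (- (1/4)))\<^sup>2)" by (intro mult_left_mono decays_L2[OF d t]) auto
 also have "\<dots> = ennreal ((S\<^sup>2 * (K * (1 + t) powr (- (1/4))))\<^sup>2)" using S0 by (simp add: power_mult_distrib flip: ennreal_mult power_mult)
 also have "S\<^sup>2 * (K * (1 + t) powr (- (1/4))) = K ^ 3 * ((t powr (- (1/4))) ^ 2 * ((1 + t) powr (- (1/4))) ^ 3)"
  by (simp add: S_def power2_eq_square power3_eq_cube)
 finally show "(nnL2 (\<lambda>x. cplx (v t x ^ 3))) <= ennreal ((K ^ 3 * (t powr (- (1/2)) * (1 + t) powr (- (3/4))))\<^sup>2)"
  unfolding p .
 have "(nnL1 (\<lambda>x. cplx (v t x ^ 3))) <= (\<integral>\<^sup>+x. ennreal S * ennreal ((v t x)\<^sup>2) \<partial>lborel)"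
  using s S0 by (intro nn_integral_mono) (simp add: norm_cube ennreal_leI mult_right_mono del: of_real_power norm_of_real flip: ennreal_mult)
 also have "\<dots> = ennreal S * (\<integral>\<^sup>+x. ennreal ((v t x)\<^sup>2) \<partial>lborel)" by (simp add: nn_integral_cmult)
 also have "\<dots> <= ennreal S * ennreal ((K * (1 + t) powr (- (1/4)))\<^sup>2)" by (intro mult_left_mono decays_L2[OF d t]) auto
 also have "\<dots> = ennreal (S * (K * (1 + t) powr (- (1/4)))\<^sup>2)" using S0 by (simp flip: ennreal_mult)
 also have "S * (K * (1 + t) powr (- (1/4)))\<^sup>2 = K ^ 3 * (t powr (- (1/4)) * ((1 + t) powr (- (1/4))) ^ 3)"
  by (simp add: S_def power2_eq_square power3_eq_cube)
 finally show "(nnL1 (\<lambda>x. cplx (v t x ^ 3))) <= ennreal (K ^ 3 * (t powr (- (1/4)) * (1 + t) powr (- (3/4))))"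
  unfolding p .
 have "norm (cplx (v t x ^ 3)) = \<bar>v t x\<bar> ^ 3" unfolding norm_of_real by (simp add: power_abs)
 also have "\<dots> <= S ^ 3" using s by (intro power_mono) auto
 also have "\<dots> = K ^ 3 * ((t powr (- (1/4))) ^ 3 * ((1 + t) powr (- (1/4))) ^ 3)" by (simp add: S_def power_mult_distrib)
 finally show "norm (cplx (v t x ^ 3)) <= K ^ 3 * (t powr (- (3/4)) * (1 + t) powr (- (3/4)))" unfolding p .
qed

text \<open>The solution seen through its continuous representative, with all integrals over
  \<open>lborel\<close>. The continuity in \<open>v_sup_cont\<close> is uniform in x; together with
  \<open>v_L2_cont\<close> it makes the two norms of \<open>decays\<close> continuous in time, as
  the continuation argument requires.\<close>

locale mild_solution =
 fixes \<alpha> \<beta> :: real and v :: "real => real => real"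
 assumes \<alpha>: "1 < \<alpha>" "\<alpha> < 3"
  and v_meas: "(\<lambda>(t, x). v t x) \<in> borel2"
  and v_cont: "\<And>t. 0 <= t ==> continuous_on UNIV (v t)"
  and v_bdd: "\<And>t. 0 <= t ==> \<exists>S. \<forall>x. \<bar>v t x\<bar> <= S"
  and v_L2: "\<And>t. 0 <= t ==> integrable lborel (\<lambda>x. (v t x)\<^sup>2)"
  and v_L2_cont: "\<And>t. 0 <= t ==> ((\<lambda>s. LINT x|lborel. (v s x - v t x)\<^sup>2) \<longlongrightarrow> 0) (at t within {0..})"
  and v_sup_cont: "\<And>t e. 0 <= t ==> 0 < e ==> \<forall>\<^sub>F s in at t within {0..}. \<forall>x. \<bar>v s x - v t x\<bar> <= e"
  and v0_int: "integrable lborel (v 0)"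
  and v0_mom: "integrable lborel (\<lambda>x. x * v 0 x)"
  and mild: "\<And>t. 0 < t ==> AE x in lborel. cplx (v t x) =
   (LINT y|lborel. kern 1 \<alpha> 0 0 t (x - y) * cplx (v 0 y))
   - cplx (\<beta> / 3) * duhamel \<alpha> (cubed v) t x"
begin

lemma \<alpha>_pos: "\<alpha> > 0" using \<alpha> by simp

lemma v_measurable [measurable]:
 assumes [measurable]: "f \<in> borel_measurable M" "g \<in> borel_measurable M"
 shows "(\<lambda>w. v (f w) (g w)) \<in> borel_measurable M"
 using measurable_compose[OF measurable_Pair[OF assms] v_meas] by simp

end

section \<open>Bootstrap and continuation in time\<close>

lemma decays_mono:
 assumes "decays v K t" "K <= K'" "0 <= K"
 shows "decays v K' t"
proof -
 have "K\<^sup>2 <= K'\<^sup>2" using assms by (intro power_mono) auto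
 then show ?thesis using assms unfolding decays_def by (auto intro: order_trans)
qed

text \<open>The integral equation holds for almost every x, whereas \<open>decays\<close> asks for
  every x. A closed set containing almost every point is the whole line.\<close>

lemma continuous_AE_le:
 fixes f :: "real => real"
 assumes "continuous_on UNIV f" "AE x in lborel. f x <= c"
 shows "f x <= c"
proof -
 have "closed {x. f x <= c}" using assms(1) by (intro closed_Collect_le continuous_intros)
 moreover have "AE x in lebesgue. x \<in> {x. f x <= c}" using assms(2) by (intro AE_completion) auto
 ultimately show ?thesis using mem_closed_if_AE_lebesgue by blast
qed

abbreviation linear_estimate :: "real => real => bool" where
 "linear_estimate \<alpha> C \<equiv> \<forall>t>0. \<forall>f N. integrable lborel f --> 0 <= N --> (LINT x|lborel. norm (f x)) <= N --> (nnL2 f) <= ennreal (N\<^sup>2) -->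
   (nnL2 (\<lambda>x. LINT y|lborel. kern 1 \<alpha> 0 0 t (x - y) * f y)) <= ennreal ((C * N * min 1 (t powr (- (1/4))))\<^sup>2) \<and>
   (\<forall>x. norm (LINT y|lborel. kern 1 \<alpha> 0 0 t (x - y) * f y) <= C * N * (t powr (- (1/4)) * min 1 (t powr (- (1/4)))))"

text \<open>For small t the estimates from L^2 data are used (rates 1 in L^2 and t^(-1/4) in sup),
  for large t those from L^1 data (t^(-1/4) and t^(-1/2)). The single number \<open>N\<close> bounds
  both norms of the data.\<close>

lemma linear_bounds:
 assumes "\<alpha> > 0"
 shows "\<exists>C>0. linear_estimate \<alpha> C"
proof -
 obtain C where C: "C > 0" "\<And>t. t > 0 ==> gauss_bounded (t / 2) (C * (1 / sqrt t) ^ 0) (symb 1 \<alpha> 0 0 t)"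
  using symb_gauss_const[OF assms, of 0] by blast
 have main: "(nnL2 (\<lambda>x. LINT y|lborel. kern 1 \<alpha> 0 0 t (x - y) * f y)) <= ennreal ((4 * C * N * min 1 (t powr (- (1/4))))\<^sup>2) \<and>
   (\<forall>x. norm (LINT y|lborel. kern 1 \<alpha> 0 0 t (x - y) * f y) <= 4 * C * N * (t powr (- (1/4)) * min 1 (t powr (- (1/4)))))"
  if t: "t > 0" and f: "integrable lborel f" and N: "0 <= N" "(LINT x|lborel. norm (f x)) <= N" "(nnL2 f) <= ennreal (N\<^sup>2)" for t f N
 proof -
  define m where "m = t powr (- (1/4))"
  have m0: "m > 0" using t by (simp add: m_def)
  have t2: "t / 2 > 0" using t by simp
  have sq: "1 / sqrt t = m\<^sup>2"
  proof -
   have "m\<^sup>2 = t powr (- (1/2))" unfolding m_def power2_eq_square powr_add[symmetric] by simp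
   then show ?thesis using t by (simp add: powr_minus powr_half_sqrt inverse_eq_divide)
  qed
  have spi: "sqrt pi <= 2" using pi_less_4 by (intro real_le_lsqrt) auto
  have s1: "sqrt (pi / t) <= 4 * m\<^sup>2"
  proof -
   have "sqrt (pi / t) = sqrt pi * m\<^sup>2" by (simp add: real_sqrt_divide flip: sq)
   also have "\<dots> <= 4 * m\<^sup>2" using spi by (intro mult_right_mono) auto
   finally show ?thesis .
  qed
  have s2: "sqrt (pi / (t / 2)) <= 4 * m\<^sup>2"
  proof -
   have "sqrt (pi / (t / 2)) = (sqrt 2 * sqrt pi) * m\<^sup>2" unfolding sq[symmetric] by (simp add: real_sqrt_divide real_sqrt_mult)
   also have "\<dots> <= (2 * 2) * m\<^sup>2"
   proof -
    have "sqrt 2 <= 2" by (rule real_le_lsqrt) auto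
    then have "sqrt 2 * sqrt pi <= 2 * 2" using spi by (rule mult_mono) auto
    then show ?thesis by (rule mult_right_mono) simp
   qed
   finally show ?thesis by simp
  qed
  have q1: "C\<^sup>2 * N\<^sup>2 <= (4 * C * N)\<^sup>2" by (simp add: power_mult_distrib)
  have q2: "C\<^sup>2 * (4 * m\<^sup>2) * N\<^sup>2 <= (4 * C * N * m)\<^sup>2"
  proof -
   have "(4 * C * N * m)\<^sup>2 = 4 * (C\<^sup>2 * (4 * m\<^sup>2) * N\<^sup>2)" by (simp add: power_mult_distrib)
   moreover have "0 <= C\<^sup>2 * (4 * m\<^sup>2) * N\<^sup>2" by simp
   ultimately show ?thesis by linarith
  qed
  have gb: "gauss_bounded (t / 2) C (symb 1 \<alpha> 0 0 t)" using C(2)[OF t] by simp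
  have eq: "(LINT y|lborel. kern 1 \<alpha> 0 0 t (x - y) * f y) = ift (\<lambda>\<xi>. symb 1 \<alpha> 0 0 t \<xi> * ft f \<xi>) x" for x
   unfolding kern_def by (rule conv_ift[OF gauss_bounded_integrable[OF gb t2] f])
  let ?L = "ift (\<lambda>\<xi>. symb 1 \<alpha> 0 0 t \<xi> * ft f \<xi>)"
  have "(nnL2 ?L) <= ennreal (C\<^sup>2) * ennreal (N\<^sup>2)"
   by (rule order_trans[OF multiplier_L2[OF gb t2 f]]) (intro mult_left_mono N, auto)
  also have "\<dots> <= ennreal ((4 * C * N)\<^sup>2)"
   unfolding ennreal_mult[OF zero_le_power2 zero_le_power2, symmetric] by (rule ennreal_leI[OF q1])
  finally have A1: "(nnL2 ?L) <= ennreal ((4 * C * N)\<^sup>2)" .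
  have "(nnL2 ?L) <= ennreal (C\<^sup>2 * sqrt (pi / (2 * (t / 2))) * N\<^sup>2)"
   by (rule multiplier_L2_L1[OF gb t2 f N(2)])
  also have "\<dots> <= ennreal (C\<^sup>2 * (4 * m\<^sup>2) * N\<^sup>2)" using s1 by (intro ennreal_leI mult_right_mono mult_left_mono) auto
  also have "\<dots> <= ennreal ((4 * C * N * m)\<^sup>2)"
   by (rule ennreal_leI[OF q2])
  finally have A2: "(nnL2 ?L) <= ennreal ((4 * C * N * m)\<^sup>2)" .
  have B1: "norm (?L x) <= 4 * C * N * m" for x
  proof -
   have "ennreal ((norm (?L x))\<^sup>2) <= ennreal (C\<^sup>2 * sqrt (pi / (2 * (t / 2)))) * ennreal (N\<^sup>2)"
    by (rule order_trans[OF multiplier_sup[OF gb t2 f]]) (intro mult_left_mono N, auto)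
   also have "\<dots> = ennreal (C\<^sup>2 * sqrt (pi / t) * N\<^sup>2)" using t by (simp flip: ennreal_mult)
   finally have "(norm (?L x))\<^sup>2 <= C\<^sup>2 * sqrt (pi / t) * N\<^sup>2" using t by (simp add: ennreal_le_iff)
   also have "\<dots> <= C\<^sup>2 * (4 * m\<^sup>2) * N\<^sup>2" using s1 by (intro mult_right_mono mult_left_mono) auto
   also have "\<dots> <= (4 * C * N * m)\<^sup>2" by (rule q2)
   finally show ?thesis using C N m0 by (intro power2_le_imp_le[of "norm _"]) auto
  qed
  have B2: "norm (?L x) <= 4 * C * N * (m * m)" for x
  proof -
   have "norm (?L x) <= C * sqrt (pi / (t / 2)) * N" by (rule multiplier_sup_L1[OF gb t2 f N(2)])
   also have "\<dots> <= C * (4 * m\<^sup>2) * N" using s2 C N by (intro mult_right_mono mult_left_mono) auto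
   finally show ?thesis by (simp add: power2_eq_square mult_ac)
  qed
  show ?thesis unfolding eq m_def[symmetric] using A1 A2 B1 B2 by (cases "1 <= m") (auto simp: min_def)
 qed
 show ?thesis using main C(1) by (intro exI[of _ "4 * C"]) auto
qed

lemma min_powr_le: "(t::real) > 0 ==> min 1 (t powr (- (1/4))) <= 2 * (1 + t) powr (- (1/4))"
 using powr_min_le[of t "min 1 (t powr (- (1/4)))" 1] by simp

abbreviation cubic_duhamel_estimate :: "real => real => bool" where
 "cubic_duhamel_estimate \<alpha> C \<equiv> \<forall>\<beta> v K t. mild_solution \<alpha> \<beta> v --> 0 < t --> 0 <= K --> (\<forall>s. 0 < s --> s < t --> decays v K s) -->
   (nnL2 (\<lambda>x. duhamel \<alpha> (cubed v) t x)) <= ennreal ((C * K ^ 3 * min 1 (t powr (- (1/4))))\<^sup>2) \<and>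
   (\<forall>x. norm (duhamel \<alpha> (cubed v) t x) <= C * K ^ 3 * (t powr (- (1/4)) * min 1 (t powr (- (1/4)))))"

text \<open>Pairing the kernel rates 1/2 and 3/4 with the forcing rates 1/2 and 3/4 gives the powers
  0, -1/4, -1/4 and -1/2 of t, the same as for the linear flow. This match closes the
  bootstrap.\<close>

lemma duhamel_cube_bounds:
 assumes "1 < \<alpha>" "\<alpha> < 3"
 shows "\<exists>C>0. cubic_duhamel_estimate \<alpha> C"
proof -
 have a: "\<alpha> > 0" using assms by simp
 from duhamel_bounds[OF a] obtain C where C: "C > 0" "duhamel_estimate \<alpha> C"
  by (elim exE conjE)
 obtain B1 where B1: "B1 > 0" "\<And>t. t > 0 ==> (\<integral>\<^sup>+s. ennreal (indicator {0<..<t} s * ((t - s) powr (- (1/2)) * s powr (- (1/2)))) \<partial>lborel) <= ennreal (B1 * t powr (1 - 1/2 - 1/2))"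
  using nn_integral_beta[of "1/2" "1/2"] by auto
 obtain B2 where B2: "B2 > 0" "\<And>t. t > 0 ==> (\<integral>\<^sup>+s. ennreal (indicator {0<..<t} s * ((t - s) powr (- (1/2)) * s powr (- (3/4)))) \<partial>lborel) <= ennreal (B2 * t powr (1 - 1/2 - 3/4))"
  using nn_integral_beta[of "1/2" "3/4"] by auto
 obtain B3 where B3: "B3 > 0" "\<And>t. t > 0 ==> (\<integral>\<^sup>+s. ennreal (indicator {0<..<t} s * ((t - s) powr (- (3/4)) * s powr (- (1/2)))) \<partial>lborel) <= ennreal (B3 * t powr (1 - 3/4 - 1/2))"
  using nn_integral_beta[of "3/4" "1/2"] by auto
 obtain B4 where B4: "B4 > 0" "\<And>t. t > 0 ==> (\<integral>\<^sup>+s. ennreal (indicator {0<..<t} s * ((t - s) powr (- (3/4)) * s powr (- (3/4)))) \<partial>lborel) <= ennreal (B4 * t powr (1 - 3/4 - 3/4))"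
  using nn_integral_beta[of "3/4" "3/4"] by auto
 define B where "B = B1 + B2 + B3 + B4"
 have B: "B1 <= B" "B2 <= B" "B3 <= B" "B4 <= B" "B > 0" using B1 B2 B3 B4 by (auto simp: B_def)
 have main: "(nnL2 (\<lambda>x. duhamel \<alpha> (cubed v) t x)) <= ennreal ((C * B * K ^ 3 * min 1 (t powr (- (1/4))))\<^sup>2) \<and>
   (\<forall>x. norm (duhamel \<alpha> (cubed v) t x) <= C * B * K ^ 3 * (t powr (- (1/4)) * min 1 (t powr (- (1/4)))))"
  if ms: "mild_solution \<alpha> \<beta> v" and t: "t > 0" and K: "K >= 0" and d: "\<forall>s. 0 < s --> s < t --> decays v K s" for \<beta> v K t
 proof -
  interpret mild_solution \<alpha> \<beta> v by fact
  define E where "E = (\<lambda>s::real. K ^ 3 * (s powr (- (1/2)) * (1 + s) powr (- (3/4))))"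
  have Em: "E \<in> borel_measurable borel" unfolding E_def by measurable
  have fm: "(\<lambda>(s, y). cplx (v s y ^ 3)) \<in> borel2" by measurable
  have "\<forall>s. 0 < s --> s < t --> integrable lborel (\<lambda>y. cplx (v s y ^ 3)) \<and> 0 <= E s \<and> (nnL2 (\<lambda>x. cplx (v s x ^ 3))) <= ennreal ((E s)\<^sup>2)"
  proof (intro allI impI conjI)
   fix s assume s: "0 < s" "s < t"
   then have ds: "decays v K s" using d by blast
   have ms: "v s \<in> borel_measurable borel" by measurable
   show "integrable lborel (\<lambda>y. cplx (v s y ^ 3))" "(nnL2 (\<lambda>x. cplx (v s x ^ 3))) <= ennreal ((E s)\<^sup>2)"
    unfolding E_def by (rule cube_bounds[OF ds s(1) K ms])+
   show "0 <= E s" using K by (simp add: E_def)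
  qed
  from C(2)[rule_format, OF t fm Em this[rule_format]]
  have D: "(nnL2 (\<lambda>x. duhamel \<alpha> (cubed v) t x)) <= (\<integral>\<^sup>+s. ennreal (C * (indicator {0<..<t} s * ((t - s) powr (- (1/2)) * E s))) \<partial>lborel)\<^sup>2"
   "ennreal (norm (duhamel \<alpha> (cubed v) t x)) <= (\<integral>\<^sup>+s. ennreal (C * (indicator {0<..<t} s * ((t - s) powr (- (3/4)) * E s))) \<partial>lborel)" for x
   by blast+
  \<comment> \<open>The exact decay exponent 5/4 at infinity would not be integrable at 0 if used as
    a pure power; the two weaker powers are integrable at 0 and decay enough.\<close>
  have E: "E s <= K ^ 3 * s powr (- (1/2))" "E s <= K ^ 3 * s powr (- (3/4))" if "s > 0" for s
  proof -
   have "(1 + s) powr (- (3/4)) <= 1 powr (- (3/4))" using that by (intro powr_mono2') auto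
   then have "s powr (- (1/2)) * (1 + s) powr (- (3/4)) <= s powr (- (1/2)) * 1" by (intro mult_left_mono) auto
   then show "E s <= K ^ 3 * s powr (- (1/2))" using K by (auto simp: E_def intro!: mult_left_mono)
   have "(1 + s) powr (- (3/4)) <= (1 + s) powr (- (1/4))" using that by (intro powr_mono) auto
   also have "\<dots> <= s powr (- (1/4))" using that by (intro powr_mono2') auto
   finally have "s powr (- (1/2)) * (1 + s) powr (- (3/4)) <= s powr (- (1/2)) * s powr (- (1/4))" by (intro mult_left_mono) auto
   also have "\<dots> = s powr (- (3/4))" unfolding powr_add[symmetric] by simp
   finally show "E s <= K ^ 3 * s powr (- (3/4))" using K by (auto simp: E_def intro!: mult_left_mono)
  qed
  have I: "(\<integral>\<^sup>+s. ennreal (C * (indicator {0<..<t} s * ((t - s) powr (- p) * E s))) \<partial>lborel) <= ennreal (C * B * K ^ 3 * t powr r)"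
   if Eq: "\<And>s. s > 0 ==> E s <= K ^ 3 * s powr (- q)" and J: "(\<integral>\<^sup>+s. ennreal (indicator {0<..<t} s * ((t - s) powr (- p) * s powr (- q))) \<partial>lborel) <= ennreal (B' * t powr r)" and B': "B' <= B" for p q r B'
  proof -
   have "(\<integral>\<^sup>+s. ennreal (C * (indicator {0<..<t} s * ((t - s) powr (- p) * E s))) \<partial>lborel) <= (\<integral>\<^sup>+s. ennreal (C * K ^ 3) * ennreal (indicator {0<..<t} s * ((t - s) powr (- p) * s powr (- q))) \<partial>lborel)"
   proof (intro nn_integral_mono)
    fix s :: real
    have "C * (indicator {0<..<t} s * ((t - s) powr (- p) * E s)) <= C * (indicator {0<..<t} s * ((t - s) powr (- p) * (K ^ 3 * s powr (- q))))"
     using Eq[of s] C(1) by (cases "s > 0") (auto simp: indicator_def intro!: mult_left_mono)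
    then have "C * (indicator {0<..<t} s * ((t - s) powr (- p) * E s)) <= (C * K ^ 3) * (indicator {0<..<t} s * ((t - s) powr (- p) * s powr (- q)))"
     by (simp add: mult_ac)
    then show "ennreal (C * (indicator {0<..<t} s * ((t - s) powr (- p) * E s))) <= ennreal (C * K ^ 3) * ennreal (indicator {0<..<t} s * ((t - s) powr (- p) * s powr (- q)))"
     using C(1) K by (subst ennreal_mult[symmetric]) (auto intro: ennreal_leI)
   qed
   also have "\<dots> = ennreal (C * K ^ 3) * (\<integral>\<^sup>+s. ennreal (indicator {0<..<t} s * ((t - s) powr (- p) * s powr (- q))) \<partial>lborel)"
    by (rule nn_integral_cmult) measurable
   also have "\<dots> <= ennreal (C * K ^ 3) * ennreal (B' * t powr r)" by (intro mult_left_mono J) auto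
   also have "\<dots> <= ennreal (C * K ^ 3) * ennreal (B * t powr r)" using B' by (intro mult_left_mono ennreal_leI mult_right_mono) auto
   also have "\<dots> = ennreal (C * B * K ^ 3 * t powr r)" using C(1) K B(5) by (subst ennreal_mult[symmetric]) (auto simp: mult_ac)
   finally show ?thesis .
  qed
  define m where "m = t powr (- (1/4))"
  have m0: "m > 0" using t by (simp add: m_def)
  have tp: "t powr (1 - 1/2 - 1/2) = 1" "t powr (1 - 1/2 - 3/4) = m" "t powr (1 - 3/4 - 1/2) = m" "t powr (1 - 3/4 - 3/4) = m * m"
   using t unfolding m_def powr_add[symmetric] by auto
  have CB: "C * B * K ^ 3 >= 0" using C(1) B(5) K by simp
  have S: "norm (duhamel \<alpha> (cubed v) t x) <= C * B * K ^ 3 * m" "norm (duhamel \<alpha> (cubed v) t x) <= C * B * K ^ 3 * (m * m)" for x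
   using order_trans[OF D(2) I[OF E(1) B3(2)[OF t] B(3)]] order_trans[OF D(2) I[OF E(2) B4(2)[OF t] B(4)]] CB m0 unfolding tp
   by (auto simp: ennreal_le_iff)
  have L: "(nnL2 (\<lambda>x. duhamel \<alpha> (cubed v) t x)) <= ennreal ((C * B * K ^ 3 * 1)\<^sup>2)"
   "(nnL2 (\<lambda>x. duhamel \<alpha> (cubed v) t x)) <= ennreal ((C * B * K ^ 3 * m)\<^sup>2)"
   using order_trans[OF D(1) power_mono[OF I[OF E(1) B1(2)[OF t] B(1)], of 2]] order_trans[OF D(1) power_mono[OF I[OF E(2) B2(2)[OF t] B(2)], of 2]] CB m0 unfolding tp
   by (simp_all add: ennreal_power)
  show ?thesis unfolding m_def[symmetric] using S L by (cases "1 <= m") (auto simp: min_def)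
 qed
 show ?thesis using main C(1) B(5) by (intro exI[of _ "C * B"]) auto
qed

abbreviation bootstrap_estimate :: "real => real => bool" where
 "bootstrap_estimate \<alpha> C \<equiv> \<forall>\<beta> v N K t. mild_solution \<alpha> \<beta> v --> 0 < t --> 0 <= K --> 0 <= N --> (LINT x|lborel. \<bar>v 0 x\<bar>) <= N --> (LINT x|lborel. (v 0 x)\<^sup>2) <= N\<^sup>2 -->
   (\<forall>s. 0 < s --> s < t --> decays v K s) --> decays v (C * (N + \<bar>\<beta>\<bar> * K ^ 3)) t"

text \<open>The Duhamel term at time t sees only earlier times, so a hypothesis on s < t yields a
  conclusion at t itself. That conclusion is linear in the data and cubic in K.\<close>

lemma bootstrap_step:
 assumes "1 < \<alpha>" "\<alpha> < 3"
 shows "\<exists>C>0. bootstrap_estimate \<alpha> C"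
proof -
 have a: "\<alpha> > 0" using assms by simp
 from linear_bounds[OF a] obtain C1 where C1: "C1 > 0" "linear_estimate \<alpha> C1"
  by (elim exE conjE)
 from duhamel_cube_bounds[OF assms] obtain C2 where C2: "C2 > 0" "cubic_duhamel_estimate \<alpha> C2"
  by (elim exE conjE)
 \<comment> \<open>One factor 2 from replacing the minimum by a power of 1 + t, another from (a +
   b)^2 <= 2a^2 + 2b^2 in the L^2 bound.\<close>
 define C where "C = 4 * (C1 + C2)"
 have "decays v (C * (N + \<bar>\<beta>\<bar> * K ^ 3)) t"
  if ms: "mild_solution \<alpha> \<beta> v" and t: "t > 0" and K: "K >= 0" and N: "0 <= N" "(LINT x|lborel. \<bar>v 0 x\<bar>) <= N" "(LINT x|lborel. (v 0 x)\<^sup>2) <= N\<^sup>2"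
   and d: "\<forall>s. 0 < s --> s < t --> decays v K s" for \<beta> v N K t
 proof -
  interpret mild_solution \<alpha> \<beta> v by fact
  define m where "m = min 1 (t powr (- (1/4)))"
  have m0: "m > 0" using t by (simp add: m_def)
  define L where "L = (\<lambda>x. LINT y|lborel. kern 1 \<alpha> 0 0 t (x - y) * cplx (v 0 y))"
  define D where "D = duhamel \<alpha> (cubed v) t"
  have [measurable]: "L \<in> borel_measurable borel" unfolding L_def by measurable
  have fm: "(\<lambda>(s, y). cplx (v s y ^ 3)) \<in> borel2" by measurable
  have [measurable]: "D \<in> borel_measurable borel" unfolding D_def duhamel_def
   using duhamel_inner_measurable[OF fm, of 1 \<alpha> 1 0 t, measurable] by measurable
  have i0: "integrable lborel (\<lambda>x. cplx (v 0 x))" using v0_int by simp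
  have n1: "(LINT x|lborel. norm (cplx (v 0 x))) <= N" using N by simp
  have n2: "(nnL2 (\<lambda>x. cplx (v 0 x))) <= ennreal (N\<^sup>2)"
   using N v_L2[of 0] by (simp add: nn_integral_eq_integral ennreal_leI)
  note LL = C1(2)[rule_format, OF t i0 N(1) n1 n2, folded m_def]
  have L: "(nnL2 L) <= ennreal ((C1 * N * m)\<^sup>2)" "norm (L x) <= C1 * N * (t powr (- (1/4)) * m)" for x
   using LL unfolding L_def by blast+
  note DD = C2(2)[rule_format, OF ms t K d[rule_format], folded m_def D_def]
  have D: "(nnL2 D) <= ennreal ((C2 * K ^ 3 * m)\<^sup>2)" "norm (D x) <= C2 * K ^ 3 * (t powr (- (1/4)) * m)" for x
   using DD by blast+
  have veq: "AE x in lborel. cplx (v t x) = L x - cplx (\<beta> / 3) * D x"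
   using mild[OF t] by (simp add: L_def D_def)
  define A where "A = C1 * N + \<bar>\<beta>\<bar> * (C2 * K ^ 3)"
  have A0: "A >= 0" using C1(1) C2(1) N K by (simp add: A_def)
  have AC: "4 * A <= C * (N + \<bar>\<beta>\<bar> * K ^ 3)"
  proof -
   have "C * (N + \<bar>\<beta>\<bar> * K ^ 3) - 4 * A = 4 * (C2 * N + C1 * (\<bar>\<beta>\<bar> * K ^ 3))" by (simp add: C_def A_def algebra_simps)
   moreover have "\<dots> >= 0" using C1(1) C2(1) N K by simp
   ultimately show ?thesis by linarith
  qed
  have b3: "\<bar>\<beta> / 3\<bar> * X <= \<bar>\<beta>\<bar> * X" if "X >= 0" for X :: real using that by (intro mult_right_mono) auto
  have "AE x in lborel. \<bar>v t x\<bar> <= A * (t powr (- (1/4)) * m)"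
   using veq
  proof eventually_elim
   case (elim x)
   have "\<bar>v t x\<bar> = norm (L x - cplx (\<beta> / 3) * D x)" by (metis elim norm_of_real)
   also have "\<dots> <= norm (L x) + \<bar>\<beta> / 3\<bar> * norm (D x)" by (rule order_trans[OF norm_triangle_ineq4]) (simp add: norm_mult)
   also have "\<dots> <= norm (L x) + \<bar>\<beta>\<bar> * norm (D x)" using b3[of "norm (D x)"] by simp
   also have "\<dots> <= C1 * N * (t powr (- (1/4)) * m) + \<bar>\<beta>\<bar> * (C2 * K ^ 3 * (t powr (- (1/4)) * m))"
    by (intro add_mono mult_left_mono L D) auto
   finally show ?case by (simp add: A_def algebra_simps)
  qed
  then have sup: "\<bar>v t x\<bar> <= A * (t powr (- (1/4)) * m)" for x
   using v_cont[of t] t by (intro continuous_AE_le[of "\<lambda>x. \<bar>v t x\<bar>"] continuous_intros) auto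
  have mle: "m <= 2 * (1 + t) powr (- (1/4))" unfolding m_def by (rule min_powr_le[OF t])
  have w: "t powr (- (1/4)) * t powr (1/4) = 1" "(1 + t) powr (- (1/4)) * (1 + t) powr (1/4) = 1"
   using t unfolding powr_add[symmetric] by auto
  have sup': "\<bar>v t x\<bar> * (t powr (1/4) * (1 + t) powr (1/4)) <= 4 * A" for x
  proof -
   have "\<bar>v t x\<bar> * (t powr (1/4) * (1 + t) powr (1/4)) <= A * (t powr (- (1/4)) * (2 * (1 + t) powr (- (1/4)))) * (t powr (1/4) * (1 + t) powr (1/4))"
    using A0 mle by (intro mult_right_mono order_trans[OF sup] mult_left_mono) auto
   also have "\<dots> = 2 * A * (t powr (- (1/4)) * t powr (1/4)) * ((1 + t) powr (- (1/4)) * (1 + t) powr (1/4))" by simp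
   also have "\<dots> <= 4 * A" unfolding w using A0 by simp
   finally show ?thesis .
  qed
  have "(\<integral>\<^sup>+x. ennreal ((v t x)\<^sup>2) \<partial>lborel) <= (\<integral>\<^sup>+x. ennreal 2 * ennreal ((norm (L x))\<^sup>2) + ennreal (2 * \<beta>\<^sup>2) * ennreal ((norm (D x))\<^sup>2) \<partial>lborel)"
  proof (rule nn_integral_mono_AE)
   show "AE x in lborel. ennreal ((v t x)\<^sup>2) <= ennreal 2 * ennreal ((norm (L x))\<^sup>2) + ennreal (2 * \<beta>\<^sup>2) * ennreal ((norm (D x))\<^sup>2)"
    using veq
   proof eventually_elim
    case (elim x)
    have "\<bar>v t x\<bar> = norm (L x - cplx (\<beta> / 3) * D x)" by (metis elim norm_of_real)
    also have "\<dots> <= norm (L x) + \<bar>\<beta> / 3\<bar> * norm (D x)" by (rule order_trans[OF norm_triangle_ineq4]) (simp add: norm_mult)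
    also have "\<dots> <= norm (L x) + \<bar>\<beta>\<bar> * norm (D x)" using b3[of "norm (D x)"] by simp
    finally have "(v t x)\<^sup>2 <= (norm (L x) + \<bar>\<beta>\<bar> * norm (D x))\<^sup>2" by (simp add: abs_le_square_iff[symmetric])
    also have "\<dots> <= 2 * (norm (L x))\<^sup>2 + 2 * (\<bar>\<beta>\<bar> * norm (D x))\<^sup>2"
     using sum_squares_bound[of "norm (L x)" "\<bar>\<beta>\<bar> * norm (D x)"] by (simp add: power2_sum)
    finally have "(v t x)\<^sup>2 <= 2 * (norm (L x))\<^sup>2 + (2 * \<beta>\<^sup>2) * (norm (D x))\<^sup>2" by (simp add: power_mult_distrib)
    then have "ennreal ((v t x)\<^sup>2) <= ennreal (2 * (norm (L x))\<^sup>2 + (2 * \<beta>\<^sup>2) * (norm (D x))\<^sup>2)" by (rule ennreal_leI)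
    then show ?case by (simp only: ennreal_plus ennreal_mult zero_le_mult_iff zero_le_power2 zero_le_numeral simp_thms)
   qed
  qed
  also have "\<dots> = ennreal 2 * (nnL2 L) + ennreal (2 * \<beta>\<^sup>2) * (nnL2 D)"
  proof -
   have "(\<lambda>x. ennreal ((norm (L x))\<^sup>2)) \<in> borel_measurable lborel" "(\<lambda>x. ennreal ((norm (D x))\<^sup>2)) \<in> borel_measurable lborel" by measurable
   then show ?thesis by (simp add: nn_integral_add nn_integral_cmult)
  qed
  also have "\<dots> <= ennreal 2 * ennreal ((C1 * N * m)\<^sup>2) + ennreal (2 * \<beta>\<^sup>2) * ennreal ((C2 * K ^ 3 * m)\<^sup>2)"
   by (intro add_mono mult_left_mono L D) auto
  also have "\<dots> = ennreal (2 * (C1 * N * m)\<^sup>2 + (2 * \<beta>\<^sup>2) * (C2 * K ^ 3 * m)\<^sup>2)"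
   by (simp only: ennreal_plus ennreal_mult zero_le_mult_iff zero_le_power2 zero_le_numeral simp_thms)
  also have "\<dots> <= ennreal ((2 * A * m)\<^sup>2)"
  proof (rule ennreal_leI)
   have "2 * (C1 * N * m)\<^sup>2 + (2 * \<beta>\<^sup>2) * (C2 * K ^ 3 * m)\<^sup>2 = 2 * m\<^sup>2 * ((C1 * N)\<^sup>2 + (\<bar>\<beta>\<bar> * (C2 * K ^ 3))\<^sup>2)" by (simp add: power_mult_distrib algebra_simps)
   also have "\<dots> <= 2 * m\<^sup>2 * A\<^sup>2" unfolding A_def power2_sum using C1(1) C2(1) N K by (intro mult_left_mono) auto
   also have "\<dots> <= (2 * A * m)\<^sup>2" by (simp add: power_mult_distrib mult_right_mono)
   finally show "2 * (C1 * N * m)\<^sup>2 + (2 * \<beta>\<^sup>2) * (C2 * K ^ 3 * m)\<^sup>2 <= (2 * A * m)\<^sup>2" .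
  qed
  finally have "(LINT x|lborel. (v t x)\<^sup>2) <= (2 * A * m)\<^sup>2"
   using v_L2[of t] t by (simp add: nn_integral_eq_integral ennreal_le_iff)
  also have "\<dots> <= (2 * A * (2 * (1 + t) powr (- (1/4))))\<^sup>2" using A0 m0 mle by (intro power_mono mult_left_mono) auto
  finally have "(LINT x|lborel. (v t x)\<^sup>2) * (1 + t) powr (1/2) <= (2 * A * (2 * (1 + t) powr (- (1/4))))\<^sup>2 * (1 + t) powr (1/2)"
   by (intro mult_right_mono) auto
  also have "\<dots> = (4 * A)\<^sup>2"
  proof -
   have "((1 + t) powr (- (1/4)))\<^sup>2 * (1 + t) powr (1/2) = 1" using t unfolding power2_eq_square powr_add[symmetric] by simp
   then have "(2 * A * (2 * (1 + t) powr (- (1/4))))\<^sup>2 * (1 + t) powr (1/2) = (4 * A)\<^sup>2 * 1" by (simp add: power_mult_distrib mult_ac)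
   then show ?thesis by simp
  qed
  finally have "decays v (4 * A) t" using sup' v_L2[of t] t by (simp add: decays_def)
  then show ?thesis by (rule decays_mono[OF _ AC]) (use A0 in simp)
 qed
 moreover have "C > 0" using C1(1) C2(1) by (simp add: C_def)
 ultimately show ?thesis by blast
qed

text \<open>At the infimum of the times where the bound with K fails, the bootstrap gives the bound
  with K/2; by continuity in time the bound with K then persists a little longer, a
  contradiction.\<close>

theorem global_decay:
 assumes "1 < \<alpha>" "\<alpha> < 3"
 shows "\<exists>\<delta>>0. \<exists>K\<ge>0. \<forall>v N. mild_solution \<alpha> \<beta> v --> 0 <= N --> N < \<delta> --> (LINT x|lborel. \<bar>v 0 x\<bar>) <= N --> (LINT x|lborel. (v 0 x)\<^sup>2) <= N\<^sup>2 --> (\<forall>t\<ge>0. decays v K t)"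
proof -
 from bootstrap_step[OF assms] obtain C where C: "C > 0" "bootstrap_estimate \<alpha> C"
  by (elim exE conjE)
 \<comment> \<open>Chosen so that the cubic part of the bootstrap is at most K/4; the summand 1
   gives K <= 1 and covers \<beta> = 0.\<close>
 define K where "K = 1 / (4 * C * \<bar>\<beta>\<bar> + 1)"
 have den: "4 * C * \<bar>\<beta>\<bar> + 1 >= 1" using C(1) by simp
 have K: "K > 0" "K <= 1" using den by (auto simp: K_def)
 have "C * \<bar>\<beta>\<bar> * K <= 1 / 4" using den by (simp add: K_def divide_le_eq)
 then have "C * \<bar>\<beta>\<bar> * K * K\<^sup>2 <= 1 / 4 * K"
 proof -
  have "K\<^sup>2 <= K" using K by (simp add: power2_eq_square mult_left_le)
  then show ?thesis using \<open>C * \<bar>\<beta>\<bar> * K <= 1 / 4\<close> K C(1) by (intro mult_mono) auto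
 qed
 then have K3: "C * (\<bar>\<beta>\<bar> * K ^ 3) <= K / 4" by (simp add: power3_eq_cube power2_eq_square mult_ac)
 \<comment> \<open>The first entry makes the linear part of the bootstrap at most K/4, the second
   gives the bound with K/2 at time 0.\<close>
 define \<delta> where "\<delta> = min (K / (4 * C)) (K / 2)"
 have \<delta>: "\<delta> > 0" using K C(1) by (simp add: \<delta>_def)
 have "decays v K t" if ms: "mild_solution \<alpha> \<beta> v" and N: "0 <= N" "N < \<delta>" "(LINT x|lborel. \<bar>v 0 x\<bar>) <= N" "(LINT x|lborel. (v 0 x)\<^sup>2) <= N\<^sup>2" and t0: "t >= 0" for v N t
 proof (rule ccontr)
  interpret mild_solution \<alpha> \<beta> v by fact
  assume bad: "\<not> decays v K t"
  define Bad where "Bad = {t. 0 <= t \<and> \<not> decays v K t}"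
  have ne: "Bad \<noteq> {}" "bdd_below Bad" using bad t0 by (auto simp: Bad_def intro: bdd_belowI[of _ 0])
  define s0 where "s0 = Inf Bad"
  have s00: "s0 >= 0" unfolding s0_def using ne by (intro cInf_greatest) (auto simp: Bad_def)
  have before: "decays v K s" if "0 <= s" "s < s0" for s
  proof (rule ccontr)
   assume "\<not> decays v K s"
   then have "s \<in> Bad" using that by (simp add: Bad_def)
   then have "s0 <= s" unfolding s0_def by (rule cInf_lower[OF _ ne(2)])
   then show False using that by simp
  qed
  have CN: "C * N <= K / 4"
  proof -
   have "N <= K / (4 * C)" using N by (simp add: \<delta>_def)
   then show ?thesis using C(1) by (simp add: pos_le_divide_eq mult_ac)
  qed
  \<comment> \<open>At \<open>s0 = 0\<close> the sup weight vanishes and the L^2 part is the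
    smallness of the data; for \<open>s0 > 0\<close> the two quarters of K add up.\<close>
  have half: "decays v (K / 2) s0"
  proof (cases "s0 = 0")
   case True
   have "N\<^sup>2 <= (K / 2)\<^sup>2" using N by (intro power_mono) (auto simp: \<delta>_def)
   then have "(LINT x|lborel. (v 0 x)\<^sup>2) <= (K / 2)\<^sup>2" using N(4) by linarith
   then show ?thesis using True K v_L2[of 0] by (simp add: decays_def)
  next
   case False
   then have s: "s0 > 0" using s00 by simp
   have "decays v (C * (N + \<bar>\<beta>\<bar> * K ^ 3)) s0"
    by (rule C(2)[rule_format, OF ms s less_imp_le[OF K(1)] N(1) N(3) N(4)]) (rule before, auto)
   moreover have "C * (N + \<bar>\<beta>\<bar> * K ^ 3) <= K / 2" using CN K3 by (simp add: distrib_left)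
   moreover have "0 <= C * (N + \<bar>\<beta>\<bar> * K ^ 3)" using C(1) N K by simp
   ultimately show ?thesis by (rule decays_mono)
  qed
  define \<omega> where "\<omega> = (\<lambda>s::real. s powr (1/4) * (1 + s) powr (1/4))"
  have \<omega>0: "\<omega> s >= 0" for s by (simp add: \<omega>_def)
  have \<omega>c: "(\<omega> \<longlongrightarrow> \<omega> s0) (at s0 within {0..})"
   unfolding \<omega>_def using s00 by (intro tendsto_intros tendsto_powr') (auto simp: eventually_at_filter)
  obtain S where S: "\<And>x. \<bar>v s0 x\<bar> <= S" using v_bdd[OF s00] by blast
  have S0: "S >= 0" using S[of 0] by linarith
  \<comment> \<open>The admissible sup increment: weighted, it uses up another quarter of K near
    \<open>s0\<close> and leaves a quarter for the change of the weight.\<close>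
  define e where "e = K / (4 * (\<omega> s0 + 1))"
  have e: "e > 0" "e * \<omega> s0 <= K / 4"
  proof -
   show "e > 0" using K \<omega>0[of s0] by (simp add: e_def)
   have "e * \<omega> s0 <= e * (\<omega> s0 + 1)" using \<open>e > 0\<close> by simp
   also have "\<dots> = K / 4"
   proof -
    have "K / (4 * a) * a = K / 4" if "a > 0" for a using that by simp
    from this[of "\<omega> s0 + 1"] show ?thesis using \<omega>0[of s0] by (simp only: e_def)
   qed
   finally show "e * \<omega> s0 <= K / 4" .
  qed
  have "((\<lambda>s. K / 2 + S * \<bar>\<omega> s - \<omega> s0\<bar> + e * \<omega> s) \<longlongrightarrow> K / 2 + S * \<bar>\<omega> s0 - \<omega> s0\<bar> + e * \<omega> s0) (at s0 within {0..})"
   by (intro tendsto_intros \<omega>c)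
  then have ev1: "\<forall>\<^sub>F s in at s0 within {0..}. K / 2 + S * \<bar>\<omega> s - \<omega> s0\<bar> + e * \<omega> s < K"
   by (rule order_tendstoD) (use e K in auto)
  define P where "P = (LINT x|lborel. (v s0 x)\<^sup>2)"
  have "((\<lambda>s. (2 * P + 2 * (LINT x|lborel. (v s x - v s0 x)\<^sup>2)) * (1 + s) powr (1/2)) \<longlongrightarrow> (2 * P + 2 * 0) * (1 + s0) powr (1/2)) (at s0 within {0..})"
   using s00 by (intro tendsto_intros v_L2_cont) auto
  \<comment> \<open>Squaring loses a factor 2, which the gap between (K/2)^2 and K^2
    absorbs.\<close>
  moreover have "(2 * P + 2 * 0) * (1 + s0) powr (1/2) < K\<^sup>2"
  proof -
   have "P * (1 + s0) powr (1/2) <= (K / 2)\<^sup>2" using half by (simp add: decays_def P_def)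
   then have "(2 * P + 2 * 0) * (1 + s0) powr (1/2) <= 2 * (K / 2)\<^sup>2" by simp
   also have "\<dots> < K\<^sup>2" using K by (simp add: power2_eq_square)
   finally show ?thesis .
  qed
  ultimately have ev2: "\<forall>\<^sub>F s in at s0 within {0..}. (2 * P + 2 * (LINT x|lborel. (v s x - v s0 x)\<^sup>2)) * (1 + s) powr (1/2) < K\<^sup>2"
   by (rule order_tendstoD)
  have "\<forall>\<^sub>F s in at s0 within {0..}. s \<in> {0..}" by (simp add: eventually_at_filter)
  with ev1 ev2 v_sup_cont[OF s00 e(1)] have "\<forall>\<^sub>F s in at s0 within {0..}. decays v K s"
  proof eventually_elim
   case (elim s)
   have "\<bar>v s x\<bar> * \<omega> s <= K" for x
   proof -
    have "\<bar>v s x\<bar> <= \<bar>v s0 x\<bar> + e" using elim(3)[rule_format, of x] by linarith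
    then have "\<bar>v s x\<bar> * \<omega> s <= (\<bar>v s0 x\<bar> + e) * \<omega> s" by (intro mult_right_mono \<omega>0)
    also have "\<dots> = \<bar>v s0 x\<bar> * \<omega> s0 + \<bar>v s0 x\<bar> * (\<omega> s - \<omega> s0) + e * \<omega> s" by (simp add: algebra_simps)
    also have "\<dots> <= K / 2 + S * \<bar>\<omega> s - \<omega> s0\<bar> + e * \<omega> s"
    proof (intro add_mono order_refl)
     show "\<bar>v s0 x\<bar> * \<omega> s0 <= K / 2" using half by (simp add: decays_def \<omega>_def)
     have "\<bar>v s0 x\<bar> * (\<omega> s - \<omega> s0) <= \<bar>v s0 x\<bar> * \<bar>\<omega> s - \<omega> s0\<bar>" by (intro mult_left_mono) auto
     also have "\<dots> <= S * \<bar>\<omega> s - \<omega> s0\<bar>" using S by (intro mult_right_mono) auto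
     finally show "\<bar>v s0 x\<bar> * (\<omega> s - \<omega> s0) <= S * \<bar>\<omega> s - \<omega> s0\<bar>" .
    qed
    finally show ?thesis using elim(1) by linarith
   qed
   moreover have "(LINT x|lborel. (v s x)\<^sup>2) * (1 + s) powr (1/2) <= K\<^sup>2"
   proof -
    have isq: "integrable lborel (\<lambda>x. (v s x)\<^sup>2)" "integrable lborel (\<lambda>x. (v s0 x)\<^sup>2)" using v_L2 elim(4) s00 by auto
    have vm: "v s \<in> borel_measurable lborel" "v s0 \<in> borel_measurable lborel" by measurable
    have im: "integrable lborel (\<lambda>x. v s x * v s0 x)" by (rule integrable_L2_mult[OF vm isq])
    have id: "integrable lborel (\<lambda>x. (v s x - v s0 x)\<^sup>2)" using isq im by (auto simp: power2_diff mult.assoc)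
    have "(LINT x|lborel. (v s x)\<^sup>2) <= (LINT x|lborel. 2 * (v s0 x)\<^sup>2 + 2 * (v s x - v s0 x)\<^sup>2)"
    proof (rule integral_mono)
     fix x
     have "2 * (v s0 x)\<^sup>2 + 2 * (v s x - v s0 x)\<^sup>2 - (v s x)\<^sup>2 = (v s x - 2 * v s0 x)\<^sup>2" by (simp add: power2_eq_square algebra_simps)
     then show "(v s x)\<^sup>2 <= 2 * (v s0 x)\<^sup>2 + 2 * (v s x - v s0 x)\<^sup>2" using zero_le_power2[of "v s x - 2 * v s0 x"] by linarith
    qed (use isq id in auto)
    also have "\<dots> = 2 * P + 2 * (LINT x|lborel. (v s x - v s0 x)\<^sup>2)" unfolding P_def using isq id by simp
    finally have "(LINT x|lborel. (v s x)\<^sup>2) * (1 + s) powr (1/2) <= (2 * P + 2 * (LINT x|lborel. (v s x - v s0 x)\<^sup>2)) * (1 + s) powr (1/2)"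
     by (intro mult_right_mono) auto
    then show ?thesis using elim(2) by linarith
   qed
   ultimately show ?case using v_L2[of s] elim(4) by (simp add: decays_def \<omega>_def)
  qed
  then obtain r where r: "r > 0" "\<And>s. s \<in> {0..} ==> s \<noteq> s0 ==> dist s s0 < r ==> decays v K s"
   unfolding eventually_at by blast
  obtain s where s: "s \<in> Bad" "s < s0 + r" using cInf_lessD[OF ne(1), of "s0 + r"] r(1) unfolding s0_def by auto
  have "s >= s0" unfolding s0_def using s ne by (intro cInf_lower) auto
  moreover have "s \<noteq> s0" using s half decays_mono[of v "K/2" s0 K] K by (auto simp: Bad_def)
  ultimately have "decays v K s" using r(2)[of s] s by (auto simp: Bad_def dist_real_def)
  then show False using s by (simp add: Bad_def)
 qed
 then show ?thesis using \<delta> K by (intro exI[of _ \<delta>] conjI exI[of _ K]) auto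
qed

section \<open>Negligible errors and first-order asymptotics\<close>

text \<open>The error class of the theorem, free of p: one vanishing factor e controls the sup norm
  at scale 1/t and the L^1 norm at scale 1/sqrt t, and by interpolation every L^p norm at the
  claimed scale. No rate is recorded, since moments of order one give none.\<close>

definition small :: "(real => real => complex) => bool" where
 "small E \<longleftrightarrow> (\<exists>e. (e \<longlongrightarrow> 0) at_top \<and> (\<forall>\<^sub>F t in at_top. 0 <= e t \<and> bnd (E t) (e t / t) (e t / sqrt t)))"

lemma smallI:
 assumes "(e \<longlongrightarrow> 0) at_top" "\<forall>\<^sub>F t in at_top. 0 <= e t \<and> bnd (E t) (e t / t) (e t / sqrt t)"
 shows "small E"
 using assms unfolding small_def by blast

lemma small_add:
 assumes "small E" "small F"
 shows "small (\<lambda>t x. E t x + F t x)"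
proof -
 obtain e where e: "(e \<longlongrightarrow> 0) at_top" "\<forall>\<^sub>F t in at_top. 0 <= e t \<and> bnd (E t) (e t / t) (e t / sqrt t)" using assms(1) unfolding small_def by blast
 obtain f where f: "(f \<longlongrightarrow> 0) at_top" "\<forall>\<^sub>F t in at_top. 0 <= f t \<and> bnd (F t) (f t / t) (f t / sqrt t)" using assms(2) unfolding small_def by blast
 show ?thesis
 proof (rule smallI[where e="\<lambda>t. e t + f t"])
  show "((\<lambda>t. e t + f t) \<longlongrightarrow> 0) at_top" using tendsto_add[OF e(1) f(1)] by simp
  show "\<forall>\<^sub>F t in at_top. 0 <= e t + f t \<and> bnd (\<lambda>x. E t x + F t x) ((e t + f t) / t) ((e t + f t) / sqrt t)"
   using e(2) f(2) eventually_gt_at_top[of 0]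
  proof eventually_elim
   case (elim t)
   then show ?case using bnd_add[of "E t" "e t / t" "e t / sqrt t" "F t" "f t / t" "f t / sqrt t"] by (simp add: add_divide_distrib)
  qed
 qed
qed

lemma small_cmult:
 assumes "small E"
 shows "small (\<lambda>t x. c * E t x)"
proof -
 obtain e where e: "(e \<longlongrightarrow> 0) at_top" "\<forall>\<^sub>F t in at_top. 0 <= e t \<and> bnd (E t) (e t / t) (e t / sqrt t)" using assms(1) unfolding small_def by blast
 show ?thesis
 proof (rule smallI[where e="\<lambda>t. norm c * e t"])
  show "((\<lambda>t. norm c * e t) \<longlongrightarrow> 0) at_top" using tendsto_mult[OF tendsto_const e(1), of "norm c"] by simp
  show "\<forall>\<^sub>F t in at_top. 0 <= norm c * e t \<and> bnd (\<lambda>x. c * E t x) (norm c * e t / t) (norm c * e t / sqrt t)"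
   using e(2)
  proof eventually_elim
   case (elim t)
   then show ?case using bnd_cmult[of "E t" "e t / t" "e t / sqrt t" c] by simp
  qed
 qed
qed

lemma small_diff:
 assumes "small E" "small F"
 shows "small (\<lambda>t x. E t x - F t x)"
 using small_add[OF assms(1) small_cmult[OF assms(2), of "-1"]] by simp

lemma small_cong:
 assumes "small E" "\<forall>\<^sub>F t in at_top. \<forall>x. E t x = F t x"
 shows "small F"
proof -
 obtain e where e: "(e \<longlongrightarrow> 0) at_top" "\<forall>\<^sub>F t in at_top. 0 <= e t \<and> bnd (E t) (e t / t) (e t / sqrt t)" using assms(1) unfolding small_def by blast
 show ?thesis
 proof (rule smallI[OF e(1)])
  show "\<forall>\<^sub>F t in at_top. 0 <= e t \<and> bnd (F t) (e t / t) (e t / sqrt t)"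
   using e(2) assms(2)
  proof eventually_elim
   case (elim t)
   then have "E t = F t" by auto
   then show ?case using elim by simp
  qed
 qed
qed

lemma small_powerI:
 assumes r: "r > 0" and C: "C >= 0" and b: "\<forall>\<^sub>F t in at_top. bnd (E t) (C * t powr (- 1 - r)) (C * t powr (- 1 / 2 - r))"
 shows "small E"
proof (rule smallI[where e="\<lambda>t. C * t powr (- r)"])
 have "((\<lambda>t. C * t powr (- r)) \<longlongrightarrow> C * 0) at_top"
  using r by (intro tendsto_mult tendsto_const tendsto_neg_powr filterlim_ident) auto
 then show "((\<lambda>t. C * t powr (- r)) \<longlongrightarrow> 0) at_top" by simp
 show "\<forall>\<^sub>F t in at_top. 0 <= C * t powr (- r) \<and> bnd (E t) (C * t powr (- r) / t) (C * t powr (- r) / sqrt t)"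
  using b eventually_gt_at_top[of 0]
 proof eventually_elim
  case (elim t)
  have "- 1 - r = - r - 1" by simp
  then have "t powr (- 1 - r) = t powr (- r) / t" using elim powr_diff[of t "- r" 1] by (simp only: powr_one)
  moreover have "- 1 / 2 - r = - r - 1 / 2" by simp
  then have "t powr (- 1 / 2 - r) = t powr (- r) / sqrt t" using elim powr_diff[of t "- r" "1/2"] by (simp only: powr_half_sqrt less_imp_le)
  ultimately show ?case using elim C by simp
 qed
qed

lemma bnd_min:
 assumes "bnd f A B" "bnd f A' B'"
 shows "bnd f (min A A') (min B B')"
 using assms by (auto simp: bnd_def min_def)

text \<open>A second-order expansion of the kernel in y would need two moments, and only one is
  available. So the first-order bound |y| and the second-order bound y^2 t^(-1/2) are combined by a
  minimum, and dominated convergence gives o(1).\<close>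

lemma small_linear:
 fixes f :: "real => real"
 assumes \<alpha>: "\<alpha> > 1" and f: "integrable lborel f" and xf: "integrable lborel (\<lambda>x. x * f x)"
 shows "small (\<lambda>t x. (LINT y|lborel. kern 1 \<alpha> 0 0 t (x - y) * cplx (f y))
   - cplx (LINT y|lborel. f y) * kern 1 \<alpha> 0 0 t x + cplx (LINT y|lborel. y * f y) * kern 1 \<alpha> 1 0 t x)"
proof -
 have a: "\<alpha> > 0" using \<alpha> by simp
 have [measurable]: "f \<in> borel_measurable borel" using f by auto
 obtain C0 where C0: "\<And>t. t >= 1 ==> bnd (kern 1 \<alpha> 0 0 t) (C0 * t powr (- (real 0 + 1) / 2)) (C0 * t powr (- real 0 / 2))"
  using kern_bnd_large[OF \<alpha>, of 0] by blast
 obtain C1 where C1: "C1 > 0" "\<And>t. t >= 1 ==> bnd (kern 1 \<alpha> 1 0 t) (C1 * t powr (- (real 1 + 1) / 2)) (C1 * t powr (- real 1 / 2))"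
  using kern_bnd_large[OF \<alpha>, of 1] by blast
 obtain C2 where C2: "C2 > 0" "\<And>t. t >= 1 ==> bnd (kern 1 \<alpha> 2 0 t) (C2 * t powr (- (real 2 + 1) / 2)) (C2 * t powr (- real 2 / 2))"
  using kern_bnd_large[OF \<alpha>, of 2] by blast
 \<comment> \<open>The entry \<open>2 * C1 * \<bar>y\<bar>\<close> is the increment plus the linear
   correction; it is the dominating function, while the other entry tends to 0.\<close>
 define g where "g = (\<lambda>t y::real. min (2 * C1 * \<bar>y\<bar>) (C2 * y\<^sup>2 * t powr (- (1/2))))"
 have g0: "g t y >= 0" for t y using C1 C2 by (simp add: g_def)
 have gle: "g t y <= 2 * C1 * \<bar>y\<bar>" for t y by (simp add: g_def)
 have [measurable]: "g t \<in> borel_measurable borel" for t unfolding g_def by measurable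
 have ixf: "integrable lborel (\<lambda>y. 2 * C1 * \<bar>y * f y\<bar>)" using xf by (intro integrable_mult_right integrable_abs)
 have ig: "integrable lborel (\<lambda>y. g t y * \<bar>f y\<bar>)" for t
  by (rule bochner_integrable_bound[OF ixf]) (use g0 gle C1 in \<open>auto intro!: AE_I2 mult_right_mono simp: abs_mult mult.assoc[symmetric]\<close>)
 define e where "e = (\<lambda>t. LINT y|lborel. g t y * \<bar>f y\<bar>)"
 have e_lim: "(e \<longlongrightarrow> 0) at_top"
 proof -
  have "((\<lambda>t. LINT y|lborel. g t y * \<bar>f y\<bar>) \<longlongrightarrow> integral\<^sup>L lborel (\<lambda>y::real. 0::real)) at_top"
  proof (rule integral_dominated_convergence_at_top[where w="\<lambda>y. 2 * C1 * \<bar>y * f y\<bar>"])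
   show "AE y in lborel. ((\<lambda>t. g t y * \<bar>f y\<bar>) \<longlongrightarrow> 0) at_top"
   proof (intro AE_I2)
    fix y
    have "((\<lambda>t. C2 * y\<^sup>2 * t powr (- (1/2))) \<longlongrightarrow> C2 * y\<^sup>2 * 0) at_top"
     by (intro tendsto_mult tendsto_const tendsto_neg_powr filterlim_ident) auto
    then have "((\<lambda>t. min (2 * C1 * \<bar>y\<bar>) (C2 * y\<^sup>2 * t powr (- (1/2)))) \<longlongrightarrow> min (2 * C1 * \<bar>y\<bar>) 0) at_top"
     by (intro tendsto_min tendsto_const) simp
    then have "((\<lambda>t. g t y) \<longlongrightarrow> 0) at_top" using C1 by (simp add: g_def)
    then show "((\<lambda>t. g t y * \<bar>f y\<bar>) \<longlongrightarrow> 0) at_top" by (rule tendsto_mult_left_zero)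
   qed
   show "\<forall>\<^sub>F t in at_top. AE y in lborel. norm (g t y * \<bar>f y\<bar>) <= 2 * C1 * \<bar>y * f y\<bar>"
    using g0 gle by (auto intro!: always_eventually AE_I2 mult_right_mono simp: abs_mult mult.assoc[symmetric])
  qed (use ixf in auto)
  then show ?thesis by (simp add: e_def)
 qed
 have e0: "e t >= 0" for t unfolding e_def using g0 by (intro integral_nonneg_AE AE_I2) auto
 let ?q = "\<lambda>t x y. kern 1 \<alpha> 0 0 t (x - y) - kern 1 \<alpha> 0 0 t x + cplx y * kern 1 \<alpha> 1 0 t x"
 have q: "bnd (\<lambda>x. ?q t x y) (g t y / t) (g t y / sqrt t)" if t: "t >= 1" for t y
 proof -
  have t0: "t > 0" using t by simp
  have d0: "(kern 1 \<alpha> 0 0 t has_vector_derivative kern 1 \<alpha> 1 0 t x) (at x)" for x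
   using kern_has_vector_derivative[OF a, of 1 t 0 0 x] t0 by simp
  have d1: "(kern 1 \<alpha> 1 0 t has_vector_derivative kern 1 \<alpha> 2 0 t x) (at x)" for x
   using kern_has_vector_derivative[OF a, of 1 t 1 0 x] t0 by (simp add: numeral_2_eq_2)
  have c: "continuous_on UNIV (kern 1 \<alpha> j 0 t)" for j using a t0 by (intro continuous_on_kern) auto
  have "bnd (\<lambda>x. ?q t x y) (\<bar>y\<bar> * (C1 * t powr (- (real 1 + 1) / 2)) + norm (cplx y) * (C1 * t powr (- (real 1 + 1) / 2)))
    (\<bar>y\<bar> * (C1 * t powr (- real 1 / 2)) + norm (cplx y) * (C1 * t powr (- real 1 / 2)))"
   using C1(1) by (intro bnd_add bnd_increment[OF d0 c C1(2)[OF t]] bnd_cmult[OF C1(2)[OF t]]) auto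
  moreover have "bnd (\<lambda>x. ?q t x y) (y\<^sup>2 * (C2 * t powr (- (real 2 + 1) / 2))) (y\<^sup>2 * (C2 * t powr (- real 2 / 2)))"
   using C2(1) by (intro bnd_increment2[OF d0 d1 c C2(2)[OF t]]) auto
  ultimately have b: "bnd (\<lambda>x. ?q t x y) (min (\<bar>y\<bar> * (C1 * t powr (- (real 1 + 1) / 2)) + norm (cplx y) * (C1 * t powr (- (real 1 + 1) / 2))) (y\<^sup>2 * (C2 * t powr (- (real 2 + 1) / 2))))
    (min (\<bar>y\<bar> * (C1 * t powr (- real 1 / 2)) + norm (cplx y) * (C1 * t powr (- real 1 / 2))) (y\<^sup>2 * (C2 * t powr (- real 2 / 2))))"
   by (rule bnd_min)
  have p: "t powr (- (real 1 + 1) / 2) = 1 / t" "t powr (- real 1 / 2) = 1 / sqrt t"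
   "t powr (- (real 2 + 1) / 2) = t powr (- (1/2)) / t" "t powr (- real 2 / 2) = t powr (- (1/2)) / sqrt t"
  proof -
   show "t powr (- (real 1 + 1) / 2) = 1 / t" using t0 by (simp add: powr_minus_divide)
   show "t powr (- real 1 / 2) = 1 / sqrt t" using t0 by (simp add: powr_minus_divide powr_half_sqrt)
   show "t powr (- (real 2 + 1) / 2) = t powr (- (1/2)) / t" using t0 powr_diff[of t "- (1/2)" 1] by simp
   show "t powr (- real 2 / 2) = t powr (- (1/2)) / sqrt t" using t0 powr_diff[of t "- (1/2)" "1/2"] by (simp add: powr_half_sqrt)
  qed
  have mn: "min (A / u) (B / u) = min A B / u" if "u > 0" for A B u :: real using that by (simp add: min_divide_distrib_right)
  from b show ?thesis unfolding p
   by (rule bnd_mono) (use t0 in \<open>simp_all add: g_def min_divide_distrib_right mult_ac\<close>)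
 qed
 have "small (\<lambda>t x. LINT y|lborel. ?q t x y * cplx (f y))"
 proof (rule smallI[OF e_lim])
  show "\<forall>\<^sub>F t in at_top. 0 <= e t \<and> bnd (\<lambda>x. LINT y|lborel. ?q t x y * cplx (f y)) (e t / t) (e t / sqrt t)"
   using eventually_ge_at_top[of 1]
  proof eventually_elim
   case (elim t)
   have "bnd (\<lambda>x. LINT y|lborel. ?q t x y * cplx (f y)) (e t / t) (e t / sqrt t)"
   proof (rule bnd_superpose[where A="\<lambda>y. g t y * \<bar>f y\<bar> / t" and B="\<lambda>y. g t y * \<bar>f y\<bar> / sqrt t"])
    have b: "bnd (\<lambda>x. ?q t x y * cplx (f y)) (g t y * \<bar>f y\<bar> / t) (g t y * \<bar>f y\<bar> / sqrt t)" for y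
     using bnd_cmult[OF q[OF elim, of y], of "cplx (f y)"] by (simp add: mult_ac)
    then show "AE y in lborel. \<forall>x. norm (?q t x y * cplx (f y)) <= g t y * \<bar>f y\<bar> / t"
     "AE y in lborel. (nnL1 (\<lambda>x. ?q t x y * cplx (f y))) <= ennreal (g t y * \<bar>f y\<bar> / sqrt t)"
     unfolding bnd_def by auto
    show "AE y in lborel. 0 <= g t y * \<bar>f y\<bar> / sqrt t" using g0 elim by auto
    show "integrable lborel (\<lambda>y. g t y * \<bar>f y\<bar> / t)" "integrable lborel (\<lambda>y. g t y * \<bar>f y\<bar> / sqrt t)" using ig by auto
    show "(LINT y|lborel. g t y * \<bar>f y\<bar> / t) <= e t / t" "(LINT y|lborel. g t y * \<bar>f y\<bar> / sqrt t) <= e t / sqrt t" by (simp_all add: e_def)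
   qed (auto simp: lborel.sigma_finite_measure_axioms)
   then show ?case using e0 by simp
  qed
 qed
 then show ?thesis
 proof (rule small_cong)
  show "\<forall>\<^sub>F t in at_top. \<forall>x. (LINT y|lborel. ?q t x y * cplx (f y)) = (LINT y|lborel. kern 1 \<alpha> 0 0 t (x - y) * cplx (f y))
   - cplx (LINT y|lborel. f y) * kern 1 \<alpha> 0 0 t x + cplx (LINT y|lborel. y * f y) * kern 1 \<alpha> 1 0 t x"
   using eventually_ge_at_top[of 1]
  proof eventually_elim
   case (elim t)
   show ?case
   proof
    fix x
    have i1: "integrable lborel (\<lambda>y. kern 1 \<alpha> 0 0 t (x - y) * cplx (f y))"
     using f by (intro bnd_conv_integrable[OF C0[OF elim]]) simp
    have i2: "integrable lborel (\<lambda>y. kern 1 \<alpha> 0 0 t x * cplx (f y))" using f by auto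
    have i3: "integrable lborel (\<lambda>y. kern 1 \<alpha> 1 0 t x * cplx (y * f y))" using xf by (intro integrable_mult_right integrable_of_real)
    have "(LINT y|lborel. ?q t x y * cplx (f y)) = (LINT y|lborel. kern 1 \<alpha> 0 0 t (x - y) * cplx (f y) - kern 1 \<alpha> 0 0 t x * cplx (f y) + kern 1 \<alpha> 1 0 t x * cplx (y * f y))"
     by (intro bochner_integral_cong) (auto simp: algebra_simps)
    also have "\<dots> = (LINT y|lborel. kern 1 \<alpha> 0 0 t (x - y) * cplx (f y)) - (LINT y|lborel. kern 1 \<alpha> 0 0 t x * cplx (f y)) + (LINT y|lborel. kern 1 \<alpha> 1 0 t x * cplx (y * f y))"
     by (simp only: bochner_integral_add[OF Bochner_Integration.integrable_diff[OF i1 i2] i3] bochner_integral_diff[OF i1 i2])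
    also have "(LINT y|lborel. kern 1 \<alpha> 0 0 t x * cplx (f y)) = cplx (LINT y|lborel. f y) * kern 1 \<alpha> 0 0 t x"
     unfolding integral_mult_right_zero integral_complex_of_real by (rule mult.commute)
    also have "(LINT y|lborel. kern 1 \<alpha> 1 0 t x * cplx (y * f y)) = cplx (LINT y|lborel. y * f y) * kern 1 \<alpha> 1 0 t x"
     unfolding integral_mult_right_zero integral_complex_of_real by (rule mult.commute)
    finally show "(LINT y|lborel. ?q t x y * cplx (f y)) = (LINT y|lborel. kern 1 \<alpha> 0 0 t (x - y) * cplx (f y))
   - cplx (LINT y|lborel. f y) * kern 1 \<alpha> 0 0 t x + cplx (LINT y|lborel. y * f y) * kern 1 \<alpha> 1 0 t x" .
   qed
  qed
 qed
qed

text \<open>The mass remainder has sup size t^(-1/2 - n(\<alpha>-1)/2), which is o(1/t) when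
  n(\<alpha>-1) > 1; the dipole starts at 1/t, so any gain suffices. These two thresholds generate
  the cases of the theorem.\<close>

lemma small_kern_remainder:
 assumes \<alpha>: "\<alpha> > 1" and n: "real n * (\<alpha> - 1) > 1" and k: "k > 0"
 shows "small (\<lambda>t x. M * kern 1 \<alpha> 0 n t x - m * kern 1 \<alpha> 1 k t x)"
proof -
 have a: "\<alpha> > 0" and n0: "n > 0" using \<alpha> n by (auto intro: gr0I)
 obtain C where C: "C > 0" "\<And>t. t > 0 ==> bnd (kern 1 \<alpha> 0 n t) (C * t powr (- (real 0 + 1) / 2 - real n * ((\<alpha> - 1) / 2))) (C * t powr (- real 0 / 2 - real n * ((\<alpha> - 1) / 2)))"
  using kern_bnd_Suc[OF a n0, of 0] by blast
 obtain D where D: "D > 0" "\<And>t. t > 0 ==> bnd (kern 1 \<alpha> 1 k t) (D * t powr (- (real 1 + 1) / 2 - real k * ((\<alpha> - 1) / 2))) (D * t powr (- real 1 / 2 - real k * ((\<alpha> - 1) / 2)))"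
  using kern_bnd_Suc[OF a k, of 1] by blast
 have "small (kern 1 \<alpha> 0 n)"
 proof (rule small_powerI[where r="real n * ((\<alpha> - 1) / 2) - 1/2"])
  have "\<And>t. - (real 0 + 1) / 2 - real n * ((\<alpha> - 1) / 2) = - 1 - (real n * ((\<alpha> - 1) / 2) - 1/2)" "\<And>t. - real 0 / 2 - real n * ((\<alpha> - 1) / 2) = - 1 / 2 - (real n * ((\<alpha> - 1) / 2) - 1/2)" by auto
  then show "\<forall>\<^sub>F t in at_top. bnd (kern 1 \<alpha> 0 n t) (C * t powr (- 1 - (real n * ((\<alpha> - 1) / 2) - 1/2))) (C * t powr (- 1 / 2 - (real n * ((\<alpha> - 1) / 2) - 1/2)))"
   using C(2) by (intro eventually_mono[OF eventually_gt_at_top[of 0]]) simp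
 qed (use n C in auto)
 moreover have "small (kern 1 \<alpha> 1 k)"
 proof (rule small_powerI[where r="real k * ((\<alpha> - 1) / 2)"])
  show "\<forall>\<^sub>F t in at_top. bnd (kern 1 \<alpha> 1 k t) (D * t powr (- 1 - real k * ((\<alpha> - 1) / 2))) (D * t powr (- 1 / 2 - real k * ((\<alpha> - 1) / 2)))"
   using D(2) by (intro eventually_mono[OF eventually_gt_at_top[of 0]]) simp
 qed (use \<alpha> k D in auto)
 ultimately show ?thesis by (intro small_diff small_cmult)
qed

section \<open>First-order asymptotics of a decaying solution\<close>

locale decaying_solution = mild_solution +
 fixes K :: real
 assumes K0: "0 <= K" and dec: "\<And>t. 0 < t ==> decays v K t"
begin

definition cube :: "real => real => complex" where "cube \<tau> y = cplx (v \<tau> y ^ 3)"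

definition M :: real where "M = (LINT x|lborel. v 0 x)"

lemma cube_measurable [measurable]:
 assumes [measurable]: "f \<in> borel_measurable N" "g \<in> borel_measurable N"
 shows "(\<lambda>w. cube (f w) (g w)) \<in> borel_measurable N"
 unfolding cube_def by measurable

text \<open>The factor with 1 + t can be traded for any power in this range: b = 1 is the true decay
  at infinity, and b below 1 is integrable at time 0.\<close>

lemma cube_L1: 
 assumes t: "t > 0" and b: "1/4 <= b" "b <= 1"
 shows "(nnL1 (cube t)) <= ennreal (K ^ 3 * t powr (- b))"
proof -
 have vm: "v t \<in> borel_measurable borel" by measurable
 have "(1 + t) powr (- (3/4)) <= (1 + t) powr (- (b - 1/4))" using t b by (intro powr_mono) auto
 also have "\<dots> <= t powr (- (b - 1/4))" using t b by (intro powr_mono2') auto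
 finally have "t powr (- (1/4)) * (1 + t) powr (- (3/4)) <= t powr (- (1/4)) * t powr (- (b - 1/4))" by (intro mult_left_mono) auto
 also have "\<dots> = t powr (- b)" unfolding powr_add[symmetric] by simp
 finally have "K ^ 3 * (t powr (- (1/4)) * (1 + t) powr (- (3/4))) <= K ^ 3 * t powr (- b)" using K0 by (intro mult_left_mono) auto
 then show ?thesis using cube_bounds(3)[OF dec[OF t] t K0 vm] unfolding cube_def by (meson ennreal_leI order_trans)
qed

lemma cube_sup: 
 assumes t: "t > 0"
 shows "norm (cube t x) <= K ^ 3 * t powr (- (3/2))"
proof -
 have vm: "v t \<in> borel_measurable borel" by measurable
 have "(1 + t) powr (- (3/4)) <= t powr (- (3/4))" using t by (intro powr_mono2') auto
 then have "t powr (- (3/4)) * (1 + t) powr (- (3/4)) <= t powr (- (3/4)) * t powr (- (3/4))" by (intro mult_left_mono) auto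
 also have "\<dots> = t powr (- (3/2))" unfolding powr_add[symmetric] by simp
 finally have "K ^ 3 * (t powr (- (3/4)) * (1 + t) powr (- (3/4))) <= K ^ 3 * t powr (- (3/2))" using K0 by (intro mult_left_mono) auto
 then show ?thesis using cube_bounds(4)[OF dec[OF t] t K0 vm, of x] unfolding cube_def by linarith
qed

lemma v_sup: 
 assumes t: "t > 0"
 shows "\<bar>v t x\<bar> <= K * t powr (- (1/2))"
proof -
 have "(1 + t) powr (- (1/4)) <= t powr (- (1/4))" using t by (intro powr_mono2') auto
 then have "t powr (- (1/4)) * (1 + t) powr (- (1/4)) <= t powr (- (1/4)) * t powr (- (1/4))" by (intro mult_left_mono) auto
 also have "\<dots> = t powr (- (1/2))" unfolding powr_add[symmetric] by simp
 finally have "K * (t powr (- (1/4)) * (1 + t) powr (- (1/4))) <= K * t powr (- (1/2))" using K0 by (intro mult_left_mono) auto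
 then show ?thesis using decays_sup[OF dec[OF t] t, of x] by linarith
qed

text \<open>The forcing is given the decay exponent 7/8 in L^2, below 1 so that it remains
  integrable at 0. With the kernel rate 3/4 this yields 1 - 3/4 - 7/8 = -5/8, strictly better than
  the rate 1/2 of the main term.\<close>

lemma duhamel_sup:
 "\<exists>C\<ge>0. \<forall>t>0. \<forall>x. norm (duhamel \<alpha> cube t x) <= C * t powr (- (5/8))"
proof -
 from duhamel_bounds[OF \<alpha>_pos] obtain C where C: "C > 0" "duhamel_estimate \<alpha> C"
  by (elim exE conjE)
 obtain B where B: "B > 0" "\<And>t. t > 0 ==> (\<integral>\<^sup>+s. ennreal (indicator {0<..<t} s * ((t - s) powr (- (3/4)) * s powr (- (7/8)))) \<partial>lborel) <= ennreal (B * t powr (1 - 3/4 - 7/8))"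
  using nn_integral_beta[of "3/4" "7/8"] by auto
 define E where "E = (\<lambda>s::real. K ^ 3 * s powr (- (7/8)))"
 have Em: "E \<in> borel_measurable borel" unfolding E_def by measurable
 have fm: "(\<lambda>(s, y). cube s y) \<in> borel2" by measurable
 have "norm (duhamel \<alpha> cube t x) <= C * K ^ 3 * B * t powr (- (5/8))" if t: "t > 0" for t x
 proof -
  have "\<forall>s. 0 < s --> s < t --> integrable lborel (cube s) \<and> 0 <= E s \<and> (nnL2 (cube s)) <= ennreal ((E s)\<^sup>2)"
  proof (intro allI impI conjI)
   fix s assume s: "0 < s" "s < t"
   have ms: "v s \<in> borel_measurable borel" by measurable
   note cb = cube_bounds[OF dec[OF s(1)] s(1) K0 ms]
   show "integrable lborel (cube s)" unfolding cube_def by (rule cb(1))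
   have "(1 + s) powr (- (3/4)) <= (1 + s) powr (- (3/8))" using s by (intro powr_mono) auto
   also have "\<dots> <= s powr (- (3/8))" using s by (intro powr_mono2') auto
   finally have "s powr (- (1/2)) * (1 + s) powr (- (3/4)) <= s powr (- (1/2)) * s powr (- (3/8))" by (intro mult_left_mono) auto
   also have "\<dots> = s powr (- (7/8))" unfolding powr_add[symmetric] by simp
   finally have "K ^ 3 * (s powr (- (1/2)) * (1 + s) powr (- (3/4))) <= E s" unfolding E_def using K0 by (intro mult_left_mono) auto
   then have "(K ^ 3 * (s powr (- (1/2)) * (1 + s) powr (- (3/4))))\<^sup>2 <= (E s)\<^sup>2" using K0 by (intro power_mono) auto
   then show "(nnL2 (cube s)) <= ennreal ((E s)\<^sup>2)"
    using cb(2) unfolding cube_def by (meson ennreal_leI order_trans)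
   show "0 <= E s" using K0 by (simp add: E_def)
  qed
  from C(2)[rule_format, OF t fm Em this[rule_format]]
  have "ennreal (norm (duhamel \<alpha> cube t x)) <= (\<integral>\<^sup>+s. ennreal (C * (indicator {0<..<t} s * ((t - s) powr (- (3/4)) * E s))) \<partial>lborel)" by blast
  also have "\<dots> = (\<integral>\<^sup>+s. ennreal (C * K ^ 3) * ennreal (indicator {0<..<t} s * ((t - s) powr (- (3/4)) * s powr (- (7/8)))) \<partial>lborel)"
   using C(1) K0 by (intro nn_integral_cong) (subst ennreal_mult[symmetric], auto simp: E_def mult_ac)
  also have "\<dots> = ennreal (C * K ^ 3) * (\<integral>\<^sup>+s. ennreal (indicator {0<..<t} s * ((t - s) powr (- (3/4)) * s powr (- (7/8)))) \<partial>lborel)"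
   by (rule nn_integral_cmult) measurable
  also have "\<dots> <= ennreal (C * K ^ 3) * ennreal (B * t powr (1 - 3/4 - 7/8))" by (intro mult_left_mono B t) auto
  also have "\<dots> = ennreal (C * K ^ 3 * (B * t powr (1 - 3/4 - 7/8)))" using C(1) K0 B(1) by (subst ennreal_mult[symmetric]) auto
  finally show ?thesis using C(1) K0 B(1) by (simp add: ennreal_le_iff mult.assoc)
 qed
 moreover have "C * K ^ 3 * B >= 0" using C(1) K0 B(1) by simp
 ultimately show ?thesis by blast
qed

lemma first_order:
 "\<exists>C\<ge>0. \<exists>\<epsilon>>0. \<forall>t\<ge>1. \<forall>x. \<bar>v t x - M * heat t x\<bar> <= C * t powr (- (1/2) - \<epsilon>)"
proof -
 obtain CD where CD: "CD >= 0" "\<And>t x. t > 0 ==> norm (duhamel \<alpha> cube t x) <= CD * t powr (- (5/8))" using duhamel_sup by blast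
 obtain C1 where C1: "C1 > 0" "\<And>t. t >= 1 ==> bnd (kern 1 \<alpha> 1 0 t) (C1 * t powr (- (real 1 + 1) / 2)) (C1 * t powr (- real 1 / 2))"
  using kern_bnd_large[OF \<alpha>(1), of 1] by blast
 obtain C0 where C0: "\<And>t. t >= 1 ==> bnd (kern 1 \<alpha> 0 0 t) (C0 * t powr (- (real 0 + 1) / 2)) (C0 * t powr (- real 0 / 2))"
  using kern_bnd_large[OF \<alpha>(1), of 0] by blast
 obtain C2 where C2: "C2 > 0" "\<And>t. t > 0 ==> bnd (kern 1 \<alpha> 0 1 t) (C2 * t powr (- (real 0 + 1) / 2 - real 1 * ((\<alpha> - 1) / 2))) (C2 * t powr (- real 0 / 2 - real 1 * ((\<alpha> - 1) / 2)))"
  using kern_bnd_Suc[OF \<alpha>_pos, of 1 0] by auto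
 define X where "X = (LINT y|lborel. \<bar>y * v 0 y\<bar>)"
 have X0: "X >= 0" by (simp add: X_def)
 define \<epsilon> where "\<epsilon> = min ((\<alpha> - 1) / 2) (1/8)"
 have "\<epsilon> > 0" using \<alpha> by (simp add: \<epsilon>_def)
 moreover have "\<epsilon> <= (\<alpha> - 1) / 2" unfolding \<epsilon>_def by (rule min.cobounded1)
 moreover have "\<epsilon> <= 1/8" unfolding \<epsilon>_def by (rule min.cobounded2)
 ultimately have \<epsilon>: "\<epsilon> > 0" "\<epsilon> <= (\<alpha> - 1) / 2" "\<epsilon> <= 1/8" by auto
 define C where "C = C1 * X + \<bar>M\<bar> * C2 + \<bar>\<beta> / 3\<bar> * CD"
 have C: "C >= 0" using C1(1) C2(1) CD(1) X0 by (simp add: C_def)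
 have "\<bar>v t x - M * heat t x\<bar> <= C * t powr (- (1/2) - \<epsilon>)" if t: "t >= 1" for t x
 proof -
  have t0: "t > 0" using t by simp
  have lin: "norm ((LINT y|lborel. kern 1 \<alpha> 0 0 t (x - y) * cplx (v 0 y)) - cplx M * kern 1 \<alpha> 0 0 t x) <= C1 * X * t powr (- 1)" for x
  proof -
   have [measurable]: "v 0 \<in> borel_measurable borel" by measurable
   have i1: "integrable lborel (\<lambda>y. kern 1 \<alpha> 0 0 t (x - y) * cplx (v 0 y))"
    using v0_int by (intro bnd_conv_integrable[OF C0[OF t]]) simp
   have i2: "integrable lborel (\<lambda>y. kern 1 \<alpha> 0 0 t x * cplx (v 0 y))" using v0_int by auto
   have "(LINT y|lborel. kern 1 \<alpha> 0 0 t x * cplx (v 0 y)) = cplx M * kern 1 \<alpha> 0 0 t x"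
    unfolding M_def integral_mult_right_zero integral_complex_of_real by (rule mult.commute)
   then have "(LINT y|lborel. kern 1 \<alpha> 0 0 t (x - y) * cplx (v 0 y)) - cplx M * kern 1 \<alpha> 0 0 t x =
     (LINT y|lborel. kern 1 \<alpha> 0 0 t (x - y) * cplx (v 0 y) - kern 1 \<alpha> 0 0 t x * cplx (v 0 y))"
    by (simp only: bochner_integral_diff[OF i1 i2])
   also have "norm \<dots> <= (LINT y|lborel. C1 * t powr (- 1) * \<bar>y * v 0 y\<bar>)"
   proof (rule Bochner_Integration.integral_norm_bound_integral)
    fix y :: real
    have d0: "(kern 1 \<alpha> 0 0 t has_vector_derivative kern 1 \<alpha> 1 0 t x) (at x)" for x
     using kern_has_vector_derivative[OF \<alpha>_pos, of 1 t 0 0 x] t0 by simp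
    have c: "continuous_on UNIV (kern 1 \<alpha> 1 0 t)" using \<alpha>_pos t0 by (intro continuous_on_kern) auto
    have "bnd (\<lambda>x. kern 1 \<alpha> 0 0 t (x - y) - kern 1 \<alpha> 0 0 t x) (\<bar>y\<bar> * (C1 * t powr (- (real 1 + 1) / 2))) (\<bar>y\<bar> * (C1 * t powr (- real 1 / 2)))"
     using C1(1) by (intro bnd_increment[OF d0 c C1(2)[OF t]]) auto
    then have "norm (kern 1 \<alpha> 0 0 t (x - y) - kern 1 \<alpha> 0 0 t x) <= \<bar>y\<bar> * (C1 * t powr (- 1))" by (simp add: bnd_def)
    then have "norm (kern 1 \<alpha> 0 0 t (x - y) - kern 1 \<alpha> 0 0 t x) * \<bar>v 0 y\<bar> <= \<bar>y\<bar> * (C1 * t powr (- 1)) * \<bar>v 0 y\<bar>" by (intro mult_right_mono) auto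
    then show "norm (kern 1 \<alpha> 0 0 t (x - y) * cplx (v 0 y) - kern 1 \<alpha> 0 0 t x * cplx (v 0 y)) <= C1 * t powr (- 1) * \<bar>y * v 0 y\<bar>"
     unfolding left_diff_distrib[symmetric] norm_mult norm_of_real abs_mult by (simp add: mult_ac)
   qed (use i1 i2 v0_mom in \<open>auto intro!: integrable_mult_right integrable_abs\<close>)
   also have "\<dots> = C1 * X * t powr (- 1)" by (simp only: integral_mult_right_zero X_def mult_ac)
   finally show ?thesis .
  qed
  have "AE x in lborel. \<bar>v t x - M * heat t x\<bar> <= C * t powr (- (1/2) - \<epsilon>)"
   using mild[OF t0]
  proof eventually_elim
   case (elim x)
   have ks: "kern 1 \<alpha> 0 0 t x = kern 1 \<alpha> 0 1 t x + cplx (heat t x)"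
    using kern_Suc[OF \<alpha>_pos t0, of 0 x] kern_heat[OF t0, of \<alpha> x] by simp
   let ?L = "LINT y|lborel. kern 1 \<alpha> 0 0 t (x - y) * cplx (v 0 y)"
   have "cplx (v t x - M * heat t x) = (?L - cplx M * kern 1 \<alpha> 0 0 t x) + cplx M * kern 1 \<alpha> 0 1 t x - cplx (\<beta> / 3) * duhamel \<alpha> cube t x"
    unfolding of_real_diff elim of_real_mult ks cube_def by (simp add: algebra_simps)
   then have "\<bar>v t x - M * heat t x\<bar> = norm ((?L - cplx M * kern 1 \<alpha> 0 0 t x) + cplx M * kern 1 \<alpha> 0 1 t x - cplx (\<beta> / 3) * duhamel \<alpha> cube t x)"
    by (metis norm_of_real)
   also have "\<dots> <= C1 * X * t powr (- 1) + \<bar>M\<bar> * (C2 * t powr (- (1/2) - (\<alpha> - 1) / 2)) + \<bar>\<beta> / 3\<bar> * (CD * t powr (- (5/8)))"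
   proof (rule order_trans[OF norm_triangle_ineq4 add_mono[OF order_trans[OF norm_triangle_ineq add_mono[OF lin]]]])
    show "norm (cplx M * kern 1 \<alpha> 0 1 t x) <= \<bar>M\<bar> * (C2 * t powr (- (1/2) - (\<alpha> - 1) / 2))"
     using C2(2)[OF t0] by (simp add: bnd_def norm_mult mult_left_mono)
    show "norm (cplx (\<beta> / 3) * duhamel \<alpha> cube t x) <= \<bar>\<beta> / 3\<bar> * (CD * t powr (- (5/8)))"
     unfolding norm_mult norm_of_real by (intro mult_left_mono CD t0) auto
   qed
   also have "\<dots> <= C1 * X * t powr (- (1/2) - \<epsilon>) + \<bar>M\<bar> * (C2 * t powr (- (1/2) - \<epsilon>)) + \<bar>\<beta> / 3\<bar> * (CD * t powr (- (1/2) - \<epsilon>))"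
    using t \<epsilon> C1(1) C2(1) CD(1) X0 by (intro add_mono mult_left_mono powr_mono) auto
   finally show ?case by (simp add: C_def algebra_simps)
  qed
  moreover have "continuous_on UNIV (\<lambda>x. \<bar>v t x - M * heat t x\<bar>)"
   unfolding heat_def using t0 by (intro continuous_intros v_cont) auto
  ultimately show ?thesis by (intro continuous_AE_le[of "\<lambda>x. \<bar>v t x - M * heat t x\<bar>"])
 qed
 with C \<epsilon>(1) show ?thesis by blast
qed

end

section \<open>Duhamel integrals over early and late times\<close>

lemma powr_from_0:
 fixes a c :: real
 assumes a: "a > -1" and c: "c >= 0"
 shows "integrable lborel (\<lambda>x. indicator {0..c} x * x powr a)" "(LINT x|lborel. indicator {0..c} x * x powr a) = c powr (a + 1) / (a + 1)"
proof -
 have "((\<lambda>x. if x \<in> {0..c} then x powr a else 0) has_integral c powr (a + 1) / (a + 1)) UNIV"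
  using has_integral_powr_from_0[OF a c] by (simp only: has_integral_restrict_UNIV)
 moreover have eq: "(\<lambda>x. if x \<in> {0..c} then x powr a else 0) = (\<lambda>x. indicator {0..c} x * x powr a)" by (auto simp: indicator_def)
 ultimately have "(\<integral>\<^sup>+x. ennreal (indicator {0..c} x * x powr a) \<partial>lborel) = ennreal (c powr (a + 1) / (a + 1))"
  by (intro nn_integral_has_integral_lborel) auto
 moreover have "0 <= c powr (a + 1) / (a + 1)" using a by simp
 ultimately have "has_bochner_integral lborel (\<lambda>x. indicator {0..c} x * x powr a) (c powr (a + 1) / (a + 1))"
  by (intro has_bochner_integral_nn_integral) auto
 then show "integrable lborel (\<lambda>x. indicator {0..c} x * x powr a)" "(LINT x|lborel. indicator {0..c} x * x powr a) = c powr (a + 1) / (a + 1)"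
  by (auto simp: has_bochner_integral_iff)
qed

lemma powr_near_t:
 fixes \<gamma> t :: real
 assumes g: "\<gamma> < 1" and t: "t > 0"
 shows "integrable lborel (\<lambda>s. indicator {t/2..<t} s * (t - s) powr (- \<gamma>))" "(LINT s|lborel. indicator {t/2..<t} s * (t - s) powr (- \<gamma>)) = (t / 2) powr (1 - \<gamma>) / (1 - \<gamma>)"
proof -
 have eq: "(\<lambda>s. indicator {t/2..<t} s * (t - s) powr (- \<gamma>)) = (\<lambda>s. indicator {0..t/2} (t + (-1) * s) * (t + (-1) * s) powr (- \<gamma>))"
  using t by (auto simp: fun_eq_iff indicator_def)
 have a: "- \<gamma> > -1" "t / 2 >= 0" using g t by auto
 show "integrable lborel (\<lambda>s. indicator {t/2..<t} s * (t - s) powr (- \<gamma>))"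
  unfolding eq by (rule lborel_integrable_real_affine[OF powr_from_0(1)[OF a]]) simp
 show "(LINT s|lborel. indicator {t/2..<t} s * (t - s) powr (- \<gamma>)) = (t / 2) powr (1 - \<gamma>) / (1 - \<gamma>)"
  unfolding eq using lborel_integral_real_affine[of "-1" "\<lambda>x. indicator {0..t/2} x * x powr (- \<gamma>)" t] powr_from_0(2)[OF a] by (simp add: add.commute)
qed

lemma powr_to_inf:
 fixes a :: real
 assumes a: "a < -1"
 shows "integrable lborel (\<lambda>x. indicator {1..} x * x powr a)"
proof -
 have "((\<lambda>x. if x \<in> {1..} then x powr a else 0) has_integral - (1 powr (a + 1)) / (a + 1)) UNIV"
  using has_integral_powr_to_inf[OF a, of 1] by (simp only: has_integral_restrict_UNIV)
 moreover have eq: "(\<lambda>x. if x \<in> {1..} then x powr a else 0) = (\<lambda>x::real. indicator {1..} x * x powr a)" by (auto simp: indicator_def)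
 ultimately have "(\<integral>\<^sup>+x. ennreal (indicator {1..} x * x powr a) \<partial>lborel) = ennreal (- (1 powr (a + 1)) / (a + 1))"
  by (intro nn_integral_has_integral_lborel) auto
 then show ?thesis by (intro integrableI_nonneg) auto
qed

definition duh :: "(real => real => complex) => (real => real => complex) => real set => real => real => complex" where
 "duh k f A t x = (LINT \<tau>|lborel. indicator A \<tau> *\<^sub>R (LINT y|lborel. k (t - \<tau>) (x - y) * f \<tau> y))"

lemma conv_measurable2:
 fixes k f :: "real => real => complex"
 assumes [measurable]: "(\<lambda>(s, x). k s x) \<in> borel2" "(\<lambda>(s, y). f s y) \<in> borel2"
 shows "(\<lambda>(x, \<tau>). LINT y|lborel. k (t - \<tau>) (x - y) * f \<tau> y) \<in> borel2"
proof -
 have 1: "(\<lambda>p. (\<lambda>(s, x). k s x) (t - snd (fst p), fst (fst p) - snd p)) \<in> borel_measurable ((borel \<Otimes>\<^sub>M borel) \<Otimes>\<^sub>M borel)"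
  by (rule measurable_compose[OF _ assms(1)]) measurable
 have 2: "(\<lambda>p. (\<lambda>(s, x). f s x) (snd (fst p), snd p)) \<in> borel_measurable ((borel \<Otimes>\<^sub>M borel) \<Otimes>\<^sub>M borel)"
  by (rule measurable_compose[OF _ assms(2)]) measurable
 have 3: "(\<lambda>(z, y). k (t - snd z) (fst z - y) * f (snd z) y) \<in> borel_measurable ((borel \<Otimes>\<^sub>M borel) \<Otimes>\<^sub>M lborel)"
  using borel_measurable_times[OF 1 2] by (simp add: split_beta')
 have "(\<lambda>z. LINT y|lborel. k (t - snd z) (fst z - y) * f (snd z) y) \<in> borel2"
  by (rule lborel.borel_measurable_lebesgue_integral[OF 3])
 then show ?thesis by (simp add: split_beta')
qed

lemma duh_bnd:
 fixes a b :: "real => real"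
 assumes km: "(\<lambda>(s, x). k s x) \<in> borel2" and fm: "(\<lambda>(s, y). f s y) \<in> borel2"
  and Am [measurable]: "A \<in> sets borel"
  and b: "\<And>s. s \<in> A ==> bnd (\<lambda>x. LINT y|lborel. k (t - s) (x - y) * f s y) (c1 * g s) (c2 * g s)"
  and g: "integrable lborel (\<lambda>s. indicator A s * g s)" "(LINT s|lborel. indicator A s * g s) <= G" and g0: "\<And>s. s \<in> A ==> 0 <= g s" and c: "0 <= c1" "0 <= c2"
 shows "bnd (duh k f A t) (c1 * G) (c2 * G)"
proof -
 note m = conv_measurable2[OF km fm, of t]
 have m2: "(\<lambda>x. LINT y|lborel. k (t - snd x) (fst x - y) * f (snd x) y) \<in> borel2"
  using m by (simp add: split_beta')
 show ?thesis unfolding duh_def[abs_def]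
 proof (rule bnd_superpose[where A="\<lambda>s. c1 * (indicator A s * g s)" and B="\<lambda>s. c2 * (indicator A s * g s)"])
  have "(\<lambda>z. indicator A (snd z) *\<^sub>R (LINT y|lborel. k (t - snd z) (fst z - y) * f (snd z) y)) \<in> borel2"
   using m2 by (intro borel_measurable_scaleR) auto
  then show "(\<lambda>(x, s). indicator A s *\<^sub>R (LINT y|lborel. k (t - s) (x - y) * f s y)) \<in> borel_measurable (lborel \<Otimes>\<^sub>M lborel)"
   by (simp add: split_beta')
  show "AE s in lborel. \<forall>x. norm (indicator A s *\<^sub>R (LINT y|lborel. k (t - s) (x - y) * f s y)) <= c1 * (indicator A s * g s)"
   using b unfolding bnd_def by (intro AE_I2) (auto simp: indicator_def)
  show "AE s in lborel. (nnL1 (\<lambda>x. indicator A s *\<^sub>R (LINT y|lborel. k (t - s) (x - y) * f s y))) <= ennreal (c2 * (indicator A s * g s))"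
   using b unfolding bnd_def by (intro AE_I2) (auto simp: indicator_def)
  show "AE s in lborel. 0 <= c2 * (indicator A s * g s)" using g0 c by (intro AE_I2) (auto simp: indicator_def)
  show "(LINT s|lborel. c1 * (indicator A s * g s)) <= c1 * G" "(LINT s|lborel. c2 * (indicator A s * g s)) <= c2 * G"
   using g c by (auto intro: mult_left_mono)
 qed (use g in \<open>auto simp: lborel.sigma_finite_measure_axioms\<close>)
qed

lemma duh_integrable:
 assumes km: "(\<lambda>(s, x). k s x) \<in> borel2" and fm: "(\<lambda>(s, y). f s y) \<in> borel2"
  and k: "\<And>s. s > 0 ==> bnd (k s) (A s) (C * s powr (- \<gamma>))" "C >= 0" "\<gamma> < 1"
  and f: "\<And>s y. s > 0 ==> norm (f s y) <= S * s powr (- (3/4))" "\<And>s. s > 0 ==> \<exists>F\<ge>0. (nnL1 (f s)) <= ennreal F"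
  and t: "t > 0"
 shows "integrable lborel (\<lambda>s. indicator {0<..<t} s *\<^sub>R (LINT y|lborel. k (t - s) (x - y) * f s y))"
proof -
 obtain B where B: "\<And>t. t > 0 ==> (\<integral>\<^sup>+s. ennreal (indicator {0<..<t} s * ((t - s) powr (- \<gamma>) * s powr (- (3/4)))) \<partial>lborel) <= ennreal (B * t powr (1 - \<gamma> - 3/4))"
  using nn_integral_beta[OF k(3), of "3/4"] by auto
 note m = conv_measurable2[OF km fm, of t]
 have m1 [measurable]: "(\<lambda>s. LINT y|lborel. k (t - s) (x - y) * f s y) \<in> borel_measurable borel"
  using measurable_Pair2[OF m, of x] by simp
 have S0: "S >= 0" using order_trans[OF norm_ge_zero f(1)[of 1 0]] by simp
 have le: "norm (indicator {0<..<t} s *\<^sub>R (LINT y|lborel. k (t - s) (x - y) * f s y)) <= (C * S) * (indicator {0<..<t} s * ((t - s) powr (- \<gamma>) * s powr (- (3/4))))" for s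
 proof (cases "s \<in> {0<..<t}")
  case True
  then have s: "s > 0" "t - s > 0" by auto
  obtain F where F: "F >= 0" "(nnL1 (f s)) <= ennreal F" using f(2)[OF s(1)] by blast
  have fs: "f s \<in> borel_measurable borel" using measurable_Pair2[OF fm, of s] by simp
  have "bnd (\<lambda>x. LINT y|lborel. k (t - s) (x - y) * f s y) (C * (t - s) powr (- \<gamma>) * (S * s powr (- (3/4)))) (C * (t - s) powr (- \<gamma>) * F)"
   by (rule bnd_cnv(1)[OF k(1)[OF s(2)] _ fs f(1)[OF s(1)] F(2,1)]) (use k in simp)
  then show ?thesis using True by (simp add: bnd_def mult_ac)
 qed simp
 show ?thesis
 proof (rule integrableI_bounded)
  have "(nnL1 (\<lambda>s. indicator {0<..<t} s *\<^sub>R (LINT y|lborel. k (t - s) (x - y) * f s y)))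
    <= (\<integral>\<^sup>+s. ennreal (C * S) * ennreal (indicator {0<..<t} s * ((t - s) powr (- \<gamma>) * s powr (- (3/4)))) \<partial>lborel)"
   using le k S0 by (intro nn_integral_mono) (subst ennreal_mult[symmetric], auto intro!: ennreal_leI)
  also have "\<dots> = ennreal (C * S) * (\<integral>\<^sup>+s. ennreal (indicator {0<..<t} s * ((t - s) powr (- \<gamma>) * s powr (- (3/4)))) \<partial>lborel)"
   by (rule nn_integral_cmult) measurable
  also have "\<dots> <= ennreal (C * S) * ennreal (B * t powr (1 - \<gamma> - 3/4))" by (intro mult_left_mono B t) auto
  also have "\<dots> < \<infinity>" by (simp add: ennreal_mult_less_top)
  finally show "(nnL1 (\<lambda>s. indicator {0<..<t} s *\<^sub>R (LINT y|lborel. k (t - s) (x - y) * f s y))) < \<infinity>" .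
 qed measurable
qed

lemma duh_split:
 assumes i: "integrable lborel (\<lambda>s. indicator {0<..<t} s *\<^sub>R (LINT y|lborel. k (t - s) (x - y) * f s y))" and t: "t > 0"
 shows "duh k f {0<..<t} t x = duh k f {0<..<t/2} t x + duh k f {t/2..<t} t x"
proof -
 let ?W = "\<lambda>s. LINT y|lborel. k (t - s) (x - y) * f s y"
 have si: "set_integrable lborel {0<..<t} ?W" using i by (simp add: set_integrable_def)
 have "set_integrable lborel {0<..<t/2} ?W" "set_integrable lborel {t/2..<t} ?W"
  using t by (auto intro: set_integrable_subset[OF si])
 then have "(LINT s|lborel. indicator {0<..<t/2} s *\<^sub>R ?W s) + (LINT s|lborel. indicator {t/2..<t} s *\<^sub>R ?W s) = (LINT s|lborel. indicator {0<..<t/2} s *\<^sub>R ?W s + indicator {t/2..<t} s *\<^sub>R ?W s)"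
  unfolding set_integrable_def by (rule bochner_integral_add[symmetric])
 also have "(\<lambda>s. indicator {0<..<t/2} s *\<^sub>R ?W s + indicator {t/2..<t} s *\<^sub>R ?W s) = (\<lambda>s. indicator {0<..<t} s *\<^sub>R ?W s)"
  using t by (auto simp: fun_eq_iff indicator_def)
 finally show ?thesis by (simp add: duh_def)
qed

lemma small_halfI:
 assumes r: "r > 0" and C: "C >= 0" and b: "\<forall>\<^sub>F t in at_top. bnd (E t) (C * (t / 2) powr (- 1 - r)) (C * (t / 2) powr (- 1 / 2 - r))"
 shows "small E"
proof (rule small_powerI[OF r, where C="C * 2 powr (1 + r)"])
 show "\<forall>\<^sub>F t in at_top. bnd (E t) (C * 2 powr (1 + r) * t powr (- 1 - r)) (C * 2 powr (1 + r) * t powr (- 1 / 2 - r))"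
  using b eventually_gt_at_top[of 0]
 proof eventually_elim
  case (elim t)
  have h: "(t / 2) powr (- p) = 2 powr p * t powr (- p)" for p using elim by (simp add: powr_divide powr_minus field_simps)
  have 1: "(t / 2) powr (- 1 - r) = 2 powr (1 + r) * t powr (- 1 - r)" using h[of "1 + r"] by (simp add: algebra_simps)
  have "(t / 2) powr (- 1 / 2 - r) = 2 powr (1 / 2 + r) * t powr (- 1 / 2 - r)" proof -
   have e: "- 1 / 2 - r = - (1 / 2 + r)" by simp
   show ?thesis unfolding e by (rule h)
  qed
  also have "\<dots> <= 2 powr (1 + r) * t powr (- 1 / 2 - r)" by (intro mult_right_mono powr_mono) auto
  finally have 2: "C * (t / 2) powr (- 1 / 2 - r) <= C * (2 powr (1 + r) * t powr (- 1 / 2 - r))" using C by (rule mult_left_mono)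
  show ?case by (rule bnd_mono[OF elim(1)]) (use 1 2 in \<open>simp_all add: mult.assoc\<close>)
 qed
qed (use C in simp)

text \<open>On the later half of the time interval the kernel is taken in L^1, where its singularity
  is integrable, and the forcing supplies the decay. The exponents add up to -1 -
  (\<open>\<gamma>\<close> - 1/2 + \<open>\<epsilon>\<close>): the gain may come from a kernel more
  singular than 1/2 or from faster decaying forcing.\<close>

lemma small_duh_near:
 assumes km: "(\<lambda>(s, x). k s x) \<in> borel2" and fm: "(\<lambda>(s, y). f s y) \<in> borel2"
  and k: "\<And>s. s > 0 ==> bnd (k s) (A s) (C * s powr (- \<gamma>))" "C >= 0" "\<gamma> < 1"
  and f: "\<And>s y. s >= 1 ==> norm (f s y) <= S * s powr (- (3/2) - \<epsilon>)" "\<And>s. s >= 1 ==> (nnL1 (f s)) <= ennreal (S * s powr (- 1 - \<epsilon>))"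
  and e: "\<epsilon> >= 0" "\<gamma> - 1/2 + \<epsilon> > 0"
 shows "small (\<lambda>t. duh k f {t/2..<t} t)"
proof -
 have S0: "S >= 0" using order_trans[OF norm_ge_zero f(1)[of 1 0]] by simp
 define r where "r = \<gamma> - 1/2 + \<epsilon>"
 define C' where "C' = C * S / (1 - \<gamma>)"
 show ?thesis
 proof (rule small_halfI[where r=r and C=C'])
  show "\<forall>\<^sub>F t in at_top. bnd (duh k f {t/2..<t} t) (C' * (t / 2) powr (- 1 - r)) (C' * (t / 2) powr (- 1 / 2 - r))"
   using eventually_ge_at_top[of 2]
  proof eventually_elim
   case (elim t)
   then have t: "t > 0" "t / 2 >= 1" by auto
   have "bnd (duh k f {t/2..<t} t) (C * S * (t / 2) powr (- (3/2) - \<epsilon>) * ((t / 2) powr (1 - \<gamma>) / (1 - \<gamma>))) (C * S * (t / 2) powr (- 1 - \<epsilon>) * ((t / 2) powr (1 - \<gamma>) / (1 - \<gamma>)))"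
   proof (rule duh_bnd[OF km fm, where g="\<lambda>s. (t - s) powr (- \<gamma>)"])
    fix s assume s: "s \<in> {t/2..<t}"
    then have s1: "s >= 1" "t - s > 0" using t by auto
    have fs: "f s \<in> borel_measurable borel" using measurable_Pair2[OF fm, of s] by simp
    have F0: "0 <= S * s powr (- 1 - \<epsilon>)" using S0 by simp
    have "bnd (\<lambda>x. LINT y|lborel. k (t - s) (x - y) * f s y) (C * (t - s) powr (- \<gamma>) * (S * s powr (- (3/2) - \<epsilon>))) (C * (t - s) powr (- \<gamma>) * (S * s powr (- 1 - \<epsilon>)))"
     by (rule bnd_cnv(1)[OF k(1)[OF s1(2)] _ fs f(1)[OF s1(1)] f(2)[OF s1(1)] F0]) (use k in simp)
    then show "bnd (\<lambda>x. LINT y|lborel. k (t - s) (x - y) * f s y) (C * S * (t / 2) powr (- (3/2) - \<epsilon>) * (t - s) powr (- \<gamma>)) (C * S * (t / 2) powr (- 1 - \<epsilon>) * (t - s) powr (- \<gamma>))"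
    proof (rule bnd_mono)
     have "s powr (- a) <= (t / 2) powr (- a)" if "a >= 0" for a using s t that by (intro powr_mono2') auto
     from this[of "3/2 + \<epsilon>"] this[of "1 + \<epsilon>"] e have p: "s powr (- (3/2) - \<epsilon>) <= (t / 2) powr (- (3/2) - \<epsilon>)" "s powr (- 1 - \<epsilon>) <= (t / 2) powr (- 1 - \<epsilon>)" by auto
     have "C * (t - s) powr (- \<gamma>) * (S * X) <= C * S * Y * (t - s) powr (- \<gamma>)" if "X <= Y" for X Y
     proof -
      have "(C * S * (t - s) powr (- \<gamma>)) * X <= (C * S * (t - s) powr (- \<gamma>)) * Y" using that k S0 by (intro mult_left_mono) auto
      then show ?thesis by (simp add: mult_ac)
     qed
     with p show "C * (t - s) powr (- \<gamma>) * (S * s powr (- (3/2) - \<epsilon>)) <= C * S * (t / 2) powr (- (3/2) - \<epsilon>) * (t - s) powr (- \<gamma>)" "C * (t - s) powr (- \<gamma>) * (S * s powr (- 1 - \<epsilon>)) <= C * S * (t / 2) powr (- 1 - \<epsilon>) * (t - s) powr (- \<gamma>)" by auto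
    qed
   qed (use powr_near_t[OF k(3) t(1)] k S0 in auto)
   moreover have "C * S * (t / 2) powr (- (3/2) - \<epsilon>) * ((t / 2) powr (1 - \<gamma>) / (1 - \<gamma>)) = C' * (t / 2) powr (- 1 - r)"
   proof -
    have "(t / 2) powr (- (3/2) - \<epsilon>) * (t / 2) powr (1 - \<gamma>) = (t / 2) powr (- 1 - r)" unfolding powr_add[symmetric] r_def by (rule arg_cong[where f="\<lambda>a. (t / 2) powr a"]) simp
    then show ?thesis by (simp add: C'_def)
   qed
   moreover have "C * S * (t / 2) powr (- 1 - \<epsilon>) * ((t / 2) powr (1 - \<gamma>) / (1 - \<gamma>)) = C' * (t / 2) powr (- 1 / 2 - r)"
   proof -
    have "(t / 2) powr (- 1 - \<epsilon>) * (t / 2) powr (1 - \<gamma>) = (t / 2) powr (- 1 / 2 - r)" unfolding powr_add[symmetric] r_def by (rule arg_cong[where f="\<lambda>a. (t / 2) powr a"]) simp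
    then show ?thesis by (simp add: C'_def)
   qed
   ultimately show ?case by simp
  qed
 qed (use e k S0 in \<open>auto simp: r_def C'_def\<close>)
qed

section \<open>The dispersive part of the Duhamel kernel is negligible\<close>

context decaying_solution
begin

lemma cube_meas_pair: "(\<lambda>(s, y). cube s y) \<in> borel2" by measurable

lemma cube_sup34: "t > 0 ==> norm (cube t x) <= K ^ 3 * t powr (- (3/4))"
proof -
 assume t: "t > 0"
 have vm: "v t \<in> borel_measurable borel" by measurable
 have "(1 + t) powr (- (3/4)) <= 1 powr (- (3/4))" using t by (intro powr_mono2') auto
 then have "t powr (- (3/4)) * (1 + t) powr (- (3/4)) <= t powr (- (3/4)) * 1" by (intro mult_left_mono) auto
 then have "K ^ 3 * (t powr (- (3/4)) * (1 + t) powr (- (3/4))) <= K ^ 3 * t powr (- (3/4))" using K0 by (intro mult_left_mono) auto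
 then show ?thesis using cube_bounds(4)[OF dec[OF t] t K0 vm, of x] unfolding cube_def by linarith
qed

lemma cube_L1_ex: "t > 0 ==> \<exists>F\<ge>0. (nnL1 (cube t)) <= ennreal F"
 using cube_L1[of t 1] K0 by (intro exI[of _ "K ^ 3 * t powr (- 1)"]) auto

lemma N1_integrable:
 assumes t: "t > 0"
 shows "integrable lborel (\<lambda>s. indicator {0<..<t} s *\<^sub>R (LINT y|lborel. kern 1 \<alpha> 1 1 (t - s) (x - y) * cube s y))"
proof -
 obtain C where C: "C > 0" "\<And>t. t > 0 ==> bnd (kern 1 \<alpha> 1 1 t) (C * t powr (- 1 - (\<alpha> - 1) / 2)) (C * t powr (- ((\<alpha> + 1) / 4)))"
  using dkern_diff_bnd[OF \<alpha>(1)] by blast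
 show ?thesis
  by (rule duh_integrable[OF kern_measurable_pair cube_meas_pair C(2) _ _ cube_sup34 cube_L1_ex t]) (use C(1) \<alpha> in auto)
qed

text \<open>At late times the exponent (\<alpha>+1)/4 exceeds 1/2, which is gain enough without
  extra decay of the cube. At early times the kernel has the extra decay \<open>\<rho>\<close>,
  while the L^1 norm of the cube, like 1/s, would cost a logarithm and is not integrable at
  0.\<close>

lemma small_N1: "small (\<lambda>t. duh (kern 1 \<alpha> 1 1) cube {0<..<t} t)"
proof -
 obtain C where C: "C > 0" "\<And>t. t > 0 ==> bnd (kern 1 \<alpha> 1 1 t) (C * t powr (- 1 - (\<alpha> - 1) / 2)) (C * t powr (- ((\<alpha> + 1) / 4)))"
  using dkern_diff_bnd[OF \<alpha>(1)] by blast
 obtain D where D: "D > 0" "\<And>t. t > 0 ==> bnd (kern 1 \<alpha> 1 1 t) (D * t powr (- 1 - (\<alpha> - 1) / 2)) (D * t powr (- 1 / 2 - (\<alpha> - 1) / 2))"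
  using kern_bnd_Suc[OF \<alpha>_pos, of 1 1] by auto
 have near: "small (\<lambda>t. duh (kern 1 \<alpha> 1 1) cube {t/2..<t} t)"
 proof (rule small_duh_near[OF kern_measurable_pair cube_meas_pair C(2), where S="K ^ 3" and \<epsilon>=0])
  show "norm (cube s y) <= K ^ 3 * s powr (- (3/2) - 0)" if "s >= 1" for s y using cube_sup[of s y] that by simp
  show "(nnL1 (cube s)) <= ennreal (K ^ 3 * s powr (- 1 - 0))" if "s >= 1" for s using cube_L1[of s 1] that by simp
 qed (use C(1) \<alpha> in auto)
 define \<rho> where "\<rho> = (\<alpha> - 1) / 2"
 \<comment> \<open>Half of the kernel gain pays for replacing 1/s by the power
   s^(\<open>\<kappa>\<close> - 1), integrable at 0; the other half remains as the rate.\<close>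
 define \<kappa> where "\<kappa> = \<rho> / 2"
 have \<kappa>: "0 < \<kappa>" "\<kappa> <= 3/4" "\<rho> - \<kappa> > 0" using \<alpha> by (auto simp: \<kappa>_def \<rho>_def)
 have far: "small (\<lambda>t. duh (kern 1 \<alpha> 1 1) cube {0<..<t/2} t)"
 proof (rule small_halfI[where r="\<rho> - \<kappa>" and C="D * K ^ 3 / \<kappa>"])
  show "\<forall>\<^sub>F t in at_top. bnd (duh (kern 1 \<alpha> 1 1) cube {0<..<t/2} t) (D * K ^ 3 / \<kappa> * (t / 2) powr (- 1 - (\<rho> - \<kappa>))) (D * K ^ 3 / \<kappa> * (t / 2) powr (- 1 / 2 - (\<rho> - \<kappa>)))"
   using eventually_gt_at_top[of 0]
  proof eventually_elim
   case (elim t)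
   have pf: "integrable lborel (\<lambda>x. indicator {0..t/2} x * x powr (\<kappa> - 1))" "(LINT x|lborel. indicator {0..t/2} x * x powr (\<kappa> - 1)) = (t / 2) powr \<kappa> / \<kappa>"
    using powr_from_0[of "\<kappa> - 1" "t / 2"] \<kappa> elim by auto
   have ind_le: "indicator {0<..<t/2} s * s powr (\<kappa> - 1) <= indicator {0..t/2} s * s powr (\<kappa> - 1)" for s by (auto simp: indicator_def)
   have gi: "integrable lborel (\<lambda>s. indicator {0<..<t/2} s * s powr (\<kappa> - 1))"
    by (rule bochner_integrable_bound[OF pf(1)]) (auto simp: indicator_def)
   have gl: "(LINT s|lborel. indicator {0<..<t/2} s * s powr (\<kappa> - 1)) <= (t / 2) powr \<kappa> / \<kappa>"
    unfolding pf(2)[symmetric] by (rule integral_mono[OF gi pf(1) ind_le])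
   have "bnd (duh (kern 1 \<alpha> 1 1) cube {0<..<t/2} t) (D * K ^ 3 * (t / 2) powr (- 1 - \<rho>) * ((t / 2) powr \<kappa> / \<kappa>)) (D * K ^ 3 * (t / 2) powr (- 1 / 2 - \<rho>) * ((t / 2) powr \<kappa> / \<kappa>))"
   proof (rule duh_bnd[OF kern_measurable_pair cube_meas_pair _ _ gi gl])
    fix s assume s: "s \<in> {0<..<t/2}"
    then have s1: "s > 0" "t - s > 0" "t - s >= t / 2" by auto
    have cs: "cube s \<in> borel_measurable borel" by measurable
    have F: "(nnL1 (cube s)) <= ennreal (K ^ 3 * s powr (\<kappa> - 1))" using cube_L1[OF s1(1), of "1 - \<kappa>"] \<kappa> by simp
    have F0: "0 <= K ^ 3 * s powr (\<kappa> - 1)" using K0 by simp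
    have B0: "0 <= D * (t - s) powr (- 1 / 2 - (\<alpha> - 1) / 2)" using D by simp
    have "bnd (\<lambda>x. LINT y|lborel. kern 1 \<alpha> 1 1 (t - s) (x - y) * cube s y) (D * (t - s) powr (- 1 - (\<alpha> - 1) / 2) * (K ^ 3 * s powr (\<kappa> - 1))) (D * (t - s) powr (- 1 / 2 - (\<alpha> - 1) / 2) * (K ^ 3 * s powr (\<kappa> - 1)))"
     by (rule bnd_cnv(2)[OF D(2)[OF s1(2)] B0 cs cube_sup34[OF s1(1)] F F0])
    then show "bnd (\<lambda>x. LINT y|lborel. kern 1 \<alpha> 1 1 (t - s) (x - y) * cube s y) (D * K ^ 3 * (t / 2) powr (- 1 - \<rho>) * s powr (\<kappa> - 1)) (D * K ^ 3 * (t / 2) powr (- 1 / 2 - \<rho>) * s powr (\<kappa> - 1))"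
    proof (rule bnd_mono)
     have "(t - s) powr (- a) <= (t / 2) powr (- a)" if "a >= 0" for a using s1 elim that by (intro powr_mono2') auto
     from this[of "1 + \<rho>"] this[of "1 / 2 + \<rho>"] \<alpha>(1) have p: "(t - s) powr (- 1 - \<rho>) <= (t / 2) powr (- 1 - \<rho>)" "(t - s) powr (- 1 / 2 - \<rho>) <= (t / 2) powr (- 1 / 2 - \<rho>)" by (auto simp: \<rho>_def)
     have "D * X * (K ^ 3 * s powr (\<kappa> - 1)) <= D * K ^ 3 * Y * s powr (\<kappa> - 1)" if "X <= Y" for X Y
     proof -
      have "(D * K ^ 3 * s powr (\<kappa> - 1)) * X <= (D * K ^ 3 * s powr (\<kappa> - 1)) * Y" using that D K0 by (intro mult_left_mono) auto
      then show ?thesis by (simp add: mult_ac)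
     qed
     with p show "D * (t - s) powr (- 1 - (\<alpha> - 1) / 2) * (K ^ 3 * s powr (\<kappa> - 1)) <= D * K ^ 3 * (t / 2) powr (- 1 - \<rho>) * s powr (\<kappa> - 1)"
      "D * (t - s) powr (- 1 / 2 - (\<alpha> - 1) / 2) * (K ^ 3 * s powr (\<kappa> - 1)) <= D * K ^ 3 * (t / 2) powr (- 1 / 2 - \<rho>) * s powr (\<kappa> - 1)"
      unfolding \<rho>_def[symmetric] by auto
    qed
   qed (use D K0 in auto)
   moreover have "(t / 2) powr (- a - \<rho>) * (t / 2) powr \<kappa> = (t / 2) powr (- a - (\<rho> - \<kappa>))" for a
    unfolding powr_add[symmetric] by (rule arg_cong[where f="\<lambda>a. (t / 2) powr a"]) simp
   from this[of 1] this[of "1/2"] have "D * K ^ 3 * (t / 2) powr (- 1 - \<rho>) * ((t / 2) powr \<kappa> / \<kappa>) = D * K ^ 3 / \<kappa> * (t / 2) powr (- 1 - (\<rho> - \<kappa>))"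
    "D * K ^ 3 * (t / 2) powr (- 1 / 2 - \<rho>) * ((t / 2) powr \<kappa> / \<kappa>) = D * K ^ 3 / \<kappa> * (t / 2) powr (- 1 / 2 - (\<rho> - \<kappa>))" by simp_all
   ultimately show ?case by (simp only:)
  qed
 qed (use \<kappa> D K0 in auto)
 show ?thesis
 proof (rule small_cong[OF small_add[OF far near]])
  show "\<forall>\<^sub>F t in at_top. \<forall>x. duh (kern 1 \<alpha> 1 1) cube {0<..<t/2} t x + duh (kern 1 \<alpha> 1 1) cube {t/2..<t} t x = duh (kern 1 \<alpha> 1 1) cube {0<..<t} t x"
   using duh_split[OF N1_integrable] by (intro eventually_mono[OF eventually_gt_at_top[of 0]]) auto
 qed
qed

end

section \<open>Concentration of the forcing\<close>

lemma spacetime_integrable: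
 fixes w :: "real => real => complex"
 assumes wm: "(\<lambda>(s, y). w s y) \<in> borel2" and w0: "\<And>s y. s <= 0 ==> w s y = 0"
  and w1: "\<And>s. 0 < s ==> s < 1 ==> (nnL1 (w s)) <= ennreal (S * s powr (- (1/4)))"
  and w2: "\<And>s. s >= 1 ==> (nnL1 (w s)) <= ennreal (S * s powr (- 1 - \<epsilon>))"
  and e: "\<epsilon> > 0" and S0: "S >= 0"
 shows "integrable (lborel \<Otimes>\<^sub>M lborel) (\<lambda>p. w (fst p) (snd p))"
proof (rule integrableI_bounded)
 have wm': "(\<lambda>p. w (fst p) (snd p)) \<in> borel2" using wm by (simp add: split_beta')
 then show m: "(\<lambda>p. w (fst p) (snd p)) \<in> borel_measurable (lborel \<Otimes>\<^sub>M lborel)" by simp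
 have i1: "integrable lborel (\<lambda>s::real. indicator {0..1} s * s powr (- (1/4)))" using powr_from_0(1)[of "- (1/4)" 1] by simp
 have i2: "integrable lborel (\<lambda>s::real. indicator {1..} s * s powr (- 1 - \<epsilon>))" using powr_to_inf[of "- 1 - \<epsilon>"] e by simp
 define h where "h = (\<lambda>s::real. S * (indicator {0..1} s * s powr (- (1/4))) + S * (indicator {1..} s * s powr (- 1 - \<epsilon>)))"
 have h: "integrable lborel h" unfolding h_def by (intro Bochner_Integration.integrable_add integrable_mult_right i1 i2)
 have h0: "h s >= 0" for s using S0 by (simp add: h_def)
 have "(nnL1 (w s)) <= ennreal (h s)" for s
 proof -
  consider "s <= 0" | "0 < s" "s < 1" | "s >= 1" by linarith
  then show ?thesis
  proof cases
   case 2 then show ?thesis using w1 by (simp add: h_def)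
  next
   case 3
   have "S * s powr (- 1 - \<epsilon>) <= h s" using 3 S0 by (simp add: h_def)
   then show ?thesis using w2[OF 3] by (meson ennreal_leI order_trans)
  qed (simp add: w0)
 qed
 then have "(\<integral>\<^sup>+s. (nnL1 (w s)) \<partial>lborel) <= (\<integral>\<^sup>+s. ennreal (h s) \<partial>lborel)" by (intro nn_integral_mono)
 also have "\<dots> = ennreal (LINT s|lborel. h s)" using h h0 by (intro nn_integral_eq_integral) auto
 also have "\<dots> < \<infinity>" by simp
 also have "(\<integral>\<^sup>+s. (nnL1 (w s)) \<partial>lborel) = (\<integral>\<^sup>+p. ennreal (norm (w (fst p) (snd p))) \<partial>(lborel \<Otimes>\<^sub>M lborel))"
  using lborel.nn_integral_fst[of "\<lambda>p. ennreal (norm (w (fst p) (snd p)))" lborel] m by simp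
 finally show "(\<integral>\<^sup>+p. ennreal (norm (w (fst p) (snd p))) \<partial>(lborel \<Otimes>\<^sub>M lborel)) < \<infinity>" .
qed

text \<open>The cost of moving a source from (s, y) to the space-time origin: it vanishes as t grows
  with (s, y) fixed, and stays bounded throughout. Sources at s >= t/2, which the indicator
  discards, are included in the same bound.\<close>

lemma dheat_concentrated:
 "\<exists>C D. 0 < C \<and> 0 < D \<and> (\<forall>t>0. \<forall>s>0. \<forall>y.
   bnd (\<lambda>x. indicator {0<..<t/2} s * dheat (t - s) (x - y) - dheat t x)
    (min (C * (s / t + \<bar>y\<bar> / sqrt t)) D / t) (min (C * (s / t + \<bar>y\<bar> / sqrt t)) D / sqrt t))"
proof -
 obtain C1 where C1: "C1 > 0" "\<And>t. t > 0 ==> bnd (dheat t) (C1 * t powr (- 1)) (C1 * t powr (- 1 / 2))"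
  using dheat_bnd by blast
 obtain C2 where C2: "C2 > 0" "\<And>t y. t > 0 ==> bnd (\<lambda>x. dheat t (x - y) - dheat t x) (C2 * \<bar>y\<bar> * t powr (- 3 / 2)) (C2 * \<bar>y\<bar> * t powr (- 1))"
  using dheat_increment by blast
 obtain C3 where C3: "C3 > 0" "\<And>t \<tau>. t > 0 ==> 0 <= \<tau> ==> \<tau> <= 2 / 3 * t ==> bnd (\<lambda>x. dheat (t - \<tau>) x - dheat t x) (C3 * \<tau> * t powr (- 2)) (C3 * \<tau> * t powr (- 3 / 2))"
  using dheat_time_increment by blast
 define C where "C = 2 * C1 + C2 + C3"
 define D where "D = 3 * C1"
 have C: "C > 0" "2 * C1 <= C" "C2 <= C" "C3 <= C" "D > 0" using C1(1) C2(1) C3(1) by (auto simp: C_def D_def)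
 have "bnd (\<lambda>x. indicator {0<..<t/2} s * dheat (t - s) (x - y) - dheat t x)
    (min (C * (s / t + \<bar>y\<bar> / sqrt t)) D / t) (min (C * (s / t + \<bar>y\<bar> / sqrt t)) D / sqrt t)" if t: "t > 0" and s: "s > 0" for t s y
 proof -
  define g where "g = min (C * (s / t + \<bar>y\<bar> / sqrt t)) D"
  have st: "sqrt t > 0" "t powr (- 1) = 1 / t" "t powr (- 1 / 2) = 1 / sqrt t" "t powr (- 2) = 1 / t / t" "t powr (- 3 / 2) = 1 / t / sqrt t"
  proof -
   have h: "t powr (- 1 / 2) = 1 / sqrt t" using t by (simp add: powr_minus powr_half_sqrt[symmetric] divide_simps)
   then show "t powr (- 1 / 2) = 1 / sqrt t" .
   show o: "t powr (- 1) = 1 / t" using t by (simp add: powr_minus divide_simps)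
   have "t powr (- 3 / 2) = t powr (- 1) * t powr (- 1 / 2)" unfolding powr_add[symmetric] by simp
   then show "t powr (- 3 / 2) = 1 / t / sqrt t" unfolding o h by simp
   have "t powr (- 2) = t powr (- 1) * t powr (- 1)" unfolding powr_add[symmetric] by simp
   then show "t powr (- 2) = 1 / t / t" unfolding o by simp
  qed (use t in simp)
  have a0: "0 <= s / t" "0 <= \<bar>y\<bar> / sqrt t" using t s by auto
  show ?thesis unfolding g_def[symmetric]
  proof (cases "s < t / 2")
   case True
   have b1: "bnd (\<lambda>x. dheat (t - s) (x - y) - dheat t (x - y)) (C3 * s * t powr (- 2)) (C3 * s * t powr (- 3 / 2))"
    using bnd_shift[OF C3(2)[OF t, of s], of y] s True by simp
   have b2: "bnd (\<lambda>x. (dheat (t - s) (x - y) - dheat t (x - y)) + (dheat t (x - y) - dheat t x))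
     (C3 * s * t powr (- 2) + C2 * \<bar>y\<bar> * t powr (- 3 / 2)) (C3 * s * t powr (- 3 / 2) + C2 * \<bar>y\<bar> * t powr (- 1))"
    by (rule bnd_add[OF b1 C2(2)[OF t]]) (use C2(1) C3(1) s in auto)
   have le: "C3 * (s / t) + C2 * (\<bar>y\<bar> / sqrt t) <= C * (s / t + \<bar>y\<bar> / sqrt t)"
    unfolding distrib_left by (intro add_mono mult_right_mono C a0)
   have q: "t = sqrt t * sqrt t" using t by simp
   have e1: "C3 * s * t powr (- 2) + C2 * \<bar>y\<bar> * t powr (- 3 / 2) = (C3 * (s / t) + C2 * (\<bar>y\<bar> / sqrt t)) / t"
    unfolding st by (simp add: add_divide_distrib)
   have e2: "C3 * s * t powr (- 3 / 2) + C2 * \<bar>y\<bar> * t powr (- 1) = (C3 * (s / t) + C2 * (\<bar>y\<bar> / sqrt t)) / sqrt t"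
    unfolding st using q by (simp add: add_divide_distrib)
   have b3: "bnd (\<lambda>x. dheat (t - s) (x - y) - dheat t x) (C * (s / t + \<bar>y\<bar> / sqrt t) / t) (C * (s / t + \<bar>y\<bar> / sqrt t) / sqrt t)"
    using bnd_mono[OF b2[unfolded e1 e2] divide_right_mono[OF le] divide_right_mono[OF le]] t by simp
   have ts: "t - s > 0" "t - s >= t / 2" using True t by auto
   have b4: "bnd (\<lambda>x. dheat (t - s) (x - y) - dheat t x) (C1 * (t - s) powr (- 1) + C1 * t powr (- 1)) (C1 * (t - s) powr (- 1 / 2) + C1 * t powr (- 1 / 2))"
    by (rule bnd_diff[OF bnd_shift[OF C1(2)[OF ts(1)]] C1(2)[OF t]]) (use C1(1) in auto)
   have p: "(t - s) powr (- a) <= 2 * t powr (- a)" if "0 <= a" "a <= 1" for a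
   proof -
    have "(t - s) powr (- a) <= (t / 2) powr (- a)" using ts t that by (intro powr_mono2') auto
    also have "\<dots> = 2 powr a * t powr (- a)" using t by (simp add: powr_divide powr_minus field_simps)
    also have "2 powr a <= 2 powr (1::real)" using that by (intro powr_mono) auto
    finally show ?thesis by (simp add: mult_right_mono)
   qed
   have p1: "C1 * (t - s) powr (- 1) <= C1 * (2 * t powr (- 1))" using p[of 1] C1(1) by (intro mult_left_mono) auto
   have p2: "C1 * (t - s) powr (- 1 / 2) <= C1 * (2 * t powr (- 1 / 2))" using p[of "1/2"] C1(1) by (intro mult_left_mono) auto
   have b5: "bnd (\<lambda>x. dheat (t - s) (x - y) - dheat t x) (D / t) (D / sqrt t)"
   proof (rule bnd_mono[OF b4])
    have "C1 * (2 * t powr (- 1)) + C1 * t powr (- 1) = D / t" "C1 * (2 * t powr (- 1 / 2)) + C1 * t powr (- 1 / 2) = D / sqrt t" unfolding st D_def by simp_all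
    with p1 p2 show "C1 * (t - s) powr (- 1) + C1 * t powr (- 1) <= D / t" "C1 * (t - s) powr (- 1 / 2) + C1 * t powr (- 1 / 2) <= D / sqrt t" by linarith+
   qed
   have "min (a / c) (b / c) = min a b / c" if "c > 0" for a b c :: real using that by (simp add: min_def divide_le_cancel)
   then show "bnd (\<lambda>x. indicator {0<..<t/2} s * dheat (t - s) (x - y) - dheat t x) (g / t) (g / sqrt t)"
    using bnd_min[OF b3 b5] True s t st(1) by (simp add: g_def)
  next
   case False
   \<comment> \<open>Here s/t is at least 1/2, so the minimum is at least \<open>C1\<close> and pays
     for the whole term \<open>dheat t x\<close>.\<close>
   have "2 * C1 * (1 / 2) <= C * (s / t + \<bar>y\<bar> / sqrt t)"
   proof (rule mult_mono)
    have "1 / 2 <= s / t" using False t by (simp add: field_simps)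
    then show "1 / 2 <= s / t + \<bar>y\<bar> / sqrt t" using a0 by linarith
   qed (use C in auto)
   then have "C1 <= g" using C1(1) by (simp add: g_def D_def)
   then have "bnd (\<lambda>x. (- 1) * dheat t x) (g / t) (g / sqrt t)"
    using st t by (intro bnd_mono[OF bnd_cmult[OF C1(2)[OF t]]]) (auto simp: divide_right_mono)
   then show "bnd (\<lambda>x. indicator {0<..<t/2} s * dheat (t - s) (x - y) - dheat t x) (g / t) (g / sqrt t)"
    using False by simp
  qed
 qed
 then show ?thesis using C by blast
qed

text \<open>Dominated convergence over space-time: the relocation cost tends to 0 pointwise and is
  bounded, so integrability of the forcing suffices and its total integral multiplies the kernel, as
  for a point mass.\<close>

lemma small_concentrated:
 fixes w :: "real => real => complex"
 assumes wi: "integrable (lborel \<Otimes>\<^sub>M lborel) (\<lambda>p. w (fst p) (snd p))" and w0: "\<And>s y. s <= 0 ==> w s y = 0"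
  and wm: "(\<lambda>(s, y). w s y) \<in> borel2"
 shows "small (\<lambda>t x. duh dheat w {0<..<t/2} t x - (LINT p|(lborel \<Otimes>\<^sub>M lborel). w (fst p) (snd p)) * dheat t x)"
proof -
 obtain C D where C: "C > 0" "D > 0" "\<And>t s y. t > 0 ==> s > 0 ==>
   bnd (\<lambda>x. indicator {0<..<t/2} s * dheat (t - s) (x - y) - dheat t x)
    (min (C * (s / t + \<bar>y\<bar> / sqrt t)) D / t) (min (C * (s / t + \<bar>y\<bar> / sqrt t)) D / sqrt t)"
  using dheat_concentrated by blast
 obtain C1 where C1: "C1 > 0" "\<And>t. t > 0 ==> bnd (dheat t) (C1 * t powr (- 1)) (C1 * t powr (- 1 / 2))"
  using dheat_bnd by blast
 have [measurable]: "(\<lambda>p. w (fst p) (snd p)) \<in> borel2" using wm by (simp add: split_beta')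
 have wmm [measurable]: "(\<lambda>z. w (f z) (g z)) \<in> borel_measurable N" if "f \<in> borel_measurable N" "g \<in> borel_measurable N" for f g :: "'z => real" and N
  using measurable_compose[OF measurable_Pair[OF that] wm] by simp
 have wn: "integrable (lborel \<Otimes>\<^sub>M lborel) (\<lambda>p. norm (w (fst p) (snd p)))" using wi by (rule integrable_norm)
 define g where "g = (\<lambda>t (p::real \<times> real). min (C * (fst p / t + \<bar>snd p\<bar> / sqrt t)) D * norm (w (fst p) (snd p)))"
 have g0: "0 <= g t p" if "t > 0" for t p
  using that C w0[of "fst p" "snd p"] by (cases "fst p > 0") (auto simp: g_def)
 have gle: "norm (g t p) <= D * norm (w (fst p) (snd p))" if "t > 0" for t p
 proof -
  have "norm (g t p) = g t p" using g0[OF that] by simp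
  also have "\<dots> <= D * norm (w (fst p) (snd p))" unfolding g_def by (intro mult_right_mono) auto
  finally show ?thesis .
 qed
 have gm: "g t \<in> borel_measurable (lborel \<Otimes>\<^sub>M lborel)" for t unfolding g_def by measurable
 have gi: "integrable (lborel \<Otimes>\<^sub>M lborel) (g t)" if "t > 0" for t
  by (rule bochner_integrable_bound[OF integrable_mult_right[OF wn, of D] gm]) (use gle[OF that] C in auto)
 show ?thesis
 proof (rule smallI[where e="\<lambda>t. LINT p|(lborel \<Otimes>\<^sub>M lborel). g t p"])
  have "((\<lambda>t. LINT p|(lborel \<Otimes>\<^sub>M lborel). g t p) \<longlongrightarrow> (LINT p|(lborel \<Otimes>\<^sub>M lborel :: (real \<times> real) measure). (0::real))) at_top"
  proof (rule integral_dominated_convergence_at_top[where s=g and f="\<lambda>p. 0" and M="lborel \<Otimes>\<^sub>M lborel" and w="\<lambda>p. D * norm (w (fst p) (snd p))"])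
   show "\<forall>\<^sub>F t in at_top. AE p in lborel \<Otimes>\<^sub>M lborel. norm (g t p) <= D * norm (w (fst p) (snd p))"
    using eventually_gt_at_top[of 0] by eventually_elim (use gle in auto)
   have "((\<lambda>t. C * (a / t + b / sqrt t)) \<longlongrightarrow> C * (0 + 0)) at_top" for a b
    by (intro tendsto_intros tendsto_divide_0[OF tendsto_const] filterlim_at_top_imp_at_infinity filterlim_ident sqrt_at_top)
   then have "((\<lambda>t. min (C * (fst p / t + \<bar>snd p\<bar> / sqrt t)) D * norm (w (fst p) (snd p))) \<longlongrightarrow> min (C * (0 + 0)) D * norm (w (fst p) (snd p))) at_top" for p
    by (rule tendsto_mult[OF tendsto_min[OF _ tendsto_const] tendsto_const])
   then show "AE p in lborel \<Otimes>\<^sub>M lborel. ((\<lambda>t. g t p) \<longlongrightarrow> 0) at_top" using C by (simp add: g_def)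
  qed (use gm wn in auto)
  then show "((\<lambda>t. LINT p|(lborel \<Otimes>\<^sub>M lborel). g t p) \<longlongrightarrow> 0) at_top" by simp
  show "\<forall>\<^sub>F t in at_top. 0 <= (LINT p|(lborel \<Otimes>\<^sub>M lborel). g t p) \<and>
    bnd (\<lambda>x. duh dheat w {0<..<t/2} t x - (LINT p|(lborel \<Otimes>\<^sub>M lborel). w (fst p) (snd p)) * dheat t x)
     ((LINT p|(lborel \<Otimes>\<^sub>M lborel). g t p) / t) ((LINT p|(lborel \<Otimes>\<^sub>M lborel). g t p) / sqrt t)"
   using eventually_gt_at_top[of 0]
  proof eventually_elim
   case (elim t)
   define H where "H = (\<lambda>x (p::real \<times> real). (indicator {0<..<t/2} (fst p) * dheat (t - fst p) (x - snd p) - dheat t x) * w (fst p) (snd p))"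
   have eq: "duh dheat w {0<..<t/2} t x - (LINT p|(lborel \<Otimes>\<^sub>M lborel). w (fst p) (snd p)) * dheat t x = (LINT p|(lborel \<Otimes>\<^sub>M lborel). H x p)" for x
   proof -
    let ?h = "\<lambda>p. indicator {0<..<t/2} (fst p) * dheat (t - fst p) (x - snd p) * w (fst p) (snd p)"
    have hb: "norm (?h p) <= 2 * C1 / t * norm (w (fst p) (snd p))" for p
    proof (cases "fst p \<in> {0<..<t/2}")
     case True
     then have p: "t - fst p > 0" "t - fst p >= t / 2" using elim by auto
     have "norm (dheat (t - fst p) (x - snd p)) <= C1 * (t - fst p) powr (- 1)" using C1(2)[OF p(1)] by (simp add: bnd_def)
     also have "\<dots> = C1 / (t - fst p)" using p by (simp add: powr_minus divide_simps)
     also have "\<dots> <= C1 / (t / 2)" using p C1(1) elim by (intro divide_left_mono) auto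
     also have "\<dots> = 2 * C1 / t" by simp
     finally have "norm (dheat (t - fst p) (x - snd p)) * norm (w (fst p) (snd p)) <= 2 * C1 / t * norm (w (fst p) (snd p))" by (intro mult_right_mono) auto
     then show ?thesis using True by (simp add: norm_mult)
    qed (use C1(1) elim in auto)
    have hi: "integrable (lborel \<Otimes>\<^sub>M lborel) ?h"
     by (rule bochner_integrable_bound[OF integrable_mult_right[OF wn, of "2 * C1 / t"]])
      (use hb C1(1) elim in \<open>auto intro!: AE_I2\<close>)
    have "duh dheat w {0<..<t/2} t x = (LINT s|lborel. LINT y|lborel. ?h (s, y))"
     unfolding duh_def by (rule bochner_integral_cong) (auto simp: indicator_def)
    also have "\<dots> = (LINT p|(lborel \<Otimes>\<^sub>M lborel). ?h p)" by (rule lborel_pair.integral_fst'[OF hi])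
    finally have d: "duh dheat w {0<..<t/2} t x = (LINT p|(lborel \<Otimes>\<^sub>M lborel). ?h p)" .
    have "(LINT p|(lborel \<Otimes>\<^sub>M lborel). w (fst p) (snd p)) * dheat t x = (LINT p|(lborel \<Otimes>\<^sub>M lborel). dheat t x * w (fst p) (snd p))"
     by (simp only: integral_mult_right_zero mult.commute)
    with d show ?thesis unfolding H_def left_diff_distrib
     by (simp only: bochner_integral_diff[OF hi integrable_mult_right[OF wi]])
   qed
   have Hb: "bnd (\<lambda>x. H x p) (g t p / t) (g t p / sqrt t)" for p
   proof (cases "fst p > 0")
    case True
    from bnd_cmult[OF C(3)[OF elim True, of "snd p"], of "w (fst p) (snd p)"]
    show ?thesis by (simp add: H_def g_def mult_ac)
   next
    case False
    then show ?thesis using w0[of "fst p" "snd p"] by (simp add: H_def g_def bnd_def)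
   qed
   have "bnd (\<lambda>x. LINT p|(lborel \<Otimes>\<^sub>M lborel). H x p) ((LINT p|(lborel \<Otimes>\<^sub>M lborel). g t p) / t) ((LINT p|(lborel \<Otimes>\<^sub>M lborel). g t p) / sqrt t)"
   proof (rule bnd_superpose[where A="\<lambda>p. g t p / t" and B="\<lambda>p. g t p / sqrt t"])
    show "sigma_finite_measure (lborel \<Otimes>\<^sub>M lborel :: (real \<times> real) measure)" by (simp add: lborel_prod sigma_finite_lborel)
    show "(\<lambda>(x, w). H x w) \<in> borel_measurable (lborel \<Otimes>\<^sub>M (lborel \<Otimes>\<^sub>M lborel))" unfolding H_def by measurable
    show "AE p in lborel \<Otimes>\<^sub>M lborel. \<forall>x. norm (H x p) <= g t p / t"
     "AE p in lborel \<Otimes>\<^sub>M lborel. (nnL1 (\<lambda>x. H x p)) <= ennreal (g t p / sqrt t)"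
     using Hb by (auto simp: bnd_def)
    show "AE p in lborel \<Otimes>\<^sub>M lborel. 0 <= g t p / sqrt t" using g0[OF elim] elim by auto
   qed (use gi[OF elim] in auto)
   then show ?case unfolding eq using g0[OF elim] by (auto intro!: integral_nonneg_AE)
  qed
 qed
qed

text \<open>The interval is cut at t/2: relocation to the origin works only while the kernel time
  stays comparable to t, and the later half is negligible by the decay of the forcing.\<close>

lemma small_duh_dheat:
 fixes w :: "real => real => complex"
 assumes wm: "(\<lambda>(s, y). w s y) \<in> borel2" and w0: "\<And>s y. s <= 0 ==> w s y = 0"
  and w1: "\<And>s. 0 < s ==> s < 1 ==> (nnL1 (w s)) <= ennreal (S * s powr (- (1/4)))"
  and w2: "\<And>s. s >= 1 ==> (nnL1 (w s)) <= ennreal (S * s powr (- 1 - \<epsilon>))"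
  and w3: "\<And>s y. s > 0 ==> norm (w s y) <= S * s powr (- (3/4))"
  and w4: "\<And>s y. s >= 1 ==> norm (w s y) <= S * s powr (- (3/2) - \<epsilon>)"
  and e: "\<epsilon> > 0"
 shows "small (\<lambda>t x. duh dheat w {0<..<t} t x - (LINT p|(lborel \<Otimes>\<^sub>M lborel). w (fst p) (snd p)) * dheat t x)"
  "\<And>t x. t > 0 ==> integrable lborel (\<lambda>s. indicator {0<..<t} s *\<^sub>R (LINT y|lborel. dheat (t - s) (x - y) * w s y))"
proof -
 have S0: "S >= 0" using order_trans[OF norm_ge_zero w3[of 1 0]] by simp
 obtain C1 where C1: "C1 > 0" "\<And>t. t > 0 ==> bnd (dheat t) (C1 * t powr (- 1)) (C1 * t powr (- 1 / 2))"
  using dheat_bnd by blast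
 have C1': "\<And>t. t > 0 ==> bnd (dheat t) (C1 * t powr (- 1)) (C1 * t powr (- (1 / 2)))" using C1(2) by simp
 have km: "(\<lambda>(s, x). dheat s x) \<in> borel2" by measurable
 have ex: "\<exists>F\<ge>0. (nnL1 (w s)) <= ennreal F" if "s > 0" for s
 proof (cases "s < 1")
  case True
  then show ?thesis using w1[OF that True] S0 by (intro exI[of _ "S * s powr (- (1/4))"]) simp
 next
  case False
  then show ?thesis using w2[of s] S0 by (intro exI[of _ "S * s powr (- 1 - \<epsilon>)"]) simp
 qed
 show int: "integrable lborel (\<lambda>s. indicator {0<..<t} s *\<^sub>R (LINT y|lborel. dheat (t - s) (x - y) * w s y))" if "t > 0" for t x
  by (rule duh_integrable[OF km wm C1' _ _ w3 ex that]) (use C1(1) in auto)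
 have near: "small (\<lambda>t. duh dheat w {t/2..<t} t)"
  by (rule small_duh_near[OF km wm C1' _ _ w4 w2]) (use C1(1) e in auto)
 note far = small_concentrated[OF spacetime_integrable[OF wm w0 w1 w2 e S0] w0 wm]
 show "small (\<lambda>t x. duh dheat w {0<..<t} t x - (LINT p|(lborel \<Otimes>\<^sub>M lborel). w (fst p) (snd p)) * dheat t x)"
 proof (rule small_cong[OF small_add[OF far near]])
  show "\<forall>\<^sub>F t in at_top. \<forall>x. duh dheat w {0<..<t/2} t x - (LINT p|(lborel \<Otimes>\<^sub>M lborel). w (fst p) (snd p)) * dheat t x + duh dheat w {t/2..<t} t x
    = duh dheat w {0<..<t} t x - (LINT p|(lborel \<Otimes>\<^sub>M lborel). w (fst p) (snd p)) * dheat t x"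
   using duh_split[OF int] by (intro eventually_mono[OF eventually_gt_at_top[of 0]]) auto
 qed
qed

section \<open>The logarithmic term and the profile\<close>

lemma lebesgue_measurable_AE:
 fixes f f0 :: "real => 'a::topological_space"
 assumes f0: "f0 \<in> borel_measurable borel" and ae: "AE x in lborel. f x = f0 x"
 shows "f \<in> borel_measurable lebesgue"
proof (rule measurableI)
 fix A :: "'a set" assume A: "A \<in> sets borel"
 have s: "f0 -` A \<in> sets (completion lborel)" using measurable_sets[OF f0 A] by simp
 have "AE x in completion lborel. x \<in> f0 -` A \<longleftrightarrow> x \<in> f -` A" using ae by (intro AE_completion) auto
 from completion.in_sets_AE[OF this s] show "f -` A \<inter> space lebesgue \<in> sets lebesgue" by simp
qed simp

text \<open>Lebesgue measure is complete, so a function equal almost everywhere to a Borel one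
  inherits its measurability; only the Borel representative has to be checked.\<close>

lemma integral_lebesgue_AE:
 fixes f f0 :: "real => 'a::{banach, second_countable_topology}"
 assumes f0: "f0 \<in> borel_measurable borel" and ae: "AE x in lborel. f x = f0 x"
 shows "integral\<^sup>L lebesgue f = integral\<^sup>L lborel f0"
proof -
 have "f0 \<in> borel_measurable lebesgue" using f0 by (simp add: measurable_completion)
 moreover have "AE x in lebesgue. f x = f0 x" using ae by (rule AE_completion)
 ultimately have "integral\<^sup>L lebesgue f = integral\<^sup>L lebesgue f0"
  using lebesgue_measurable_AE[OF f0 ae] by (intro integral_cong_AE)
 then show ?thesis using lebesgue_integral_lborel[OF f0] by simp
qed

text \<open>The exponent triples, which is a Gaussian of a third of the time, and the prefactor is
  compared. The constant 1/(4 sqrt 3 pi) is the space integral of the cube at time 1; times \<beta>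
  M^3/3 it is the coefficient of the logarithm.\<close>

lemma heat_cube:
 assumes t: "t > 0"
 shows "heat t x ^ 3 = 1 / (4 * sqrt 3 * pi) / t * heat (t / 3) x"
proof -
 define r where "r = sqrt (4 * pi * t)"
 have r: "r > 0" "r * r = 4 * pi * t" using t by (auto simp: r_def)
 have e: "exp (- x\<^sup>2 / (4 * t)) ^ 3 = exp (- x\<^sup>2 / (4 * (t / 3)))"
  unfolding exp_of_nat_mult[symmetric] by simp
 have q: "sqrt (4 * pi * (t / 3)) = r / sqrt 3" by (simp add: r_def real_sqrt_divide)
 have "heat t x ^ 3 = 1 / r ^ 3 * exp (- x\<^sup>2 / (4 * (t / 3)))"
  unfolding heat_def r_def[symmetric] power_mult_distrib e power_divide by simp
 also have "1 / r ^ 3 = 1 / (4 * sqrt 3 * pi) / t * (1 / (r / sqrt 3))"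
 proof -
  have "r ^ 3 = 4 * pi * t * r" using r(2) by (simp add: power3_eq_cube)
  then show ?thesis using r(1) t by (simp add: divide_simps)
 qed
 finally show ?thesis unfolding heat_def q by simp
qed

lemma kern_semigroup:
 assumes s: "s > 0" and r: "r > 0"
 shows "(LINT y|lborel. kern 0 1 j 0 s (x - y) * cplx (heat r y)) = kern 0 1 j 0 (s + r) x"
  "integrable lborel (\<lambda>y. kern 0 1 j 0 s (x - y) * cplx (heat r y))"
proof -
 obtain C where C: "C1_gauss (r / 2) (C * (1 / sqrt r) ^ 0 * (r powr (- ((1 - 1) / 2))) ^ 0)
   (C * (1 / sqrt r) ^ 0 * (r powr (- ((1 - 1) / 2))) ^ 0 * sqrt r * (if (0::nat) = 0 then 1 + 0 * r powr (- ((1 - 1) / 2)) else 1))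
   (symb 0 1 0 0 r) (symb' 0 1 0 0 r)"
  using C1_gauss_symb[of 1 0 0] r by force
 have h: "(\<lambda>y. cplx (heat r y)) = ift (symb 0 1 0 0 r)"
  using kern_heat[OF r, of 1] by (auto simp: kern_def fun_eq_iff)
 have ft: "ft (\<lambda>y. cplx (heat r y)) \<eta> = symb 0 1 0 0 r \<eta>" for \<eta> unfolding h using ft_ift(1)[OF C] r by simp
 have i: "integrable lborel (\<lambda>y. cplx (heat r y))" unfolding h using ft_ift(2)[OF C] r by simp
 have g: "integrable lborel (symb 0 1 j 0 s)" by (rule symb_integrable) (use s in auto)
 have m: "symb 0 1 j 0 s \<xi> * symb 0 1 0 0 r \<xi> = symb 0 1 j 0 (s + r) \<xi>" for \<xi>
 proof -
  have "cplx (exp (- (s * \<xi>\<^sup>2))) * cplx (exp (- (r * \<xi>\<^sup>2))) = cplx (exp (- ((s + r) * \<xi>\<^sup>2)))"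
   unfolding of_real_mult[symmetric] exp_add[symmetric] by (simp add: distrib_right)
  then show ?thesis by (simp add: symb_def rho_def)
 qed
 show "(LINT y|lborel. kern 0 1 j 0 s (x - y) * cplx (heat r y)) = kern 0 1 j 0 (s + r) x"
  unfolding kern_def conv_ift[OF g i] ft m ..
 obtain B where B: "B > 0" "bnd (kern 0 1 j 0 s) (B * s powr (- (real j + 1) / 2)) (B * s powr (- real j / 2))"
  using heat_kern_bnd[of 1 j] s by auto
 show "integrable lborel (\<lambda>y. kern 0 1 j 0 s (x - y) * cplx (heat r y))" by (rule bnd_conv_integrable[OF B(2) i])
qed

text \<open>The cube at time r is a heat kernel at time r/3, so the semigroup property adds s and
  r/3. In the Duhamel term s = t - r, which gives the time t - 2r/3.\<close>

lemma conv_dheat_heat_cube: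
 assumes s: "s > 0" and r: "r > 0"
 shows "(LINT y|lborel. dheat s (x - y) * cplx ((m * heat r y) ^ 3)) = cplx (m ^ 3 * (1 / (4 * sqrt 3 * pi)) / r) * dheat (s + r / 3) x"
  "integrable lborel (\<lambda>y. dheat s (x - y) * cplx ((m * heat r y) ^ 3))"
proof -
 define a where "a = m ^ 3 * (1 / (4 * sqrt 3 * pi)) / r"
 have eq: "dheat s (x - y) * cplx ((m * heat r y) ^ 3) = cplx a * (kern 0 1 1 0 s (x - y) * cplx (heat (r / 3) y))" for y
  unfolding power_mult_distrib heat_cube[OF r] dheat_eq_kern[OF s zero_less_one] a_def by simp
 have r3: "r / 3 > 0" "s + r / 3 > 0" using r s by auto
 show "(LINT y|lborel. dheat s (x - y) * cplx ((m * heat r y) ^ 3)) = cplx (m ^ 3 * (1 / (4 * sqrt 3 * pi)) / r) * dheat (s + r / 3) x"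
  unfolding eq integral_mult_right_zero kern_semigroup(1)[OF s r3(1)] dheat_eq_kern[OF r3(2) zero_less_one] a_def ..
 show "integrable lborel (\<lambda>y. dheat s (x - y) * cplx ((m * heat r y) ^ 3))"
  unfolding eq by (intro integrable_mult_right kern_semigroup(2) s r3)
qed

text \<open>Differentiation under the integral: the mean value inequality bounds the difference
  quotients by the same integrable majorant as the derivatives.\<close>

lemma has_field_derivative_integral:
 fixes f f' :: "real => real => real"
 assumes f: "\<And>x. integrable M (\<lambda>s. f s x)" and d: "\<And>s x. (f s has_real_derivative f' s x) (at x)"
  and b: "\<And>s x. \<bar>f' s x\<bar> <= b s" "integrable M b" and m: "(\<lambda>s. f' s x) \<in> borel_measurable M"
 shows "((\<lambda>x. LINT s|M. f s x) has_real_derivative (LINT s|M. f' s x)) (at x)"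
 unfolding has_field_derivative_iff tendsto_at_iff_sequentially
proof (intro allI impI)
 fix X :: "nat => real"
 assume X: "\<forall>i. X i \<in> UNIV - {x}" "X \<longlonglongrightarrow> x"
 have eq: "((\<lambda>y. ((LINT s|M. f s y) - (LINT s|M. f s x)) / (y - x)) \<circ> X) = (\<lambda>i. LINT s|M. (f s (X i) - f s x) / (X i - x))"
  by (simp add: fun_eq_iff f bochner_integral_diff)
 show "((\<lambda>y. ((LINT s|M. f s y) - (LINT s|M. f s x)) / (y - x)) \<circ> X) \<longlonglongrightarrow> (LINT s|M. f' s x)"
  unfolding eq
 proof (rule integral_dominated_convergence[where w=b])
  show "AE s in M. (\<lambda>i. (f s (X i) - f s x) / (X i - x)) \<longlonglongrightarrow> f' s x"
  proof (intro AE_I2)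
   fix s
   show "(\<lambda>i. (f s (X i) - f s x) / (X i - x)) \<longlonglongrightarrow> f' s x"
    using d[of s x] X unfolding has_field_derivative_iff tendsto_at_iff_sequentially comp_def by blast
  qed
  show "AE s in M. norm ((f s (X i) - f s x) / (X i - x)) <= b s" for i
  proof (intro AE_I2)
   fix s
   have "norm (f s (X i) - f s x) <= b s * norm (X i - x)"
    by (rule field_differentiable_bound[where S=UNIV and f'="f' s"]) (use d b in auto)
   moreover have "X i - x \<noteq> 0" using X(1) by simp
   ultimately show "norm ((f s (X i) - f s x) / (X i - x)) <= b s" by (simp add: norm_divide pos_divide_le_eq)
  qed
 qed (use f b m in \<open>auto intro!: borel_measurable_divide\<close>)
qed

text \<open>The profile before rescaling. Subtracting \<open>heat1 t x\<close> makes the bracket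
  O(s) and cancels the singularity 1/s; the subtracted part, integrated from time 1, is the
  logarithm.\<close>

definition profile :: "real => real => real" where
 "profile t x = (LINT s|lborel. indicator {0<..<t} s * (1 / (4 * sqrt 3 * pi) / s * (heat1 (t - 2 * s / 3) x - heat1 t x)))"

lemma heat_time_increment:
 "\<exists>C>0. \<forall>s\<in>{0<..<1}. \<forall>x. \<bar>heat (1 - 2 * s / 3) x - heat 1 x\<bar> <= C * s"
proof -
 obtain C where C: "C > 0" "\<And>t. t > 0 ==> bnd (kern 0 1 2 0 t) (C * t powr (- (real 2 + 1) / 2)) (C * t powr (- real 2 / 2))"
  using heat_kern_bnd[of 1 2] by auto
 define B where "B = C * (1/3) powr (- 3 / 2)"
 have "\<bar>heat (1 - 2 * s / 3) x - heat 1 x\<bar> <= B * s" if s: "s \<in> {0<..<1}" for s x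
 proof -
  have "norm (heat (1 - 2 * s / 3) x - heat 1 x) <= B * norm ((1 - 2 * s / 3) - 1)"
  proof (rule field_differentiable_bound[where S="{1/3..1}" and f'="\<lambda>t. heat2 t x"])
   fix t :: real assume t: "t \<in> {1/3..1}"
   then show "((\<lambda>t. heat t x) has_field_derivative heat2 t x) (at t within {1/3..1})"
    by (intro has_field_derivative_at_within[OF heat_DERIV_t]) auto
   have "norm (kern 0 1 2 0 t x) <= C * t powr (- 3 / 2)" using C(2)[of t] t by (simp add: bnd_def)
   also have "\<dots> <= B" unfolding B_def using t C(1) by (intro mult_left_mono powr_mono2') auto
   finally show "norm (heat2 t x) <= B" using t kern_heat2[of 1 t x] by simp
  qed (use s in auto)
  also have "\<dots> <= B * s" using s C(1) by (intro mult_left_mono) (auto simp: B_def)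
  finally show ?thesis by simp
 qed
 moreover have "B > 0" using C(1) by (simp add: B_def)
 ultimately show ?thesis by blast
qed

lemma integrable_indicator_cmult: "A \<in> sets borel ==> emeasure lborel A < \<infinity> ==> integrable lborel (\<lambda>s::real. indicator A s * (c::real))"
 by simp

lemma heat1_time_increment:
 "\<exists>C>0. \<forall>t>0. \<forall>s\<in>{0<..<t}. \<forall>x. \<bar>heat1 (t - 2 * s / 3) x - heat1 t x\<bar> <= C * s * t powr (- 2)"
proof -
 obtain C where C: "C > 0" "\<And>t \<tau>. t > 0 ==> 0 <= \<tau> ==> \<tau> <= 2 / 3 * t ==> bnd (\<lambda>x. dheat (t - \<tau>) x - dheat t x) (C * \<tau> * t powr (- 2)) (C * \<tau> * t powr (- 3 / 2))"
  using dheat_time_increment by blast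
 have "\<bar>heat1 (t - 2 * s / 3) x - heat1 t x\<bar> <= C * s * t powr (- 2)" if t: "t > 0" and s: "s \<in> {0<..<t}" for t s x
 proof -
  have "\<bar>heat1 (t - 2 * s / 3) x - heat1 t x\<bar> = norm (dheat (t - 2 * s / 3) x - dheat t x)"
   unfolding dheat_def of_real_diff[symmetric] norm_of_real ..
  also have "\<dots> <= C * (2 * s / 3) * t powr (- 2)" using C(2)[OF t, of "2 * s / 3"] s by (simp add: bnd_def)
  also have "\<dots> <= C * s * t powr (- 2)" using C(1) s by (intro mult_right_mono mult_left_mono) auto
  finally show ?thesis .
 qed
 then show ?thesis using C(1) by blast
qed

lemma profile_integrable:
 assumes t: "t > 0"
 shows "integrable lborel (\<lambda>s. indicator {0<..<t} s * (1 / (4 * sqrt 3 * pi) / s * (heat1 (t - 2 * s / 3) x - heat1 t x)))"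
proof -
 obtain C where C: "C > 0" "\<And>t s x. t > 0 ==> s \<in> {0<..<t} ==> \<bar>heat1 (t - 2 * s / 3) x - heat1 t x\<bar> <= C * s * t powr (- 2)"
  using heat1_time_increment by blast
 define c :: real where "c = 1 / (4 * sqrt 3 * pi)"
 have c: "c > 0" by (simp add: c_def)
 show ?thesis unfolding c_def[symmetric]
 proof (rule bochner_integrable_bound[OF integrable_indicator_cmult[of "{0<..<t}" "c * C * t powr (- 2)"]])
  show "AE s in lborel. norm (indicator {0<..<t} s * (c / s * (heat1 (t - 2 * s / 3) x - heat1 t x))) <= norm (indicator {0<..<t} s * (c * C * t powr (- 2)))"
  proof (intro AE_I2)
   fix s
   show "norm (indicator {0<..<t} s * (c / s * (heat1 (t - 2 * s / 3) x - heat1 t x))) <= norm (indicator {0<..<t} s * (c * C * t powr (- 2)))"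
   proof (cases "s \<in> {0<..<t}")
    case True
    have "c / s * \<bar>heat1 (t - 2 * s / 3) x - heat1 t x\<bar> <= c / s * (C * s * t powr (- 2))"
     using C(2)[OF t True] c True by (intro mult_left_mono) auto
    also have "\<dots> = c * C * t powr (- 2)" using True by simp
    finally show ?thesis using True c C(1) by (simp add: abs_mult)
   qed simp
  qed
 qed (use t in simp_all)
qed

text \<open>The semigroup property evaluates the convolutions in closed form, the derivative passes
  under the integral since the increments are O(s) uniformly in x, and parabolic scaling takes time
  1 to time t.\<close>

lemma Psi_eq_profile:
 assumes t: "t > 0"
 shows "Psi t x = profile t x"
proof -
 define c :: real where "c = 1 / (4 * sqrt 3 * pi)"
 have c: "c > 0" by (simp add: c_def)
 define f where "f = (\<lambda>s x::real. indicator {0<..<1} s * (c / s * (heat (1 - 2 * s / 3) x - heat 1 x)))"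
 define f' where "f' = (\<lambda>s x::real. indicator {0<..<1} s * (c / s * (heat1 (1 - 2 * s / 3) x - heat1 1 x)))"
 \<comment> \<open>The forcing is the cubed heat kernel minus the multiple of the heat kernel that
   has the same mass; convolved up to time 1, the subtracted term becomes a multiple of
   \<open>heat 1\<close>.\<close>
 have F: "F_scaled s y = c / s * (heat (s / 3) y - heat s y)" if s: "s > 0" for s y
 proof -
  define r where "r = sqrt s"
  have r: "r > 0" "s = r ^ 2" using s by (auto simp: r_def)
  have p: "sqrt (pi ^ 3) = pi * sqrt pi" by (simp add: power3_eq_cube real_sqrt_mult)
  have q: "s powr (- 3 / 2) = 1 / (s * r)"
  proof -
   have "s powr (3 / 2) = s powr 1 * s powr (1 / 2)" unfolding powr_add[symmetric] by simp
   then have "s powr (3 / 2) = s * r" using s by (simp add: r_def powr_half_sqrt)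
   then show ?thesis by (simp add: powr_minus divide_simps)
  qed
  have e: "(y / sqrt s)\<^sup>2 = y\<^sup>2 / s" using s by (simp add: power_divide)
  have h: "heat s y = 1 / (2 * sqrt pi * r) * exp (- y\<^sup>2 / (4 * s))" by (simp add: heat_def real_sqrt_mult r_def)
  have h3: "heat (s / 3) y = sqrt 3 / (2 * sqrt pi * r) * exp (- 3 * y\<^sup>2 / (4 * s))" by (simp add: heat_def real_sqrt_mult real_sqrt_divide r_def mult.commute)
  have e1: "exp (- 3 * (y / sqrt s)\<^sup>2 / 4) = exp (- 3 * y\<^sup>2 / (4 * s))" unfolding e by simp
  have e2: "exp (- (y / sqrt s)\<^sup>2 / 4) = exp (- y\<^sup>2 / (4 * s))" unfolding e by simp
  have k1: "1 / (s * r) * (1 / (8 * sqrt (pi ^ 3))) = c / s * (sqrt 3 / (2 * sqrt pi * r))" unfolding p c_def by simp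
  have k2: "1 / (s * r) * (1 / (8 * sqrt (3 * pi ^ 3))) = c / s * (1 / (2 * sqrt pi * r))" unfolding real_sqrt_mult p c_def by simp
  have "F_scaled s y = (1 / (s * r) * (1 / (8 * sqrt (pi ^ 3)))) * exp (- 3 * y\<^sup>2 / (4 * s)) - (1 / (s * r) * (1 / (8 * sqrt (3 * pi ^ 3)))) * exp (- y\<^sup>2 / (4 * s))"
   unfolding F_scaled_def F_star_def q e1 e2 by (simp only: right_diff_distrib mult.assoc)
  also have "\<dots> = c / s * (heat (s / 3) y - heat s y)" unfolding k1 k2 h h3 by (simp only: right_diff_distrib mult.assoc)
  finally show ?thesis .
 qed
 have hh: "(LINT y|lborel. heat s (x - y) * heat r y) = heat (s + r) x" "integrable lborel (\<lambda>y. heat s (x - y) * heat r y)" if "s > 0" "r > 0" for s r x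
 proof -
  have sr: "s + r > 0" using that by simp
  have eq: "kern 0 1 0 0 s (x - y) * cplx (heat r y) = cplx (heat s (x - y) * heat r y)" for y
   using kern_heat[OF that(1), of 1] by simp
  have "cplx (LINT y|lborel. heat s (x - y) * heat r y) = cplx (heat (s + r) x)"
   using kern_semigroup(1)[OF that, of 0 x] unfolding eq integral_complex_of_real kern_heat[OF sr] .
  then show "(LINT y|lborel. heat s (x - y) * heat r y) = heat (s + r) x" by (simp only: of_real_eq_iff)
  show "integrable lborel (\<lambda>y. heat s (x - y) * heat r y)"
   using kern_semigroup(2)[OF that, of 0 x] unfolding eq complex_of_real_integrable_eq .
 qed
 have cv: "conv (heat (1 - s)) (F_scaled s) x = c / s * (heat (1 - 2 * s / 3) x - heat 1 x)" if s: "s \<in> {0<..<1}" for s x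
 proof -
  have s1: "s > 0" "1 - s > 0" "s / 3 > 0" using s by auto
  have "conv (heat (1 - s)) (F_scaled s) x = (LINT y|lborel. heat (1 - s) (x - y) * F_scaled s y)"
   unfolding conv_def by (rule lebesgue_integral_lborel) (simp add: F[OF s1(1)])
  also have "\<dots> = (LINT y|lborel. c / s * (heat (1 - s) (x - y) * heat (s / 3) y - heat (1 - s) (x - y) * heat s y))"
   unfolding F[OF s1(1)] by (simp add: algebra_simps)
  also have "\<dots> = c / s * (heat (1 - s + s / 3) x - heat (1 - s + s) x)"
   unfolding integral_mult_right_zero bochner_integral_diff[OF hh(2)[OF s1(2,3)] hh(2)[OF s1(2,1)]] hh(1)[OF s1(2,3)] hh(1)[OF s1(2,1)] ..
  finally show ?thesis by (simp add: algebra_simps)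
 qed
 obtain C where C: "C > 0" "\<And>s x. s \<in> {0<..<1} ==> \<bar>heat (1 - 2 * s / 3) x - heat 1 x\<bar> <= C * s" using heat_time_increment by blast
 obtain D where D0: "D > 0" "\<And>t s x. t > 0 ==> s \<in> {0<..<t} ==> \<bar>heat1 (t - 2 * s / 3) x - heat1 t x\<bar> <= D * s * t powr (- 2)"
  using heat1_time_increment by blast
 have D: "D > 0" "\<And>s x. s \<in> {0<..<1} ==> \<bar>heat1 (1 - 2 * s / 3) x - heat1 1 x\<bar> <= D * s" using D0(1) D0(2)[of 1] by simp_all
 have fm: "(\<lambda>s. f s x) \<in> borel_measurable lborel" for x unfolding f_def by measurable
 have "(LINT s:{0..1}|lebesgue. conv (heat (1 - s)) (F_scaled s) x) = (LINT s|lborel. f s x)" for x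
 proof -
  have "AE s in lborel. s \<noteq> (0::real) \<and> s \<noteq> 1"
   using AE_lborel_singleton[of "0::real"] AE_lborel_singleton[of "1::real"] by auto
  then have ae: "AE s in lborel. indicator {0..1} s *\<^sub>R conv (heat (1 - s)) (F_scaled s) x = f s x"
  proof (rule AE_mp, intro AE_I2 impI)
   fix s :: real assume s: "s \<noteq> 0 \<and> s \<noteq> 1"
   show "indicator {0..1} s *\<^sub>R conv (heat (1 - s)) (F_scaled s) x = f s x"
   proof (cases "s \<in> {0<..<1}")
    case True
    then show ?thesis using cv[OF True] by (simp add: f_def)
   next
    case False
    then show ?thesis using s by (auto simp: f_def indicator_def)
   qed
  qed
  show ?thesis unfolding set_lebesgue_integral_def
   by (rule integral_lebesgue_AE[OF _ ae]) (use fm in simp)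
 qed
 then have "Psi_star y = deriv (\<lambda>x. LINT s|lborel. f s x) y" for y by (simp add: Psi_star_def)
 also have "\<dots> y = (LINT s|lborel. f' s y)" for y
 proof (rule DERIV_imp_deriv, rule has_field_derivative_integral)
  have b: "\<bar>indicator {0<..<1} s * (c / s * z)\<bar> <= indicator {0<..<1} s * (c * E)" if "s \<in> {0<..<1} ==> \<bar>z\<bar> <= E * s" for s z E :: real
  proof (cases "s \<in> {0<..<1}")
   case True
   have "c / s * \<bar>z\<bar> <= c / s * (E * s)" using that[OF True] c True by (intro mult_left_mono) auto
   then show ?thesis using True c by (simp add: abs_mult)
  qed simp
  show "integrable lborel (\<lambda>s. f s x)" for x
   by (rule bochner_integrable_bound[OF integrable_indicator_cmult[of "{0<..<1}" "c * C"] fm])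
    (use b[of _ _ C] C in \<open>auto simp: f_def intro!: AE_I2 order_trans[OF _ abs_ge_self]\<close>)
  show "\<bar>f' s x\<bar> <= indicator {0<..<1} s * (c * D)" for s x unfolding f'_def by (rule b) (rule D(2))
  show "(f s has_real_derivative f' s x) (at x)" for s x
  proof (cases "s \<in> {0<..<1}")
   case True
   then show ?thesis unfolding f_def f'_def by (auto intro!: derivative_eq_intros heat_DERIV)
  qed (simp add: f_def f'_def)
  show "(\<lambda>s. f' s y) \<in> borel_measurable lborel" unfolding f'_def by measurable
 qed simp
 finally have star: "Psi_star y = (LINT s|lborel. f' s y)" for y .
 \<comment> \<open>Parabolic scaling of the first derivative; substituting t s in the time integral
   then gives the factor 1/t of the self-similar form.\<close>
 have sc: "heat1 (t * a) x = heat1 a (x / sqrt t) / t" if "a > 0" for a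
 proof -
  define r where "r = sqrt t"
  have r: "r > 0" "t = r ^ 2" using t by (auto simp: r_def)
  show ?thesis using that r by (simp add: heat1_def heat_def r_def[symmetric] real_sqrt_mult power_divide field_simps power2_eq_square)
 qed
 have "profile t x = t * (LINT s|lborel. indicator {0<..<t} (t * s) * (c / (t * s) * (heat1 (t - 2 * (t * s) / 3) x - heat1 t x)))"
  unfolding profile_def c_def[symmetric]
  using lborel_integral_real_affine[of t "\<lambda>s. indicator {0<..<t} s * (c / s * (heat1 (t - 2 * s / 3) x - heat1 t x))" 0] t by simp
 also have "\<dots> = (LINT s|lborel. t * (indicator {0<..<t} (t * s) * (c / (t * s) * (heat1 (t - 2 * (t * s) / 3) x - heat1 t x))))"
  by (simp only: integral_mult_right_zero)
 also have "\<dots> = (LINT s|lborel. 1 / t * f' s (x / sqrt t))"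
 proof (rule bochner_integral_cong[OF refl])
  fix s :: real
  show "t * (indicator {0<..<t} (t * s) * (c / (t * s) * (heat1 (t - 2 * (t * s) / 3) x - heat1 t x))) = 1 / t * f' s (x / sqrt t)"
  proof (cases "s \<in> {0<..<1}")
   case True
   have a: "t - 2 * (t * s) / 3 = t * (1 - 2 * s / 3)" by (simp add: algebra_simps)
   have "t * s \<in> {0<..<t}" using True t by simp
   then show ?thesis unfolding a f'_def using sc[of "1 - 2 * s / 3"] sc[of 1] True t by (simp add: diff_divide_distrib[symmetric])
  next
   case False
   then have "t * s \<notin> {0<..<t}" using t by (auto simp: zero_less_mult_iff)
   then show ?thesis using False by (simp add: f'_def)
  qed
 qed
 also have "\<dots> = Psi t x" unfolding integral_mult_right_zero Psi_def star by simp
 finally show ?thesis by simp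
qed

text \<open>The part of the profile integral over times in (0, 1). The comparison forcing is
  switched on only at time 1, so this part must be taken out; it is smaller than the leading scale
  by a factor 1/t.\<close>

definition log_error :: "real => real => complex" where
 "log_error t x = (LINT s|lborel. indicator {0<..<1} s * cplx (1 / (4 * sqrt 3 * pi) / s) * (dheat (t - 2 * s / 3) x - dheat t x))"

lemma small_log_error: "small log_error"
proof -
 define c :: real where "c = 1 / (4 * sqrt 3 * pi)"
 have c: "c > 0" by (simp add: c_def)
 obtain C where C: "C > 0" "\<And>t \<tau>. t > 0 ==> 0 <= \<tau> ==> \<tau> <= 2 / 3 * t ==> bnd (\<lambda>x. dheat (t - \<tau>) x - dheat t x) (C * \<tau> * t powr (- 2)) (C * \<tau> * t powr (- 3 / 2))"
  using dheat_time_increment by blast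
 show ?thesis
 proof (rule small_powerI[where r=1 and C="c * C"])
  show "\<forall>\<^sub>F t in at_top. bnd (log_error t) (c * C * t powr (- 1 - 1)) (c * C * t powr (- 1 / 2 - 1))"
   using eventually_ge_at_top[of 1]
  proof eventually_elim
   case (elim t)
   have ig: "integrable lborel (\<lambda>s::real. indicator {0<..<1} s * (c * C * t powr a))" "(LINT s|lborel. indicator {0<..<1} (s::real) * (c * C * t powr a)) <= c * C * t powr a" for a
    by simp_all
   have bs: "bnd (\<lambda>x. indicator {0<..<1} s * cplx (c / s) * (dheat (t - 2 * s / 3) x - dheat t x)) (indicator {0<..<1} s * (c * C * t powr (- 2))) (indicator {0<..<1} s * (c * C * t powr (- 3 / 2)))" for s
   proof (cases "s \<in> {0<..<1}")
    case True
    have "bnd (\<lambda>x. cplx (c / s) * (dheat (t - 2 * s / 3) x - dheat t x)) (norm (cplx (c / s)) * (C * (2 * s / 3) * t powr (- 2))) (norm (cplx (c / s)) * (C * (2 * s / 3) * t powr (- 3 / 2)))"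
     using True elim by (intro bnd_cmult C) auto
    then have "bnd (\<lambda>x. cplx (c / s) * (dheat (t - 2 * s / 3) x - dheat t x)) (c * C * t powr (- 2)) (c * C * t powr (- 3 / 2))"
    proof (rule bnd_mono)
     have "norm (cplx (c / s)) * (C * (2 * s / 3) * z) <= c * C * z" if "z >= 0" for z
     proof -
      have "norm (cplx (c / s)) * (C * (2 * s / 3) * z) = 2 / 3 * (c * C * z)" using True c by (simp add: norm_divide)
      also have "\<dots> <= 1 * (c * C * z)" using c C(1) that by (intro mult_right_mono) auto
      finally show ?thesis by simp
     qed
     then show "norm (cplx (c / s)) * (C * (2 * s / 3) * t powr (- 2)) <= c * C * t powr (- 2)" "norm (cplx (c / s)) * (C * (2 * s / 3) * t powr (- 3 / 2)) <= c * C * t powr (- 3 / 2)" by auto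
    qed
    then show ?thesis using True by simp
   qed (simp add: bnd_def)
   have "bnd (\<lambda>x. LINT s|lborel. indicator {0<..<1} s * cplx (c / s) * (dheat (t - 2 * s / 3) x - dheat t x)) (c * C * t powr (- 2)) (c * C * t powr (- 3 / 2))"
   proof (rule bnd_superpose[OF _ _ _ _ _ ig ig])
    show "(\<lambda>(x, s). indicator {0<..<1} s * cplx (c / s) * (dheat (t - 2 * s / 3) x - dheat t x)) \<in> borel_measurable (lborel \<Otimes>\<^sub>M lborel)" by measurable
   qed (use bs c C(1) in \<open>auto simp: bnd_def lborel.sigma_finite_measure_axioms\<close>)
   then show ?case unfolding log_error_def c_def[symmetric] by simp
  qed
 qed (use c C in auto)
qed

text \<open>Add and subtract \<open>dheat t x\<close> under the integral: the constant part
  integrates 1/s to \<open>ln t\<close>, the compensated part is the profile less its portion before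
  time 1.\<close>

lemma profile_expansion:
 assumes t: "t > 1"
 shows "(LINT s|lborel. indicator {1..<t} s *\<^sub>R (cplx (1 / (4 * sqrt 3 * pi) / s) * dheat (t - 2 * s / 3) x))
  = cplx (1 / (4 * sqrt 3 * pi) * ln t) * dheat t x + cplx (profile t x) - log_error t x"
  "integrable lborel (\<lambda>s. indicator {1..<t} s *\<^sub>R (cplx (1 / (4 * sqrt 3 * pi) / s) * dheat (t - 2 * s / 3) x))"
proof -
 define c :: real where "c = 1 / (4 * sqrt 3 * pi)"
 let ?p = "\<lambda>s. indicator {0<..<t} s * (c / s * (heat1 (t - 2 * s / 3) x - heat1 t x))"
 let ?q = "\<lambda>s. indicator {0<..<1} s * (c / s * (heat1 (t - 2 * s / 3) x - heat1 t x))"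
 let ?l = "\<lambda>s. 1 / s * indicator {1..t} (s::real)"
 have p: "integrable lborel ?p" unfolding c_def using t by (intro profile_integrable) simp
 have q: "integrable lborel ?q"
 proof (rule bochner_integrable_bound[OF p])
  show "AE s in lborel. norm (?q s) <= norm (?p s)" using t by (intro AE_I2) (auto simp: indicator_def)
 qed measurable
 have D: "DERIV ln s :> 1 / s" "isCont (\<lambda>s. 1 / s) s" if "1 <= s" for s :: real
  using that by (auto intro!: DERIV_ln_divide continuous_intros)
 have l: "integrable lborel ?l" "(LINT s|lborel. ?l s) = ln t"
  using integral_FTC_Icc_real[of 1 t ln "\<lambda>s. 1 / s"] borel_integrable_atLeastAtMost[of 1 t "\<lambda>s. 1 / s"] D t by (auto simp: indicator_def if_distrib cong: if_cong)
 let ?F = "\<lambda>s. ?l s * (c * heat1 t x) + ?p s - ?q s"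
 have Fi: "integrable lborel ?F" by (intro Bochner_Integration.integrable_add Bochner_Integration.integrable_diff integrable_mult_left l p q)
 have ae: "AE s in lborel. cplx (?F s) = indicator {1..<t} s *\<^sub>R (cplx (c / s) * dheat (t - 2 * s / 3) x)"
  using AE_lborel_singleton[of t]
 proof (rule AE_mp, intro AE_I2 impI)
  fix s assume s: "s \<noteq> t"
  consider "s <= 0" | "0 < s" "s < 1" | "1 <= s" "s < t" | "s > t" using s by linarith
  then show "cplx (?F s) = indicator {1..<t} s *\<^sub>R (cplx (c / s) * dheat (t - 2 * s / 3) x)"
  proof cases
   case 3
   then have "?F s = c / s * heat1 (t - 2 * s / 3) x" by (simp add: algebra_simps)
   then show ?thesis using 3 by (simp add: dheat_def)
  qed (use t in auto)
 qed
 have m: "(\<lambda>s. indicator {1..<t} s *\<^sub>R (cplx (c / s) * dheat (t - 2 * s / 3) x)) \<in> borel_measurable lborel" by measurable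
 have m2: "(\<lambda>s. cplx (?F s)) \<in> borel_measurable lborel" by measurable
 have i2: "integrable lborel (\<lambda>s. cplx (?F s))" using Fi by (simp only: complex_of_real_integrable_eq)
 show "integrable lborel (\<lambda>s. indicator {1..<t} s *\<^sub>R (cplx (1 / (4 * sqrt 3 * pi) / s) * dheat (t - 2 * s / 3) x))"
  unfolding c_def[symmetric] by (rule integrable_cong_AE_imp[OF i2 m ae])
 have "(LINT s|lborel. indicator {1..<t} s *\<^sub>R (cplx (c / s) * dheat (t - 2 * s / 3) x)) = (LINT s|lborel. cplx (?F s))"
  by (rule integral_cong_AE[OF m m2]) (use ae in \<open>auto elim: AE_mp\<close>)
 also have "\<dots> = cplx (LINT s|lborel. ?F s)" by (rule integral_complex_of_real)
 also have "(LINT s|lborel. ?F s) = ln t * (c * heat1 t x) + (LINT s|lborel. ?p s) - (LINT s|lborel. ?q s)"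
  unfolding bochner_integral_diff[OF Bochner_Integration.integrable_add[OF integrable_mult_left[OF l(1)] p] q]
   bochner_integral_add[OF integrable_mult_left[OF l(1)] p] integral_mult_left_zero l(2) ..
 also have "cplx \<dots> = cplx (c * ln t) * dheat t x + cplx (profile t x) - cplx (LINT s|lborel. ?q s)"
  unfolding profile_def c_def[symmetric] dheat_def by simp
 also have "cplx (LINT s|lborel. ?q s) = log_error t x"
  unfolding log_error_def c_def[symmetric] integral_complex_of_real[symmetric]
  by (rule bochner_integral_cong) (auto simp: indicator_def dheat_def)
 finally show "(LINT s|lborel. indicator {1..<t} s *\<^sub>R (cplx (1 / (4 * sqrt 3 * pi) / s) * dheat (t - 2 * s / 3) x))
  = cplx (1 / (4 * sqrt 3 * pi) * ln t) * dheat t x + cplx (profile t x) - log_error t x" unfolding c_def .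
qed

section \<open>Second-order expansion\<close>

lemma abs_cube_diff_le:
 fixes a b :: real
 shows "\<bar>a ^ 3 - b ^ 3\<bar> <= \<bar>a - b\<bar> * (3 / 2 * (a\<^sup>2 + b\<^sup>2))"
proof -
 have 1: "a ^ 3 - b ^ 3 = (a - b) * (a\<^sup>2 + a * b + b\<^sup>2)" by (simp add: power3_eq_cube power2_eq_square algebra_simps)
 have 2: "\<bar>a\<^sup>2 + a * b + b\<^sup>2\<bar> <= 3 / 2 * (a\<^sup>2 + b\<^sup>2)"
 proof -
  have "0 <= (a - b)\<^sup>2" "0 <= (a + b)\<^sup>2" by simp_all
  then show ?thesis unfolding abs_le_iff power2_sum power2_diff by (auto simp: algebra_simps)
 qed
 show ?thesis unfolding 1 abs_mult by (rule mult_left_mono[OF 2]) simp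
qed

context decaying_solution
begin

definition mom :: real where "mom = (LINT x|lborel. x * v 0 x)"

definition cubic_mass :: real where
 "cubic_mass = (LINT \<tau>|lborel. indicator {0..1} \<tau> *\<^sub>R (LINT y|lborel. v \<tau> y ^ 3)) +
   (LINT \<tau>|lborel. indicator {1..} \<tau> *\<^sub>R (LINT y|lborel. v \<tau> y ^ 3 - (M * heat \<tau> y) ^ 3))"

text \<open>The mass of the comparison forcing is proportional to 1/s, not integrable at time 0,
  hence the switch at time 1. The same cut appears in the definition of the cubic moment.\<close>

definition heat_cube_part :: "real => real => complex" where
 "heat_cube_part s y = (if s < 1 then 0 else cplx ((M * heat s y) ^ 3))"

definition rest :: "real => real => complex" where
 "rest s y = (if s <= 0 then 0 else cube s y - heat_cube_part s y)"

lemma rest_measurable: "(\<lambda>(s, y). rest s y) \<in> borel2"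
 unfolding rest_def heat_cube_part_def by measurable

text \<open>Before time 1 this is the cube alone. From time 1 on, the first-order asymptotics gain
  s^(-\<open>\<epsilon>\<close>) on one factor of the difference of cubes, which turns the
  borderline decay 1/s in L^1 into an integrable one.\<close>

lemma rest_bounds:
 "\<exists>S \<epsilon>. \<epsilon> > 0 \<and> S >= 0 \<and>
  (\<forall>s. 0 < s --> s < 1 --> (nnL1 (rest s)) <= ennreal (S * s powr (- (1/4)))) \<and>
  (\<forall>s\<ge>1. (nnL1 (rest s)) <= ennreal (S * s powr (- 1 - \<epsilon>))) \<and>
  (\<forall>s>0. \<forall>y. norm (rest s y) <= S * s powr (- (3/4))) \<and>
  (\<forall>s\<ge>1. \<forall>y. norm (rest s y) <= S * s powr (- (3/2) - \<epsilon>))"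
proof -
 obtain C \<epsilon> where C: "C >= 0" "\<epsilon> > 0" "\<And>t x. t >= 1 ==> \<bar>v t x - M * heat t x\<bar> <= C * t powr (- (1/2) - \<epsilon>)"
  using first_order by blast
 obtain H where H: "H > 0" "\<And>t. t > 0 ==> bnd (kern 0 1 0 0 t) (H * t powr (- (real 0 + 1) / 2)) (H * t powr (- real 0 / 2))"
  using heat_kern_bnd[of 1 0] by auto
 have h1: "\<bar>heat t x\<bar> <= H * t powr (- (1/2))" if "t > 0" for t x
  using H(2)[OF that] kern_heat[OF that, of 1] by (simp add: bnd_def)
 have h2: "(\<integral>\<^sup>+x. ennreal \<bar>heat t x\<bar> \<partial>lborel) <= ennreal H" if "t > 0" for t
  using H(2)[OF that] kern_heat[OF that, of 1] that by (simp add: bnd_def)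
 define L where "L = 3 / 2 * (K\<^sup>2 + M\<^sup>2 * H\<^sup>2)"
 define S where "S = K ^ 3 + C * L"
 have L: "L >= 0" by (simp add: L_def)
 have S: "K ^ 3 <= S" "C * L <= S" "S >= 0" using K0 C(1) L by (auto simp: S_def)
 have r: "norm (rest s y) <= C * s powr (- (1/2) - \<epsilon>) * (3 / 2 * ((v s y)\<^sup>2 + (M * heat s y)\<^sup>2))" if s: "s >= 1" for s y
 proof -
  have "norm (rest s y) = \<bar>v s y ^ 3 - (M * heat s y) ^ 3\<bar>"
   using s by (simp add: rest_def heat_cube_part_def cube_def flip: of_real_power of_real_diff of_real_mult)
  also have "\<dots> <= \<bar>v s y - M * heat s y\<bar> * (3 / 2 * ((v s y)\<^sup>2 + (M * heat s y)\<^sup>2))" by (rule abs_cube_diff_le)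
  also have "\<dots> <= C * s powr (- (1/2) - \<epsilon>) * (3 / 2 * ((v s y)\<^sup>2 + (M * heat s y)\<^sup>2))" by (intro mult_right_mono C(3)[OF s]) simp
  finally show ?thesis .
 qed
 have sup: "norm (rest s y) <= S * s powr (- (3/2) - \<epsilon>)" if s: "s >= 1" for s y
 proof -
  have e: "(s powr (- (1/2)))\<^sup>2 = s powr (- 1)" unfolding power2_eq_square powr_add[symmetric] by simp
  have "\<bar>v s y\<bar>\<^sup>2 <= (K * s powr (- (1/2)))\<^sup>2" using v_sup[of s y] s by (intro power_mono) auto
  then have 1: "(v s y)\<^sup>2 <= K\<^sup>2 * s powr (- 1)" by (simp only: power2_abs power_mult_distrib e)
  have "\<bar>heat s y\<bar>\<^sup>2 <= (H * s powr (- (1/2)))\<^sup>2" using h1[of s y] s by (intro power_mono) auto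
  then have "(heat s y)\<^sup>2 <= H\<^sup>2 * s powr (- 1)" by (simp only: power2_abs power_mult_distrib e)
  then have "M\<^sup>2 * (heat s y)\<^sup>2 <= M\<^sup>2 * (H\<^sup>2 * s powr (- 1))" by (rule mult_left_mono) simp
  moreover have "3 / 2 * (X + M\<^sup>2 * Y) <= L * u" if "X <= K\<^sup>2 * u" "M\<^sup>2 * Y <= M\<^sup>2 * (H\<^sup>2 * u)" for X Y u
   using that by (simp add: L_def algebra_simps)
  ultimately have "3 / 2 * ((v s y)\<^sup>2 + (M * heat s y)\<^sup>2) <= L * s powr (- 1)" unfolding power_mult_distrib using 1 by blast
  then have "C * s powr (- (1/2) - \<epsilon>) * (3 / 2 * ((v s y)\<^sup>2 + (M * heat s y)\<^sup>2)) <= C * s powr (- (1/2) - \<epsilon>) * (L * s powr (- 1))"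
   using C(1) by (intro mult_left_mono) auto
  also have "\<dots> = C * L * (s powr (- (1/2) - \<epsilon>) * s powr (- 1))" by simp
  also have "s powr (- (1/2) - \<epsilon>) * s powr (- 1) = s powr (- (3/2) - \<epsilon>)" unfolding powr_add[symmetric] by simp
  also have "C * L * \<dots> <= S * \<dots>" using S by (intro mult_right_mono) auto
  finally show ?thesis using r[OF s, of y] by linarith
 qed
 have L1: "(nnL1 (rest s)) <= ennreal (S * s powr (- 1 - \<epsilon>))" if s: "s >= 1" for s
 proof -
  have s0: "s > 0" using s by simp
  define a where "a = C * s powr (- (1/2) - \<epsilon>) * (3 / 2)"
  have a: "a >= 0" using C(1) by (simp add: a_def)
  have V: "(\<integral>\<^sup>+y. ennreal ((v s y)\<^sup>2) \<partial>lborel) <= ennreal (K\<^sup>2 * s powr (- (1/2)))"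
  proof -
   have "((1 + s) powr (- (1/4)))\<^sup>2 = (1 + s) powr (- (1/2))" unfolding power2_eq_square powr_add[symmetric] by simp
   also have "\<dots> <= s powr (- (1/2))" using s by (intro powr_mono2') auto
   finally have "(K * (1 + s) powr (- (1/4)))\<^sup>2 <= K\<^sup>2 * s powr (- (1/2))" unfolding power_mult_distrib by (intro mult_left_mono) auto
   then show ?thesis using decays_L2[OF dec[OF s0] s0] by (meson ennreal_leI order_trans)
  qed
  have W: "(\<integral>\<^sup>+y. ennreal ((M * heat s y)\<^sup>2) \<partial>lborel) <= ennreal (M\<^sup>2 * H\<^sup>2 * s powr (- (1/2)))"
  proof -
   have "(M * heat s y)\<^sup>2 <= M\<^sup>2 * (H * s powr (- (1/2))) * \<bar>heat s y\<bar>" for y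
   proof -
    have "\<bar>heat s y\<bar> * \<bar>heat s y\<bar> <= H * s powr (- (1/2)) * \<bar>heat s y\<bar>" by (intro mult_right_mono h1[OF s0]) simp
    then have "M\<^sup>2 * (\<bar>heat s y\<bar> * \<bar>heat s y\<bar>) <= M\<^sup>2 * (H * s powr (- (1/2)) * \<bar>heat s y\<bar>)" by (rule mult_left_mono) simp
    then show ?thesis by (simp add: power_mult_distrib power2_eq_square mult_ac)
   qed
   then have "(\<integral>\<^sup>+y. ennreal ((M * heat s y)\<^sup>2) \<partial>lborel) <= (\<integral>\<^sup>+y. ennreal (M\<^sup>2 * (H * s powr (- (1/2)))) * ennreal \<bar>heat s y\<bar> \<partial>lborel)"
    using H(1) by (intro nn_integral_mono) (subst ennreal_mult[symmetric], auto intro!: ennreal_leI)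
   also have "\<dots> = ennreal (M\<^sup>2 * (H * s powr (- (1/2)))) * (\<integral>\<^sup>+y. ennreal \<bar>heat s y\<bar> \<partial>lborel)" by (rule nn_integral_cmult) measurable
   also have "\<dots> <= ennreal (M\<^sup>2 * (H * s powr (- (1/2)))) * ennreal H" by (intro mult_left_mono h2[OF s0]) auto
   also have "\<dots> = ennreal (M\<^sup>2 * (H * s powr (- (1/2))) * H)" using H(1) by (subst ennreal_mult) auto
   finally show ?thesis by (simp add: power2_eq_square mult_ac)
  qed
  have "(nnL1 (rest s)) <= (\<integral>\<^sup>+y. ennreal a * (ennreal ((v s y)\<^sup>2) + ennreal ((M * heat s y)\<^sup>2)) \<partial>lborel)"
  proof (rule nn_integral_mono)
   fix y
   have "norm (rest s y) <= a * ((v s y)\<^sup>2 + (M * heat s y)\<^sup>2)" using r[OF s, of y] by (simp only: a_def mult.assoc)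
   then have "ennreal (norm (rest s y)) <= ennreal (a * ((v s y)\<^sup>2 + (M * heat s y)\<^sup>2))" by (rule ennreal_leI)
   also have "\<dots> = ennreal a * (ennreal ((v s y)\<^sup>2) + ennreal ((M * heat s y)\<^sup>2))" using a by (simp add: ennreal_mult)
   finally show "ennreal (norm (rest s y)) <= ennreal a * (ennreal ((v s y)\<^sup>2) + ennreal ((M * heat s y)\<^sup>2))" .
  qed
  also have "\<dots> = ennreal a * ((\<integral>\<^sup>+y. ennreal ((v s y)\<^sup>2) \<partial>lborel) + (\<integral>\<^sup>+y. ennreal ((M * heat s y)\<^sup>2) \<partial>lborel))"
   by (subst nn_integral_cmult, measurable, subst nn_integral_add, measurable)
  also have "\<dots> <= ennreal a * (ennreal (K\<^sup>2 * s powr (- (1/2))) + ennreal (M\<^sup>2 * H\<^sup>2 * s powr (- (1/2))))" by (intro mult_left_mono add_mono V W) auto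
  also have "\<dots> = ennreal (a * (K\<^sup>2 * s powr (- (1/2)) + M\<^sup>2 * H\<^sup>2 * s powr (- (1/2))))" using a by (subst ennreal_plus[symmetric], simp, simp, subst ennreal_mult, auto)
  also have "a * (K\<^sup>2 * s powr (- (1/2)) + M\<^sup>2 * H\<^sup>2 * s powr (- (1/2))) = C * L * (s powr (- (1/2) - \<epsilon>) * s powr (- (1/2)))"
   by (simp add: a_def L_def algebra_simps)
  also have "s powr (- (1/2) - \<epsilon>) * s powr (- (1/2)) = s powr (- 1 - \<epsilon>)" unfolding powr_add[symmetric] by simp
  also have "ennreal (C * L * s powr (- 1 - \<epsilon>)) <= ennreal (S * s powr (- 1 - \<epsilon>))" using S by (intro ennreal_leI mult_right_mono) auto
  finally show ?thesis .
 qed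
 have c: "rest s y = cube s y" if "0 < s" "s < 1" for s y using that by (simp add: rest_def heat_cube_part_def)
 have b1: "(nnL1 (rest s)) <= ennreal (S * s powr (- (1/4)))" if s: "0 < s" "s < 1" for s
 proof -
  have "K ^ 3 * s powr (- (1/4)) <= S * s powr (- (1/4))" using S by (intro mult_right_mono) auto
  then show ?thesis using cube_L1[OF s(1), of "1/4"] unfolding c[OF s] by (auto intro: order_trans ennreal_leI)
 qed
 have b3: "norm (rest s y) <= S * s powr (- (3/4))" if s: "s > 0" for s y
 proof (cases "s < 1")
  case True
  have "K ^ 3 * s powr (- (3/4)) <= S * s powr (- (3/4))" using S by (intro mult_right_mono) auto
  then show ?thesis using cube_sup34[OF s, of y] unfolding c[OF s True] by linarith
 next
  case False
  have "S * s powr (- (3/2) - \<epsilon>) <= S * s powr (- (3/4))" using False S C(2) by (intro mult_left_mono powr_mono) auto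
  then show ?thesis using sup[of s y] False by linarith
 qed
 show ?thesis using b1 b3 sup L1 C(2) S(3) by (intro exI[of _ S] exI[of _ \<epsilon>]) auto
qed

lemma conv_cube_integrable:
 assumes k: "bnd k A B" and s: "s > 0"
 shows "integrable lborel (\<lambda>y. k (x - y) * cube s y)"
proof -
 have vs: "v s \<in> borel_measurable borel" by measurable
 have "integrable lborel (cube s)" unfolding cube_def using cube_bounds(1)[OF dec[OF s] s K0 vs] .
 then show ?thesis by (rule bnd_conv_integrable[OF k])
qed

text \<open>The weight found by concentrating the forcing at the origin is the constant of the
  statement: Fubini and the cut at time 1 match, up to single times, the two pieces in which that
  constant is defined.\<close>

lemma rest_integral: "(LINT p|(lborel \<Otimes>\<^sub>M lborel). rest (fst p) (snd p)) = cplx cubic_mass"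
proof -
 obtain S \<epsilon> where S: "\<epsilon> > 0" "S >= 0" "\<And>s. 0 < s ==> s < 1 ==> (nnL1 (rest s)) <= ennreal (S * s powr (- (1/4)))"
  "\<And>s. s >= 1 ==> (nnL1 (rest s)) <= ennreal (S * s powr (- 1 - \<epsilon>))"
  using rest_bounds by blast
 have r0: "rest s y = 0" if "s <= 0" for s y using that by (simp add: rest_def)
 note i = spacetime_integrable[OF rest_measurable r0 S(3,4,1,2)]
 have eq: "(LINT p|(lborel \<Otimes>\<^sub>M lborel). rest (fst p) (snd p)) = (LINT s|lborel. LINT y|lborel. rest s y)"
  using lborel_pair.integral_fst'[OF i] by simp
 define w where "w = (\<lambda>s. LINT y|lborel. rest s y)"
 have wi: "integrable lborel w" using lborel_pair.integrable_fst'[OF i] by (simp add: w_def)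
 have w1: "integrable lborel (\<lambda>s. indicator {0..1} s *\<^sub>R w s)" "integrable lborel (\<lambda>s. indicator {1..} s *\<^sub>R w s)"
  by (rule integrable_mult_indicator[OF _ wi]; simp)+
 have w0: "w s = 0" if "s < 0" for s using that by (simp add: w_def rest_def[abs_def])
 have "(LINT s|lborel. w s) = (LINT s|lborel. indicator {0..1} s *\<^sub>R w s + indicator {1..} s *\<^sub>R w s)"
 proof (rule integral_cong_AE)
  show "AE s in lborel. w s = indicator {0..1} s *\<^sub>R w s + indicator {1..} s *\<^sub>R w s"
   using AE_lborel_singleton[of "1::real"] by eventually_elim (auto simp: indicator_def w0)
 qed (use wi w1 in auto)
 also have "\<dots> = (LINT s|lborel. indicator {0..1} s *\<^sub>R w s) + (LINT s|lborel. indicator {1..} s *\<^sub>R w s)"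
  by (rule bochner_integral_add[OF w1])
 also have "(LINT s|lborel. indicator {1..} s *\<^sub>R w s) = cplx (LINT \<tau>|lborel. indicator {1..} \<tau> *\<^sub>R (LINT y|lborel. v \<tau> y ^ 3 - (M * heat \<tau> y) ^ 3))"
  unfolding integral_complex_of_real[symmetric]
 proof (rule bochner_integral_cong[OF refl])
  fix s :: real
  have "w s = (LINT y|lborel. cplx (v s y ^ 3 - (M * heat s y) ^ 3))" if "s >= 1"
   unfolding w_def using that by (intro bochner_integral_cong) (auto simp: rest_def heat_cube_part_def cube_def)
  then show "indicator {1..} s *\<^sub>R w s = cplx (indicator {1..} s *\<^sub>R (LINT y|lborel. v s y ^ 3 - (M * heat s y) ^ 3))"
   unfolding integral_complex_of_real by (cases "s >= 1") auto
 qed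
 also have "(LINT s|lborel. indicator {0..1} s *\<^sub>R w s) = (LINT \<tau>|lborel. cplx (indicator {0..1} \<tau> *\<^sub>R (LINT y|lborel. v \<tau> y ^ 3)))"
 proof (rule integral_cong_AE)
  show "AE s in lborel. indicator {0..1} s *\<^sub>R w s = cplx (indicator {0..1} s *\<^sub>R (LINT y|lborel. v s y ^ 3))"
   using AE_lborel_singleton[of "0::real"] AE_lborel_singleton[of "1::real"]
  proof eventually_elim
   case (elim s)
   have "w s = (LINT y|lborel. cplx (v s y ^ 3))" if "0 < s" "s < 1"
    unfolding w_def using that by (intro bochner_integral_cong) (auto simp: rest_def heat_cube_part_def cube_def)
   then show ?case unfolding integral_complex_of_real using elim by (cases "0 < s \<and> s < 1") (auto simp: indicator_def)
  qed
  have "(\<lambda>s. LINT y|lborel. v s y ^ 3) \<in> borel_measurable borel" by measurable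
  then show "(\<lambda>s. cplx (indicator {0..1} s *\<^sub>R (LINT y|lborel. v s y ^ 3))) \<in> borel_measurable lborel" by measurable
 qed (use w1 in auto)
 finally show ?thesis unfolding eq w_def[symmetric] cubic_mass_def integral_complex_of_real by simp
qed

text \<open>Kernel and forcing are split in turn: the dispersive part of the kernel is negligible,
  the heat part acting on \<open>rest\<close> yields the point mass, and the heat part acting on the
  comparison forcing yields logarithm and profile exactly, up to \<open>log_error\<close>.\<close>

lemma small_nonlinear:
 "small (\<lambda>t x. duhamel \<alpha> cube t x
   - (cplx (1 / (4 * sqrt 3 * pi) * M ^ 3 * ln t + cubic_mass) * dheat t x + cplx (M ^ 3 * profile t x)))"
proof -
 obtain S \<epsilon> where S: "\<epsilon> > 0" "S >= 0" "\<And>s. 0 < s ==> s < 1 ==> (nnL1 (rest s)) <= ennreal (S * s powr (- (1/4)))"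
  "\<And>s. s >= 1 ==> (nnL1 (rest s)) <= ennreal (S * s powr (- 1 - \<epsilon>))"
  "\<And>s y. s > 0 ==> norm (rest s y) <= S * s powr (- (3/4))"
  "\<And>s y. s >= 1 ==> norm (rest s y) <= S * s powr (- (3/2) - \<epsilon>)"
  using rest_bounds by blast
 have r0: "rest s y = 0" if "s <= 0" for s y using that by (simp add: rest_def)
 have rs: "small (\<lambda>t x. duh dheat rest {0<..<t} t x - (LINT p|(lborel \<Otimes>\<^sub>M lborel). rest (fst p) (snd p)) * dheat t x)"
  by (rule small_duh_dheat(1)[OF rest_measurable r0 S(3-6,1)])
 have ri: "integrable lborel (\<lambda>s. indicator {0<..<t} s *\<^sub>R (LINT y|lborel. dheat (t - s) (x - y) * rest s y))" if "t > 0" for t x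
  by (rule small_duh_dheat(2)[OF rest_measurable r0 S(3-6,1) that])
 obtain D where D: "\<And>t. t > 0 ==> bnd (dheat t) (D * t powr (- 1)) (D * t powr (- 1 / 2))" using dheat_bnd by blast
 obtain D1 where D1: "\<And>t. t > 0 ==> bnd (kern 1 \<alpha> 1 1 t) (D1 * t powr (- 1 - (\<alpha> - 1) / 2)) (D1 * t powr (- ((\<alpha> + 1) / 4)))"
  using dkern_diff_bnd[OF \<alpha>(1)] by blast
 \<comment> \<open>For t > 1 this is an identity; all smallness has been proved for the separate
   pieces.\<close>
 have split: "duhamel \<alpha> cube t x = duh (kern 1 \<alpha> 1 1) cube {0<..<t} t x + duh dheat rest {0<..<t} t x
   + cplx (M ^ 3) * (cplx (1 / (4 * sqrt 3 * pi) * ln t) * dheat t x + cplx (profile t x) - log_error t x)"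
  if t: "t > 1" for t x
 proof -
  have t0: "t > 0" using t by simp
  let ?a = "\<lambda>s. indicator {0<..<t} s *\<^sub>R (LINT y|lborel. kern 1 \<alpha> 1 1 (t - s) (x - y) * cube s y)"
  let ?b = "\<lambda>s. indicator {0<..<t} s *\<^sub>R (LINT y|lborel. dheat (t - s) (x - y) * rest s y)"
  let ?c = "\<lambda>s. indicator {1..<t} s *\<^sub>R (cplx (1 / (4 * sqrt 3 * pi) / s) * dheat (t - 2 * s / 3) x)"
  have "indicator {0<..<t} s *\<^sub>R (LINT y|lborel. kern 1 \<alpha> 1 0 (t - s) (x - y) * cube s y) = ?a s + ?b s + cplx (M ^ 3) * ?c s" for s
  proof (cases "s \<in> {0<..<t}")
   case True
   then have s: "s > 0" "t - s > 0" by auto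
   have k: "kern 1 \<alpha> 1 0 (t - s) z = kern 1 \<alpha> 1 1 (t - s) z + dheat (t - s) z" for z
    using kern_Suc[of \<alpha> "t - s" 1 z] s \<alpha>_pos dheat_eq_kern[OF s(2) \<alpha>_pos] by simp
   have i1: "integrable lborel (\<lambda>y. kern 1 \<alpha> 1 1 (t - s) (x - y) * cube s y)" by (rule conv_cube_integrable[OF D1[OF s(2)] s(1)])
   have i2: "integrable lborel (\<lambda>y. dheat (t - s) (x - y) * cube s y)" by (rule conv_cube_integrable[OF D[OF s(2)] s(1)])
   have e: "(LINT y|lborel. kern 1 \<alpha> 1 0 (t - s) (x - y) * cube s y) = (LINT y|lborel. kern 1 \<alpha> 1 1 (t - s) (x - y) * cube s y) + (LINT y|lborel. dheat (t - s) (x - y) * cube s y)"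
    unfolding k distrib_right by (rule bochner_integral_add[OF i1 i2])
   have "(LINT y|lborel. dheat (t - s) (x - y) * cube s y) = (LINT y|lborel. dheat (t - s) (x - y) * rest s y) + cplx (M ^ 3) * ?c s"
   proof (cases "s < 1")
    case True
    then show ?thesis using s by (simp add: rest_def heat_cube_part_def)
   next
    case False
    have i3: "integrable lborel (\<lambda>y. dheat (t - s) (x - y) * cplx ((M * heat s y) ^ 3))"
     by (rule conv_dheat_heat_cube(2)[OF s(2,1)])
    have "(LINT y|lborel. dheat (t - s) (x - y) * rest s y) = (LINT y|lborel. dheat (t - s) (x - y) * cube s y - dheat (t - s) (x - y) * cplx ((M * heat s y) ^ 3))"
     using False s by (simp add: rest_def heat_cube_part_def right_diff_distrib)
    also have "\<dots> = (LINT y|lborel. dheat (t - s) (x - y) * cube s y) - (LINT y|lborel. dheat (t - s) (x - y) * cplx ((M * heat s y) ^ 3))"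
     by (rule bochner_integral_diff[OF i2 i3])
    also have "(LINT y|lborel. dheat (t - s) (x - y) * cplx ((M * heat s y) ^ 3)) = cplx (M ^ 3 * (1 / (4 * sqrt 3 * pi)) / s) * dheat (t - s + s / 3) x"
     by (rule conv_dheat_heat_cube(1)[OF s(2,1)])
    also have "t - s + s / 3 = t - 2 * s / 3" by simp
    also have "cplx (M ^ 3 * (1 / (4 * sqrt 3 * pi)) / s) * dheat (t - 2 * s / 3) x = cplx (M ^ 3) * ?c s"
     using False True by simp
    finally show ?thesis by simp
   qed
   then show ?thesis unfolding e using True by simp
  qed (use t in auto)
  then have "duhamel \<alpha> cube t x = (LINT s|lborel. ?a s + ?b s + cplx (M ^ 3) * ?c s)" unfolding duhamel_def by simp
  also have "\<dots> = (LINT s|lborel. ?a s) + (LINT s|lborel. ?b s) + cplx (M ^ 3) * (LINT s|lborel. ?c s)"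
   unfolding bochner_integral_add[OF Bochner_Integration.integrable_add[OF N1_integrable[OF t0] ri[OF t0]] integrable_mult_right[OF profile_expansion(2)[OF t]]]
    bochner_integral_add[OF N1_integrable[OF t0] ri[OF t0]] integral_mult_right_zero ..
  finally show ?thesis unfolding profile_expansion(1)[OF t] duh_def .
 qed
 show ?thesis
 proof (rule small_cong[OF small_diff[OF small_add[OF small_N1 rs] small_cmult[OF small_log_error, of "cplx (M ^ 3)"]]])
  show "\<forall>\<^sub>F t in at_top. \<forall>x. duh (kern 1 \<alpha> 1 1) cube {0<..<t} t x + (duh dheat rest {0<..<t} t x - (LINT p|(lborel \<Otimes>\<^sub>M lborel). rest (fst p) (snd p)) * dheat t x) - cplx (M ^ 3) * log_error t x
   = duhamel \<alpha> cube t x - (cplx (1 / (4 * sqrt 3 * pi) * M ^ 3 * ln t + cubic_mass) * dheat t x + cplx (M ^ 3 * profile t x))"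
   using eventually_gt_at_top[of 1]
  proof eventually_elim
   case (elim t)
   show ?case unfolding split[OF elim] rest_integral by (simp add: algebra_simps)
  qed
 qed
qed

theorem expansion:
 "\<exists>R. small R \<and> (\<forall>t>0. AE x in lborel. cplx (v t x) = cplx M * kern 1 \<alpha> 0 0 t x - cplx mom * kern 1 \<alpha> 1 0 t x
   - cplx (\<beta> / 3) * (cplx (1 / (4 * sqrt 3 * pi) * M ^ 3 * ln t + cubic_mass) * dheat t x + cplx (M ^ 3 * profile t x)) + R t x)"
proof (intro exI conjI allI impI)
 let ?L = "\<lambda>t x. (LINT y|lborel. kern 1 \<alpha> 0 0 t (x - y) * cplx (v 0 y)) - cplx M * kern 1 \<alpha> 0 0 t x + cplx mom * kern 1 \<alpha> 1 0 t x"
 let ?N = "\<lambda>t x. duhamel \<alpha> cube t x - (cplx (1 / (4 * sqrt 3 * pi) * M ^ 3 * ln t + cubic_mass) * dheat t x + cplx (M ^ 3 * profile t x))"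
 show "small (\<lambda>t x. ?L t x - cplx (\<beta> / 3) * ?N t x)"
  by (intro small_diff small_cmult small_nonlinear small_linear[OF \<alpha>(1) v0_int v0_mom, folded M_def mom_def])
 fix t :: real assume "t > 0"
 from mild[OF this] show "AE x in lborel. cplx (v t x) = cplx M * kern 1 \<alpha> 0 0 t x - cplx mom * kern 1 \<alpha> 1 0 t x
   - cplx (\<beta> / 3) * (cplx (1 / (4 * sqrt 3 * pi) * M ^ 3 * ln t + cubic_mass) * dheat t x + cplx (M ^ 3 * profile t x))
   + (?L t x - cplx (\<beta> / 3) * ?N t x)"
 proof eventually_elim
  case (elim x)
  have e: "duhamel \<alpha> (cubed v) t x = duhamel \<alpha> cube t x" by (simp add: cube_def[abs_def])
  show ?case unfolding elim e by (simp add: algebra_simps)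
 qed
qed

end

text \<open>Interpolation: the rth power of the modulus is at most A^(r-1) times the modulus, with A
  the sup bound. Only the norms of f and g are compared, almost everywhere, so a real error may be
  measured through a complex one.\<close>

lemma Lp_norm_bnd:
 fixes f :: "real => 'a::real_normed_vector" and p :: ennreal
 assumes g: "bnd g (e / t) (e / sqrt t)" and t: "t > 0" and e: "e >= 0"
  and ae: "AE x in lborel. norm (f x) = norm (g x)" and p: "1 <= p"
 shows "ennreal (t powr (1/2 * (1 - enn2real (1 / p)) + 1/2)) * Lp_norm p f <= ennreal e"
proof -
 have [measurable]: "g \<in> borel_measurable borel" using g by (simp add: bnd_def)
 define A where "A = e / t"
 have A: "A >= 0" "\<And>x. norm (g x) <= A" using g t e by (auto simp: bnd_def A_def)
 have B: "(nnL1 g) <= ennreal (e / sqrt t)" using g by (simp add: bnd_def)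
 show ?thesis
 proof (cases p)
  case (real r)
  have r: "r >= 1" using p real by (simp add: ennreal_1[symmetric] del: ennreal_1)
  have ip: "enn2real (1 / p) = 1 / r"
   using real r divide_ennreal[of 1 r] by simp
  define I where "I = (\<integral>\<^sup>+x. ennreal (norm (f x) powr r) \<partial>lebesgue)"
  define J where "J = A powr (r - 1) * (e / sqrt t)"
  have J: "J >= 0" using e t by (simp add: J_def)
  have "I = (\<integral>\<^sup>+x. ennreal (norm (f x) powr r) \<partial>lborel)" unfolding I_def by (rule nn_integral_completion)
  also have "\<dots> <= (\<integral>\<^sup>+x. ennreal (A powr (r - 1)) * ennreal (norm (g x)) \<partial>lborel)"
  proof (rule nn_integral_mono_AE)
   show "AE x in lborel. ennreal (norm (f x) powr r) <= ennreal (A powr (r - 1)) * ennreal (norm (g x))"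
    using ae
   proof eventually_elim
    case (elim x)
    have "norm (g x) powr r <= A powr (r - 1) * norm (g x)"
    proof (cases "norm (g x) = 0")
     case False
     then have pos: "norm (g x) > 0" by simp
     have "norm (g x) powr r = norm (g x) powr (r - 1) * norm (g x) powr 1" unfolding powr_add[symmetric] by simp
     also have "\<dots> <= A powr (r - 1) * norm (g x)" using A r pos by (auto intro!: mult_right_mono powr_mono2)
     finally show ?thesis .
    qed simp
    then have "ennreal (norm (g x) powr r) <= ennreal (A powr (r - 1) * norm (g x))" by (rule ennreal_leI)
    then show ?case unfolding elim by (subst (asm) ennreal_mult) auto
   qed
  qed
  also have "\<dots> = ennreal (A powr (r - 1)) * (nnL1 g)" by (rule nn_integral_cmult) measurable
  also have "\<dots> <= ennreal (A powr (r - 1)) * ennreal (e / sqrt t)" by (intro mult_left_mono B) auto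
  also have "\<dots> = ennreal J" using e t unfolding J_def by (subst ennreal_mult) auto
  finally have I: "I <= ennreal J" .
  have fin: "I \<noteq> \<infinity>" using I by (auto simp: top_unique)
  have "enn2real I <= J" using enn2real_mono[OF I] J by simp
  then have "enn2real I powr (1 / r) <= J powr (1 / r)" using r by (intro powr_mono2) auto
  moreover have "Lp_norm p f = ennreal (enn2real I powr (1 / r))"
   using real r fin by (simp add: Lp_norm_def I_def[symmetric] Let_def)
  ultimately have L: "Lp_norm p f <= ennreal (J powr (1 / r))" by (simp add: ennreal_leI)
  have "t powr (1/2 * (1 - 1 / r) + 1/2) * J powr (1 / r) = e"
  \<comment> \<open>For positive \<open>e\<close> the powers are collected: the exponent of
    \<open>e\<close> is 1 and that of t is 0, which is why the weight in the statement is the right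
    one.\<close>
  proof (cases "e = 0")
   case False
   then have e0: "e > 0" using e by simp
   have st: "sqrt t = t powr (1/2)" using t by (simp add: powr_half_sqrt)
   have "J = (e powr (r - 1) * e powr 1) * (t powr (- (r - 1)) * t powr (- (1/2)))"
   proof -
    have 1: "(e / t) powr (r - 1) = e powr (r - 1) * t powr (- (r - 1))"
     using e0 t by (simp add: powr_divide powr_minus_divide del: minus_diff_eq)
    have 2: "e / t powr (1/2) = e powr 1 * t powr (- (1/2))" using e0 by (simp add: powr_minus_divide)
    show ?thesis unfolding J_def A_def st 1 2 by (simp only: mult_ac)
   qed
   also have "\<dots> = e powr r * t powr (1/2 - r)" unfolding powr_add[symmetric] by simp
   finally have "J powr (1 / r) = e powr (r * (1 / r)) * t powr ((1/2 - r) * (1 / r))"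
    using e0 t by (simp add: powr_mult powr_powr)
   moreover have "r * (1 / r) = 1" using r by simp
   ultimately have "t powr (1/2 * (1 - 1 / r) + 1/2) * J powr (1 / r) = e * (t powr (1/2 * (1 - 1 / r) + 1/2) * t powr ((1/2 - r) * (1 / r)))"
    using e0 by simp
   also have "t powr (1/2 * (1 - 1 / r) + 1/2) * t powr ((1/2 - r) * (1 / r)) = t powr 0"
    unfolding powr_add[symmetric] using r by (intro arg_cong[where f="\<lambda>a. t powr a"]) (simp add: field_simps)
   finally show ?thesis using t by simp
  qed (simp add: J_def)
  then have "ennreal (t powr (1/2 * (1 - 1 / r) + 1/2)) * ennreal (J powr (1 / r)) = ennreal e" by (subst ennreal_mult[symmetric]) auto
  then show ?thesis unfolding ip using mult_left_mono[OF L, of "ennreal (t powr (1/2 * (1 - 1 / r) + 1/2))"] by simp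
 next
  case top
  have "AE x in lborel. ennreal (norm (f x)) = ennreal (norm (g x))" using ae by eventually_elim simp
  from lebesgue_measurable_AE[OF _ this] have "(\<lambda>x. ennreal (norm (f x))) \<in> borel_measurable lebesgue" by simp
  moreover have "AE x in lebesgue. ennreal (norm (f x)) <= ennreal A"
  proof (rule AE_completion)
   show "AE x in lborel. ennreal (norm (f x)) <= ennreal A" using ae by eventually_elim (simp add: A ennreal_leI)
  qed
  ultimately have L: "Lp_norm p f <= ennreal A" unfolding Lp_norm_def using top by auto
  have w: "t powr (1/2 * (1 - enn2real (1 / p)) + 1/2) = t" using top t by simp
  have "ennreal t * ennreal A = ennreal e" using t e by (subst ennreal_mult[symmetric]) (auto simp: A_def)
  then show ?thesis unfolding w using mult_left_mono[OF L, of "ennreal t"] by simp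
 qed
qed

lemma small_Lp_tendsto:
 fixes f :: "real => real => 'a::real_normed_vector"
 assumes R: "small R" and ae: "\<And>t. t > 0 ==> AE x in lborel. norm (f t x) = norm (R t x)" and p: "1 <= p"
 shows "((\<lambda>t. ennreal (t powr (1/2 * (1 - enn2real (1 / p)) + 1/2)) * Lp_norm p (f t)) \<longlongrightarrow> 0) at_top"
proof -
 obtain e where e: "(e \<longlongrightarrow> 0) at_top" "\<forall>\<^sub>F t in at_top. 0 <= e t \<and> bnd (R t) (e t / t) (e t / sqrt t)"
  using R unfolding small_def by blast
 show ?thesis
 proof (rule tendsto_sandwich[of "\<lambda>_. 0" _ _ "\<lambda>t. ennreal (e t)"])
  show "\<forall>\<^sub>F t in at_top. ennreal (t powr (1/2 * (1 - enn2real (1 / p)) + 1/2)) * Lp_norm p (f t) <= ennreal (e t)"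
   using e(2) eventually_gt_at_top[of 0] by eventually_elim (use Lp_norm_bnd ae p in blast)
  show "((\<lambda>t. ennreal (e t)) \<longlongrightarrow> 0) at_top" using tendsto_ennrealI[OF e(1)] by simp
 qed auto
qed

section \<open>Fractional-derivative sums as telescoping kernel differences\<close>

lemma ift_cmult: "c * ift g x = ift (\<lambda>\<xi>. c * g \<xi>) x"
proof -
 have "(LINT \<xi>|lborel. iexp (x * \<xi>) * (c * g \<xi>)) = (LINT \<xi>|lborel. c * (iexp (x * \<xi>) * g \<xi>))" by (simp add: mult.left_commute)
 then show ?thesis unfolding ift_def integral_mult_right_zero by simp
qed

lemma ift_diff:
 assumes "integrable lborel g" "integrable lborel h"
 shows "ift g x - ift h x = ift (\<lambda>\<xi>. g \<xi> - h \<xi>) x"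
proof -
 have i: "integrable lborel (\<lambda>\<xi>. iexp (x * \<xi>) * f \<xi>)" if "integrable lborel f" for f using that by (rule integrable_iexp_mult) measurable
 have "(LINT \<xi>|lborel. iexp (x * \<xi>) * (g \<xi> - h \<xi>)) = (LINT \<xi>|lborel. iexp (x * \<xi>) * g \<xi>) - (LINT \<xi>|lborel. iexp (x * \<xi>) * h \<xi>)"
  unfolding right_diff_distrib by (rule bochner_integral_diff[OF i[OF assms(1)] i[OF assms(2)]])
 then show ?thesis unfolding ift_def by (simp add: diff_divide_distrib)
qed

lemma good_symb:
 assumes "\<alpha> > 0" "t > 0"
 shows "good (symb 0 \<alpha> j n t)"
proof -
 obtain C where "C1_gauss (t / 2) (C * (1 / sqrt t) ^ j * (t powr (- ((\<alpha> - 1) / 2))) ^ n)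
   (C * (1 / sqrt t) ^ j * (t powr (- ((\<alpha> - 1) / 2))) ^ n * sqrt t * (if n = 0 then 1 + 0 * t powr (- ((\<alpha> - 1) / 2)) else 1))
   (symb 0 \<alpha> j n t) (symb' 0 \<alpha> j n t)"
  using C1_gauss_symb[OF assms(1), of j n] assms(2) by force
 moreover have "t / 2 > 0" using assms by simp
 ultimately show ?thesis unfolding good_def by blast
qed

text \<open>Two consecutive remainders differ by one Taylor term of the oscillating exponential; on
  the frequency side that term is a power of the fractional operator applied to a heat
  symbol.\<close>

lemma symb_diff:
 "symb 1 \<alpha> j k t \<xi> - symb 1 \<alpha> j (Suc k) t \<xi> = cplx (t ^ k / fact k) * ((\<i> * cplx (psi \<alpha> \<xi>)) ^ k * ((\<i> * cplx \<xi>) ^ j * symb 0 1 0 0 t \<xi>))"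
 by (simp add: symb_def rho_Suc power_mult_distrib rho_def[of 0] field_simps)

text \<open>Each summand of the statement is a difference of consecutive kernel remainders, so the
  sum over k telescopes. Mass and dipole are treated as one good symbol because the operator is
  applied to their combination.\<close>

lemma frac_dx_power_dipole:
 assumes a: "\<alpha> > 0" and t: "t > 0"
 shows "cplx (t ^ k / fact k) * (frac_dx \<alpha> ^^ k) (\<lambda>y. cplx (M * heat t y - m * deriv (heat t) y)) x =
  cplx M * (kern 1 \<alpha> 0 k t x - kern 1 \<alpha> 0 (Suc k) t x) - cplx m * (kern 1 \<alpha> 1 k t x - kern 1 \<alpha> 1 (Suc k) t x)"
proof -
 define g where "g = (\<lambda>\<xi>. (cplx M - cplx m * (\<i> * cplx \<xi>)) * symb 0 1 0 0 t \<xi>)"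
 have i: "integrable lborel (symb c \<alpha> j n t)" if "0 <= c" "c <= 1" for c j n by (rule symb_integrable[OF a that t])
 have i1: "integrable lborel (symb 0 1 j n t)" for j n by (rule symb_integrable) (use t in auto)
 have gg: "good g" unfolding g_def
 proof (rule good_multiplier[OF good_symb])
  show "((\<lambda>\<xi>. cplx M - cplx m * (\<i> * cplx \<xi>)) has_vector_derivative - (cplx m * \<i>)) (at \<xi>)" for \<xi>
   by (auto intro!: derivative_eq_intros simp: has_vector_derivative_def scaleR_conv_of_real fun_eq_iff)
  have "1 <= exp (1 * \<bar>\<xi>\<bar>)" "\<bar>\<xi>\<bar> <= exp (1 * \<bar>\<xi>\<bar>)" for \<xi> :: real 
   using exp_ge_add_one_self[of "\<bar>\<xi>\<bar>"] unfolding mult_1 by linarith+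
  then have le: "\<bar>M\<bar> * 1 + \<bar>m\<bar> * \<bar>\<xi>\<bar> <= (\<bar>M\<bar> + \<bar>m\<bar>) * exp (1 * \<bar>\<xi>\<bar>)" "\<bar>m\<bar> * 1 <= (\<bar>M\<bar> + \<bar>m\<bar>) * exp (1 * \<bar>\<xi>\<bar>)" for \<xi>
   unfolding distrib_right by (intro add_mono mult_left_mono; simp) (intro add_increasing mult_left_mono; simp)
  show "norm (cplx M - cplx m * (\<i> * cplx \<xi>)) <= (\<bar>M\<bar> + \<bar>m\<bar>) * exp (1 * \<bar>\<xi>\<bar>)" for \<xi>
   by (rule order_trans[OF norm_triangle_ineq4 order_trans[OF _ le(1)]]) (simp add: norm_mult)
  show "norm (- (cplx m * \<i>)) <= (\<bar>M\<bar> + \<bar>m\<bar>) * exp (1 * \<bar>\<xi>\<bar>)" for \<xi>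
   using le(2)[of \<xi>] by (simp add: norm_mult)
 qed (use t in auto)
 have h: "(\<lambda>y. cplx (M * heat t y - m * deriv (heat t) y)) = ift g"
 proof
  fix y
  have "cplx (M * heat t y - m * deriv (heat t) y) = cplx M * kern 0 1 0 0 t y - cplx m * kern 0 1 1 0 t y"
   using kern_heat[OF t, of 1 y] kern_heat1[of 1 t y] deriv_heat[OF t, of y] t by simp
  also have "\<dots> = ift (\<lambda>\<xi>. cplx M * symb 0 1 0 0 t \<xi> - cplx m * symb 0 1 1 0 t \<xi>) y"
   unfolding kern_def ift_cmult by (rule ift_diff; rule integrable_mult_right[OF i1])
  also have "(\<lambda>\<xi>. cplx M * symb 0 1 0 0 t \<xi> - cplx m * symb 0 1 1 0 t \<xi>) = g"
   by (simp add: g_def fun_eq_iff symb_def algebra_simps)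
  finally show "cplx (M * heat t y - m * deriv (heat t) y) = ift g y" .
 qed
 have "(\<lambda>f y. cplx 1 * frac_dx \<alpha> f y) = frac_dx \<alpha>" by simp
 then have "(frac_dx \<alpha> ^^ k) (ift g) = ift (\<lambda>\<xi>. (\<i> * psi \<alpha> \<xi>) ^ k * g \<xi>)"
  using frac_dx_power[OF gg a, of 1 k] by simp
 then have "cplx (t ^ k / fact k) * (frac_dx \<alpha> ^^ k) (ift g) x = ift (\<lambda>\<xi>. cplx (t ^ k / fact k) * ((\<i> * psi \<alpha> \<xi>) ^ k * g \<xi>)) x"
  by (simp only: ift_cmult)
 also have "(\<lambda>\<xi>. cplx (t ^ k / fact k) * ((\<i> * psi \<alpha> \<xi>) ^ k * g \<xi>)) =
   (\<lambda>\<xi>. cplx M * (symb 1 \<alpha> 0 k t \<xi> - symb 1 \<alpha> 0 (Suc k) t \<xi>) - cplx m * (symb 1 \<alpha> 1 k t \<xi> - symb 1 \<alpha> 1 (Suc k) t \<xi>))"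
  unfolding symb_diff g_def by (simp add: fun_eq_iff algebra_simps)
 also have "ift \<dots> x = cplx M * (kern 1 \<alpha> 0 k t x - kern 1 \<alpha> 0 (Suc k) t x) - cplx m * (kern 1 \<alpha> 1 k t x - kern 1 \<alpha> 1 (Suc k) t x)"
  unfolding kern_def ift_diff[OF i i, OF zero_le_one order_refl zero_le_one order_refl] ift_cmult
  by (rule ift_diff[symmetric]; intro integrable_mult_right Bochner_Integration.integrable_diff i) auto
 finally show ?thesis unfolding h .
qed

lemma frac_dx_power_heat:
 assumes a: "\<alpha> > 0" and t: "t > 0"
 shows "cplx (M / fact k) * ((\<lambda>f y. cplx t * frac_dx \<alpha> f y) ^^ k) (\<lambda>y. cplx (heat t y)) x =
  cplx M * (kern 1 \<alpha> 0 k t x - kern 1 \<alpha> 0 (Suc k) t x)"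
proof -
 have i: "integrable lborel (symb 1 \<alpha> 0 n t)" for n by (rule symb_integrable[OF a _ _ t]) auto
 have h: "(\<lambda>y. cplx (heat t y)) = ift (symb 0 1 0 0 t)"
  using kern_heat[OF t, of 1] by (simp add: kern_def fun_eq_iff)
 have gg: "good (symb 0 1 0 0 t)" by (rule good_symb) (use t in auto)
 have "((\<lambda>f y. cplx t * frac_dx \<alpha> f y) ^^ k) (ift (symb 0 1 0 0 t)) = ift (\<lambda>\<xi>. (cplx t * \<i> * psi \<alpha> \<xi>) ^ k * symb 0 1 0 0 t \<xi>)"
  using frac_dx_power[OF gg a] by blast
 then have "cplx (M / fact k) * ((\<lambda>f y. cplx t * frac_dx \<alpha> f y) ^^ k) (ift (symb 0 1 0 0 t)) x
   = ift (\<lambda>\<xi>. cplx (M / fact k) * ((cplx t * \<i> * psi \<alpha> \<xi>) ^ k * symb 0 1 0 0 t \<xi>)) x"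
  by (simp only: ift_cmult)
 also have "(\<lambda>\<xi>. cplx (M / fact k) * ((cplx t * \<i> * psi \<alpha> \<xi>) ^ k * symb 0 1 0 0 t \<xi>)) = (\<lambda>\<xi>. cplx M * (symb 1 \<alpha> 0 k t \<xi> - symb 1 \<alpha> 0 (Suc k) t \<xi>))"
  unfolding symb_diff by (simp add: fun_eq_iff power_mult_distrib)
 also have "ift \<dots> x = cplx M * (kern 1 \<alpha> 0 k t x - kern 1 \<alpha> 0 (Suc k) t x)"
  unfolding kern_def ift_diff[OF i i] ift_cmult ..
 finally show ?thesis unfolding h .
qed

text \<open>The error of the theorem for all three cases, with n Taylor terms in the mass part and k
  in the dipole part: n = k = 1 in the first case, n = N + 1 and k = N in the second, n = k = N + 1
  in the third.\<close>

definition (in decaying_solution) remainder :: "nat => nat => real => real => complex" where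
 "remainder n k t x = cplx (v t x)
   - (cplx M * (kern 1 \<alpha> 0 0 t x - kern 1 \<alpha> 0 n t x) - cplx mom * (kern 1 \<alpha> 1 0 t x - kern 1 \<alpha> 1 k t x))
   + cplx (\<beta> * M ^ 3 / (12 * sqrt 3 * pi) * ln t * deriv (heat t) x)
   + cplx (\<beta> * cubic_mass / 3 * deriv (heat t) x)
   + cplx (\<beta> * M ^ 3 / 3 * Psi t x)"

lemma (in decaying_solution) asymptotics:
 assumes n: "real n * (\<alpha> - 1) > 1" and k: "k > 0"
 shows "\<exists>R. small R \<and> (\<forall>t>0. AE x in lborel. remainder n k t x = R t x)"
proof -
 obtain R where R: "small R" "\<And>t. t > 0 ==> AE x in lborel. cplx (v t x) = cplx M * kern 1 \<alpha> 0 0 t x - cplx mom * kern 1 \<alpha> 1 0 t x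
   - cplx (\<beta> / 3) * (cplx (1 / (4 * sqrt 3 * pi) * M ^ 3 * ln t + cubic_mass) * dheat t x + cplx (M ^ 3 * profile t x)) + R t x"
  using expansion by blast
 show ?thesis
 proof (intro exI conjI allI impI)
  show "small (\<lambda>t x. R t x + (cplx M * kern 1 \<alpha> 0 n t x - cplx mom * kern 1 \<alpha> 1 k t x))"
   by (intro small_add R(1) small_kern_remainder \<alpha>(1) n k)
  fix t :: real assume t: "t > 0"
  from R(2)[OF t] show "AE x in lborel. remainder n k t x = R t x + (cplx M * kern 1 \<alpha> 0 n t x - cplx mom * kern 1 \<alpha> 1 k t x)"
  proof eventually_elim
   case (elim x)
   have "\<beta> * M ^ 3 / (12 * sqrt 3 * pi) * ln t * d + \<beta> * cubic_mass / 3 * d + \<beta> * M ^ 3 / 3 * q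
     = \<beta> / 3 * ((1 / (4 * sqrt 3 * pi) * M ^ 3 * ln t + cubic_mass) * d + M ^ 3 * q)" for d q
    by (simp add: algebra_simps)
   note eq = this[of "heat1 t x" "profile t x"]
   have eq2: "cplx (\<beta> * M ^ 3 / (12 * sqrt 3 * pi) * ln t * deriv (heat t) x)
     + cplx (\<beta> * cubic_mass / 3 * deriv (heat t) x) + cplx (\<beta> * M ^ 3 / 3 * Psi t x)
     = cplx (\<beta> / 3) * (cplx (1 / (4 * sqrt 3 * pi) * M ^ 3 * ln t + cubic_mass) * dheat t x + cplx (M ^ 3 * profile t x))"
    unfolding deriv_heat[OF t] Psi_eq_profile[OF t] dheat_def of_real_add[symmetric] of_real_mult[symmetric] eq ..
   have alg: "z - (c * (a - a') - d * (b - b')) + c1 + c2 + c3 = r + (c * a' - d * b')"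
    if "z = c * a - d * b - E + r" "c1 + c2 + c3 = E" for z c a a' d b b' c1 c2 c3 r E :: complex
    unfolding that(1) that(2)[symmetric] by (simp add: algebra_simps)
   show ?case unfolding remainder_def by (rule alg[OF elim eq2])
  qed
 qed
qed

section \<open>Global mild solutions\<close>

lemma green_eq_kern: "green \<alpha> t = kern 1 \<alpha> 0 0 t"
proof
 fix x
 have e: "exp (cplx (- t * \<xi>\<^sup>2) + \<i> * cplx (t * \<bar>\<xi>\<bar> powr \<alpha> * \<xi>)) = symb 1 \<alpha> 0 0 t \<xi>" for \<xi>
  unfolding exp_add exp_of_real symb_def rho_def psi_def by (simp add: mult.assoc)
 have s: "cplx (1 / sqrt (2 * pi)) * (cplx (sqrt (2 * pi)) * z) = z" for z by (simp flip: of_real_mult)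
 show "green \<alpha> t x = kern 1 \<alpha> 0 0 t x"
  unfolding green_def e kern_def by (subst inv_fourier_eq) (auto simp: s simp del: of_real_mult)
qed

lemma dx_green:
 assumes "\<alpha> > 0" "t > 0"
 shows "dx (green \<alpha> t) = kern 1 \<alpha> 1 0 t"
proof
 fix x
 show "dx (green \<alpha> t) x = kern 1 \<alpha> 1 0 t x"
  unfolding dx_def green_eq_kern using kern_has_vector_derivative[OF assms(1), of 1 t 0 0 x] assms(2)
  by (intro vector_derivative_at) simp
qed

lemma integrable_lebesgue_AE:
 fixes f f0 :: "real => real"
 assumes f: "integrable lebesgue f" and f0: "f0 \<in> borel_measurable borel" and ae: "AE x in lborel. f x = f0 x"
 shows "integrable lborel f0"
proof -
 have m: "f0 \<in> borel_measurable lebesgue" using f0 by (simp add: measurable_completion)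
 have "integrable lebesgue f0"
  by (rule integrable_cong_AE_imp[OF f m]) (use AE_completion[OF ae] in \<open>auto elim: AE_mp\<close>)
 then show ?thesis using f0 by (simp add: integrable_completion)
qed

text \<open>A representative is chosen at each time separately. The choices are compatible because a
  difference of two of them is continuous and agrees almost everywhere with the representative of
  the difference. Negative times get 0, which makes joint measurability a question about
  \<open>{0..} \<times> UNIV\<close>.\<close>

lemma continuous_rep_family:
 assumes u: "H1_continuous u"
 obtains v where "\<And>t. 0 <= t ==> continuous_on UNIV (v t)" "\<And>t. 0 <= t ==> AE x in lborel. u t x = v t x"
  "\<And>t x. 0 <= t ==> \<bar>v t x\<bar> <= 2 * H1_norm (u t)" "\<And>t. 0 <= t ==> integrable lborel (\<lambda>x. (v t x)\<^sup>2)"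
  "\<And>t. 0 <= t ==> (LINT x|lborel. (v t x)\<^sup>2) <= (H1_norm (u t))\<^sup>2"
  "\<And>s t x. 0 <= s ==> 0 <= t ==> \<bar>v s x - v t x\<bar> <= 2 * H1_norm (\<lambda>x. u s x - u t x)"
  "\<And>s t. 0 <= s ==> 0 <= t ==> (LINT x|lborel. (v s x - v t x)\<^sup>2) <= (H1_norm (\<lambda>x. u s x - u t x))\<^sup>2"
  "\<And>t. t < 0 ==> v t = (\<lambda>x. 0)"
proof -
 have h: "H1 (u t)" if "0 <= t" for t using u that by (simp add: H1_continuous_def)
 define P where "P = (\<lambda>t w. continuous_on UNIV w \<and> (AE x in lborel. u t x = w x) \<and> (\<forall>x. \<bar>w x\<bar> <= 2 * H1_norm (u t))
  \<and> integrable lborel (\<lambda>x. (w x)\<^sup>2) \<and> (LINT x|lborel. (w x)\<^sup>2) <= (H1_norm (u t))\<^sup>2)"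
 define v where "v = (\<lambda>t. if 0 <= t then SOME w. P t w else (\<lambda>x. 0))"
 have v: "P t (v t)" if "0 <= t" for t
 proof -
  have "\<exists>w. P t w" unfolding P_def by (rule H1_continuous_rep[OF h[OF that]])
  then have "P t (SOME w. P t w)" by (rule someI_ex)
  then show ?thesis using that by (simp add: v_def)
 qed
 have d: "\<bar>v s x - v t x\<bar> <= 2 * H1_norm (\<lambda>x. u s x - u t x)" "(LINT x|lborel. (v s x - v t x)\<^sup>2) <= (H1_norm (\<lambda>x. u s x - u t x))\<^sup>2"
  if st: "0 <= s" "0 <= t" for s t x
 proof -
  obtain w where w: "continuous_on UNIV w" "AE x in lborel. u s x - u t x = w x" "\<And>x. \<bar>w x\<bar> <= 2 * H1_norm (\<lambda>x. u s x - u t x)"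
   "integrable lborel (\<lambda>x. (w x)\<^sup>2)" "(LINT x|lborel. (w x)\<^sup>2) <= (H1_norm (\<lambda>x. u s x - u t x))\<^sup>2"
   using H1_continuous_rep[OF H1_diff[OF h[OF st(1)] h[OF st(2)]]] by blast
  have c: "continuous_on UNIV (v s)" "continuous_on UNIV (v t)" using v st by (auto simp: P_def)
  have "AE x in lborel. u s x = v s x" "AE x in lborel. u t x = v t x" using v st by (auto simp: P_def)
  with w(2) have ae: "AE x in lborel. v s x - v t x = w x" by eventually_elim simp
  have [measurable]: "v s \<in> borel_measurable borel" "v t \<in> borel_measurable borel" "w \<in> borel_measurable borel"
   using c w(1) by (auto intro: borel_measurable_continuous_onI)
  have "AE x in lborel. \<bar>v s x - v t x\<bar> <= 2 * H1_norm (\<lambda>x. u s x - u t x)" using ae by eventually_elim (simp add: w(3))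
  then show "\<bar>v s x - v t x\<bar> <= 2 * H1_norm (\<lambda>x. u s x - u t x)"
   by (rule continuous_AE_le[rotated]) (intro continuous_intros c)
  have "(LINT x|lborel. (v s x - v t x)\<^sup>2) = (LINT x|lborel. (w x)\<^sup>2)"
   by (rule integral_cong_AE) (use ae in \<open>auto elim: AE_mp\<close>)
  then show "(LINT x|lborel. (v s x - v t x)\<^sup>2) <= (H1_norm (\<lambda>x. u s x - u t x))\<^sup>2" using w(5) by simp
 qed
 show thesis by (rule that[of v]) (use v d in \<open>auto simp: P_def v_def\<close>)
qed

text \<open>Every integral in the equation depends only on classes of functions, so u may be
  replaced by its representative. Joint Borel measurability follows from joint continuity:
  continuity in time uniform in x, together with continuity in x.\<close>

lemma mild_solution_of_global:
 assumes \<alpha>: "1 < \<alpha>" "\<alpha> < 3" and u0: "integrable lebesgue u0" "integrable lebesgue (\<lambda>x. x * u0 x)"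
  and u: "global_mild_solution \<alpha> \<beta> u0 u"
 shows "\<exists>v. mild_solution \<alpha> \<beta> v \<and> (\<forall>t\<ge>0. AE x in lborel. u t x = v t x) \<and> (AE x in lborel. u0 x = v 0 x)
  \<and> (LINT x|lborel. (v 0 x)\<^sup>2) <= (H1_norm (u 0))\<^sup>2"
proof -
 have uc: "H1_continuous u" and ui: "AE x in lebesgue. u 0 x = u0 x"
  and um: "\<And>t. t > 0 ==> AE x in lebesgue. cplx (u t x) =
     conv (green \<alpha> t) (\<lambda>y. of_real (u0 y)) x - of_real (\<beta> / 3) *
      (LINT \<tau>:{0..t}|lebesgue. conv (dx (green \<alpha> (t - \<tau>))) (\<lambda>y. of_real ((u \<tau> y) ^ 3)) x)"
  using u by (auto simp: global_mild_solution_def)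
 obtain v where v: "\<And>t. 0 <= t ==> continuous_on UNIV (v t)" "\<And>t. 0 <= t ==> AE x in lborel. u t x = v t x"
  "\<And>t x. 0 <= t ==> \<bar>v t x\<bar> <= 2 * H1_norm (u t)" "\<And>t. 0 <= t ==> integrable lborel (\<lambda>x. (v t x)\<^sup>2)"
  "\<And>t. 0 <= t ==> (LINT x|lborel. (v t x)\<^sup>2) <= (H1_norm (u t))\<^sup>2"
  "\<And>s t x. 0 <= s ==> 0 <= t ==> \<bar>v s x - v t x\<bar> <= 2 * H1_norm (\<lambda>x. u s x - u t x)"
  "\<And>s t. 0 <= s ==> 0 <= t ==> (LINT x|lborel. (v s x - v t x)\<^sup>2) <= (H1_norm (\<lambda>x. u s x - u t x))\<^sup>2"
  "\<And>t. t < 0 ==> v t = (\<lambda>x. 0)"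
  by (rule continuous_rep_family[OF uc]) blast
 have a0: "\<alpha> > 0" using \<alpha> by simp
 have lim: "((\<lambda>s. H1_norm (\<lambda>x. u s x - u t x)) \<longlongrightarrow> 0) (at t within {0..})" if "0 <= t" for t
  using uc that by (simp add: H1_continuous_def)
 have s0: "\<forall>\<^sub>F s in at t within {0..}. 0 <= s" for t :: real by (simp add: eventually_at_filter)
 have sup: "\<forall>\<^sub>F s in at t within {0..}. \<forall>x. \<bar>v s x - v t x\<bar> <= e" if t: "0 <= t" and e: "0 < e" for t e
 proof -
  have "e / 2 > 0" using e by simp
  note order_tendstoD(2)[OF lim[OF t] this]
  then show ?thesis using s0
  proof eventually_elim
   case (elim s)
   show ?case
   proof
    fix x
    have "2 * H1_norm (\<lambda>x. u s x - u t x) <= e" using elim(1) by simp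
    with v(6)[OF elim(2) t] show "\<bar>v s x - v t x\<bar> <= e" by (rule order_trans)
   qed
  qed
 qed
 have vm [measurable]: "v t \<in> borel_measurable borel" for t
  using v(1)[of t] v(8)[of t] by (cases "0 <= t") (auto intro: borel_measurable_continuous_onI)
 have pair: "(\<lambda>(t, x). v t x) \<in> borel2"
 proof -
  have "continuous_on ({0..} \<times> UNIV) (\<lambda>(t, x). v t x)"
   unfolding continuous_on_def
  proof clarify
   fix t x :: real assume t: "0 <= t"
   show "((\<lambda>(t, x). v t x) \<longlongrightarrow> v t x) (at (t, x) within {0..} \<times> UNIV)"
   proof (rule tendstoI)
    fix e :: real assume e: "0 < e"
    have e2: "e / 2 > 0" using e by simp
    obtain d where d: "d > 0" "\<And>s y. 0 <= s ==> s \<noteq> t ==> dist s t < d ==> \<bar>v s y - v t y\<bar> <= e / 2"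
     using sup[OF t e2] unfolding eventually_at by auto
    have d': "\<bar>v (fst p) y - v t y\<bar> <= e / 2" if "p \<in> {0..} \<times> UNIV" "dist p (t, x) < d" for p y
    proof (cases "fst p = t")
     case False
     have "dist (fst p) t < d" using dist_fst_le[of p "(t, x)"] that(2) by simp
     then show ?thesis using d(2)[OF _ False] that(1) by (auto simp: mem_Times_iff)
    qed (use e in simp)
    have 1: "\<forall>\<^sub>F p in at (t, x) within {0..} \<times> UNIV. \<forall>y. \<bar>v (fst p) y - v t y\<bar> <= e / 2"
     unfolding eventually_at using d(1) d' by blast
    have "isCont (v t) x" using v(1)[OF t] by (simp add: continuous_on_eq_continuous_at)
    then have "((\<lambda>p. v t (snd p)) \<longlongrightarrow> v t x) (at (t, x) within {0..} \<times> UNIV)"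
     by (rule isCont_tendsto_compose) (auto intro!: tendsto_eq_intros)
    then have 2: "\<forall>\<^sub>F p in at (t, x) within {0..} \<times> UNIV. dist (v t (snd p)) (v t x) < e / 2" using e2 by (rule tendstoD)
    show "\<forall>\<^sub>F p in at (t, x) within {0..} \<times> UNIV. dist (case p of (t, x) => v t x) (v t x) < e"
     using 1 2
    proof eventually_elim
     case (elim p)
     have "\<bar>v (fst p) (snd p) - v t (snd p)\<bar> <= e / 2" using elim(1) by blast
     moreover have "\<bar>v t (snd p) - v t x\<bar> < e / 2" using elim(2) by (simp only: dist_real_def)
     ultimately have "\<bar>v (fst p) (snd p) - v t x\<bar> < e" by linarith
     then show ?case by (simp add: split_beta' dist_real_def)
    qed
   qed
  qed
  moreover have "{0..} \<times> (UNIV :: real set) \<in> sets (borel :: (real \<times> real) measure)" by (intro borel_closed closed_Times) auto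
  ultimately have "(\<lambda>p. if p \<in> {0..} \<times> UNIV then (\<lambda>(t, x). v t x) p else 0) \<in> borel_measurable borel"
   by (intro borel_measurable_continuous_on_if) auto
  also have "(\<lambda>p. if p \<in> {0..} \<times> UNIV then (\<lambda>(t, x). v t x) p else 0) = (\<lambda>(t, x). v t x)"
   using v(8) by (auto simp: fun_eq_iff not_le)
  finally show ?thesis by (simp add: borel_prod)
 qed
 have ae0: "AE x in lborel. u0 x = v 0 x"
 proof -
  have "AE x in lborel. u 0 x = v 0 x" by (rule v(2)) simp
  with ui[unfolded AE_completion_iff] show ?thesis by eventually_elim simp
 qed
 have i0: "integrable lborel (v 0)" by (rule integrable_lebesgue_AE[OF u0(1) vm ae0])
 have i1: "integrable lborel (\<lambda>x. x * v 0 x)"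
  by (rule integrable_lebesgue_AE[OF u0(2)]) (use ae0 in \<open>auto elim: AE_mp\<close>)
 have km: "(\<lambda>(s, x). kern 1 \<alpha> 1 0 s x) \<in> borel2" by (rule kern_measurable_pair)
 have cm: "(\<lambda>(s, x). cplx (v s x ^ 3)) \<in> borel2"
  using pair by (simp add: split_beta')
 have mild: "AE x in lborel. cplx (v t x) =
   (LINT y|lborel. kern 1 \<alpha> 0 0 t (x - y) * cplx (v 0 y))
   - cplx (\<beta> / 3) * duhamel \<alpha> (cubed v) t x" if t: "0 < t" for t
 proof -
  have 1: "conv (green \<alpha> t) (\<lambda>y. of_real (u0 y)) x = (LINT y|lborel. kern 1 \<alpha> 0 0 t (x - y) * cplx (v 0 y))" for x
   unfolding conv_def green_eq_kern by (rule integral_lebesgue_AE) (use ae0 in \<open>auto elim: AE_mp\<close>)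
  have 2: "conv (dx (green \<alpha> (t - \<tau>))) (\<lambda>y. of_real (u \<tau> y ^ 3)) x = (LINT y|lborel. kern 1 \<alpha> 1 0 (t - \<tau>) (x - y) * cplx (v \<tau> y ^ 3))"
   if "0 < \<tau>" "\<tau> < t" for \<tau> x
  proof -
   have g: "dx (green \<alpha> (t - \<tau>)) = kern 1 \<alpha> 1 0 (t - \<tau>)" using dx_green a0 that by simp
   have ae: "AE y in lborel. u \<tau> y = v \<tau> y" using v(2) that by simp
   show ?thesis unfolding conv_def g
   proof (rule integral_lebesgue_AE)
    show "AE y in lborel. kern 1 \<alpha> 1 0 (t - \<tau>) (x - y) * of_real (u \<tau> y ^ 3) = kern 1 \<alpha> 1 0 (t - \<tau>) (x - y) * cplx (v \<tau> y ^ 3)"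
     using ae by eventually_elim simp
   qed measurable
  qed
  have 3: "(LINT \<tau>:{0..t}|lebesgue. conv (dx (green \<alpha> (t - \<tau>))) (\<lambda>y. of_real (u \<tau> y ^ 3)) x) = duhamel \<alpha> (cubed v) t x" for x
   unfolding set_lebesgue_integral_def duhamel_def
  proof (rule integral_lebesgue_AE)
   have "(\<lambda>s. LINT y|lborel. kern 1 \<alpha> 1 0 (t - s) (x - y) * cplx (v s y ^ 3)) \<in> borel_measurable borel"
    using measurable_Pair2[OF conv_measurable2[OF km cm, of t], of x] by simp
   then show "(\<lambda>s. indicator {0<..<t} s *\<^sub>R (LINT y|lborel. kern 1 \<alpha> 1 0 (t - s) (x - y) * cplx (v s y ^ 3))) \<in> borel_measurable borel"
    by measurable
   show "AE s in lborel. indicator {0..t} s *\<^sub>R conv (dx (green \<alpha> (t - s))) (\<lambda>y. of_real (u s y ^ 3)) x =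
     indicator {0<..<t} s *\<^sub>R (LINT y|lborel. kern 1 \<alpha> 1 0 (t - s) (x - y) * cplx (v s y ^ 3))"
    using AE_lborel_singleton[of "0::real"] AE_lborel_singleton[of t]
   proof eventually_elim
    case (elim s)
    show ?case
    proof (cases "0 < s \<and> s < t")
     case True
     then show ?thesis using 2[of s x] by simp
    next
     case False
     then show ?thesis using elim by (auto simp: indicator_def)
    qed
   qed
  qed
  have "AE x in lborel. u t x = v t x" using v(2) t by simp
  with um[OF t, unfolded AE_completion_iff 1 3] show ?thesis by eventually_elim simp
 qed
 have "mild_solution \<alpha> \<beta> v"
 proof
  show "((\<lambda>s. LINT x|lborel. (v s x - v t x)\<^sup>2) \<longlongrightarrow> 0) (at t within {0..})" if t: "0 <= t" for t
  proof (rule tendsto_sandwich[of "\<lambda>_. 0" _ _ "\<lambda>s. (H1_norm (\<lambda>x. u s x - u t x))\<^sup>2"])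
   show "\<forall>\<^sub>F s in at t within {0..}. (LINT x|lborel. (v s x - v t x)\<^sup>2) <= (H1_norm (\<lambda>x. u s x - u t x))\<^sup>2"
    using s0 by eventually_elim (use v(7) t in blast)
   show "((\<lambda>s. (H1_norm (\<lambda>x. u s x - u t x))\<^sup>2) \<longlongrightarrow> 0) (at t within {0..})" using tendsto_power[OF lim[OF t], of 2] by simp
  qed auto
  show "\<exists>S. \<forall>x. \<bar>v t x\<bar> <= S" if "0 <= t" for t using v(3)[OF that] by blast
 qed (use \<alpha> pair v(1,4) sup i0 i1 mild in auto)
 then show ?thesis using v(2,5) ae0 by auto
qed

text \<open>Changing each time slice on a null set changes neither the data integrals nor the inner
  integrals of the cubic moment, so the constants of the statement are those of the
  representative.\<close>

lemma constants_eq: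
 assumes ms: "decaying_solution \<alpha> \<beta> v K" and ae: "\<And>t. t >= 0 ==> AE x in lborel. u t x = v t x" and ae0: "AE x in lborel. u0 x = v 0 x"
 shows "mass u0 = decaying_solution.M v" "first_moment u0 = decaying_solution.mom v" "cubic_moment u0 u = decaying_solution.cubic_mass v"
proof -
 interpret decaying_solution \<alpha> \<beta> v K by fact
 show m: "mass u0 = M" unfolding mass_def M_def by (rule integral_lebesgue_AE[OF _ ae0]) measurable
 show "first_moment u0 = mom" unfolding first_moment_def mom_def by (rule integral_lebesgue_AE) (use ae0 in \<open>auto elim: AE_mp\<close>)
 have vm: "v t \<in> borel_measurable borel" for t by measurable
 have 1: "(LINT y|lebesgue. u t y ^ 3) = (LINT y|lborel. v t y ^ 3)"
  "(LINT y|lebesgue. u t y ^ 3 - (M * heat t y) ^ 3) = (LINT y|lborel. v t y ^ 3 - (M * heat t y) ^ 3)" if "t >= 0" for t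
  using ae[OF that] by (auto intro!: integral_lebesgue_AE elim: AE_mp)
 have 2: "(LINT \<tau>:{0..1}|lebesgue. LINT y|lebesgue. u \<tau> y ^ 3) = (LINT \<tau>|lborel. indicator {0..1} \<tau> *\<^sub>R (LINT y|lborel. v \<tau> y ^ 3))"
  unfolding set_lebesgue_integral_def by (rule integral_lebesgue_AE) (auto simp: indicator_def 1)
 have 3: "(LINT \<tau>:{1..}|lebesgue. LINT y|lebesgue. u \<tau> y ^ 3 - (M * heat \<tau> y) ^ 3) = (LINT \<tau>|lborel. indicator {1..} \<tau> *\<^sub>R (LINT y|lborel. v \<tau> y ^ 3 - (M * heat \<tau> y) ^ 3))"
  unfolding set_lebesgue_integral_def by (rule integral_lebesgue_AE) (auto simp: indicator_def 1)
 show "cubic_moment u0 u = cubic_mass" unfolding cubic_moment_def cubic_mass_def m 2 3 ..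
qed

theorem corollary2p5:
  fixes \<alpha> \<beta> :: real
  assumes "1 < \<alpha>" and "\<alpha> < 3"
  shows "\<exists>\<delta>>0. \<forall>(u0 :: real \<Rightarrow> real) (u :: real \<Rightarrow> real \<Rightarrow> real).
    H1 u0 \<and> integrable lebesgue u0 \<and> integrable lebesgue (\<lambda>x. x * u0 x) \<and>
    H1_norm u0 + (LINT x|lebesgue. \<bar>u0 x\<bar>) < \<delta> \<and>
    global_mild_solution \<alpha> \<beta> u0 u \<longrightarrow>
    (let M = mass u0; m = first_moment u0; MM = cubic_moment u0 u in
      (2 < \<alpha> \<longrightarrow>
        (\<forall>p::ennreal. 1 \<le> p \<longrightarrow>
          ((\<lambda>t. ennreal (t powr (1/2 * (1 - enn2real (1 / p)) + 1/2)) *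
             Lp_norm p (\<lambda>x.
               u t x - M * heat t x
               + \<beta> * M ^ 3 / (12 * sqrt 3 * pi) * ln t * deriv (heat t) x
               + (m + \<beta> * MM / 3) * deriv (heat t) x
               + \<beta> * M ^ 3 / 3 * Psi t x)) \<longlongrightarrow> 0) at_top)) \<and>
      (\<forall>N::nat. 1 \<le> N \<and> \<alpha> = (real N + 1) / real N \<longrightarrow>
        (\<forall>p::ennreal. 1 \<le> p \<longrightarrow>
          ((\<lambda>t. ennreal (t powr (1/2 * (1 - enn2real (1 / p)) + 1/2)) *
             Lp_norm p (\<lambda>x.
               complex_of_real (u t x)
               - (\<Sum>k = 0..N - 1. complex_of_real (t ^ k / fact k) *
                    (frac_dx \<alpha> ^^ k)
                      (\<lambda>y. complex_of_real (M * heat t y - m * deriv (heat t) y)) x)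
               - complex_of_real (M / fact N) *
                    ((\<lambda>f y. complex_of_real t * frac_dx \<alpha> f y) ^^ N)
                      (\<lambda>y. complex_of_real (heat t y)) x
               + complex_of_real (\<beta> * M ^ 3 / (12 * sqrt 3 * pi) * ln t * deriv (heat t) x)
               + complex_of_real (\<beta> * MM / 3 * deriv (heat t) x)
               + complex_of_real (\<beta> * M ^ 3 / 3 * Psi t x))) \<longlongrightarrow> 0) at_top)) \<and>
      (\<forall>N::nat. 1 \<le> N \<and> (real N + 2) / (real N + 1) < \<alpha> \<and> \<alpha> < (real N + 1) / real N \<longrightarrow>
        (\<forall>p::ennreal. 1 \<le> p \<longrightarrow>
          ((\<lambda>t. ennreal (t powr (1/2 * (1 - enn2real (1 / p)) + 1/2)) *
             Lp_norm p (\<lambda>x.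
               complex_of_real (u t x)
               - (\<Sum>k = 0..N. complex_of_real (t ^ k / fact k) *
                    (frac_dx \<alpha> ^^ k)
                      (\<lambda>y. complex_of_real (M * heat t y - m * deriv (heat t) y)) x)
               + complex_of_real (\<beta> * M ^ 3 / (12 * sqrt 3 * pi) * ln t * deriv (heat t) x)
               + complex_of_real (\<beta> * MM / 3 * deriv (heat t) x)
               + complex_of_real (\<beta> * M ^ 3 / 3 * Psi t x))) \<longlongrightarrow> 0) at_top)))"
proof -
 obtain \<delta> K where \<delta>: "\<delta> > 0" and K: "K >= 0" and decay: "\<And>v N. mild_solution \<alpha> \<beta> v ==> 0 <= N ==> N < \<delta> ==>
   (LINT x|lborel. \<bar>v 0 x\<bar>) <= N ==> (LINT x|lborel. (v 0 x)\<^sup>2) <= N\<^sup>2 ==> \<forall>t\<ge>0. decays v K t"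
  using global_decay[OF assms] by blast
 have a0: "\<alpha> > 0" using assms by simp
 show ?thesis
 proof (rule exI[of _ \<delta>], intro conjI \<delta> allI impI, goal_cases)
  case (1 u0 u)
  note a = 1
  then obtain v where v: "mild_solution \<alpha> \<beta> v" "\<And>t. t >= 0 ==> AE x in lborel. u t x = v t x" "AE x in lborel. u0 x = v 0 x"
   using mild_solution_of_global[OF assms] by blast
  interpret mild_solution \<alpha> \<beta> v by fact
  have h0: "H1_norm u0 >= 0" by (simp add: H1_norm_def)
  have [measurable]: "v 0 \<in> borel_measurable borel" by measurable
  have 1: "(LINT x|lebesgue. \<bar>u0 x\<bar>) = (LINT x|lborel. \<bar>v 0 x\<bar>)"
   by (rule integral_lebesgue_AE) (use v(3) in \<open>auto elim: AE_mp\<close>)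
  have n0: "(LINT x|lborel. \<bar>v 0 x\<bar>) >= 0" by simp
  have 2: "(LINT x|lborel. (v 0 x)\<^sup>2) <= (H1_norm u0)\<^sup>2"
  proof -
   have "(LINT x|lebesgue. (u0 x)\<^sup>2) = (LINT x|lborel. (v 0 x)\<^sup>2)"
    by (rule integral_lebesgue_AE) (use v(3) in \<open>auto elim: AE_mp\<close>)
   moreover have "0 <= (LINT x|lebesgue. (u0 x)\<^sup>2)" "0 <= (LINT x|lebesgue. (weak_derivative u0 x)\<^sup>2)" by simp_all
   ultimately show ?thesis by (simp add: H1_norm_def)
  qed
  \<comment> \<open>The sum of the H^1 and L^1 norms is the single size that bounds both the L^1 and
    the L^2 norm of the data, as \<open>decay\<close> demands.\<close>
  have "(H1_norm u0)\<^sup>2 <= (H1_norm u0 + (LINT x|lborel. \<bar>v 0 x\<bar>))\<^sup>2" using h0 n0 by (intro power_mono) auto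
  with decay[OF v(1), of "H1_norm u0 + (LINT x|lborel. \<bar>v 0 x\<bar>)"] 1 2 h0 n0 a
  have "\<forall>t\<ge>0. decays v K t" by auto
  then have ds: "decaying_solution \<alpha> \<beta> v K" using v(1) K by (simp add: decaying_solution_def decaying_solution_axioms_def)
  interpret decaying_solution \<alpha> \<beta> v K by fact
  have c: "mass u0 = M" "first_moment u0 = mom" "cubic_moment u0 u = cubic_mass" using constants_eq[OF ds v(2,3)] by auto
  \<comment> \<open>The sum telescopes to differences between the full kernels and their nth
    remainders.\<close>
  have sum: "(\<Sum>k<n. cplx (t ^ k / fact k) * (frac_dx \<alpha> ^^ k) (\<lambda>y. cplx (M * heat t y - mom * deriv (heat t) y)) x)
   = cplx M * (kern 1 \<alpha> 0 0 t x - kern 1 \<alpha> 0 n t x) - cplx mom * (kern 1 \<alpha> 1 0 t x - kern 1 \<alpha> 1 n t x)" if "t > 0" for n t x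
  proof (induction n)
   case (Suc n)
   show ?case unfolding sum.lessThan_Suc Suc.IH unfolding frac_dx_power_dipole[OF a0 that] by (simp add: algebra_simps)
  qed simp
  show ?case
   unfolding Let_def c
  proof (intro conjI allI impI, goal_cases)
   case (1 p)
   \<comment> \<open>For \<alpha> > 2 one Taylor term is enough: the heat kernel alone describes the
     linear flow.\<close>
   then have n: "real 1 * (\<alpha> - 1) > 1" by simp
   obtain R where R: "small R" "\<And>t. t > 0 ==> AE x in lborel. remainder 1 1 t x = R t x"
    using asymptotics[OF n zero_less_one] by blast
   show ?case
   proof (rule small_Lp_tendsto[OF R(1) _ 1(2)], goal_cases)
    case t: (1 t)
    have k: "kern 1 \<alpha> 0 0 t x - kern 1 \<alpha> 0 1 t x = cplx (heat t x)" "kern 1 \<alpha> 1 0 t x - kern 1 \<alpha> 1 1 t x = cplx (deriv (heat t) x)" for x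
     using kern_Suc[OF a0 t, of 0 x] kern_Suc[OF a0 t, of 1 x] kern_heat[OF t] kern_heat1[OF a0 t] deriv_heat[OF t] by simp_all
    have "AE x in lborel. u t x = v t x" using v(2) t by simp
    with R(2)[OF t] show ?case
    proof eventually_elim
     case (elim x)
     have "R t x = cplx (u t x - M * heat t x + \<beta> * M ^ 3 / (12 * sqrt 3 * pi) * ln t * deriv (heat t) x
       + (mom + \<beta> * cubic_mass / 3) * deriv (heat t) x + \<beta> * M ^ 3 / 3 * Psi t x)"
      unfolding elim(1)[symmetric] remainder_def k elim(2) of_real_mult[symmetric] of_real_diff[symmetric] of_real_add[symmetric] of_real_eq_iff
      by (simp add: distrib_right)
     then show ?case by (simp only: norm_of_real real_norm_def)
    qed
   qed
  next
   case N: (2 N p)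
   \<comment> \<open>Here N(\<alpha>-1) equals 1, the borderline at which the Nth mass remainder
     still has size 1/t. One further mass term is therefore kept, while the dipole stops at N
     terms.\<close>
   then have n: "real (Suc N) * (\<alpha> - 1) > 1" "N > 0" by (auto simp: field_simps)
   obtain R where R: "small R" "\<And>t. t > 0 ==> AE x in lborel. remainder (Suc N) N t x = R t x"
    using asymptotics[OF n] by blast
   have set: "{0..N - 1} = {..<N}" using N by auto
   show ?case
   proof (rule small_Lp_tendsto[OF R(1) _ N(2)], goal_cases)
    case t: (1 t)
    have "AE x in lborel. u t x = v t x" using v(2) t by simp
    with R(2)[OF t] show ?case
    proof eventually_elim
     case (elim x)
     have alg: "z - (c * (a - a') - d) - c * (a' - a'') = z - (c * (a - a'') - d)" for z c a a' a'' d :: complex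
      by (simp add: algebra_simps)
     show ?case unfolding set sum[OF t] frac_dx_power_heat[OF a0 t] elim(2) alg elim(1)[unfolded remainder_def] ..
    qed
   qed
  next
   case N: (3 N p)
   \<comment> \<open>The lower bound on \<alpha> says precisely that (N+1)(\<alpha>-1) > 1.\<close>
   then have "real N + 2 < \<alpha> * (real N + 1)" by (simp add: pos_divide_less_eq add_pos_nonneg)
   then have n: "real (Suc N) * (\<alpha> - 1) > 1" by (simp add: algebra_simps)
   obtain R where R: "small R" "\<And>t. t > 0 ==> AE x in lborel. remainder (Suc N) (Suc N) t x = R t x"
    using asymptotics[OF n zero_less_Suc, of N] by blast
   have set: "{0..N} = {..<Suc N}" by auto
   show ?case
   proof (rule small_Lp_tendsto[OF R(1) _ N(2)], goal_cases)
    case t: (1 t)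
    have "AE x in lborel. u t x = v t x" using v(2) t by simp
    with R(2)[OF t] show ?case
     by eventually_elim (simp only: set sum[OF t] remainder_def)
   qed
  qed
 qed
qed

end
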